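(* Suppose that $F_\bullet=(F\le F_1,F_2\le F_0)$ is an injective diamond of rings with $F$ a field of characteristic unequal to two, and each $F_i$ ($i=0,1,2$) a finite direct product of fields. Write $F_i=\prod_{v\in\mathcal V_i}F_v$ where each $F_v$ is a field. Assume moreover that patching holds for $F_\bullet$ and that factorization holds for the diamond of groups $\operatorname{SO}(nh)(F_\bullet)$ for each $n>0$, where $h$ is a hyperbolic plane $\langle 1,-1\rangle$. Then: (a) There is an exact sequence $$0\to P_{F_\bullet}\to \operatorname{W}(F)\to \operatorname{W}(F_1)\times \operatorname{W}(F_2)\to \operatorname{W}(F_0),$$ where the map on the right is given by taking the difference of the restrictions of the two Witt classes, and where $P_{F_\bullet}$ is the subgroup of $\operatorname{W}(F)$ consisting of classes of locally hyperbolic binary Pfister forms, i.e. forms $\langle 1,-d\rangle$ where $d\in F^\times$ becomes a square in each $F_i$. (b) The group $P_{F_\bullet}$ is naturally isomorphic to the kernel of the local-global map $H^1(F,\mu_2)\to\prod_v H^1(F_v,\mu_2)$, i.e. the group of square classes in $F^\times$ that become the trivial square class in each $F_v^\times$. (c) For every quadratic form $q$ over $F$, factorization holds for the diamond of groups $\operatorname{SO}(q)(F_\bullet)$. (d) The local-global principle for isotropy holds for quadratic forms over $F$ that are of dimension unequal to two, and for binary forms that do not lie in $P_{F_\bullet}$ (i.e. whose Witt class does not lie in $P_{F_\bullet}$). That is, if such a form $q$ becomes isotropic over $F_v$ for each $v\in\mathcal V_1\cup\mathcal V_2$, then $q$ is isotropic. (e) If $q$ is a regular quadratic form over $F$ then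 $\operatorname{i_W}(q)=\min\{\operatorname{i_W}(q_v)\mid v\in\mathcal V_1\cup\mathcal V_2\}-\varepsilon$, where $q_v$ denotes the base change of $q$ to $F_v$, and where $\varepsilon=1$ if $q$ represents a non-trivial class in $P_{F_\bullet}$ (i.e. the Witt class of $q$ is a non-trivial element of $P_{F_\bullet}$) and otherwise $\varepsilon=0$.
   Context: An injective diamond of rings $R_\bullet=(R\le R_1,R_2\le R_0)$ is a commutative square of injective ring homomorphisms $R\to R_i\to R_0$ ($i=1,2$), regarded as inclusions. Patching holds for $R_\bullet$ if for every $n\ge1$, inside $\operatorname{GL}_n(R_0)$, one has $\operatorname{GL}_n(R)=\operatorname{GL}_n(R_1)\cap\operatorname{GL}_n(R_2)$ and every element of $\operatorname{GL}_n(R_0)$ is a product $g_1g_2$ with $g_i\in\operatorname{GL}_n(R_i)$. For a linear algebraic group $G$ over $F$, $G(F_\bullet)$ is the diamond of groups $(G(F),G(F_1),G(F_2),G(F_0))$; factorization holds for it if every element of $G(F_0)$ is a product $g_1g_2$ with $g_i\in G(F_i)$. $\operatorname{SO}(q)$ is the special orthogonal group of a quadratic form $q$. $\operatorname{W}(\cdot)$ is the Witt ring of a field (characteristic not two), and $\operatorname{W}(\prod F_v):=\prod\operatorname{W}(F_v)$. $\operatorname{i_W}(q)$ is the Witt index, i.e. the number of hyperbolic planes in the Witt decomposition of $q$. $nh$ is the orthogonal sum of $n$ copies of $h$. $H^1$ denotes Galois cohomology.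
   Formalization: Part (c) is stated for regular quadratic forms q only: for degenerate q the group SO(q) has no standard meaning, and with the naive definition the claim fails for q = ⟨1⟩ ⊥ ⟨0⟩ whenever the group P is non-trivial. *)

theory Defs
  imports
    "HOL-Algebra.Algebra"
    "HOL-Combinatorics.Permutations"
    "Jordan_Normal_Form.Matrix"
begin

text \<open>
  Rings and fields are HOL-Algebra structures with explicit carriers, so that the fields indexed by
  a set \<^term>\<open>V\<close> may differ from index to index. Matrices are those of the type \<^typ>\<open>'a mat\<close>, with
  entries in the carrier; ring homomorphisms act on them by \<^const>\<open>map_mat\<close>. The name
  \<open>ring_hom\<close> is qualified because the matrix library brings in a locale of the same name.
\<close>

section \<open>Matrices over a ring\<close>

definition mat_prod :: "('a, 'm) ring_scheme \<Rightarrow> 'a mat \<Rightarrow> 'a mat \<Rightarrow> 'a mat" where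
  "mat_prod R A B = mat (dim_row A) (dim_col B)
     (\<lambda>(i, j). \<Oplus>\<^bsub>R\<^esub>k\<in>{..<dim_col A}. A $$ (i, k) \<otimes>\<^bsub>R\<^esub> B $$ (k, j))"

definition mat_monoid :: "('a, 'm) ring_scheme \<Rightarrow> nat \<Rightarrow> 'a mat monoid" where
  "mat_monoid R n = \<lparr>carrier = {A \<in> carrier_mat n n. elements_mat A \<subseteq> carrier R},
     monoid.mult = mat_prod R,
     one = mat n n (\<lambda>(i, j). if i = j then \<one>\<^bsub>R\<^esub> else \<zero>\<^bsub>R\<^esub>)\<rparr>"

definition GL :: "nat \<Rightarrow> ('a, 'm) ring_scheme \<Rightarrow> 'a mat monoid" where
  "GL n R = units_of (mat_monoid R n)"

definition mat_det :: "('a, 'm) ring_scheme \<Rightarrow> 'a mat \<Rightarrow> 'a" where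
  "mat_det R A = (\<Oplus>\<^bsub>R\<^esub>p\<in>{p. p permutes {..<dim_row A}}.
     (if evenperm p then \<one>\<^bsub>R\<^esub> else \<ominus>\<^bsub>R\<^esub> \<one>\<^bsub>R\<^esub>) \<otimes>\<^bsub>R\<^esub>
     (\<Otimes>\<^bsub>R\<^esub>i\<in>{..<dim_row A}. A $$ (i, p i)))"


section \<open>Diamonds of rings, patching and factorization\<close>

definition product_ring :: "'v set \<Rightarrow> ('v \<Rightarrow> ('a, 'm) ring_scheme) \<Rightarrow> ('v \<Rightarrow> 'a) ring" where
  "product_ring V K = \<lparr>carrier = (\<Pi>\<^sub>E v\<in>V. carrier (K v)),
     monoid.mult = (\<lambda>x y. \<lambda>v\<in>V. x v \<otimes>\<^bsub>K v\<^esub> y v),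
     one = (\<lambda>v\<in>V. \<one>\<^bsub>K v\<^esub>),
     ring.zero = (\<lambda>v\<in>V. \<zero>\<^bsub>K v\<^esub>),
     ring.add = (\<lambda>x y. \<lambda>v\<in>V. x v \<oplus>\<^bsub>K v\<^esub> y v)\<rparr>"

text \<open>The maps are \<open>a\<^sub>i : R \<rightarrow> R\<^sub>i\<close> and \<open>b\<^sub>i : R\<^sub>i \<rightarrow> R\<^sub>0\<close>.\<close>

definition injective_diamond ::
  "('r, 'm) ring_scheme \<Rightarrow> ('r1, 'm1) ring_scheme \<Rightarrow> ('r2, 'm2) ring_scheme \<Rightarrow>
   ('r0, 'm0) ring_scheme \<Rightarrow> ('r \<Rightarrow> 'r1) \<Rightarrow> ('r \<Rightarrow> 'r2) \<Rightarrow> ('r1 \<Rightarrow> 'r0) \<Rightarrow> ('r2 \<Rightarrow> 'r0) \<Rightarrow> bool"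
where
  "injective_diamond R R1 R2 R0 a1 a2 b1 b2 \<longleftrightarrow>
     ring R \<and> ring R1 \<and> ring R2 \<and> ring R0 \<and>
     a1 \<in> Ring.ring_hom R R1 \<and> inj_on a1 (carrier R) \<and>
     a2 \<in> Ring.ring_hom R R2 \<and> inj_on a2 (carrier R) \<and>
     b1 \<in> Ring.ring_hom R1 R0 \<and> inj_on b1 (carrier R1) \<and>
     b2 \<in> Ring.ring_hom R2 R0 \<and> inj_on b2 (carrier R2) \<and>
     (\<forall>x\<in>carrier R. b1 (a1 x) = b2 (a2 x))"

definition factorization ::
  "('g1, 'm1) monoid_scheme \<Rightarrow> ('g2, 'm2) monoid_scheme \<Rightarrow> ('g0, 'm0) monoid_scheme \<Rightarrow>
   ('g1 \<Rightarrow> 'g0) \<Rightarrow> ('g2 \<Rightarrow> 'g0) \<Rightarrow> bool"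
where
  "factorization G1 G2 G0 f1 f2 \<longleftrightarrow>
     (\<forall>g\<in>carrier G0. \<exists>g1\<in>carrier G1. \<exists>g2\<in>carrier G2. g = f1 g1 \<otimes>\<^bsub>G0\<^esub> f2 g2)"

definition patching ::
  "('r, 'm) ring_scheme \<Rightarrow> ('r1, 'm1) ring_scheme \<Rightarrow> ('r2, 'm2) ring_scheme \<Rightarrow>
   ('r0, 'm0) ring_scheme \<Rightarrow> ('r \<Rightarrow> 'r1) \<Rightarrow> ('r \<Rightarrow> 'r2) \<Rightarrow> ('r1 \<Rightarrow> 'r0) \<Rightarrow> ('r2 \<Rightarrow> 'r0) \<Rightarrow> bool"
where
  "patching R R1 R2 R0 a1 a2 b1 b2 \<longleftrightarrow>
     (\<forall>n\<ge>1.
        map_mat (b1 \<circ> a1) ` carrier (GL n R) =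
          map_mat b1 ` carrier (GL n R1) \<inter> map_mat b2 ` carrier (GL n R2) \<and>
        factorization (GL n R1) (GL n R2) (GL n R0) (map_mat b1) (map_mat b2))"


section \<open>Quadratic forms\<close>

text \<open>
  Over a field of characteristic not two, a quadratic form of dimension \<open>n\<close> is
  \<open>\<Sum>\<^sub>i\<^sub>,\<^sub>j q\<^sub>i\<^sub>j x\<^sub>i x\<^sub>j\<close> for a unique symmetric matrix \<open>(q\<^sub>i\<^sub>j)\<close>; the form is identified with that matrix.
  Base change along a homomorphism \<open>f\<close> is \<^term>\<open>map_mat f\<close>.
\<close>

definition quad_form :: "('a, 'm) ring_scheme \<Rightarrow> 'a mat \<Rightarrow> bool" where
  "quad_form R Q \<longleftrightarrow>
     dim_col Q = dim_row Q \<and> elements_mat Q \<subseteq> carrier R \<and> transpose_mat Q = Q"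

definition quad_value :: "('a, 'm) ring_scheme \<Rightarrow> 'a mat \<Rightarrow> 'a vec \<Rightarrow> 'a" where
  "quad_value R Q x =
     (\<Oplus>\<^bsub>R\<^esub>i\<in>{..<dim_row Q}. \<Oplus>\<^bsub>R\<^esub>j\<in>{..<dim_row Q}. Q $$ (i, j) \<otimes>\<^bsub>R\<^esub> x $ i \<otimes>\<^bsub>R\<^esub> x $ j)"

definition isotropic :: "('a, 'm) ring_scheme \<Rightarrow> 'a mat \<Rightarrow> bool" where
  "isotropic R Q \<longleftrightarrow>
     (\<exists>x\<in>carrier_vec (dim_row Q). set\<^sub>v x \<subseteq> carrier R \<and>
        x \<noteq> vec (dim_row Q) (\<lambda>_. \<zero>\<^bsub>R\<^esub>) \<and> quad_value R Q x = \<zero>\<^bsub>R\<^esub>)"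

definition regular_forms :: "('a, 'm) ring_scheme \<Rightarrow> 'a mat set" where
  "regular_forms R = {Q. quad_form R Q \<and> Q \<in> carrier (GL (dim_row Q) R)}"

definition isometric :: "('a, 'm) ring_scheme \<Rightarrow> 'a mat \<Rightarrow> 'a mat \<Rightarrow> bool" where
  "isometric R Q Q' \<longleftrightarrow> dim_row Q = dim_row Q' \<and>
     (\<exists>C\<in>carrier (GL (dim_row Q) R). mat_prod R (mat_prod R (transpose_mat C) Q') C = Q)"

definition orth_sum :: "('a, 'm) ring_scheme \<Rightarrow> 'a mat \<Rightarrow> 'a mat \<Rightarrow> 'a mat" where
  "orth_sum R Q Q' = four_block_mat Q
     (mat (dim_row Q) (dim_col Q') (\<lambda>_. \<zero>\<^bsub>R\<^esub>)) (mat (dim_row Q') (dim_col Q) (\<lambda>_. \<zero>\<^bsub>R\<^esub>)) Q'"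

definition tensor_form :: "('a, 'm) ring_scheme \<Rightarrow> 'a mat \<Rightarrow> 'a mat \<Rightarrow> 'a mat" where
  "tensor_form R Q Q' = (let m = dim_row Q' in
     mat (dim_row Q * m) (dim_row Q * m)
       (\<lambda>(i, j). Q $$ (i div m, j div m) \<otimes>\<^bsub>R\<^esub> Q' $$ (i mod m, j mod m)))"

definition diag_form :: "('a, 'm) ring_scheme \<Rightarrow> 'a list \<Rightarrow> 'a mat" where
  "diag_form R cs = mat (length cs) (length cs) (\<lambda>(i, j). if i = j then cs ! i else \<zero>\<^bsub>R\<^esub>)"

definition hyperbolic_plane :: "('a, 'm) ring_scheme \<Rightarrow> 'a mat" where
  "hyperbolic_plane R = diag_form R [\<one>\<^bsub>R\<^esub>, \<ominus>\<^bsub>R\<^esub> \<one>\<^bsub>R\<^esub>]"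

definition hyperbolic_space :: "('a, 'm) ring_scheme \<Rightarrow> nat \<Rightarrow> 'a mat" where
  "hyperbolic_space R n = (orth_sum R (hyperbolic_plane R) ^^ n) (diag_form R [])"

definition binary_pfister :: "('a, 'm) ring_scheme \<Rightarrow> 'a \<Rightarrow> 'a mat" where
  "binary_pfister R d = diag_form R [\<one>\<^bsub>R\<^esub>, \<ominus>\<^bsub>R\<^esub> d]"

text \<open>
  Only meaningful for regular forms \<open>Q\<close>, where the Witt decomposition has no totally isotropic part.
\<close>

definition witt_index :: "('a, 'm) ring_scheme \<Rightarrow> 'a mat \<Rightarrow> nat" where
  "witt_index R Q = (THE m. \<exists>Q'. quad_form R Q' \<and> \<not> isotropic R Q' \<and>
     isometric R Q (orth_sum R (hyperbolic_space R m) Q'))"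

text \<open>
  The group \<open>SO(Q)(S)\<close> of points in \<open>S\<close>, when \<open>Q\<close> has been base changed to \<open>S\<close>.
\<close>

definition SO :: "('a, 'm) ring_scheme \<Rightarrow> 'a mat \<Rightarrow> 'a mat monoid" where
  "SO S Q = (GL (dim_row Q) S)\<lparr>carrier := {A \<in> carrier (GL (dim_row Q) S).
     mat_prod S (mat_prod S (transpose_mat A) Q) A = Q \<and> mat_det S A = \<one>\<^bsub>S\<^esub>}\<rparr>"

definition SO_factorization ::
  "'r mat \<Rightarrow> ('r1, 'm1) ring_scheme \<Rightarrow> ('r2, 'm2) ring_scheme \<Rightarrow> ('r0, 'm0) ring_scheme \<Rightarrow>
   ('r \<Rightarrow> 'r1) \<Rightarrow> ('r \<Rightarrow> 'r2) \<Rightarrow> ('r1 \<Rightarrow> 'r0) \<Rightarrow> ('r2 \<Rightarrow> 'r0) \<Rightarrow> bool"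
where
  "SO_factorization Q R1 R2 R0 a1 a2 b1 b2 \<longleftrightarrow>
     factorization (SO R1 (map_mat a1 Q)) (SO R2 (map_mat a2 Q)) (SO R0 (map_mat (b1 \<circ> a1) Q))
       (map_mat b1) (map_mat b2)"


section \<open>The Witt ring\<close>

definition witt_rel :: "('a, 'm) ring_scheme \<Rightarrow> ('a mat \<times> 'a mat) set" where
  "witt_rel R = {(Q, Q'). Q \<in> regular_forms R \<and> Q' \<in> regular_forms R \<and>
     (\<exists>m m'. isometric R (orth_sum R Q (hyperbolic_space R m))
                          (orth_sum R Q' (hyperbolic_space R m')))}"

text \<open>
  For a form that is not regular, the Witt class below is the empty set, which is not an element of
  the Witt ring.
\<close>

definition witt_class :: "('a, 'm) ring_scheme \<Rightarrow> 'a mat \<Rightarrow> 'a mat set" where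
  "witt_class R Q = witt_rel R `` {Q}"

definition witt_ring :: "('a, 'm) ring_scheme \<Rightarrow> 'a mat set ring" where
  "witt_ring R = \<lparr>carrier = regular_forms R // witt_rel R,
     monoid.mult = (\<lambda>Z Y. \<Union>Q\<in>Z. \<Union>Q'\<in>Y. witt_class R (tensor_form R Q Q')),
     one = witt_class R (diag_form R [\<one>\<^bsub>R\<^esub>]),
     ring.zero = witt_class R (diag_form R []),
     ring.add = (\<lambda>Z Y. \<Union>Q\<in>Z. \<Union>Q'\<in>Y. witt_class R (orth_sum R Q Q'))\<rparr>"

abbreviation witt_group :: "('a, 'm) ring_scheme \<Rightarrow> 'a mat set monoid" where
  "witt_group R \<equiv> add_monoid (witt_ring R)"

definition witt_res :: "('b, 'n) ring_scheme \<Rightarrow> ('a \<Rightarrow> 'b) \<Rightarrow> 'a mat set \<Rightarrow> 'b mat set" where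
  "witt_res S f Z = (\<Union>Q\<in>Z. witt_class S (map_mat f Q))"

definition witt_group_prod ::
  "'v set \<Rightarrow> ('v \<Rightarrow> ('a, 'm) ring_scheme) \<Rightarrow> ('v \<Rightarrow> 'a mat set) monoid" where
  "witt_group_prod V K = product_group V (\<lambda>v. witt_group (K v))"

text \<open>Restriction \<open>W(F) \<rightarrow> W(\<Prod>\<^sub>v K\<^sub>v)\<close> along a homomorphism \<open>a : F \<rightarrow> \<Prod>\<^sub>v K\<^sub>v\<close>.\<close>

definition witt_res_field_prod ::
  "'v set \<Rightarrow> ('v \<Rightarrow> ('a, 'm) ring_scheme) \<Rightarrow> ('f \<Rightarrow> 'v \<Rightarrow> 'a) \<Rightarrow> 'f mat set \<Rightarrow> 'v \<Rightarrow> 'a mat set"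
where
  "witt_res_field_prod V K a Z = (\<lambda>v\<in>V. witt_res (K v) (\<lambda>x. a x v) Z)"

text \<open>
  Restriction \<open>W(\<Prod>\<^sub>v\<^sub>\<in>\<^sub>V K\<^sub>v) \<rightarrow> W(\<Prod>\<^sub>w\<^sub>\<in>\<^sub>V\<^sub>0 K\<^sub>w)\<close> along a homomorphism \<open>b\<close> between finite products of
  fields. The \<open>w\<close>-component of \<open>b\<close> is a homomorphism to a field, so exactly one of the orthogonal
  idempotents of the source has non-zero image, and the \<open>w\<close>-component of \<open>b\<close> factors through the
  projection onto the corresponding factor.
\<close>

definition factor_incl :: "'v set \<Rightarrow> ('v \<Rightarrow> ('a, 'm) ring_scheme) \<Rightarrow> 'v \<Rightarrow> 'a \<Rightarrow> 'v \<Rightarrow> 'a" where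
  "factor_incl V K v x = (\<lambda>u\<in>V. if u = v then x else \<zero>\<^bsub>K u\<^esub>)"

definition factor_below ::
  "'v set \<Rightarrow> ('v \<Rightarrow> ('a, 'm) ring_scheme) \<Rightarrow> (('v \<Rightarrow> 'a) \<Rightarrow> 'v \<Rightarrow> 'a) \<Rightarrow> 'v \<Rightarrow> 'v" where
  "factor_below V K b w = (THE v. v \<in> V \<and> b (factor_incl V K v \<one>\<^bsub>K v\<^esub>) w \<noteq> \<zero>\<^bsub>K w\<^esub>)"

definition witt_res_prod ::
  "'v set \<Rightarrow> 'v set \<Rightarrow> ('v \<Rightarrow> ('a, 'm) ring_scheme) \<Rightarrow> (('v \<Rightarrow> 'a) \<Rightarrow> 'v \<Rightarrow> 'a) \<Rightarrow>
   ('v \<Rightarrow> 'a mat set) \<Rightarrow> 'v \<Rightarrow> 'a mat set"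
where
  "witt_res_prod V V0 K b Z = (\<lambda>w\<in>V0.
     let v = factor_below V K b w in witt_res (K w) (\<lambda>x. b (factor_incl V K v x) w) (Z v))"

definition is_square_in :: "('a, 'm) ring_scheme \<Rightarrow> 'a \<Rightarrow> bool" where
  "is_square_in R x \<longleftrightarrow> (\<exists>y\<in>carrier R. x = y \<otimes>\<^bsub>R\<^esub> y)"

definition pfister_classes ::
  "('r, 'm) ring_scheme \<Rightarrow> ('r1, 'm1) ring_scheme \<Rightarrow> ('r2, 'm2) ring_scheme \<Rightarrow>
   ('r0, 'm0) ring_scheme \<Rightarrow> ('r \<Rightarrow> 'r1) \<Rightarrow> ('r \<Rightarrow> 'r2) \<Rightarrow> ('r1 \<Rightarrow> 'r0) \<Rightarrow> 'r mat set set"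
where
  "pfister_classes R R1 R2 R0 a1 a2 b1 = {witt_class R (binary_pfister R d) | d. d \<in> Units R \<and>
     is_square_in R1 (a1 d) \<and> is_square_in R2 (a2 d) \<and> is_square_in R0 (b1 (a1 d))}"


section \<open>Square classes\<close>

definition unit_squares :: "('a, 'm) ring_scheme \<Rightarrow> 'a set" where
  "unit_squares R = {x \<otimes>\<^bsub>R\<^esub> x | x. x \<in> Units R}"

definition square_class_group :: "('a, 'm) ring_scheme \<Rightarrow> 'a set monoid" where
  "square_class_group R = units_of R Mod unit_squares R"

definition square_class :: "('a, 'm) ring_scheme \<Rightarrow> 'a \<Rightarrow> 'a set" where
  "square_class R d = unit_squares R #>\<^bsub>units_of R\<^esub> d"

definition square_class_res :: "('b, 'n) ring_scheme \<Rightarrow> ('a \<Rightarrow> 'b) \<Rightarrow> 'a set \<Rightarrow> 'b set" where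
  "square_class_res S f Z = (\<Union>d\<in>Z. square_class S (f d))"

definition square_class_local_kernel ::
  "('f, 'm) ring_scheme \<Rightarrow> 'v set \<Rightarrow> ('v \<Rightarrow> ('a, 'n) ring_scheme) \<Rightarrow> ('v \<Rightarrow> 'f \<Rightarrow> 'a) \<Rightarrow> 'f set set"
where
  "square_class_local_kernel F V K e =
     kernel (square_class_group F) (product_group V (\<lambda>v. square_class_group (K v)))
       (\<lambda>Z. \<lambda>v\<in>V. square_class_res (K v) (e v) Z)"


section \<open>Galois cohomology of roots of unity in degree one\<close>

type_synonym 'a cl = "('a list \<times> nat) multiset \<Rightarrow> 'a"

abbreviation alg_cl :: "('a, 'm) ring_scheme \<Rightarrow> 'a cl ring" where
  "alg_cl F \<equiv> field.alg_closure F"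

abbreviation to_cl :: "('a, 'm) ring_scheme \<Rightarrow> 'a \<Rightarrow> 'a cl" where
  "to_cl F \<equiv> ring.indexed_const F"

text \<open>
  The absolute Galois group, as the group of all automorphisms of the algebraic closure over \<open>F\<close>:
  restriction to the separable closure is an isomorphism of topological groups.
\<close>

definition abs_gal :: "('a, 'm) ring_scheme \<Rightarrow> ('a cl \<Rightarrow> 'a cl) set" where
  "abs_gal F = {s \<in> ring_iso (alg_cl F) (alg_cl F) \<inter> extensional (carrier (alg_cl F)).
     \<forall>x\<in>carrier F. s (to_cl F x) = to_cl F x}"

definition mu :: "nat \<Rightarrow> ('a, 'm) ring_scheme \<Rightarrow> 'a cl set" where
  "mu n F = {x \<in> carrier (alg_cl F). x [^]\<^bsub>alg_cl F\<^esub> n = \<one>\<^bsub>alg_cl F\<^esub>}"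

text \<open>
  Continuous 1-cocycles. A basis of neighbourhoods of \<open>s\<close> in the Krull topology is given by the
  sets of all \<open>t\<close> that agree with \<open>s\<close> on a finite set of elements.
\<close>

definition cocycles :: "nat \<Rightarrow> ('a, 'm) ring_scheme \<Rightarrow> (('a cl \<Rightarrow> 'a cl) \<Rightarrow> 'a cl) monoid" where
  "cocycles n F = \<lparr>carrier = {c \<in> abs_gal F \<rightarrow>\<^sub>E mu n F.
       (\<forall>s\<in>abs_gal F. \<forall>t\<in>abs_gal F.
          c (compose (carrier (alg_cl F)) s t) = c s \<otimes>\<^bsub>alg_cl F\<^esub> s (c t)) \<and>
       (\<forall>s\<in>abs_gal F. \<exists>A. finite A \<and> A \<subseteq> carrier (alg_cl F) \<and>
          (\<forall>t\<in>abs_gal F. (\<forall>x\<in>A. t x = s x) \<longrightarrow> c t = c s))},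
     monoid.mult = (\<lambda>c d. \<lambda>s\<in>abs_gal F. c s \<otimes>\<^bsub>alg_cl F\<^esub> d s),
     one = (\<lambda>s\<in>abs_gal F. \<one>\<^bsub>alg_cl F\<^esub>)\<rparr>"

definition coboundaries :: "nat \<Rightarrow> ('a, 'm) ring_scheme \<Rightarrow> (('a cl \<Rightarrow> 'a cl) \<Rightarrow> 'a cl) set" where
  "coboundaries n F =
     {\<lambda>s\<in>abs_gal F. s x \<otimes>\<^bsub>alg_cl F\<^esub> inv\<^bsub>alg_cl F\<^esub> x | x. x \<in> mu n F}"

definition H1_mu :: "nat \<Rightarrow> ('a, 'm) ring_scheme \<Rightarrow> (('a cl \<Rightarrow> 'a cl) \<Rightarrow> 'a cl) set monoid" where
  "H1_mu n F = cocycles n F Mod coboundaries n F"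

text \<open>
  Restriction along \<open>f : F \<rightarrow> K\<close> is induced by an embedding of the algebraic closures over \<open>f\<close>, and
  does not depend on its choice.
\<close>

definition cl_embedding ::
  "('a, 'm) ring_scheme \<Rightarrow> ('b, 'n) ring_scheme \<Rightarrow> ('a \<Rightarrow> 'b) \<Rightarrow> 'a cl \<Rightarrow> 'b cl" where
  "cl_embedding F K f = (SOME j. j \<in> Ring.ring_hom (alg_cl F) (alg_cl K) \<and>
     (\<forall>x\<in>carrier F. j (to_cl F x) = to_cl K (f x)))"

definition gal_res ::
  "('a, 'm) ring_scheme \<Rightarrow> ('b, 'n) ring_scheme \<Rightarrow> ('a \<Rightarrow> 'b) \<Rightarrow> ('b cl \<Rightarrow> 'b cl) \<Rightarrow> 'a cl \<Rightarrow> 'a cl"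
where
  "gal_res F K f s = (let j = cl_embedding F K f in
     (\<lambda>x\<in>carrier (alg_cl F). inv_into (carrier (alg_cl F)) j (s (j x))))"

definition cocycle_res ::
  "('a, 'm) ring_scheme \<Rightarrow> ('b, 'n) ring_scheme \<Rightarrow> ('a \<Rightarrow> 'b) \<Rightarrow>
   (('a cl \<Rightarrow> 'a cl) \<Rightarrow> 'a cl) \<Rightarrow> ('b cl \<Rightarrow> 'b cl) \<Rightarrow> 'b cl"
where
  "cocycle_res F K f c = (\<lambda>s\<in>abs_gal K. cl_embedding F K f (c (gal_res F K f s)))"

definition H1_res ::
  "nat \<Rightarrow> ('a, 'm) ring_scheme \<Rightarrow> ('b, 'n) ring_scheme \<Rightarrow> ('a \<Rightarrow> 'b) \<Rightarrow>
   (('a cl \<Rightarrow> 'a cl) \<Rightarrow> 'a cl) set \<Rightarrow> (('b cl \<Rightarrow> 'b cl) \<Rightarrow> 'b cl) set"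
where
  "H1_res n F K f Z = (\<Union>c\<in>Z. coboundaries n K #>\<^bsub>cocycles n K\<^esub> cocycle_res F K f c)"

definition H1_local_kernel ::
  "nat \<Rightarrow> ('f, 'm) ring_scheme \<Rightarrow> 'v set \<Rightarrow> ('v \<Rightarrow> ('a, 'n) ring_scheme) \<Rightarrow> ('v \<Rightarrow> 'f \<Rightarrow> 'a) \<Rightarrow>
   (('f cl \<Rightarrow> 'f cl) \<Rightarrow> 'f cl) set set"
where
  "H1_local_kernel n F V K e =
     kernel (H1_mu n F) (product_group V (\<lambda>v. H1_mu n (K v)))
       (\<lambda>Z. \<lambda>v\<in>V. H1_res n F (K v) (e v) Z)"

text \<open>The Kummer class of \<open>d\<close>, represented by \<open>s \<mapsto> s(r) / r\<close> for any \<open>n\<close>-th root \<open>r\<close> of \<open>d\<close>.\<close>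

definition kummer_class ::
  "nat \<Rightarrow> ('a, 'm) ring_scheme \<Rightarrow> 'a \<Rightarrow> (('a cl \<Rightarrow> 'a cl) \<Rightarrow> 'a cl) set" where
  "kummer_class n F d =
     (let r = (SOME r. r \<in> carrier (alg_cl F) \<and> r [^]\<^bsub>alg_cl F\<^esub> n = to_cl F d) in
      coboundaries n F #>\<^bsub>cocycles n F\<^esub>
        (\<lambda>s\<in>abs_gal F. s r \<otimes>\<^bsub>alg_cl F\<^esub> inv\<^bsub>alg_cl F\<^esub> r))"

end

theory Submission
  imports Defs "Jordan_Normal_Form.Determinant"
begin

text \<open>
  The basic local-global step is that a regular form over \<open>F\<close> which is hyperbolic over every factor
  of \<open>F\<^sub>1\<close> and \<open>F\<^sub>2\<close> and whose determinant differs from that of \<open>nh\<close> by a square of \<open>F\<close> is itself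
  isometric to \<open>nh\<close>: local isometries with prescribed determinant differ over \<open>F\<^sub>0\<close> by an element of
  \<open>SO(nh)(F\<^sub>0)\<close>, which factors, and the corrected isometries descend by patching. By Witt cancellation
  the same holds with \<open>nh\<close> replaced by an arbitrary regular form, and together with patching this
  gives factorization for \<open>SO(q)\<close>. Since \<open>SO(q)\<close> is transitive on isotropic vectors in dimension at
  least three, isotropic vectors can then be patched. A locally hyperbolic form is Witt equivalent to
  the binary Pfister form of its signed discriminant, which is locally a square; this identifies the
  kernel of restriction with \<open>P\<close>, and Kummer theory identifies \<open>P\<close> with the kernel on \<open>H\<^sup>1(F, \<mu>\<^sub>2)\<close>.
\<close>

section \<open>Extension of embeddings, Galois conjugation, and Hilbert 90 for characters with
  values 1 and -1\<close>

section \<open>Automorphisms of an algebraic closure\<close>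

subsection \<open>Extension of homomorphisms\<close>

text \<open>The group \<open>P\<close> measures the gap between O and SO. Factorization is given for
  SO only, and over a product of fields the determinant of an isometry is an independent sign in
  each factor; signs over \<open>F0\<close> need not be products of signs from \<open>F1\<close> and
  \<open>F2\<close>. So each gluing step carries an element \<open>c\<close> of \<open>F\<close>
  that prescribes the determinants on both sides at once, and a form is controlled only together
  with its determinant. What remains is a discriminant that is locally a square. For the same reason
  dimension two is exceptional for isotropy: only isometries of determinant -1 exchange the two
  isotropic lines of a hyperbolic plane, and there is no complement in which to correct the sign.
  The passage from nh to a general q uses that the sum of q and -q is nh for n = dim q. Exactness in
  the middle meets another obstacle: local Witt classes must be represented in one common dimension,
  so the parity of dimensions must be shown to be constant. On the cohomological side positive
  characteristic is allowed, so that elements fixed by all automorphisms of the algebraic closure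
  may be purely inseparable over the base field.\<close>

lemma hom_cringI: "cring R ==> cring S ==> h \<in> Ring.ring_hom R S ==> ring_hom_cring R S h"
  by (intro ring_hom_cring.intro ring_hom_cring_axioms.intro)

text \<open>Applying \<open>g\<close> to coefficients is compatible with products and sums of
  coefficient lists only up to leading zeros; \<open>normalize\<close> removes these, and evaluation
  does not see them.\<close>

lemma eval_map_hom:
  assumes "field L" "subfield D L" "field N" "g \<in> Ring.ring_hom (L\<lparr>carrier := D\<rparr>) N" "b \<in> carrier N"
  shows "(\<lambda>p. ring.eval N (map g p) b) \<in> Ring.ring_hom (univ_poly L D) N"
proof -
  interpret L: field L by fact
  interpret N: field N by fact
  let ?D = "L\<lparr>carrier := D\<rparr>"
  have sr: "subring D L" using assms(2) by (rule subfieldE(1))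
  have rD: "ring ?D" by (rule L.subring_is_ring[OF sr])
  interpret h: ring_hom_ring ?D N g by (rule ring_hom_ringI2[OF rD N.is_ring assms(4)])
  have st: "set p \<subseteq> D" "set (map g p) \<subseteq> carrier N" if "p \<in> carrier (univ_poly L D)" for p
    using that h.hom_closed unfolding univ_poly_carrier[symmetric] polynomial_def by auto
  show ?thesis
  proof (rule ring_hom_memI)
    fix p assume p: "p \<in> carrier (univ_poly L D)"
    show "N.eval (map g p) b \<in> carrier N" using N.eval_in_carrier[OF st(2)[OF p] assms(5)] .
    fix q assume q: "q \<in> carrier (univ_poly L D)"
    have pq: "p \<otimes>\<^bsub>univ_poly L D\<^esub> q \<in> carrier (univ_poly L D)" "p \<oplus>\<^bsub>univ_poly L D\<^esub> q \<in> carrier (univ_poly L D)"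
      using ring.ring_simprules(1,5)[OF L.univ_poly_is_ring[OF sr] p q] by auto
    have "N.eval (map g (p \<otimes>\<^bsub>univ_poly L D\<^esub> q)) b = N.eval (N.normalize (map g (ring.poly_mult ?D p q))) b"
      using N.eval_normalize[OF st(2)[OF pq(1)] assms(5)] by (simp add: univ_poly_mult L.poly_mult_consistent[OF sr])
    also have "\<dots> = N.eval (map g p) b \<otimes>\<^bsub>N\<^esub> N.eval (map g q) b"
      using h.poly_mult_hom'[of p q] st[OF p] st[OF q] N.eval_poly_mult[OF st(2)[OF p] st(2)[OF q] assms(5)] by simp
    finally show "N.eval (map g (p \<otimes>\<^bsub>univ_poly L D\<^esub> q)) b = N.eval (map g p) b \<otimes>\<^bsub>N\<^esub> N.eval (map g q) b" .
    have "N.eval (map g (p \<oplus>\<^bsub>univ_poly L D\<^esub> q)) b = N.eval (N.normalize (map g (ring.poly_add ?D p q))) b"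
      using N.eval_normalize[OF st(2)[OF pq(2)] assms(5)] by (simp add: univ_poly_add L.poly_add_consistent[OF sr])
    also have "\<dots> = N.eval (map g p) b \<oplus>\<^bsub>N\<^esub> N.eval (map g q) b"
      using h.poly_add_hom'[of p q] st[OF p] st[OF q] N.eval_poly_add[OF st(2)[OF p] st(2)[OF q] assms(5)] by simp
    finally show "N.eval (map g (p \<oplus>\<^bsub>univ_poly L D\<^esub> q)) b = N.eval (map g p) b \<oplus>\<^bsub>N\<^esub> N.eval (map g q) b" .
  next
    show "N.eval (map g \<one>\<^bsub>univ_poly L D\<^esub>) b = \<one>\<^bsub>N\<^esub>"
      using assms(5) ring_hom_one[OF assms(4)] by (simp add: univ_poly_one)
  qed
qed

text \<open>The extension has to send the value of a polynomial at \<open>x\<close> to the value at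
  \<open>b\<close> of its image under \<open>g\<close>. This is well defined because a polynomial
  vanishing at \<open>x\<close> is a multiple of the minimal polynomial, whose image vanishes at
  \<open>b\<close>, and it is defined everywhere because the simple extension is the image of
  evaluation at \<open>x\<close>.\<close>

lemma extend_hom_simple:
  assumes "field L" "field N" "subfield D L" "g \<in> Ring.ring_hom (L\<lparr>carrier := D\<rparr>) N"
    and "x \<in> carrier L" "(ring.algebraic L over D) x" "b \<in> carrier N" "ring.eval N (map g (ring.Irr L D x)) b = \<zero>\<^bsub>N\<^esub>"
  obtains g' where "g' \<in> Ring.ring_hom (L\<lparr>carrier := ring.simple_extension L D x\<rparr>) N" "\<And>d. d \<in> D ==> g' d = g d" "g' x = b"
proof -
  interpret L: field L by fact
  interpret N: field N by fact
  have sr: "subring D L" using assms(3) by (rule subfieldE(1))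
  have DL: "D \<subseteq> carrier L" using assms(3) by (rule subfieldE(3))
  let ?P = "univ_poly L D"
  define \<sigma> where "\<sigma> = (\<lambda>p. N.eval (map g p) b)"
  define \<epsilon> where "\<epsilon> = (\<lambda>p. L.eval p x)"
  have cP: "cring ?P" using L.univ_poly_is_domain[OF sr] by (rule domain.axioms(1))
  interpret P: cring ?P by (rule cP)
  interpret S: ring_hom_cring ?P N \<sigma>
    by (intro hom_cringI cP N.is_cring)
      (unfold \<sigma>_def, rule eval_map_hom[OF assms(1,3,2,4,7)])
  interpret E: ring_hom_cring ?P L \<epsilon>
    unfolding \<epsilon>_def by (rule L.eval_cring_hom[OF sr assms(5)])
  note Irr = L.IrrE[OF assms(3,5,6)]
  have wd0: "\<sigma> p = \<zero>\<^bsub>N\<^esub>" if p: "p \<in> carrier ?P" "\<epsilon> p = \<zero>\<^bsub>L\<^esub>" for p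
  proof -
    have "L.Irr D x pdivides\<^bsub>L\<^esub> p"
      using L.Irr_minimal[OF assms(3,5,6) p(1)] p(2) by (simp add: \<epsilon>_def)
    then have "L.Irr D x divides\<^bsub>?P\<^esub> p"
      using L.pdivides_iff_shell[OF assms(3) Irr(1) p(1)] by simp
    then obtain q where q: "q \<in> carrier ?P" "p = L.Irr D x \<otimes>\<^bsub>?P\<^esub> q"
      unfolding factor_def by auto
    have "\<sigma> (L.Irr D x) = \<zero>\<^bsub>N\<^esub>" using assms(8) by (simp add: \<sigma>_def)
    then show ?thesis using q Irr(1) by simp
  qed
  have wd: "\<sigma> p = \<sigma> q" if "p \<in> carrier ?P" "q \<in> carrier ?P" "\<epsilon> p = \<epsilon> q" for p q
  proof -
    have "\<epsilon> (p \<ominus>\<^bsub>?P\<^esub> q) = \<zero>\<^bsub>L\<^esub>"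
      using that E.hom_closed by (simp add: P.minus_eq L.r_neg)
    then have "\<sigma> (p \<ominus>\<^bsub>?P\<^esub> q) = \<zero>\<^bsub>N\<^esub>" using wd0[of "p \<ominus>\<^bsub>?P\<^esub> q"] that by simp
    then have "\<sigma> p \<ominus>\<^bsub>N\<^esub> \<sigma> q = \<zero>\<^bsub>N\<^esub>" using that by (simp add: P.minus_eq N.minus_eq)
    then show ?thesis using that by (simp add: S.hom_closed)
  qed
  define g' where "g' = (\<lambda>y. \<sigma> (SOME p. p \<in> carrier ?P \<and> \<epsilon> p = y))"
  have g': "g' (\<epsilon> p) = \<sigma> p" if "p \<in> carrier ?P" for p
  proof -
    have "(SOME q. q \<in> carrier ?P \<and> \<epsilon> q = \<epsilon> p) \<in> carrier ?P \<and> \<epsilon> (SOME q. q \<in> carrier ?P \<and> \<epsilon> q = \<epsilon> p) = \<epsilon> p"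
      using someI[of "\<lambda>q. q \<in> carrier ?P \<and> \<epsilon> q = \<epsilon> p" p] that by simp
    then show ?thesis unfolding g'_def using wd that by blast
  qed
  have img: "L.simple_extension D x = \<epsilon> ` carrier ?P"
    unfolding \<epsilon>_def by (rule L.simple_extension_as_eval_img[OF DL assms(5)])
  show ?thesis
  proof (rule that[of g'])
    show "g' \<in> Ring.ring_hom (L\<lparr>carrier := L.simple_extension D x\<rparr>) N"
    proof (rule ring_hom_memI)
      fix u assume "u \<in> carrier (L\<lparr>carrier := L.simple_extension D x\<rparr>)"
      then obtain p where p: "p \<in> carrier ?P" "u = \<epsilon> p" by (auto simp: img)
      show "g' u \<in> carrier N" using p g' by simp
      fix v assume "v \<in> carrier (L\<lparr>carrier := L.simple_extension D x\<rparr>)"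
      then obtain q where q: "q \<in> carrier ?P" "v = \<epsilon> q" by (auto simp: img)
      show "g' (u \<otimes>\<^bsub>L\<lparr>carrier := L.simple_extension D x\<rparr>\<^esub> v) = g' u \<otimes>\<^bsub>N\<^esub> g' v"
        using p q g'[of "p \<otimes>\<^bsub>?P\<^esub> q"] g' by simp
      show "g' (u \<oplus>\<^bsub>L\<lparr>carrier := L.simple_extension D x\<rparr>\<^esub> v) = g' u \<oplus>\<^bsub>N\<^esub> g' v"
        using p q g'[of "p \<oplus>\<^bsub>?P\<^esub> q"] g' by simp
    next
      show "g' \<one>\<^bsub>L\<lparr>carrier := L.simple_extension D x\<rparr>\<^esub> = \<one>\<^bsub>N\<^esub>"
        using g'[of "\<one>\<^bsub>?P\<^esub>"] by simp
    qed
    have g0: "g \<zero>\<^bsub>L\<^esub> = \<zero>\<^bsub>N\<^esub>"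
      using ring_hom_zero[OF assms(4) L.subring_is_ring[OF sr] N.is_ring] by simp
    have g1: "g \<one>\<^bsub>L\<^esub> = \<one>\<^bsub>N\<^esub>" using ring_hom_one[OF assms(4)] by simp
    show "g' d = g d" if d: "d \<in> D" for d
    proof (cases "d = \<zero>\<^bsub>L\<^esub>")
      case True
      have "g' (\<epsilon> \<zero>\<^bsub>?P\<^esub>) = \<zero>\<^bsub>N\<^esub>" using g'[of "\<zero>\<^bsub>?P\<^esub>"] by simp
      then show ?thesis using True g0 by simp
    next
      case False
      have p: "[d] \<in> carrier ?P" using d False unfolding univ_poly_carrier[symmetric] polynomial_def by simp
      have "g d \<in> carrier N" using ring_hom_closed[OF assms(4)] d by simp
      moreover have "d \<in> carrier L" using d DL by blast
      ultimately show ?thesis using g'[OF p] assms(5,7) by (simp add: \<epsilon>_def \<sigma>_def)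
    qed
    have p: "[\<one>\<^bsub>L\<^esub>, \<zero>\<^bsub>L\<^esub>] \<in> carrier ?P"
      using subringE(2,3)[OF sr] unfolding univ_poly_carrier[symmetric] polynomial_def by simp
    show "g' x = b" using g'[OF p] assms(5,7) g0 g1 by (simp add: \<epsilon>_def \<sigma>_def)
  qed
qed

text \<open>
  Graphs of homomorphisms from subfields of \<open>L\<close> to \<open>N\<close>, axiomatised by finitary conditions so that
  Zorn's lemma applies to them.
\<close>

definition hom_graph :: "('a, 'm) ring_scheme => ('b, 'n) ring_scheme => ('a \<times> 'b) set => bool" where
  "hom_graph L N \<Gamma> \<longleftrightarrow> \<Gamma> \<subseteq> carrier L \<times> carrier N \<and> (\<one>\<^bsub>L\<^esub>, \<one>\<^bsub>N\<^esub>) \<in> \<Gamma> \<and>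
     (\<forall>a b c d. (a, b) \<in> \<Gamma> \<longrightarrow> (c, d) \<in> \<Gamma> \<longrightarrow> (a \<oplus>\<^bsub>L\<^esub> c, b \<oplus>\<^bsub>N\<^esub> d) \<in> \<Gamma> \<and> (a \<otimes>\<^bsub>L\<^esub> c, b \<otimes>\<^bsub>N\<^esub> d) \<in> \<Gamma>) \<and>
     (\<forall>a b. (a, b) \<in> \<Gamma> \<longrightarrow> (\<ominus>\<^bsub>L\<^esub> a, \<ominus>\<^bsub>N\<^esub> b) \<in> \<Gamma> \<and> (a \<noteq> \<zero>\<^bsub>L\<^esub> \<longrightarrow> (\<exists>c. (inv\<^bsub>L\<^esub> a, c) \<in> \<Gamma>))) \<and>
     (\<forall>b. (\<zero>\<^bsub>L\<^esub>, b) \<in> \<Gamma> \<longrightarrow> b = \<zero>\<^bsub>N\<^esub>)"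

text \<open>Subtracting two pairs over the same element gives a pair over zero, so the last
  condition of \<open>hom_graph\<close> makes the relation single-valued; the condition on inverses
  makes its domain a subfield.\<close>

lemma hom_graph_hom:
  assumes "field L" "field N" "hom_graph L N \<Gamma>"
  obtains g where "subfield (Domain \<Gamma>) L" "g \<in> Ring.ring_hom (L\<lparr>carrier := Domain \<Gamma>\<rparr>) N" "\<Gamma> = {(d, g d) |d. d \<in> Domain \<Gamma>}"
proof -
  interpret L: field L by fact
  interpret N: field N by fact
  note G = assms(3)[unfolded hom_graph_def]
  have car: "a \<in> carrier L" "b \<in> carrier N" if "(a, b) \<in> \<Gamma>" for a b using G that by auto
  have uniq: "b = b'" if "(a, b) \<in> \<Gamma>" "(a, b') \<in> \<Gamma>" for a b b'
  proof -
    have "(a \<oplus>\<^bsub>L\<^esub> \<ominus>\<^bsub>L\<^esub> a, b \<oplus>\<^bsub>N\<^esub> \<ominus>\<^bsub>N\<^esub> b') \<in> \<Gamma>" using G that by blast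
    then have "(\<zero>\<^bsub>L\<^esub>, b \<oplus>\<^bsub>N\<^esub> \<ominus>\<^bsub>N\<^esub> b') \<in> \<Gamma>" using car that by (simp add: L.r_neg)
    then have "b \<ominus>\<^bsub>N\<^esub> b' = \<zero>\<^bsub>N\<^esub>" using G by (auto simp: N.minus_eq)
    then show ?thesis using car that by simp
  qed
  define g where "g = (\<lambda>a. THE b. (a, b) \<in> \<Gamma>)"
  have g: "g a = b" if "(a, b) \<in> \<Gamma>" for a b unfolding g_def using that uniq by blast
  have gD: "(a, g a) \<in> \<Gamma>" if "a \<in> Domain \<Gamma>" for a using that g by auto
  have sf: "subfield (Domain \<Gamma>) L"
  proof (rule L.subfieldI'[OF L.subringI])
    show "Domain \<Gamma> \<subseteq> carrier L" "\<one>\<^bsub>L\<^esub> \<in> Domain \<Gamma>" using G by auto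
    show "\<ominus>\<^bsub>L\<^esub> h \<in> Domain \<Gamma>" if "h \<in> Domain \<Gamma>" for h using G that by blast
    show "h1 \<otimes>\<^bsub>L\<^esub> h2 \<in> Domain \<Gamma>" "h1 \<oplus>\<^bsub>L\<^esub> h2 \<in> Domain \<Gamma>" if "h1 \<in> Domain \<Gamma>" "h2 \<in> Domain \<Gamma>" for h1 h2
      using G that by blast+
    show "inv\<^bsub>L\<^esub> h \<in> Domain \<Gamma>" if "h \<in> Domain \<Gamma> - {\<zero>\<^bsub>L\<^esub>}" for h using G that by blast
  qed
  have hom: "g \<in> Ring.ring_hom (L\<lparr>carrier := Domain \<Gamma>\<rparr>) N"
  proof (rule ring_hom_memI)
    fix a assume "a \<in> carrier (L\<lparr>carrier := Domain \<Gamma>\<rparr>)"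
    then have a: "(a, g a) \<in> \<Gamma>" using gD by simp
    then show "g a \<in> carrier N" using car by blast
    fix c assume "c \<in> carrier (L\<lparr>carrier := Domain \<Gamma>\<rparr>)"
    then have c: "(c, g c) \<in> \<Gamma>" using gD by simp
    have "(a \<otimes>\<^bsub>L\<^esub> c, g a \<otimes>\<^bsub>N\<^esub> g c) \<in> \<Gamma>" "(a \<oplus>\<^bsub>L\<^esub> c, g a \<oplus>\<^bsub>N\<^esub> g c) \<in> \<Gamma>" using G a c by blast+
    then show "g (a \<otimes>\<^bsub>L\<lparr>carrier := Domain \<Gamma>\<rparr>\<^esub> c) = g a \<otimes>\<^bsub>N\<^esub> g c"
      "g (a \<oplus>\<^bsub>L\<lparr>carrier := Domain \<Gamma>\<rparr>\<^esub> c) = g a \<oplus>\<^bsub>N\<^esub> g c" using g by simp_all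
  qed (use G g in simp)
  have "\<Gamma> = {(d, g d) |d. d \<in> Domain \<Gamma>}" using g gD by auto
  then show ?thesis using that sf hom by blast
qed

lemma hom_graphI:
  assumes "field L" "field N" "subfield D L" "g \<in> Ring.ring_hom (L\<lparr>carrier := D\<rparr>) N"
  shows "hom_graph L N {(d, g d) |d. d \<in> D}"
proof -
  interpret L: field L by fact
  interpret N: field N by fact
  have sr: "subring D L" using assms(3) by (rule subfieldE(1))
  interpret h: ring_hom_ring "L\<lparr>carrier := D\<rparr>" N g
    by (rule ring_hom_ringI2[OF L.subring_is_ring[OF sr] N.is_ring assms(4)])
  have DL: "D \<subseteq> carrier L" using assms(3) by (rule subfieldE(3))
  have ops: "\<ominus>\<^bsub>L\<^esub> a \<in> D" "a \<oplus>\<^bsub>L\<^esub> b \<in> D" "a \<otimes>\<^bsub>L\<^esub> b \<in> D" "\<one>\<^bsub>L\<^esub> \<in> D" "\<zero>\<^bsub>L\<^esub> \<in> D" if "a \<in> D" "b \<in> D" for a b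
    using subringE[OF sr] that by auto
  have one: "\<one>\<^bsub>L\<^esub> \<in> D" "\<zero>\<^bsub>L\<^esub> \<in> D" using subringE[OF sr] by auto
  have gc: "g a \<in> carrier N" if "a \<in> D" for a using h.hom_closed that by simp
  have g0: "g \<zero>\<^bsub>L\<^esub> = \<zero>\<^bsub>N\<^esub>" using h.hom_zero by simp
  have gneg: "g (\<ominus>\<^bsub>L\<^esub> a) = \<ominus>\<^bsub>N\<^esub> g a" if "a \<in> D" for a
  proof -
    have "g (\<ominus>\<^bsub>L\<^esub> a \<oplus>\<^bsub>L\<^esub> a) = g (\<ominus>\<^bsub>L\<^esub> a) \<oplus>\<^bsub>N\<^esub> g a" using h.hom_add[of "\<ominus>\<^bsub>L\<^esub> a" a] ops that by simp
    then have "g (\<ominus>\<^bsub>L\<^esub> a) \<oplus>\<^bsub>N\<^esub> g a = \<zero>\<^bsub>N\<^esub>" using that DL g0 L.l_neg[of a] by auto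
    then show ?thesis using N.minus_equality gc ops that by (metis N.a_comm N.minus_minus N.minus_unique)
  qed
  have inv: "inv\<^bsub>L\<^esub> a \<in> D" if "a \<in> D" "a \<noteq> \<zero>\<^bsub>L\<^esub>" for a
    using L.subfield_m_inv(1)[OF assms(3), of a] that by auto
  show ?thesis
    unfolding hom_graph_def
    using DL gc one ops gneg inv g0 h.hom_add h.hom_mult h.hom_one by auto
qed

text \<open>A maximal graph has domain \<open>L\<close>: for an \<open>x\<close> outside, the image
  of its minimal polynomial over the domain has a root in the algebraically closed \<open>N\<close>,
  and sending \<open>x\<close> to that root would enlarge the graph.\<close>

lemma extend_hom_algebraic:
  assumes "field L" "algebraically_closed N" "subfield k L" "\<And>x. x \<in> carrier L ==> (ring.algebraic L over k) x"
    and "f \<in> Ring.ring_hom (L\<lparr>carrier := k\<rparr>) N"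
  obtains j where "j \<in> Ring.ring_hom L N" "\<And>x. x \<in> k ==> j x = f x"
proof -
  interpret L: field L by fact
  interpret N: algebraically_closed N by fact
  note N = N.field_axioms
  define A where "A = {\<Gamma>. hom_graph L N \<Gamma> \<and> {(d, f d) |d. d \<in> k} \<subseteq> \<Gamma>}"
  have A0: "{(d, f d) |d. d \<in> k} \<in> A" unfolding A_def using hom_graphI[OF assms(1) N assms(3,5)] by simp
  have "\<exists>\<Gamma>\<in>A. \<forall>\<Delta>\<in>A. \<Gamma> \<subseteq> \<Delta> \<longrightarrow> \<Delta> = \<Gamma>"
  proof (rule subset_Zorn_nonempty)
    show "A \<noteq> {}" using A0 by blast
    fix C assume C: "C \<noteq> {}" "subset.chain A C"
    have CA: "C \<subseteq> A" using C(2) by (simp add: subset.chain_def)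
    have two: "\<exists>\<Gamma>\<in>C. p \<in> \<Gamma> \<and> q \<in> \<Gamma>" if "p \<in> \<Union>C" "q \<in> \<Union>C" for p q
      using that C(2) unfolding subset_chain_def by blast
    have good: "hom_graph L N \<Gamma>" "{(d, f d) |d. d \<in> k} \<subseteq> \<Gamma>" if "\<Gamma> \<in> C" for \<Gamma> using CA that by (auto simp: A_def)
    have "hom_graph L N (\<Union>C)"
      unfolding hom_graph_def
    proof (intro conjI allI impI)
      have "\<Gamma> \<subseteq> carrier L \<times> carrier N" if "\<Gamma> \<in> C" for \<Gamma> using good(1)[OF that] by (simp add: hom_graph_def)
      then show "\<Union>C \<subseteq> carrier L \<times> carrier N" by blast
      show "(\<one>\<^bsub>L\<^esub>, \<one>\<^bsub>N\<^esub>) \<in> \<Union>C" using good(1) C(1) by (auto simp: hom_graph_def)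
      fix a b
      {
        fix c d assume ab: "(a, b) \<in> \<Union>C" "(c, d) \<in> \<Union>C"
        from two[OF this] obtain \<Gamma> where \<Gamma>: "\<Gamma> \<in> C" "(a, b) \<in> \<Gamma>" "(c, d) \<in> \<Gamma>" by blast
        from good(1)[OF \<Gamma>(1)] \<Gamma>(2,3) have "(a \<oplus>\<^bsub>L\<^esub> c, b \<oplus>\<^bsub>N\<^esub> d) \<in> \<Gamma> \<and> (a \<otimes>\<^bsub>L\<^esub> c, b \<otimes>\<^bsub>N\<^esub> d) \<in> \<Gamma>"
          unfolding hom_graph_def by blast
        then show "(a \<oplus>\<^bsub>L\<^esub> c, b \<oplus>\<^bsub>N\<^esub> d) \<in> \<Union>C" "(a \<otimes>\<^bsub>L\<^esub> c, b \<otimes>\<^bsub>N\<^esub> d) \<in> \<Union>C" using \<Gamma>(1) by blast+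
      }
      {
        assume "(a, b) \<in> \<Union>C"
        then obtain \<Gamma> where \<Gamma>: "\<Gamma> \<in> C" "(a, b) \<in> \<Gamma>" by blast
        from good(1)[OF \<Gamma>(1)] \<Gamma>(2) have "(\<ominus>\<^bsub>L\<^esub> a, \<ominus>\<^bsub>N\<^esub> b) \<in> \<Gamma>" "a \<noteq> \<zero>\<^bsub>L\<^esub> ==> \<exists>c. (inv\<^bsub>L\<^esub> a, c) \<in> \<Gamma>"
          unfolding hom_graph_def by blast+
        then show "(\<ominus>\<^bsub>L\<^esub> a, \<ominus>\<^bsub>N\<^esub> b) \<in> \<Union>C" "a \<noteq> \<zero>\<^bsub>L\<^esub> ==> \<exists>c. (inv\<^bsub>L\<^esub> a, c) \<in> \<Union>C" using \<Gamma>(1) by blast+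
      }
    next
      fix b assume "(\<zero>\<^bsub>L\<^esub>, b) \<in> \<Union>C"
      then show "b = \<zero>\<^bsub>N\<^esub>" using good(1) by (auto simp: hom_graph_def)
    qed
    moreover have "{(d, f d) |d. d \<in> k} \<subseteq> \<Union>C" using good(2) C(1) by blast
    ultimately show "\<Union>C \<in> A" by (simp add: A_def)
  qed
  then obtain \<Gamma> where \<Gamma>: "hom_graph L N \<Gamma>" "{(d, f d) |d. d \<in> k} \<subseteq> \<Gamma>"
    and max: "\<And>\<Delta>. hom_graph L N \<Delta> ==> \<Gamma> \<subseteq> \<Delta> ==> \<Delta> = \<Gamma>"
    unfolding A_def by (smt (verit, best) mem_Collect_eq order_trans)
  from hom_graph_hom[OF assms(1) N \<Gamma>(1)] obtain g where g: "subfield (Domain \<Gamma>) L"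
    "g \<in> Ring.ring_hom (L\<lparr>carrier := Domain \<Gamma>\<rparr>) N" "\<Gamma> = {(d, g d) |d. d \<in> Domain \<Gamma>}" .
  define D where "D = Domain \<Gamma>"
  note gD = g[folded D_def]
  have kD: "k \<subseteq> D" using \<Gamma>(2) by (auto simp: D_def)
  have "x \<in> D" if x: "x \<in> carrier L" for x
  proof (rule ccontr)
    assume nx: "x \<notin> D"
    have alg: "(L.algebraic over D) x" by (rule L.algebraic_mono[OF kD assms(4)[OF x]])
    note Irr = L.IrrE[OF gD(1) x alg]
    have deg: "length (L.Irr D x) - 1 \<ge> 1" using L.pirreducible_degree[OF gD(1) Irr(1,2)] .
    have fD: "field (L\<lparr>carrier := D\<rparr>)" using L.subfield_iff(2)[OF gD(1)] .
    have q: "map g (L.Irr D x) \<in> carrier (univ_poly N (carrier N))"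
      using polynomial_hom[OF gD(2) fD N] Irr(1) L.univ_poly_consistent[OF subfieldE(1)[OF gD(1)]] by simp
    have "N.splitted (map g (L.Irr D x))" by (rule N.roots_over_carrier[OF q])
    then have "N.roots (map g (L.Irr D x)) \<noteq> {#}" using deg by (auto simp: N.splitted_def)
    then obtain b where "b \<in># N.roots (map g (L.Irr D x))" by blast
    then have b: "b \<in> carrier N" "N.eval (map g (L.Irr D x)) b = \<zero>\<^bsub>N\<^esub>"
      using N.roots_mem_iff_is_root[OF q] by (auto simp: N.is_root_def)
    from extend_hom_simple[OF assms(1) N gD(1,2) x alg b] obtain g' where
      g': "g' \<in> Ring.ring_hom (L\<lparr>carrier := L.simple_extension D x\<rparr>) N" "\<And>d. d \<in> D ==> g' d = g d" "g' x = b" by blast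
    have sE: "subfield (L.simple_extension D x) L" using L.simple_extension_is_subfield[OF gD(1) x] alg by simp
    have inc: "D \<subseteq> L.simple_extension D x" "x \<in> L.simple_extension D x"
      using L.simple_extension_incl[OF subfieldE(3)[OF gD(1)] x] L.simple_extension_mem[OF subfieldE(1)[OF gD(1)] x] by auto
    have sub: "\<Gamma> \<subseteq> {(d, g' d) |d. d \<in> L.simple_extension D x}"
      using gD(3) g'(2) inc(1) by force
    have "{(d, g' d) |d. d \<in> L.simple_extension D x} = \<Gamma>"
      by (rule max[OF hom_graphI[OF assms(1) N sE g'(1)] sub])
    then have "x \<in> D" using inc(2) by (auto simp: D_def)
    then show False using nx by simp
  qed
  then have DL: "D = carrier L" using subfieldE(3)[OF gD(1)] by auto
  show ?thesis
  proof (rule that[of g])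
    show "g \<in> Ring.ring_hom L N" using gD(2) unfolding DL by (simp add: Ring.ring_hom_def)
    show "g x = f x" if "x \<in> k" for x
    proof -
      have "(x, f x) \<in> \<Gamma>" using \<Gamma>(2) that by blast
      then show ?thesis using gD(3) by auto
    qed
  qed
qed

subsection \<open>Fixed elements\<close>

context algebraic_closure
begin

text \<open>Taken inside \<open>extensional\<close>, as in \<open>abs_gal\<close>, so that
  automorphisms agreeing on the carrier are equal as functions.\<close>

definition Gal :: "('a => 'a) set" where
  "Gal = {s \<in> ring_iso L L \<inter> extensional (carrier L). \<forall>x\<in>K. s x = x}"

lemma subfield_K: "subfield K L"
  by unfold_locales

lemma subring_K: "subring K L"
  using subfield_K by (rule subfieldE(1))

lemma K_carrier: "K \<subseteq> carrier L"
  using subfield_K by (rule subfieldE(3))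

lemma Gal_hom: "s \<in> Gal ==> ring_hom_cring L L s"
  unfolding Gal_def ring_iso_def
  by (intro hom_cringI is_cring) auto

lemma Gal_closed: "s \<in> Gal ==> x \<in> carrier L ==> s x \<in> carrier L"
  by (auto simp: Gal_def ring_iso_def intro: ring_hom_closed[of s L L])

lemma Gal_fix: "s \<in> Gal ==> x \<in> K ==> s x = x"
  by (simp add: Gal_def)

lemma Gal_bij: "s \<in> Gal ==> bij_betw s (carrier L) (carrier L)"
  by (simp add: Gal_def ring_iso_def)

lemma Gal_inj: "s \<in> Gal ==> inj_on s (carrier L)"
  using Gal_bij bij_betw_def by blast

lemma Gal_extensional: "s \<in> Gal ==> s \<in> extensional (carrier L)"
  by (simp add: Gal_def)

lemma Irr_K: assumes "x \<in> carrier L"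
  shows "Irr K x \<in> carrier (univ_poly L K)" "Irr K x \<in> carrier (univ_poly L (carrier L))" "Irr K x \<noteq> []"
    "eval (Irr K x) x = \<zero>" "set (Irr K x) \<subseteq> K"
proof -
  note I = IrrE[OF subfield_K assms algebraic_extension[OF assms]]
  show 1: "Irr K x \<in> carrier (univ_poly L K)" and "eval (Irr K x) x = \<zero>" using I by auto
  show "Irr K x \<noteq> []" using pirreducibleE(1)[OF subring_K I(1,2)] .
  show "set (Irr K x) \<subseteq> K" using 1 unfolding univ_poly_carrier[symmetric] polynomial_def by auto
  show "Irr K x \<in> carrier (univ_poly L (carrier L))" using carrier_polynomial[OF subring_K] 1 by (simp add: univ_poly_carrier)
qed

lemma finite_conjugates: "x \<in> carrier L ==> finite {y \<in> carrier L. eval (Irr K x) y = \<zero>}"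
  using finite_number_of_roots[OF Irr_K(2)] Irr_K(3) by (auto simp: is_root_def)

lemma hom_conjugate:
  assumes "j \<in> Ring.ring_hom L L" "\<And>x. x \<in> K ==> j x = x" "x \<in> carrier L" "y \<in> carrier L" "eval (Irr K x) y = \<zero>"
  shows "eval (Irr K x) (j y) = \<zero>"
proof -
  interpret h: ring_hom_ring L L j by (rule ring_hom_ringI2[OF ring_axioms ring_axioms assms(1)])
  have "map j (Irr K x) = Irr K x" using Irr_K(5)[OF assms(3)] assms(2) by (intro map_idI) auto
  moreover have "set (Irr K x) \<subseteq> carrier L" using Irr_K(5)[OF assms(3)] K_carrier by auto
  ultimately show ?thesis using h.eval_hom'[OF assms(4), of "Irr K x"] assms(5) by simp
qed

text \<open>Surjectivity is the point: an endomorphism over \<open>K\<close> is injective and maps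
  the finite root set of each minimal polynomial into itself, hence onto itself.\<close>

lemma endo_Gal:
  assumes "j \<in> Ring.ring_hom L L" "\<And>x. x \<in> K ==> j x = x"
  shows "restrict j (carrier L) \<in> Gal"
proof -
  have inj: "inj_on j (carrier L)"
    using non_trivial_field_hom_is_inj[OF assms(1) field_axioms field_axioms] .
  have "y \<in> j ` carrier L" if y: "y \<in> carrier L" for y
  proof -
    let ?S = "{z \<in> carrier L. eval (Irr K y) z = \<zero>}"
    have "j ` ?S \<subseteq> ?S" using hom_conjugate[OF assms y] ring_hom_closed[OF assms(1)] by auto
    moreover have "inj_on j ?S" using inj by (rule inj_on_subset) auto
    ultimately have "j ` ?S = ?S" using endo_inj_surj finite_conjugates[OF y] by blast
    then show ?thesis using y Irr_K(4)[OF y] by blast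
  qed
  then have "j ` carrier L = carrier L" using ring_hom_closed[OF assms(1)] by blast
  then have "j \<in> ring_iso L L" using assms(1) inj by (simp add: ring_iso_def bij_betw_def)
  then have "restrict j (carrier L) \<in> ring_iso L L" by (rule ring_iso_restrict) simp
  then show ?thesis using assms(2) K_carrier by (auto simp: Gal_def)
qed

lemma Gal_compose: "s \<in> Gal ==> t \<in> Gal ==> compose (carrier L) s t \<in> Gal"
proof -
  assume st: "s \<in> Gal" "t \<in> Gal"
  have "s \<circ> t \<in> Ring.ring_hom L L"
    using st by (intro ring_hom_trans[of t L L s L]) (auto simp: Gal_def ring_iso_def)
  then have "restrict (s \<circ> t) (carrier L) \<in> Gal" by (rule endo_Gal) (simp add: Gal_fix[OF st(1)] Gal_fix[OF st(2)])
  moreover have "restrict (s \<circ> t) (carrier L) = compose (carrier L) s t" by (auto simp: compose_def)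
  ultimately show ?thesis by simp
qed

lemma Gal_inverse:
  assumes "s \<in> Gal"
  obtains t where "t \<in> Gal" "\<And>x. x \<in> carrier L ==> t (s x) = x" "\<And>x. x \<in> carrier L ==> s (t x) = x"
proof
  let ?t = "inv_into (carrier L) s"
  have iso: "s \<in> ring_iso L L" using assms by (simp add: Gal_def)
  have t: "?t \<in> ring_iso L L" using ring_iso_set_sym[OF ring_axioms iso] .
  have inj: "inj_on s (carrier L)" using Gal_inj[OF assms] .
  show "restrict ?t (carrier L) \<in> Gal"
  proof (rule endo_Gal)
    show "?t \<in> Ring.ring_hom L L" using t by (simp add: ring_iso_def)
    show "?t x = x" if "x \<in> K" for x using inv_into_f_f[OF inj, of x] Gal_fix[OF assms that] that K_carrier by auto
  qed
  show "restrict ?t (carrier L) (s x) = x" if "x \<in> carrier L" for x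
    using inv_into_f_f[OF inj that] Gal_closed[OF assms that] by simp
  show "s (restrict ?t (carrier L) x) = x" if "x \<in> carrier L" for x
    using f_inv_into_f[of x s "carrier L"] Gal_bij[OF assms] that by (auto simp: bij_betw_def)
qed

lemma Gal_id: "restrict (\<lambda>x. x) (carrier L) \<in> Gal"
  by (rule endo_Gal) (auto simp: Ring.ring_hom_def)

text \<open>Sending \<open>x\<close> to \<open>y\<close> defines a map on
  \<open>simple_extension K x\<close>, which extends to \<open>L\<close> because \<open>L\<close> is
  algebraic over this subfield and algebraically closed; by \<open>endo_Gal\<close> the result is an
  automorphism.\<close>

lemma conjugate_Gal:
  assumes "x \<in> carrier L" "y \<in> carrier L" "eval (Irr K x) y = \<zero>"
  obtains s where "s \<in> Gal" "s x = y"
proof -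
  have id: "(\<lambda>x. x) \<in> Ring.ring_hom (L\<lparr>carrier := K\<rparr>) L" using K_carrier by (auto simp: Ring.ring_hom_def)
  have alg: "(algebraic over K) x" using algebraic_extension[OF assms(1)] .
  from extend_hom_simple[OF field_axioms field_axioms subfield_K id assms(1) alg assms(2)] assms(3)
  obtain g where g: "g \<in> Ring.ring_hom (L\<lparr>carrier := simple_extension K x\<rparr>) L" "\<And>d. d \<in> K ==> g d = d" "g x = y"
    by auto
  have inc: "K \<subseteq> simple_extension K x" "x \<in> simple_extension K x"
    using simple_extension_incl[OF K_carrier assms(1)] simple_extension_mem[OF subring_K assms(1)] by auto
  have sE: "subfield (simple_extension K x) L" using simple_extension_is_subfield[OF subfield_K assms(1)] alg by simp
  have algE: "(algebraic over (simple_extension K x)) z" if "z \<in> carrier L" for z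
    using algebraic_mono[OF inc(1) algebraic_extension[OF that]] .
  from extend_hom_algebraic[OF field_axioms algebraically_closed_axioms sE algE g(1)]
  obtain j where j: "j \<in> Ring.ring_hom L L" "\<And>z. z \<in> simple_extension K x ==> j z = g z" by blast
  have "restrict j (carrier L) \<in> Gal" by (rule endo_Gal[OF j(1)]) (use j(2) g(2) inc in auto)
  then show ?thesis using that[of "restrict j (carrier L)"] j(2)[OF inc(2)] g(3) assms(1) by simp
qed

lemma exists_root_poly:
  assumes "p \<in> carrier (univ_poly L (carrier L))" "length p \<ge> 2"
  obtains y where "y \<in> carrier L" "eval p y = \<zero>"
proof -
  have "splitted p" by (rule roots_over_carrier[OF assms(1)])
  then have "roots p \<noteq> {#}" using assms(2) by (auto simp: splitted_def)
  then obtain y where "y \<in># roots p" by blast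
  then show ?thesis using that roots_mem_iff_is_root[OF assms(1)] by (auto simp: is_root_def)
qed

text \<open>Since the polynomial splits, it is a constant times a power of X - x. Only the value at
  zero is recorded: for coefficients in \<open>K\<close> it lies in \<open>K\<close>, which is how a
  power of \<open>x\<close> is found there.\<close>

lemma sole_root:
  assumes "x \<in> carrier L" "p \<in> carrier (univ_poly L (carrier L))" "p \<noteq> []"
    and "\<And>y. y \<in> carrier L ==> eval p y = \<zero> ==> y = x"
  shows "eval p \<zero> = hd p \<otimes> (\<ominus> x) [^] (length p - 1)"
  using assms(2-4)
proof (induction "length p" arbitrary: p rule: less_induct)
  case less
  have pc: "polynomial (carrier L) p" "set p \<subseteq> carrier L"
    using less.prems(1) by (auto simp: univ_poly_carrier[symmetric] polynomial_def)
  show ?case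
  proof (cases "length p \<ge> 2")
    case False
    then obtain c where "p = [c]" using less.prems(2) by (cases p) (auto simp: Suc_le_eq)
    then show ?thesis using pc by simp
  next
    case True
    from exists_root_poly[OF less.prems(1) True] obtain y where "y \<in> carrier L" "eval p y = \<zero>" .
    then have "is_root p x" using less.prems(2,3) by (auto simp: is_root_def)
    from is_root_imp_pdivides[OF less.prems(1) this]
    obtain q where q: "q \<in> carrier (univ_poly L (carrier L))" "p = [\<one>, \<ominus> x] \<otimes>\<^bsub>univ_poly L (carrier L)\<^esub> q"
      unfolding pdivides_def factor_def by auto
    have l: "[\<one>, \<ominus> x] \<in> carrier (univ_poly L (carrier L))"
      using assms(1) by (auto simp: univ_poly_carrier[symmetric] polynomial_def)
    have pol: "polynomial (carrier L) [\<one>, \<ominus> x]" "polynomial (carrier L) q" using l q(1) by (auto simp: univ_poly_carrier)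
    have pm: "p = poly_mult [\<one>, \<ominus> x] q" using q(2) by (simp add: univ_poly_mult)
    have qn: "q \<noteq> []"
    proof
      assume "q = []"
      then have "p = \<zero>\<^bsub>univ_poly L (carrier L)\<^esub>"
        using q(2) l cring.cring_simprules(27)[OF univ_poly_is_cring[OF carrier_is_subring] l] by (simp add: univ_poly_zero)
      then show False using less.prems(2) by (simp add: univ_poly_zero)
    qed
    have len: "length p - 1 = Suc (length q - 1)"
      using poly_mult_degree_eq[OF carrier_is_subring pol] qn pm by simp
    then have lt: "length q < length p" by simp
    have hdp: "hd p = hd q"
    proof -
      have "hd q \<in> carrier L" using pol(2) qn unfolding polynomial_def by (cases q) auto
      then show ?thesis using poly_mult_lead_coeff[OF carrier_is_subring pol _ qn] pm by simp
    qed
    have ev: "eval p z = (z \<ominus> x) \<otimes> eval q z" if "z \<in> carrier L" for z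
      using ring_hom_memE(2)[OF eval_is_hom[OF carrier_is_subring that] l q(1)] q(2) that assms(1) by (simp add: minus_eq)
    have qc: "eval q z \<in> carrier L" if "z \<in> carrier L" for z
      using eval_poly_in_carrier[OF carrier_is_subring pol(2) that] .
    have "eval q \<zero> = hd q \<otimes> (\<ominus> x) [^] (length q - 1)"
    proof (rule less.hyps[OF lt q(1) qn])
      fix y assume y: "y \<in> carrier L" "eval q y = \<zero>"
      then have "eval p y = \<zero>" using ev[OF y(1)] assms(1) by simp
      then show "y = x" using less.prems(3) y by simp
    qed
    moreover have "hd q \<in> carrier L" using pol(2) qn unfolding polynomial_def by (cases q) auto
    ultimately show ?thesis
      unfolding len hdp ev[OF zero_closed] using assms(1) by (simp add: minus_eq m_ac)
  qed
qed

text \<open>All conjugates of \<open>x\<close> coincide, so up to sign the constant coefficient of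
  its minimal polynomial is a power of \<open>x\<close>. In positive characteristic \<open>x\<close>
  itself need not lie in \<open>K\<close>.\<close>

lemma fixed_power:
  assumes "x \<in> carrier L" "\<And>s. s \<in> Gal ==> s x = x"
  obtains m :: nat where "m > 0" "x [^] m \<in> K"
proof -
  let ?p = "Irr K x"
  note I = Irr_K[OF assms(1)]
  have "y = x" if "y \<in> carrier L" "eval ?p y = \<zero>" for y
    using conjugate_Gal[OF assms(1) that] assms(2) by metis
  then have ev: "eval ?p \<zero> = hd ?p \<otimes> (\<ominus> x) [^] (length ?p - 1)"
    by (intro sole_root[OF assms(1) I(2,3)])
  have hd1: "hd ?p = \<one>" using IrrE(3)[OF subfield_K assms(1) algebraic_extension[OF assms(1)]] .
  have zK: "\<zero> \<in> K" "\<one> \<in> K" using subringE(2,3)[OF subring_K] by auto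
  have "ring.eval (L\<lparr>carrier := K\<rparr>) ?p \<zero> \<in> K"
    using ring.eval_in_carrier[OF subring_is_ring[OF subring_K], of ?p \<zero>] I(5) zK by simp
  then have mK: "(\<ominus> x) [^] (length ?p - 1) \<in> K" using ev hd1 eval_consistent[OF subring_K] assms(1) by simp
  have pw: "(\<ominus> x) [^] m = x [^] m \<or> (\<ominus> x) [^] m = \<ominus> (x [^] m)" for m :: nat
    using assms(1) by (induction m) (auto simp: l_minus r_minus)
  have "x [^] (length ?p - 1) \<in> K"
    using pw[of "length ?p - 1"] mK subringE(5)[OF subring_K, of "(\<ominus> x) [^] (length ?p - 1)"] assms(1) by auto
  moreover have "length ?p - 1 > 0"
    using pirreducible_degree[OF subfield_K I(1)] IrrE(2)[OF subfield_K assms(1) algebraic_extension[OF assms(1)]] by simp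
  ultimately show ?thesis using that by blast
qed

text \<open>Otherwise X^2 - z^2 would be the minimal polynomial of \<open>z\<close> up to a
  constant, and the negative of \<open>z\<close> would be a conjugate, different from
  \<open>z\<close> in characteristic not two.\<close>

lemma fixed_quadratic:
  assumes two: "\<one> \<oplus> \<one> \<noteq> \<zero>" and z: "z \<in> carrier L" "z \<otimes> z \<in> K" "\<And>s. s \<in> Gal ==> s z = z"
  shows "z \<in> K"
proof (rule ccontr)
  assume nz: "z \<notin> K"
  note I = Irr_K[OF z(1)]
  have irr: "pirreducible K (Irr K z)" and lc: "hd (Irr K z) = \<one>"
    using IrrE(2,3)[OF subfield_K z(1) algebraic_extension[OF z(1)]] by auto
  let ?P = "[\<one>, \<zero>, \<ominus> (z \<otimes> z)]"
  have ops: "\<zero> \<in> K" "\<one> \<in> K" "\<ominus> (z \<otimes> z) \<in> K" using subringE(2,3,5)[OF subring_K] z(2) by auto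
  have P: "?P \<in> carrier (univ_poly L K)" using ops by (auto simp: univ_poly_carrier[symmetric] polynomial_def)
  have ev: "eval ?P y = y \<otimes> y \<ominus> z \<otimes> z" if "y \<in> carrier L" for y
    using that z(1) by (simp add: numeral_2_eq_2 minus_eq)
  have "Irr K z pdivides ?P"
    using Irr_minimal[OF subfield_K z(1) algebraic_extension[OF z(1)] P] ev[OF z(1)] z(1) by (simp add: minus_eq r_neg)
  then have "Irr K z divides\<^bsub>univ_poly L K\<^esub> ?P" using pdivides_iff_shell[OF subfield_K I(1) P] by simp
  then obtain q where q: "q \<in> carrier (univ_poly L K)" "?P = Irr K z \<otimes>\<^bsub>univ_poly L K\<^esub> q"
    unfolding factor_def by auto
  have pm: "?P = poly_mult (Irr K z) q" using q(2) by (simp add: univ_poly_mult)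
  have pol: "polynomial K (Irr K z)" "polynomial K q" using I(1) q(1) by (auto simp: univ_poly_carrier)
  have qn: "q \<noteq> []" using pm poly_mult_zero(2)[OF I(2)[THEN polynomial_in_carrier[OF carrier_is_subring, folded univ_poly_carrier[symmetric]]]] by auto
  have "length ?P - 1 = (length (Irr K z) - 1) + (length q - 1)"
    using poly_mult_degree_eq[OF subring_K pol] qn I(3) arg_cong[OF pm, of length] by simp
  then have deg: "(length (Irr K z) - 1) + (length q - 1) = 2" by simp
  have d2: "length (Irr K z) - 1 \<noteq> 1"
  proof
    assume "length (Irr K z) - 1 = 1"
    then have "length (Irr K z) = 2" by simp
    then obtain a b where ab: "Irr K z = [a, b]" by (metis (no_types, opaque_lifting) One_nat_def Suc_1 length_0_conv length_Suc_conv)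
    have "a = \<one>" using lc ab by simp
    moreover have bK: "b \<in> K" "b \<in> carrier L" using I(5) ab K_carrier by auto
    ultimately have "z \<oplus> b = \<zero>" using I(4) ab z(1) by simp
    then have "z = \<ominus> b" using sum_zero_eq_neg[OF z(1) bK(2)] by simp
    then show False using nz subringE(5)[OF subring_K bK(1)] by simp
  qed
  have "length (Irr K z) - 1 \<ge> 1" using pirreducible_degree[OF subfield_K I(1) irr] .
  \<comment> \<open>The cofactor \<open>q\<close> is a nonzero constant, so the root
    \<open>\<ominus> z\<close> of X^2 - z^2 is also a root of \<open>Irr K z\<close>.\<close>
  then have "length q - 1 = 0" using d2 deg by linarith
  then have "length q = 1" using qn by (cases q) auto
  then obtain c where c: "q = [c]" by (metis One_nat_def length_0_conv length_Suc_conv)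
  have cc: "c \<in> carrier L" "c \<noteq> \<zero>" using pol(2) c K_carrier by (auto simp: polynomial_def)
  have mz: "\<ominus> z \<in> carrier L" using z(1) by simp
  have "eval ?P (\<ominus> z) = eval (Irr K z) (\<ominus> z) \<otimes> c"
    using ring_hom_memE(2)[OF eval_is_hom[OF subring_K mz] I(1) q(1)] q(2) c cc mz by simp
  moreover have "eval ?P (\<ominus> z) = \<zero>" using ev[OF mz] z(1) by (simp add: l_minus r_minus minus_eq r_neg)
  moreover have "eval (Irr K z) (\<ominus> z) \<in> carrier L" using eval_poly_in_carrier[OF subring_K pol(1) mz] .
  ultimately have "eval (Irr K z) (\<ominus> z) = \<zero>" using cc integral by metis
  from conjugate_Gal[OF z(1) mz this] obtain s where s: "s \<in> Gal" "s z = \<ominus> z" .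
  then have "z = \<ominus> z" using z(3) by metis
  then have "z \<oplus> z = \<zero>" using z(1) by (metis l_neg)
  then have "(\<one> \<oplus> \<one>) \<otimes> z = \<zero>" using z(1) by (simp add: l_distr)
  then have "z = \<zero>" using integral[of "\<one> \<oplus> \<one>" z] two z(1) by auto
  then show False using nz ops by simp
qed

end

subsection \<open>Linear independence of characters\<close>

text \<open>Dedekind's argument: choose \<open>w\<close> where \<tau> and \<rho> differ, substitute
  w x for x in the relation and subtract \<rho> w times the relation; this removes \<rho>. The
  common domain is a multiplicative monoid \<open>M\<close>, as the characters to come are
  restrictions of automorphisms to a set closed under products.\<close>

lemma (in field) characters_independent:
  assumes "finite T" "M \<subseteq> carrier R" "\<one> \<in> M" "\<And>x y. x \<in> M ==> y \<in> M ==> x \<otimes> y \<in> M"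
    and "\<And>\<tau> x. \<tau> \<in> T ==> x \<in> M ==> \<tau> x \<in> carrier R"
    and "\<And>\<tau> x y. \<tau> \<in> T ==> x \<in> M ==> y \<in> M ==> \<tau> (x \<otimes> y) = \<tau> x \<otimes> \<tau> y"
    and "\<And>\<tau>. \<tau> \<in> T ==> \<tau> \<one> = \<one>"
    and "\<And>\<tau> \<tau>'. \<tau> \<in> T ==> \<tau>' \<in> T ==> \<tau> \<noteq> \<tau>' ==> \<exists>x\<in>M. \<tau> x \<noteq> \<tau>' x"
    and "\<And>\<tau>. \<tau> \<in> T ==> a \<tau> \<in> carrier R"
    and "\<And>x. x \<in> M ==> (\<Oplus>\<tau>\<in>T. a \<tau> \<otimes> \<tau> x) = \<zero>"
  shows "\<tau> \<in> T ==> a \<tau> = \<zero>"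
  using assms(1,5-10)
proof (induction T arbitrary: a \<tau> rule: finite_induct)
  case empty
  then show ?case by simp
next
  case (insert \<rho> T)
  have cl: "\<tau> x \<in> carrier R" "a \<tau> \<in> carrier R" if "\<tau> \<in> insert \<rho> T" "x \<in> M" for \<tau> x
    using insert.prems that by auto
  have ac: "a \<tau> \<in> carrier R" if "\<tau> \<in> insert \<rho> T" for \<tau> using insert.prems that by auto
  have sum: "a \<rho> \<otimes> \<rho> x \<oplus> (\<Oplus>\<tau>\<in>T. a \<tau> \<otimes> \<tau> x) = \<zero>" if "x \<in> M" for x
  proof -
    have "(\<Oplus>\<tau>\<in>insert \<rho> T. a \<tau> \<otimes> \<tau> x) = a \<rho> \<otimes> \<rho> x \<oplus> (\<Oplus>\<tau>\<in>T. a \<tau> \<otimes> \<tau> x)"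
      using insert.hyps cl that by (intro finsum_insert) auto
    then show ?thesis using insert.prems(7)[OF that] by simp
  qed
  have T0: "a \<tau> = \<zero>" if t: "\<tau> \<in> T" for \<tau>
  proof -
    have "\<tau> \<noteq> \<rho>" using t insert.hyps by auto
    then obtain w where w: "w \<in> M" "\<tau> w \<noteq> \<rho> w" using insert.prems(5) t by blast
    have rw: "\<rho> w \<in> carrier R" using cl w by auto
    define b where "b = (\<lambda>\<tau>. a \<tau> \<otimes> (\<tau> w \<ominus> \<rho> w))"
    have bc: "b \<tau> \<in> carrier R" if "\<tau> \<in> T" for \<tau> unfolding b_def using cl that w rw by auto
    have "(\<Oplus>\<tau>\<in>T. b \<tau> \<otimes> \<tau> x) = \<zero>" if x: "x \<in> M" for x
    proof -
      have wx: "w \<otimes> x \<in> M" using assms(4) w x by auto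
      have rx: "\<rho> x \<in> carrier R" using cl x by auto
      define S where "S = (\<Oplus>\<tau>\<in>T. a \<tau> \<otimes> \<tau> x)"
      have S: "S \<in> carrier R" unfolding S_def using cl x by (intro finsum_closed) auto
      have "(\<Oplus>\<tau>\<in>T. a \<tau> \<otimes> \<tau> (w \<otimes> x)) = (\<Oplus>\<tau>\<in>T. b \<tau> \<otimes> \<tau> x \<oplus> \<rho> w \<otimes> (a \<tau> \<otimes> \<tau> x))"
      proof (intro finsum_cong')
        fix \<tau> assume t: "\<tau> \<in> T"
        have "\<tau> (w \<otimes> x) = \<tau> w \<otimes> \<tau> x" using insert.prems(3) t w x by auto
        moreover have "\<tau> w \<in> carrier R" "\<tau> x \<in> carrier R" "a \<tau> \<in> carrier R" using cl t w x by auto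
        moreover from this have "b \<tau> \<otimes> \<tau> x = a \<tau> \<otimes> (\<tau> w \<otimes> \<tau> x) \<oplus> \<ominus> (\<rho> w \<otimes> (a \<tau> \<otimes> \<tau> x))"
          unfolding b_def using rw by (simp add: minus_eq l_distr r_distr l_minus r_minus m_ac)
        ultimately show "a \<tau> \<otimes> \<tau> (w \<otimes> x) = b \<tau> \<otimes> \<tau> x \<oplus> \<rho> w \<otimes> (a \<tau> \<otimes> \<tau> x)"
          using rw by (simp add: a_assoc l_neg)
      qed (use cl bc x rw in auto)
      also have "\<dots> = (\<Oplus>\<tau>\<in>T. b \<tau> \<otimes> \<tau> x) \<oplus> (\<Oplus>\<tau>\<in>T. \<rho> w \<otimes> (a \<tau> \<otimes> \<tau> x))"
        using cl bc x rw by (intro finsum_addf) auto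
      also have "(\<Oplus>\<tau>\<in>T. \<rho> w \<otimes> (a \<tau> \<otimes> \<tau> x)) = \<rho> w \<otimes> S"
        unfolding S_def using cl x rw insert.hyps by (subst finsum_rdistr) auto
      finally have e: "(\<Oplus>\<tau>\<in>T. a \<tau> \<otimes> \<tau> (w \<otimes> x)) = (\<Oplus>\<tau>\<in>T. b \<tau> \<otimes> \<tau> x) \<oplus> \<rho> w \<otimes> S" .
      define B where "B = (\<Oplus>\<tau>\<in>T. b \<tau> \<otimes> \<tau> x)"
      have B: "B \<in> carrier R" unfolding B_def using cl bc x by (intro finsum_closed) auto
      have ar: "a \<rho> \<in> carrier R" using ac by auto
      have 1: "a \<rho> \<otimes> (\<rho> w \<otimes> \<rho> x) \<oplus> (B \<oplus> \<rho> w \<otimes> S) = \<zero>"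
        using sum[OF wx] e insert.prems(3)[of \<rho> w x] w x by (simp add: B_def)
      have 2: "\<rho> w \<otimes> (a \<rho> \<otimes> \<rho> x \<oplus> S) = \<zero>" using sum[OF x] rw by (simp add: S_def)
      have "B = (a \<rho> \<otimes> (\<rho> w \<otimes> \<rho> x) \<oplus> (B \<oplus> \<rho> w \<otimes> S)) \<ominus> \<rho> w \<otimes> (a \<rho> \<otimes> \<rho> x \<oplus> S)"
      proof -
        have "a \<rho> \<otimes> (\<rho> w \<otimes> \<rho> x) = \<rho> w \<otimes> (a \<rho> \<otimes> \<rho> x)" using ar rw rx by (simp add: m_ac)
        then have "(a \<rho> \<otimes> (\<rho> w \<otimes> \<rho> x) \<oplus> (B \<oplus> \<rho> w \<otimes> S)) \<ominus> \<rho> w \<otimes> (a \<rho> \<otimes> \<rho> x \<oplus> S) =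
            B \<oplus> (\<rho> w \<otimes> (a \<rho> \<otimes> \<rho> x \<oplus> S) \<ominus> \<rho> w \<otimes> (a \<rho> \<otimes> \<rho> x \<oplus> S))"
          using ar rw rx B S by (simp add: minus_eq r_distr a_ac)
        then show ?thesis using ar rw rx B S by (simp add: minus_eq r_neg)
      qed
      also have "\<dots> = \<zero>" using 1 2 by (simp add: minus_eq)
      finally show ?thesis by (simp add: B_def)
    qed
    then have "b \<tau> = \<zero>" using insert.IH[of \<tau> b] t insert.prems bc by auto
    then have "a \<tau> \<otimes> (\<tau> w \<ominus> \<rho> w) = \<zero>" by (simp add: b_def)
    moreover have "\<tau> w \<ominus> \<rho> w \<noteq> \<zero>" using w rw cl t by auto
    ultimately show ?thesis using integral[of "a \<tau>" "\<tau> w \<ominus> \<rho> w"] cl t w rw by auto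
  qed
  have "(\<Oplus>\<tau>\<in>T. a \<tau> \<otimes> \<tau> \<one>) = (\<Oplus>\<tau>\<in>T. \<zero>)" using T0 cl assms(3) by (intro finsum_cong') auto
  then have "a \<rho> = \<zero>" using sum[OF assms(3)] insert.prems(4)[of \<rho>] ac by simp
  then show ?case using T0 insert.prems(1) by auto
qed

subsection \<open>Quadratic characters of the Galois group\<close>

context algebraic_closure
begin

text \<open>
  Hilbert 90 for the characters with values \<open>\<plusminus>1\<close>. Elements fixed by all automorphisms are only
  purely inseparable over \<open>K\<close>; an odd power takes care of this.
\<close>

lemma quadratic_character:
  assumes two: "\<one> \<oplus> \<one> \<noteq> \<zero>"
    and c: "\<And>s. s \<in> Gal ==> c s \<in> {\<one>, \<ominus> \<one>}"
    and cm: "\<And>s t. s \<in> Gal ==> t \<in> Gal ==> c (compose (carrier L) s t) = c s \<otimes> c t"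
    and A: "finite A" "A \<subseteq> carrier L" "\<And>t. t \<in> Gal ==> (\<forall>x\<in>A. t x = x) ==> c t = \<one>"
  obtains y where "y \<in> carrier L" "y \<noteq> \<zero>" "y \<otimes> y \<in> K" "\<And>s. s \<in> Gal ==> s y = c s \<otimes> y"
proof -
  have cc: "c s \<in> carrier L" "c s \<otimes> c s = \<one>" "c s \<in> K" if "s \<in> Gal" for s
  proof -
    have 1: "\<ominus> \<one> \<otimes> \<ominus> \<one> = \<one>" by (simp add: l_minus)
    have 2: "\<one> \<in> K" "\<ominus> \<one> \<in> K" using subringE(3)[OF subring_K] subringE(5)[OF subring_K] by blast+
    have "c s = \<one> \<or> c s = \<ominus> \<one>" using c[OF that] by blast
    then show "c s \<in> carrier L" "c s \<otimes> c s = \<one>" "c s \<in> K" using 1 2 by auto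
  qed
  \<comment> \<open>\<open>M\<close> consists of the elements fixed by the pointwise stabiliser of
    the finite set \<open>A\<close>. Automorphisms that agree on \<open>A\<close> agree on
    \<open>M\<close> and have the same value under \<open>c\<close>, so \<open>c\<close> factors
    through the set \<open>T\<close> of restrictions to \<open>M\<close>, which is finite because
    each element of \<open>A\<close> has finitely many conjugates.\<close>
  define M where "M = {z \<in> carrier L. \<forall>t\<in>Gal. (\<forall>x\<in>A. t x = x) \<longrightarrow> t z = z}"
  have AM: "A \<subseteq> M" using A(2) by (auto simp: M_def)
  have Mc: "M \<subseteq> carrier L" by (auto simp: M_def)
  have M1: "\<one> \<in> M" using Gal_fix subringE(3)[OF subring_K] by (auto simp: M_def)
  have Mm: "x \<otimes> y \<in> M" if "x \<in> M" "y \<in> M" for x y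
  proof -
    have "t (x \<otimes> y) = x \<otimes> y" if "t \<in> Gal" "\<forall>x\<in>A. t x = x" for t
    proof -
      have "t x = x" "t y = y" "x \<in> carrier L" "y \<in> carrier L" using \<open>x \<in> M\<close> \<open>y \<in> M\<close> that unfolding M_def by blast+
      then show ?thesis using ring_hom_mult[OF ring_hom_cring.homh[OF Gal_hom[OF that(1)]], of x y] by simp
    qed
    then show ?thesis using that by (simp add: M_def)
  qed
  have same: "(\<forall>x\<in>M. s x = t x) \<and> c s = c t" if st: "s \<in> Gal" "t \<in> Gal" and eq: "\<forall>x\<in>A. s x = t x" for s t
  proof -
    from Gal_inverse[OF st(2)] obtain t' where t': "t' \<in> Gal" "\<And>x. x \<in> carrier L ==> t' (t x) = x" "\<And>x. x \<in> carrier L ==> t (t' x) = x" by blast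
    define u where "u = compose (carrier L) t' s"
    have u: "u \<in> Gal" unfolding u_def by (rule Gal_compose[OF t'(1) st(1)])
    have uA: "\<forall>x\<in>A. u x = x" using eq t'(2) A(2) by (auto simp: u_def compose_def)
    have ux: "u x = x" if "x \<in> M" for x using that u uA by (auto simp: M_def)
    have tu: "t (u x) = s x" if "x \<in> carrier L" for x
      using t'(3)[of "s x"] Gal_closed[OF st(1) that] that by (simp add: u_def compose_def)
    have "s x = t x" if "x \<in> M" for x using tu[of x] ux[OF that] that Mc by auto
    moreover have "s = compose (carrier L) t u"
      using Gal_extensional[OF st(1)] tu by (intro extensionalityI[of s "carrier L"]) (auto simp: compose_def)
    then have "c s = c t" using cm[OF st(2) u] A(3)[OF u uA] cc(1)[OF st(2)] by simp
    ultimately show ?thesis by blast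
  qed
  define T where "T = (\<lambda>t. restrict t M) ` Gal"
  have finT: "finite T"
  proof -
    have inj: "inj_on (\<lambda>\<tau>. restrict \<tau> A) T"
    proof (rule inj_onI)
      fix \<tau> \<tau>' assume "\<tau> \<in> T" "\<tau>' \<in> T" and eq: "restrict \<tau> A = restrict \<tau>' A"
      then obtain t t' where t: "t \<in> Gal" "\<tau> = restrict t M" "t' \<in> Gal" "\<tau>' = restrict t' M" by (auto simp: T_def)
      have "t x = t' x" if "x \<in> A" for x using fun_cong[OF eq, of x] that t AM by auto
      then show "\<tau> = \<tau>'" using same[OF t(1,3)] t by (auto intro!: restrict_ext)
    qed
    have sub: "(\<lambda>\<tau>. restrict \<tau> A) ` T \<subseteq> (\<Pi>\<^sub>E a\<in>A. {y \<in> carrier L. eval (Irr K a) y = \<zero>})"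
    proof (rule image_subsetI)
      fix \<tau> assume "\<tau> \<in> T"
      then obtain t where t: "t \<in> Gal" "\<tau> = restrict t M" by (auto simp: T_def)
      have "t \<in> Ring.ring_hom L L" using t(1) by (simp add: Gal_def ring_iso_def)
      then have "t a \<in> carrier L \<and> eval (Irr K a) (t a) = \<zero>" if "a \<in> A" for a
        using hom_conjugate[OF _ Gal_fix[OF t(1)], of a a] Irr_K(4)[of a] Gal_closed[OF t(1)] that A(2) by auto
      then show "restrict \<tau> A \<in> (\<Pi>\<^sub>E a\<in>A. {y \<in> carrier L. eval (Irr K a) y = \<zero>})" using t(2) AM by auto
    qed
    have "finite (\<Pi>\<^sub>E a\<in>A. {y \<in> carrier L. eval (Irr K a) y = \<zero>})"
      using A(1,2) finite_conjugates by (intro finite_PiE) auto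
    then show ?thesis by (rule finite_imageD[OF finite_subset[OF sub] inj])
  qed
  define C where "C = (\<lambda>\<tau>. c (SOME t. t \<in> Gal \<and> restrict t M = \<tau>))"
  have Ct: "C (restrict t M) = c t" if t: "t \<in> Gal" for t
  proof -
    define u where "u = (SOME u. u \<in> Gal \<and> restrict u M = restrict t M)"
    have "u \<in> Gal \<and> restrict u M = restrict t M" unfolding u_def by (rule someI[of _ t]) (use t in simp)
    then have u: "u \<in> Gal" "restrict u M = restrict t M" by blast+
    have "u x = t x" if "x \<in> A" for x using fun_cong[OF u(2), of x] that AM by auto
    then show ?thesis using same[OF u(1) t] by (simp add: C_def u_def)
  qed
  have Tcl: "\<tau> x \<in> carrier L" if "\<tau> \<in> T" "x \<in> M" for \<tau> x
    using that Gal_closed Mc by (auto simp: T_def)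
  have Ccl: "C \<tau> \<in> carrier L" if "\<tau> \<in> T" for \<tau> using that Ct cc by (auto simp: T_def)
  \<comment> \<open>A Lagrange resolvent that does not vanish. Independence of characters applies
    because the coefficient at the identity has square one and so is nonzero.\<close>
  have "\<exists>z\<in>M. (\<Oplus>\<tau>\<in>T. C \<tau> \<otimes> \<tau> z) \<noteq> \<zero>"
  proof (rule ccontr)
    assume neg: "\<not> ?thesis"
    let ?\<tau> = "restrict (restrict (\<lambda>x. x) (carrier L)) M"
    have t: "?\<tau> \<in> T" unfolding T_def by (rule imageI[OF Gal_id])
    have "C ?\<tau> = \<zero>"
    proof (rule characters_independent[of T M C, OF finT Mc M1])
      show "x \<otimes> y \<in> M" if "x \<in> M" "y \<in> M" for x y using Mm[OF that] .
      show "\<tau> x \<in> carrier L" if "\<tau> \<in> T" "x \<in> M" for \<tau> x using Tcl[OF that] .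
      show "C \<tau> \<in> carrier L" if "\<tau> \<in> T" for \<tau> using Ccl[OF that] .
      show "?\<tau> \<in> T" by (rule t)
      show "\<tau> (x \<otimes> y) = \<tau> x \<otimes> \<tau> y" if "\<tau> \<in> T" "x \<in> M" "y \<in> M" for \<tau> x y
      proof -
        from that(1) obtain s where s: "s \<in> Gal" "\<tau> = restrict s M" by (auto simp: T_def)
        show ?thesis using ring_hom_mult[OF ring_hom_cring.homh[OF Gal_hom[OF s(1)]], of x y] s(2) that Mm[OF that(2,3)] Mc by auto
      qed
      show "\<tau> \<one> = \<one>" if "\<tau> \<in> T" for \<tau> using that M1 Gal_fix subringE(3)[OF subring_K] by (auto simp: T_def)
      show "\<exists>x\<in>M. \<tau> x \<noteq> \<tau>' x" if "\<tau> \<in> T" "\<tau>' \<in> T" "\<tau> \<noteq> \<tau>'" for \<tau> \<tau>'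
      proof (rule ccontr)
        assume "\<not> ?thesis"
        then have "\<tau> = \<tau>'" using that(1,2) by (intro extensionalityI[of \<tau> M]) (auto simp: T_def)
        then show False using that by simp
      qed
    qed (use neg in auto)
    then have "c (restrict (\<lambda>x. x) (carrier L)) = \<zero>" using Ct[OF Gal_id] by simp
    then show False using cc(2)[OF Gal_id] one_not_zero by simp
  qed
  then obtain z where z: "z \<in> M" "(\<Oplus>\<tau>\<in>T. C \<tau> \<otimes> \<tau> z) \<noteq> \<zero>" by blast
  define y where "y = (\<Oplus>\<tau>\<in>T. C \<tau> \<otimes> \<tau> z)"
  have y: "y \<in> carrier L" "y \<noteq> \<zero>" unfolding y_def using z Ccl Tcl by (auto intro!: finsum_closed)
  have sy: "s y = c s \<otimes> y" if s: "s \<in> Gal" for s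
  proof -
    interpret S: ring_hom_cring L L s by (rule Gal_hom[OF s])
    \<comment> \<open>Composition with \<open>s\<close> permutes \<open>T\<close>; reindexing the
      resolvent along this permutation turns the multiplicativity of \<open>c\<close> into the
      factor \<open>c s\<close>.\<close>
    define \<sigma> where "\<sigma> = (\<lambda>\<tau>. \<lambda>x\<in>M. s (\<tau> x))"
    have st: "\<sigma> (restrict t M) = restrict (compose (carrier L) s t) M" for t
      by (rule ext) (use Mc in \<open>auto simp: \<sigma>_def compose_def restrict_def\<close>)
    have \<sigma>T: "\<sigma> ` T \<subseteq> T"
    proof
      fix \<rho> assume "\<rho> \<in> \<sigma> ` T"
      then obtain t where "t \<in> Gal" "\<rho> = \<sigma> (restrict t M)" by (auto simp: T_def)
      then show "\<rho> \<in> T" using st Gal_compose[OF s] by (auto simp: T_def)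
    qed
    have inj: "inj_on \<sigma> T"
    proof (rule inj_onI)
      fix \<tau> \<tau>' assume t: "\<tau> \<in> T" "\<tau>' \<in> T" "\<sigma> \<tau> = \<sigma> \<tau>'"
      have "\<tau> x = \<tau>' x" if x: "x \<in> M" for x
      proof -
        have "s (\<tau> x) = s (\<tau>' x)" using fun_cong[OF t(3), of x] x by (simp add: \<sigma>_def)
        then show ?thesis using inj_onD[OF Gal_inj[OF s]] Tcl t x by blast
      qed
      then show "\<tau> = \<tau>'" using t by (intro extensionalityI[of \<tau> M]) (auto simp: T_def)
    qed
    have surj: "\<sigma> ` T = T" using endo_inj_surj[OF finT \<sigma>T inj] .
    have C\<sigma>: "C \<tau> = c s \<otimes> C (\<sigma> \<tau>)" if "\<tau> \<in> T" for \<tau>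
    proof -
      from that obtain t where t: "t \<in> Gal" "\<tau> = restrict t M" by (auto simp: T_def)
      have "C (\<sigma> \<tau>) = c s \<otimes> c t" using Ct[OF Gal_compose[OF s t(1)]] cm[OF s t(1)] st t by simp
      then show ?thesis using Ct[OF t(1)] t cc[OF s] cc(1)[OF t(1)] by (simp add: m_assoc[symmetric])
    qed
    have "s y = (\<Oplus>\<tau>\<in>T. s (C \<tau> \<otimes> \<tau> z))"
      unfolding y_def using z Ccl Tcl by (subst S.hom_finsum) (auto simp: comp_def)
    also have "\<dots> = (\<Oplus>\<tau>\<in>T. c s \<otimes> (C (\<sigma> \<tau>) \<otimes> \<sigma> \<tau> z))"
    proof (rule finsum_cong')
      show "(\<lambda>\<tau>. c s \<otimes> (C (\<sigma> \<tau>) \<otimes> \<sigma> \<tau> z)) \<in> T \<rightarrow> carrier L"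
        using cc(1)[OF s] Ccl Tcl z \<sigma>T by auto
      fix \<tau> assume t: "\<tau> \<in> T"
      have "C \<tau> \<in> K" using t Ct cc(3) by (auto simp: T_def)
      then have "s (C \<tau> \<otimes> \<tau> z) = C \<tau> \<otimes> s (\<tau> z)" using Ccl[OF t] Tcl[OF t z(1)] Gal_fix[OF s] by simp
      moreover have "\<sigma> \<tau> z = s (\<tau> z)" using z by (simp add: \<sigma>_def)
      moreover have "C (\<sigma> \<tau>) \<in> carrier L" "s (\<tau> z) \<in> carrier L" using Ccl \<sigma>T t Gal_closed[OF s Tcl[OF t z(1)]] by auto
      ultimately show "s (C \<tau> \<otimes> \<tau> z) = c s \<otimes> (C (\<sigma> \<tau>) \<otimes> \<sigma> \<tau> z)"
        using C\<sigma>[OF t] cc(1)[OF s] by (simp add: m_assoc)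
    qed simp
    also have "\<dots> = c s \<otimes> (\<Oplus>\<tau>\<in>T. C (\<sigma> \<tau>) \<otimes> \<sigma> \<tau> z)"
      using cc(1)[OF s] Ccl Tcl z \<sigma>T finT by (subst finsum_rdistr) auto
    also have "(\<Oplus>\<tau>\<in>T. C (\<sigma> \<tau>) \<otimes> \<sigma> \<tau> z) = (\<Oplus>\<tau>\<in>\<sigma> ` T. C \<tau> \<otimes> \<tau> z)"
      using Ccl Tcl z \<sigma>T inj by (subst finsum_reindex) auto
    finally show ?thesis unfolding surj y_def .
  qed
  define x where "x = y \<otimes> y"
  have x: "x \<in> carrier L" using y by (simp add: x_def)
  have sx: "s x = x" if s: "s \<in> Gal" for s
  proof -
    interpret S: ring_hom_cring L L s by (rule Gal_hom[OF s])
    have "s x = (c s \<otimes> c s) \<otimes> (y \<otimes> y)" using sy[OF s] y cc(1)[OF s] by (simp add: x_def m_ac)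
    then show ?thesis using cc(2)[OF s] y by (simp add: x_def)
  qed
  obtain m0 :: nat where m0: "m0 > 0" "x [^] m0 \<in> K" using fixed_power[of x] x sx by blast
  \<comment> \<open>The square x of \<open>y\<close> is fixed by \<open>Gal\<close>, so a power of
    it lies in \<open>K\<close>. The least exponent is odd: for m = h + h the element x^h would be
    fixed with square in \<open>K\<close>, hence in \<open>K\<close> by
    \<open>fixed_quadratic\<close>. Raising \<open>y\<close> to the odd power \<open>m\<close>
    brings its square into \<open>K\<close> and leaves the character unchanged.\<close>
  define m where "m = (LEAST m::nat. m > 0 \<and> x [^] m \<in> K)"
  have m: "m > 0" "x [^] m \<in> K" using LeastI[of "\<lambda>m. m > 0 \<and> x [^] m \<in> K" m0] m0 by (auto simp: m_def)
  have min: "m \<le> k" if "k > 0" "x [^] k \<in> K" for k :: nat unfolding m_def using that by (intro Least_le) auto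
  have spow: "s (u [^] k) = (s u) [^] k" if s: "s \<in> Gal" and u: "u \<in> carrier L" for s u and k :: nat
  proof -
    interpret S: ring_hom_cring L L s by (rule Gal_hom[OF s])
    show ?thesis using u by (induction k) auto
  qed
  have "odd m"
  proof
    assume "even m"
    then obtain h where h: "m = h + h" by (metis evenE mult_2)
    have "x [^] h \<in> K"
    proof (rule fixed_quadratic[OF two])
      show "x [^] h \<in> carrier L" using x by simp
      show "x [^] h \<otimes> x [^] h \<in> K" using m(2) x by (simp add: h nat_pow_mult)
      show "s (x [^] h) = x [^] h" if "s \<in> Gal" for s using spow[OF that x] sx[OF that] by simp
    qed
    then show False using min[of h] m(1) h by simp
  qed
  then obtain h where h: "m = Suc (h + h)" by (metis oddE mult_2 Suc_eq_plus1)
  show ?thesis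
  proof (rule that[of "y [^] m"])
    show "y [^] m \<in> carrier L" using y by simp
    show "y [^] m \<noteq> \<zero>" using Units_pow_closed[of y m] y by (auto simp: field_Units)
    show "y [^] m \<otimes> y [^] m \<in> K" using m(2) y by (simp add: x_def nat_pow_distrib)
    show "s (y [^] m) = c s \<otimes> y [^] m" if s: "s \<in> Gal" for s
    proof -
      have "(c s) [^] (h + h) = \<one>"
        using cc(1,2)[OF s] by (metis nat_pow_distrib nat_pow_mult nat_pow_one)
      then have "(c s) [^] m = c s" using cc(1)[OF s] by (simp add: h)
      then show ?thesis using spow[OF s y(1)] sy[OF s] cc(1)[OF s] y(1) by (simp add: nat_pow_distrib)
    qed
  qed
qed

end

lemma restrict_eq_iff: "restrict f A = restrict g A \<longleftrightarrow> (\<forall>x\<in>A. f x = g x)"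
  by (auto simp: restrict_def fun_eq_iff)

section \<open>Square classes as continuous quadratic characters of the Galois group\<close>

section \<open>Kummer theory in degree two\<close>

context
  fixes F :: "'f ring" (structure)
  assumes F: "field F" and two: "\<one> \<oplus> \<one> \<noteq> \<zero>"
begin

interpretation F: field F by (rule F)
interpretation A: algebraic_closure "alg_cl F" "to_cl F ` carrier F" by (rule F.alg_closureE(1))

abbreviation (input) AF where "AF \<equiv> alg_cl F"

lemma abs_gal_eq: "abs_gal F = A.Gal"
  by (simp add: abs_gal_def A.Gal_def)

lemma to_cl_hom: "to_cl F \<in> Ring.ring_hom F AF"
  by (rule F.alg_closureE(2))

lemma to_cl_inj: "x \<in> carrier F ==> y \<in> carrier F ==> to_cl F x = to_cl F y ==> x = y"
  using F.indexed_const_inj_on by (auto dest: inj_onD)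

lemma to_cl_closed: "x \<in> carrier F ==> to_cl F x \<in> carrier AF"
  using ring_hom_closed[OF to_cl_hom] .

lemma to_cl_zero: "to_cl F \<zero> = \<zero>\<^bsub>AF\<^esub>"
  using ring_hom_zero[OF to_cl_hom F.is_ring A.is_ring] .

lemma two_cl: "\<one>\<^bsub>AF\<^esub> \<oplus>\<^bsub>AF\<^esub> \<one>\<^bsub>AF\<^esub> \<noteq> \<zero>\<^bsub>AF\<^esub>"
  using two to_cl_inj[of "\<one> \<oplus> \<one>" "\<zero>"] ring_hom_add[OF to_cl_hom, of "\<one>" "\<one>"]
    ring_hom_one[OF to_cl_hom] to_cl_zero by auto

lemma minus_one_neq: "\<ominus>\<^bsub>AF\<^esub> \<one>\<^bsub>AF\<^esub> \<noteq> \<one>\<^bsub>AF\<^esub>"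
  using two_cl A.l_neg[of "\<one>\<^bsub>AF\<^esub>"] by force

lemma mu_2: "mu 2 F = {\<one>\<^bsub>AF\<^esub>, \<ominus>\<^bsub>AF\<^esub> \<one>\<^bsub>AF\<^esub>}"
proof -
  have c2: "\<ominus>\<^bsub>AF\<^esub> \<one>\<^bsub>AF\<^esub> \<otimes>\<^bsub>AF\<^esub> \<ominus>\<^bsub>AF\<^esub> \<one>\<^bsub>AF\<^esub> = \<one>\<^bsub>AF\<^esub>" by (simp add: A.l_minus)
  have iff: "x \<in> mu 2 F \<longleftrightarrow> x \<in> carrier AF \<and> x \<otimes>\<^bsub>AF\<^esub> x = \<one>\<^bsub>AF\<^esub>" for x by (auto simp: mu_def numeral_2_eq_2)
  show ?thesis
  proof (intro equalityI subsetI)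
    fix x assume "x \<in> mu 2 F"
    then show "x \<in> {\<one>\<^bsub>AF\<^esub>, \<ominus>\<^bsub>AF\<^esub> \<one>\<^bsub>AF\<^esub>}" using A.square_eq_one[of x] iff[of x] by blast
  next
    fix x assume "x \<in> {\<one>\<^bsub>AF\<^esub>, \<ominus>\<^bsub>AF\<^esub> \<one>\<^bsub>AF\<^esub>}"
    then show "x \<in> mu 2 F" using c2 iff[of x] by auto
  qed
qed

lemma gal_minus_one: "s \<in> abs_gal F ==> s (\<ominus>\<^bsub>AF\<^esub> \<one>\<^bsub>AF\<^esub>) = \<ominus>\<^bsub>AF\<^esub> \<one>\<^bsub>AF\<^esub>"
  "s \<in> abs_gal F ==> s \<one>\<^bsub>AF\<^esub> = \<one>\<^bsub>AF\<^esub>"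
  using A.Gal_fix[of s] subringE(3,5)[OF A.subring_K] by (auto simp: abs_gal_eq)

text \<open>The Galois group fixes both elements of \<open>mu 2 F\<close>. With only the trivial
  coboundary, every class in \<open>H1_mu 2 F\<close> is the singleton of its cocycle, and this is
  the form in which classes are handled below.\<close>

lemma coboundaries_2: "coboundaries 2 F = {\<lambda>s\<in>abs_gal F. \<one>\<^bsub>AF\<^esub>}"
proof -
  have u: "\<ominus>\<^bsub>AF\<^esub> \<one>\<^bsub>AF\<^esub> \<in> Units AF" using A.field_Units by (simp add: A.add.inv_eq_1_iff)
  have *: "(\<lambda>s\<in>abs_gal F. s x \<otimes>\<^bsub>AF\<^esub> inv\<^bsub>AF\<^esub> x) = (\<lambda>s\<in>abs_gal F. \<one>\<^bsub>AF\<^esub>)" if "x \<in> mu 2 F" for x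
    using that u unfolding mu_2 by (intro restrict_ext) (auto simp: gal_minus_one A.l_minus)
  have "coboundaries 2 F = (\<lambda>x. \<lambda>s\<in>abs_gal F. s x \<otimes>\<^bsub>AF\<^esub> inv\<^bsub>AF\<^esub> x) ` mu 2 F" unfolding coboundaries_def by blast
  also have "\<dots> = (\<lambda>x. \<lambda>s\<in>abs_gal F. \<one>\<^bsub>AF\<^esub>) ` mu 2 F" by (rule image_cong[OF refl *])
  finally show ?thesis by (simp add: mu_2)
qed

lemma one_cocycles: "\<one>\<^bsub>cocycles 2 F\<^esub> = (\<lambda>s\<in>abs_gal F. \<one>\<^bsub>AF\<^esub>)"
  and mult_cocycles: "c \<otimes>\<^bsub>cocycles 2 F\<^esub> d = (\<lambda>s\<in>abs_gal F. c s \<otimes>\<^bsub>AF\<^esub> d s)"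
  by (simp_all add: cocycles_def)

lemma cocycle_coset:
  assumes "c \<in> abs_gal F \<rightarrow>\<^sub>E mu 2 F"
  shows "coboundaries 2 F #>\<^bsub>cocycles 2 F\<^esub> c = {c}"
proof -
  have "(\<lambda>s\<in>abs_gal F. \<one>\<^bsub>AF\<^esub> \<otimes>\<^bsub>AF\<^esub> c s) = c"
  proof
    fix s
    show "(\<lambda>s\<in>abs_gal F. \<one>\<^bsub>AF\<^esub> \<otimes>\<^bsub>AF\<^esub> c s) s = c s"
    proof (cases "s \<in> abs_gal F")
      case True
      then have "c s \<in> carrier AF" using assms mu_2 by (auto dest!: PiE_mem)
      then show ?thesis using True by simp
    next
      case False
      then show ?thesis using PiE_arb[OF assms False] by simp
    qed
  qed
  moreover have "(\<lambda>s\<in>abs_gal F. (\<lambda>s\<in>abs_gal F. \<one>\<^bsub>AF\<^esub>) s \<otimes>\<^bsub>AF\<^esub> c s) = (\<lambda>s\<in>abs_gal F. \<one>\<^bsub>AF\<^esub> \<otimes>\<^bsub>AF\<^esub> c s)"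
    by (intro restrict_ext) simp
  ultimately show ?thesis by (simp add: r_coset_def coboundaries_2 mult_cocycles)
qed

lemma cocycle_PiE: "c \<in> carrier (cocycles 2 F) ==> c \<in> abs_gal F \<rightarrow>\<^sub>E mu 2 F"
  by (simp add: cocycles_def)

lemma carrier_H1: "carrier (H1_mu 2 F) = {{c} |c. c \<in> carrier (cocycles 2 F)}"
  using cocycle_coset[OF cocycle_PiE] by (auto simp: H1_mu_def FactGroup_def RCOSETS_def)

lemma one_H1: "\<one>\<^bsub>H1_mu 2 F\<^esub> = {\<lambda>s\<in>abs_gal F. \<one>\<^bsub>AF\<^esub>}"
  by (simp add: H1_mu_def FactGroup_def coboundaries_2)

lemma mult_H1: "{c} \<otimes>\<^bsub>H1_mu 2 F\<^esub> {d} = {c \<otimes>\<^bsub>cocycles 2 F\<^esub> d}"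
  by (simp add: H1_mu_def FactGroup_def set_mult_def)

text \<open>The Kummer cocycle s(r) / r of a square root \<open>r\<close>, written as a sign so that
  its values visibly lie in \<open>mu 2 F\<close>; \<open>kcoc_eq\<close> returns to the
  quotient.\<close>

definition kcoc :: "'f cl => ('f cl => 'f cl) => 'f cl" where
  "kcoc r = (\<lambda>s\<in>abs_gal F. if s r = r then \<one>\<^bsub>AF\<^esub> else \<ominus>\<^bsub>AF\<^esub> \<one>\<^bsub>AF\<^esub>)"

definition sqrt_of :: "'f => 'f cl => bool" where
  "sqrt_of d r \<longleftrightarrow> d \<in> Units F \<and> r \<in> carrier AF \<and> r \<otimes>\<^bsub>AF\<^esub> r = to_cl F d"

lemma sqrt_nonzero: "sqrt_of d r ==> r \<noteq> \<zero>\<^bsub>AF\<^esub>"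
proof
  assume r: "sqrt_of d r" "r = \<zero>\<^bsub>AF\<^esub>"
  have d: "d \<in> Units F" using r(1) by (simp add: sqrt_of_def)
  have "to_cl F d = to_cl F \<zero>" using to_cl_zero r by (simp add: sqrt_of_def)
  then have "d = \<zero>" by (rule to_cl_inj[OF F.Units_closed[OF d] F.zero_closed])
  then show False using d F.field_Units by simp
qed

lemma square_eq_cl:
  assumes "a \<in> carrier AF" "b \<in> carrier AF" "a \<otimes>\<^bsub>AF\<^esub> a = b \<otimes>\<^bsub>AF\<^esub> b"
  shows "a = b \<or> a = \<ominus>\<^bsub>AF\<^esub> b"
proof -
  have "(a \<ominus>\<^bsub>AF\<^esub> b) \<otimes>\<^bsub>AF\<^esub> (a \<oplus>\<^bsub>AF\<^esub> b) = a \<otimes>\<^bsub>AF\<^esub> a \<oplus>\<^bsub>AF\<^esub> (a \<otimes>\<^bsub>AF\<^esub> b \<oplus>\<^bsub>AF\<^esub> \<ominus>\<^bsub>AF\<^esub> (a \<otimes>\<^bsub>AF\<^esub> b)) \<oplus>\<^bsub>AF\<^esub> \<ominus>\<^bsub>AF\<^esub> (b \<otimes>\<^bsub>AF\<^esub> b)"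
    using assms(1,2) by (simp add: A.minus_eq A.l_distr A.r_distr A.l_minus A.r_minus A.a_ac A.m_ac)
  also have "\<dots> = \<zero>\<^bsub>AF\<^esub>" using assms by (simp add: A.r_neg)
  finally have "a \<ominus>\<^bsub>AF\<^esub> b = \<zero>\<^bsub>AF\<^esub> \<or> a \<oplus>\<^bsub>AF\<^esub> b = \<zero>\<^bsub>AF\<^esub>" using A.integral assms(1,2) by blast
  then show ?thesis using assms A.sum_zero_eq_neg by auto
qed

lemma minus_neq_self:
  assumes "r \<in> carrier AF" "r \<noteq> \<zero>\<^bsub>AF\<^esub>" shows "\<ominus>\<^bsub>AF\<^esub> r \<noteq> r"
proof
  assume "\<ominus>\<^bsub>AF\<^esub> r = r"
  then have "r \<oplus>\<^bsub>AF\<^esub> r = \<zero>\<^bsub>AF\<^esub>" using A.l_neg[OF assms(1)] by simp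
  then have "(\<one>\<^bsub>AF\<^esub> \<oplus>\<^bsub>AF\<^esub> \<one>\<^bsub>AF\<^esub>) \<otimes>\<^bsub>AF\<^esub> r = \<zero>\<^bsub>AF\<^esub>" using assms(1) by (simp add: A.l_distr)
  then show False using A.integral[of "\<one>\<^bsub>AF\<^esub> \<oplus>\<^bsub>AF\<^esub> \<one>\<^bsub>AF\<^esub>" r] assms two_cl by auto
qed

lemma gal_sign:
  assumes "sqrt_of d r" "s \<in> abs_gal F"
  shows "s r = r \<or> s r = \<ominus>\<^bsub>AF\<^esub> r"
proof -
  interpret S: ring_hom_cring AF AF s using A.Gal_hom assms by (simp add: abs_gal_eq)
  have r: "r \<in> carrier AF" using assms by (simp add: sqrt_of_def)
  have "s r \<otimes>\<^bsub>AF\<^esub> s r = s (to_cl F d)" using assms r by (metis S.hom_mult sqrt_of_def)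
  also have "\<dots> = r \<otimes>\<^bsub>AF\<^esub> r"
    using A.Gal_fix[of s "to_cl F d"] assms by (auto simp: abs_gal_eq sqrt_of_def F.Units_closed)
  finally show ?thesis using square_eq_cl[OF S.hom_closed[OF r] r] by simp
qed

lemma gal_neg: "s \<in> abs_gal F ==> r \<in> carrier AF ==> s (\<ominus>\<^bsub>AF\<^esub> r) = \<ominus>\<^bsub>AF\<^esub> s r"
  using ring_hom_cring.hom_a_inv[OF A.Gal_hom] by (simp add: abs_gal_eq)

lemma kcoc_eq:
  assumes "sqrt_of d r"
  shows "(\<lambda>s\<in>abs_gal F. s r \<otimes>\<^bsub>AF\<^esub> inv\<^bsub>AF\<^esub> r) = kcoc r"
  unfolding kcoc_def
proof (rule restrict_ext)
  fix s assume s: "s \<in> abs_gal F"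
  have r: "r \<in> carrier AF" "r \<in> Units AF" using assms sqrt_nonzero[OF assms] A.field_Units by (auto simp: sqrt_of_def)
  then show "s r \<otimes>\<^bsub>AF\<^esub> inv\<^bsub>AF\<^esub> r = (if s r = r then \<one>\<^bsub>AF\<^esub> else \<ominus>\<^bsub>AF\<^esub> \<one>\<^bsub>AF\<^esub>)"
    using gal_sign[OF assms s] by (auto simp: A.l_minus)
qed

text \<open>The root in \<open>kummer_class\<close> is picked by \<open>SOME\<close>; the only other
  candidate is its negative, so this makes the choice immaterial.\<close>

lemma kcoc_minus:
  assumes "r \<in> carrier AF" shows "kcoc (\<ominus>\<^bsub>AF\<^esub> r) = kcoc r"
  unfolding kcoc_def
proof (rule restrict_ext)
  fix s assume s: "s \<in> abs_gal F"
  have "s r \<in> carrier AF" using A.Gal_closed s assms by (simp add: abs_gal_eq)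
  then have "s (\<ominus>\<^bsub>AF\<^esub> r) = \<ominus>\<^bsub>AF\<^esub> r \<longleftrightarrow> s r = r" using gal_neg[OF s assms] assms by (metis A.minus_minus)
  then show "(if s (\<ominus>\<^bsub>AF\<^esub> r) = \<ominus>\<^bsub>AF\<^esub> r then \<one>\<^bsub>AF\<^esub> else \<ominus>\<^bsub>AF\<^esub> \<one>\<^bsub>AF\<^esub>) = (if s r = r then \<one>\<^bsub>AF\<^esub> else \<ominus>\<^bsub>AF\<^esub> \<one>\<^bsub>AF\<^esub>)"
    by simp
qed

lemma exists_sqrt:
  assumes "d \<in> Units F" obtains r where "sqrt_of d r"
proof -
  have d: "to_cl F d \<in> carrier AF" using assms to_cl_closed F.Units_closed by auto
  have p: "[\<one>\<^bsub>AF\<^esub>, \<zero>\<^bsub>AF\<^esub>, \<ominus>\<^bsub>AF\<^esub> to_cl F d] \<in> carrier (univ_poly AF (carrier AF))"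
    using d by (auto simp: univ_poly_carrier[symmetric] polynomial_def)
  from A.exists_root_poly[OF p] obtain r where r: "r \<in> carrier AF" "A.eval [\<one>\<^bsub>AF\<^esub>, \<zero>\<^bsub>AF\<^esub>, \<ominus>\<^bsub>AF\<^esub> to_cl F d] r = \<zero>\<^bsub>AF\<^esub>"
    by auto
  have "r \<otimes>\<^bsub>AF\<^esub> r \<ominus>\<^bsub>AF\<^esub> to_cl F d = \<zero>\<^bsub>AF\<^esub>" using r d by (simp add: numeral_2_eq_2 A.minus_eq)
  then have "r \<otimes>\<^bsub>AF\<^esub> r = to_cl F d" using r d by simp
  then show ?thesis using that r assms by (auto simp: sqrt_of_def)
qed

lemma kcoc_PiE: "kcoc r \<in> abs_gal F \<rightarrow>\<^sub>E mu 2 F"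
  by (auto simp: kcoc_def mu_2)

lemma kummer_class_eq:
  assumes "sqrt_of d r" shows "kummer_class 2 F d = {kcoc r}"
proof -
  have pow: "x [^]\<^bsub>AF\<^esub> (2::nat) = x \<otimes>\<^bsub>AF\<^esub> x" if "x \<in> carrier AF" for x using that by (simp add: numeral_2_eq_2)
  define r' where "r' = (SOME r. r \<in> carrier AF \<and> r [^]\<^bsub>AF\<^esub> (2::nat) = to_cl F d)"
  have "r' \<in> carrier AF \<and> r' [^]\<^bsub>AF\<^esub> (2::nat) = to_cl F d"
    unfolding r'_def by (rule someI[of _ r]) (use assms pow in \<open>auto simp: sqrt_of_def\<close>)
  then have r': "sqrt_of d r'" using assms pow by (auto simp: sqrt_of_def)
  have "r' = r \<or> r' = \<ominus>\<^bsub>AF\<^esub> r" using square_eq_cl[of r' r] assms r' by (auto simp: sqrt_of_def)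
  then have "kcoc r' = kcoc r" using kcoc_minus[of r] assms by (auto simp: sqrt_of_def)
  then show ?thesis
    using cocycle_coset[OF kcoc_PiE] unfolding kummer_class_def Let_def r'_def[symmetric] kcoc_eq[OF r'] by simp
qed

lemma kcoc_carrier:
  assumes "sqrt_of d r" shows "kcoc r \<in> carrier (cocycles 2 F)"
proof -
  have r: "r \<in> carrier AF" using assms by (simp add: sqrt_of_def)
  have nr: "\<ominus>\<^bsub>AF\<^esub> r \<noteq> r" using minus_neq_self r sqrt_nonzero[OF assms] by auto
  have "kcoc r (compose (carrier AF) s t) = kcoc r s \<otimes>\<^bsub>AF\<^esub> s (kcoc r t)" if st: "s \<in> abs_gal F" "t \<in> abs_gal F" for s t
  proof -
    have c: "compose (carrier AF) s t \<in> abs_gal F" using A.Gal_compose st by (simp add: abs_gal_eq)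
    have v: "compose (carrier AF) s t r = s (t r)" using r by (simp add: compose_def)
    have nn: "\<ominus>\<^bsub>AF\<^esub> (\<ominus>\<^bsub>AF\<^esub> r) = r" using r by simp
    from gal_sign[OF assms st(1)] gal_sign[OF assms st(2)] show ?thesis
      using st c v nr nn gal_minus_one[OF st(1)] gal_neg[OF st(1) r] by (elim disjE) (auto simp: kcoc_def A.l_minus A.r_minus)
  qed
  \<comment> \<open>Continuity: the value at \<open>s\<close> depends on \<open>s r\<close> only, so
    agreement on the single element \<open>r\<close> suffices.\<close>
  moreover have "\<exists>B. finite B \<and> B \<subseteq> carrier AF \<and> (\<forall>t\<in>abs_gal F. (\<forall>x\<in>B. t x = s x) \<longrightarrow> kcoc r t = kcoc r s)"
    if "s \<in> abs_gal F" for s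
    using that r by (intro exI[of _ "{r}"]) (auto simp: kcoc_def)
  ultimately show ?thesis using kcoc_PiE by (simp add: cocycles_def)
qed

lemma kummer_class_closed: "d \<in> Units F ==> kummer_class 2 F d \<in> carrier (H1_mu 2 F)"
  using exists_sqrt kummer_class_eq kcoc_carrier carrier_H1 by (metis (mono_tags, lifting) mem_Collect_eq)

lemma kummer_class_mult:
  assumes "d \<in> Units F" "d' \<in> Units F"
  shows "kummer_class 2 F (d \<otimes> d') = kummer_class 2 F d \<otimes>\<^bsub>H1_mu 2 F\<^esub> kummer_class 2 F d'"
proof -
  obtain r r' where r: "sqrt_of d r" "sqrt_of d' r'" using exists_sqrt assms by metis
  have rc: "r \<in> carrier AF" "r' \<in> carrier AF" "r \<otimes>\<^bsub>AF\<^esub> r = to_cl F d" "r' \<otimes>\<^bsub>AF\<^esub> r' = to_cl F d'" using r by (auto simp: sqrt_of_def)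
  have "(r \<otimes>\<^bsub>AF\<^esub> r') \<otimes>\<^bsub>AF\<^esub> (r \<otimes>\<^bsub>AF\<^esub> r') = (r \<otimes>\<^bsub>AF\<^esub> r) \<otimes>\<^bsub>AF\<^esub> (r' \<otimes>\<^bsub>AF\<^esub> r')" using rc(1,2) by (simp add: A.m_ac)
  then have "sqrt_of (d \<otimes> d') (r \<otimes>\<^bsub>AF\<^esub> r')"
    using assms rc ring_hom_mult[OF to_cl_hom] by (auto simp: sqrt_of_def F.Units_closed)
  note rr = this
  have "kcoc (r \<otimes>\<^bsub>AF\<^esub> r') = kcoc r \<otimes>\<^bsub>cocycles 2 F\<^esub> kcoc r'"
    unfolding mult_cocycles unfolding kcoc_def
  proof (rule restrict_ext)
    fix s assume s: "s \<in> abs_gal F"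
    have m: "s (r \<otimes>\<^bsub>AF\<^esub> r') = s r \<otimes>\<^bsub>AF\<^esub> s r'"
      using ring_hom_mult[OF ring_hom_cring.homh[OF A.Gal_hom], of s r r'] s rc by (simp add: abs_gal_eq)
    have n: "\<ominus>\<^bsub>AF\<^esub> r \<noteq> r" "\<ominus>\<^bsub>AF\<^esub> r' \<noteq> r'" "\<ominus>\<^bsub>AF\<^esub> (r \<otimes>\<^bsub>AF\<^esub> r') \<noteq> r \<otimes>\<^bsub>AF\<^esub> r'"
      using minus_neq_self rc sqrt_nonzero r rr by auto
    have e: "\<ominus>\<^bsub>AF\<^esub> r \<otimes>\<^bsub>AF\<^esub> r' = \<ominus>\<^bsub>AF\<^esub> (r \<otimes>\<^bsub>AF\<^esub> r')" "r \<otimes>\<^bsub>AF\<^esub> \<ominus>\<^bsub>AF\<^esub> r' = \<ominus>\<^bsub>AF\<^esub> (r \<otimes>\<^bsub>AF\<^esub> r')"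
      "\<ominus>\<^bsub>AF\<^esub> r \<otimes>\<^bsub>AF\<^esub> \<ominus>\<^bsub>AF\<^esub> r' = r \<otimes>\<^bsub>AF\<^esub> r'" "\<ominus>\<^bsub>AF\<^esub> \<one>\<^bsub>AF\<^esub> \<otimes>\<^bsub>AF\<^esub> \<ominus>\<^bsub>AF\<^esub> \<one>\<^bsub>AF\<^esub> = \<one>\<^bsub>AF\<^esub>"
      using rc by (simp_all add: A.l_minus A.r_minus)
    from gal_sign[OF r(1) s] gal_sign[OF r(2) s]
    show "(if s (r \<otimes>\<^bsub>AF\<^esub> r') = r \<otimes>\<^bsub>AF\<^esub> r' then \<one>\<^bsub>AF\<^esub> else \<ominus>\<^bsub>AF\<^esub> \<one>\<^bsub>AF\<^esub>) =
      (\<lambda>s\<in>abs_gal F. if s r = r then \<one>\<^bsub>AF\<^esub> else \<ominus>\<^bsub>AF\<^esub> \<one>\<^bsub>AF\<^esub>) s \<otimes>\<^bsub>AF\<^esub>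
      (\<lambda>s\<in>abs_gal F. if s r' = r' then \<one>\<^bsub>AF\<^esub> else \<ominus>\<^bsub>AF\<^esub> \<one>\<^bsub>AF\<^esub>) s"
      using s m n e by (elim disjE) simp_all
  qed
  then show ?thesis using kummer_class_eq[OF r(1)] kummer_class_eq[OF r(2)] kummer_class_eq[OF rr] mult_H1 by simp
qed

text \<open>Triviality means that every automorphism fixes the square root \<open>r\<close>. As the
  square of \<open>r\<close> comes from \<open>F\<close>, so does \<open>r\<close> by
  \<open>fixed_quadratic\<close>, even if the closure is inseparable over \<open>F\<close>.\<close>

lemma kummer_class_trivial_iff:
  assumes "d \<in> Units F"
  shows "kummer_class 2 F d = \<one>\<^bsub>H1_mu 2 F\<^esub> \<longleftrightarrow> is_square_in F d"
proof -
  obtain r where r: "sqrt_of d r" using exists_sqrt assms by metis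
  have rc: "r \<in> carrier AF" "r \<otimes>\<^bsub>AF\<^esub> r = to_cl F d" "d \<in> carrier F" using r by (auto simp: sqrt_of_def F.Units_closed)
  have "kummer_class 2 F d = \<one>\<^bsub>H1_mu 2 F\<^esub> \<longleftrightarrow> (\<forall>s\<in>abs_gal F. s r = r)"
  proof -
    have "kcoc r = (\<lambda>s\<in>abs_gal F. \<one>\<^bsub>AF\<^esub>) \<longleftrightarrow> (\<forall>s\<in>abs_gal F. s r = r)"
      unfolding kcoc_def restrict_eq_iff using minus_one_neq by auto
    then show ?thesis by (simp add: kummer_class_eq[OF r] one_H1)
  qed
  also have "\<dots> \<longleftrightarrow> r \<in> to_cl F ` carrier F"
  proof
    assume "\<forall>s\<in>abs_gal F. s r = r"
    then show "r \<in> to_cl F ` carrier F"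
      using A.fixed_quadratic[OF two_cl rc(1)] rc(2,3) by (auto simp: abs_gal_eq)
  qed (use A.Gal_fix in \<open>auto simp: abs_gal_eq\<close>)
  also have "\<dots> \<longleftrightarrow> is_square_in F d"
  proof
    assume "r \<in> to_cl F ` carrier F"
    then obtain x where x: "x \<in> carrier F" "r = to_cl F x" by blast
    then have "to_cl F (x \<otimes> x) = to_cl F d" using rc ring_hom_mult[OF to_cl_hom x(1) x(1)] by simp
    then have "d = x \<otimes> x" using to_cl_inj[of "x \<otimes> x" d] x rc by simp
    then show "is_square_in F d" using x by (auto simp: is_square_in_def)
  next
    assume "is_square_in F d"
    then obtain x where x: "x \<in> carrier F" "d = x \<otimes> x" by (auto simp: is_square_in_def)
    then have "r \<otimes>\<^bsub>AF\<^esub> r = to_cl F x \<otimes>\<^bsub>AF\<^esub> to_cl F x" using rc ring_hom_mult[OF to_cl_hom x(1) x(1)] by simp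
    then have "r = to_cl F x \<or> r = \<ominus>\<^bsub>AF\<^esub> to_cl F x" using square_eq_cl[OF rc(1) to_cl_closed[OF x(1)]] by simp
    moreover have "\<ominus>\<^bsub>AF\<^esub> to_cl F x \<in> to_cl F ` carrier F" using subringE(5)[OF A.subring_K] x by auto
    ultimately show "r \<in> to_cl F ` carrier F" using x by auto
  qed
  finally show ?thesis .
qed

text \<open>Since the action on signs is trivial, a cocycle is a character.
  \<open>quadratic_character\<close> provides an eigenvector \<open>y\<close> for it with square in
  the base field, and this square is the required \<open>d\<close>.\<close>

lemma kummer_class_surj:
  assumes "Z \<in> carrier (H1_mu 2 F)"
  obtains d where "d \<in> Units F" "Z = kummer_class 2 F d"
proof -
  obtain c where c: "c \<in> carrier (cocycles 2 F)" "Z = {c}" using assms carrier_H1 by auto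
  have cv: "c s \<in> {\<one>\<^bsub>AF\<^esub>, \<ominus>\<^bsub>AF\<^esub> \<one>\<^bsub>AF\<^esub>}" if "s \<in> A.Gal" for s
    using cocycle_PiE[OF c(1)] that mu_2 by (auto simp: abs_gal_eq dest!: PiE_mem)
  have cm: "c (compose (carrier AF) s t) = c s \<otimes>\<^bsub>AF\<^esub> c t" if "s \<in> A.Gal" "t \<in> A.Gal" for s t
  proof -
    have "s (c t) = c t" using cv[OF that(2)] gal_minus_one[of s] that by (auto simp: abs_gal_eq)
    moreover have "c (compose (carrier AF) s t) = c s \<otimes>\<^bsub>AF\<^esub> s (c t)" using c(1) that by (simp add: cocycles_def abs_gal_eq)
    ultimately show ?thesis by simp
  qed
  let ?id = "restrict (\<lambda>x. x) (carrier AF)"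
  have id: "?id \<in> A.Gal" by (rule A.Gal_id)
  have cid: "c ?id = \<one>\<^bsub>AF\<^esub>"
  proof -
    have "compose (carrier AF) ?id ?id = ?id" by (auto simp: compose_def)
    then have "c ?id = c ?id \<otimes>\<^bsub>AF\<^esub> c ?id" using cm[OF id id] by simp
    then show ?thesis using cv[OF id] minus_one_neq by (auto simp: A.l_minus)
  qed
  have "\<forall>s\<in>abs_gal F. \<exists>A. finite A \<and> A \<subseteq> carrier AF \<and> (\<forall>t\<in>abs_gal F. (\<forall>x\<in>A. t x = s x) \<longrightarrow> c t = c s)"
    using c(1) by (simp add: cocycles_def)
  \<comment> \<open>Continuity is used at the identity, where the character has value one.\<close>
  from this[unfolded abs_gal_eq, rule_format, OF id] obtain B where
    B: "finite B" "B \<subseteq> carrier AF" "\<forall>t\<in>A.Gal. (\<forall>x\<in>B. t x = ?id x) \<longrightarrow> c t = c ?id" by blast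
  have B3: "c t = \<one>\<^bsub>AF\<^esub>" if "t \<in> A.Gal" "\<forall>x\<in>B. t x = x" for t
  proof -
    have "\<forall>x\<in>B. t x = ?id x" using that(2) B(2) by auto
    then show ?thesis using B(3) that(1) cid by simp
  qed
  obtain y where
    y: "y \<in> carrier AF" "y \<noteq> \<zero>\<^bsub>AF\<^esub>" "y \<otimes>\<^bsub>AF\<^esub> y \<in> to_cl F ` carrier F" "\<And>s. s \<in> A.Gal ==> s y = c s \<otimes>\<^bsub>AF\<^esub> y"
    using A.quadratic_character[of c B, OF two_cl cv cm B(1,2) B3] by blast
  from y(3) obtain d where d: "d \<in> carrier F" "y \<otimes>\<^bsub>AF\<^esub> y = to_cl F d" by auto
  have "d \<noteq> \<zero>" using d(2) to_cl_zero y(1,2) A.integral[of y y] by auto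
  then have sq: "sqrt_of d y" using d y(1) F.field_Units by (simp add: sqrt_of_def)
  have "c s = kcoc y s" for s
  proof (cases "s \<in> abs_gal F")
    case True
    then show ?thesis
      using cv[of s] y(1) y(4)[of s] minus_neq_self[OF y(1,2)] by (auto simp: abs_gal_eq kcoc_def A.l_minus)
  next
    case False
    then show ?thesis using PiE_arb[OF cocycle_PiE[OF c(1)] False] by (simp add: kcoc_def)
  qed
  then have "c = kcoc y" by blast
  then show ?thesis using that[of d] kummer_class_eq[OF sq] c(2) sq by (simp add: sqrt_of_def)
qed

end

text \<open>Over \<open>L\<close> the polynomial splits into linear factors, so in the field
  \<open>N\<close> its image has no roots beyond the images of those in \<open>L\<close>. This makes
  the image of one algebraic closure in another stable under automorphisms that fix the image of the
  base field.\<close>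

lemma image_root:
  assumes "algebraic_closure L k" "field N" "j \<in> Ring.ring_hom L N"
    and "p \<in> carrier (univ_poly L (carrier L))" "p \<noteq> []" "y \<in> carrier N" "ring.eval N (map j p) y = \<zero>\<^bsub>N\<^esub>"
  shows "y \<in> j ` carrier L"
proof -
  interpret L: algebraic_closure L k by fact
  interpret N: field N by fact
  have Lc: "L\<lparr>carrier := carrier L\<rparr> = L" by simp
  have hom: "(\<lambda>p. N.eval (map j p) y) \<in> Ring.ring_hom (univ_poly L (carrier L)) N"
    using eval_map_hom[OF L.field_axioms L.carrier_is_subfield assms(2) _ assms(6), of j] assms(3) unfolding Lc by simp
  have inj: "inj_on j (carrier L)" using non_trivial_field_hom_is_inj[OF assms(3) L.field_axioms assms(2)] .
  have j0: "j \<zero>\<^bsub>L\<^esub> = \<zero>\<^bsub>N\<^esub>" using ring_hom_zero[OF assms(3) L.is_ring N.is_ring] .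
  have j1: "j \<one>\<^bsub>L\<^esub> = \<one>\<^bsub>N\<^esub>" using ring_hom_one[OF assms(3)] .
  show ?thesis
    using assms(4,5,7)
  proof (induction "length p" arbitrary: p rule: less_induct)
    case less
    show ?case
    proof (cases "length p \<ge> 2")
      case False
      then obtain c where c: "p = [c]" using less.prems(2) by (cases p) (auto simp: Suc_le_eq)
      have cc: "c \<in> carrier L" "c \<noteq> \<zero>\<^bsub>L\<^esub>" using less.prems(1) c by (auto simp: univ_poly_carrier[symmetric] polynomial_def)
      have "j c = \<zero>\<^bsub>N\<^esub>" using less.prems(3) c cc assms(6) ring_hom_closed[OF assms(3) cc(1)] by simp
      then show ?thesis using inj_onD[OF inj, of c "\<zero>\<^bsub>L\<^esub>"] cc j0 by simp
    next
      case True
      from L.exists_root_poly[OF less.prems(1) True] obtain r where r: "r \<in> carrier L" "L.eval p r = \<zero>\<^bsub>L\<^esub>" .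
      then have "L.is_root p r" using less.prems(2) by (auto simp: L.is_root_def)
      from L.is_root_imp_pdivides[OF less.prems(1) this]
      obtain q where q: "q \<in> carrier (univ_poly L (carrier L))" "p = [\<one>\<^bsub>L\<^esub>, \<ominus>\<^bsub>L\<^esub> r] \<otimes>\<^bsub>univ_poly L (carrier L)\<^esub> q"
        unfolding pdivides_def factor_def by auto
      have l: "[\<one>\<^bsub>L\<^esub>, \<ominus>\<^bsub>L\<^esub> r] \<in> carrier (univ_poly L (carrier L))"
        using r by (auto simp: univ_poly_carrier[symmetric] polynomial_def)
      have pol: "polynomial\<^bsub>L\<^esub> (carrier L) [\<one>\<^bsub>L\<^esub>, \<ominus>\<^bsub>L\<^esub> r]" "polynomial\<^bsub>L\<^esub> (carrier L) q" using l q(1) by (auto simp: univ_poly_carrier)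
      have pm: "p = L.poly_mult [\<one>\<^bsub>L\<^esub>, \<ominus>\<^bsub>L\<^esub> r] q" using q(2) by (simp add: univ_poly_mult)
      have qn: "q \<noteq> []"
      proof
        assume "q = []"
        then have "p = \<zero>\<^bsub>univ_poly L (carrier L)\<^esub>"
          using q(2) l cring.cring_simprules(27)[OF L.univ_poly_is_cring[OF L.carrier_is_subring] l] by (simp add: univ_poly_zero)
        then show False using less.prems(2) by (simp add: univ_poly_zero)
      qed
      have len: "length p - 1 = Suc (length q - 1)"
        using L.poly_mult_degree_eq[OF L.carrier_is_subring pol] qn pm by simp
      then have lt: "length q < length p" by simp
      have jr: "j r \<in> carrier N" "j (\<ominus>\<^bsub>L\<^esub> r) = \<ominus>\<^bsub>N\<^esub> j r"
      proof -
        interpret J: ring_hom_cring L N j by (intro hom_cringI L.is_cring N.is_cring assms(3))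
        show "j r \<in> carrier N" "j (\<ominus>\<^bsub>L\<^esub> r) = \<ominus>\<^bsub>N\<^esub> j r" using r by auto
      qed
      have "N.eval (map j p) y = (y \<ominus>\<^bsub>N\<^esub> j r) \<otimes>\<^bsub>N\<^esub> N.eval (map j q) y"
        using ring_hom_memE(2)[OF hom l q(1)] q(2) j1 jr assms(6) by (simp add: N.minus_eq)
      then have "y \<ominus>\<^bsub>N\<^esub> j r = \<zero>\<^bsub>N\<^esub> \<or> N.eval (map j q) y = \<zero>\<^bsub>N\<^esub>"
        using less.prems(3) N.integral[of "y \<ominus>\<^bsub>N\<^esub> j r" "N.eval (map j q) y"] ring_hom_closed[OF hom q(1)] jr assms(6) by auto
      then show ?thesis
      proof
        assume "y \<ominus>\<^bsub>N\<^esub> j r = \<zero>\<^bsub>N\<^esub>"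
        then show ?thesis using jr assms(6) r by auto
      next
        assume "N.eval (map j q) y = \<zero>\<^bsub>N\<^esub>"
        then show ?thesis using less.hyps[OF lt q(1) qn] by simp
      qed
    qed
  qed
qed

context
  fixes F :: "'f ring" (structure) and E :: "'e ring" and f
  assumes F: "field F" and two: "\<one> \<oplus> \<one> \<noteq> \<zero>"
    and E: "field E" and two': "\<one>\<^bsub>E\<^esub> \<oplus>\<^bsub>E\<^esub> \<one>\<^bsub>E\<^esub> \<noteq> \<zero>\<^bsub>E\<^esub>" and f: "f \<in> Ring.ring_hom F E"
begin

interpretation F: field F by (rule F)
interpretation E: field E by (rule E)
interpretation A: algebraic_closure "alg_cl F" "to_cl F ` carrier F" by (rule F.alg_closureE(1))
interpretation B: algebraic_closure "alg_cl E" "to_cl E ` carrier E" by (rule E.alg_closureE(1))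

text \<open>What has to be shown is that the \<open>SOME\<close> in \<open>cl_embedding\<close> is
  satisfiable: \<open>alg_cl F\<close> is algebraic over its copy of \<open>F\<close>, and
  \<open>alg_cl E\<close> is algebraically closed, so the map \<open>f\<close> between the copies of
  \<open>F\<close> and \<open>E\<close> extends.\<close>

lemma cl_embedding_hom:
  "cl_embedding F E f \<in> Ring.ring_hom (alg_cl F) (alg_cl E)"
  "x \<in> carrier F ==> cl_embedding F E f (to_cl F x) = to_cl E (f x)"
proof -
  let ?i = "inv_into (carrier F) (to_cl F)"
  have inj: "inj_on (to_cl F) (carrier F)" by (rule F.indexed_const_inj_on)
  have i: "?i (to_cl F x) = x" if "x \<in> carrier F" for x using inv_into_f_f[OF inj that] .
  note th = to_cl_hom[OF F two] and te = to_cl_hom[OF E two']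
  have "(\<lambda>u. to_cl E (f (?i u))) \<in> Ring.ring_hom (alg_cl F\<lparr>carrier := to_cl F ` carrier F\<rparr>) (alg_cl E)"
  proof (rule ring_hom_memI, simp_all)
    fix u v assume "u \<in> to_cl F ` carrier F" "v \<in> to_cl F ` carrier F"
    then obtain x y where x: "x \<in> carrier F" "u = to_cl F x" and y: "y \<in> carrier F" "v = to_cl F y" by blast
    have "u \<otimes>\<^bsub>alg_cl F\<^esub> v = to_cl F (x \<otimes> y)" "u \<oplus>\<^bsub>alg_cl F\<^esub> v = to_cl F (x \<oplus> y)"
      using x y ring_hom_mult[OF th x(1) y(1)] ring_hom_add[OF th x(1) y(1)] by auto
    then show "to_cl E (f (?i (u \<otimes>\<^bsub>alg_cl F\<^esub> v))) = to_cl E (f (?i u)) \<otimes>\<^bsub>alg_cl E\<^esub> to_cl E (f (?i v))"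
      "to_cl E (f (?i (u \<oplus>\<^bsub>alg_cl F\<^esub> v))) = to_cl E (f (?i u)) \<oplus>\<^bsub>alg_cl E\<^esub> to_cl E (f (?i v))"
      using x y i ring_hom_mult[OF f x(1) y(1)] ring_hom_add[OF f x(1) y(1)]
        ring_hom_mult[OF te ring_hom_closed[OF f x(1)] ring_hom_closed[OF f y(1)]] ring_hom_add[OF te ring_hom_closed[OF f x(1)] ring_hom_closed[OF f y(1)]]
      by simp_all
  next
    fix u assume "u \<in> to_cl F ` carrier F"
    then obtain x where x: "x \<in> carrier F" "u = to_cl F x" by blast
    then show "to_cl E (f (?i u)) \<in> carrier (alg_cl E)" using i ring_hom_closed[OF te ring_hom_closed[OF f x(1)]] by simp
  next
    have "?i \<one>\<^bsub>alg_cl F\<^esub> = \<one>" using i[OF F.one_closed] ring_hom_one[OF th] by simp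
    then show "to_cl E (f (?i \<one>\<^bsub>alg_cl F\<^esub>)) = \<one>\<^bsub>alg_cl E\<^esub>" using ring_hom_one[OF f] ring_hom_one[OF te] by simp
  qed
  from extend_hom_algebraic[OF A.field_axioms B.algebraically_closed_axioms A.subfield_K A.algebraic_extension this]
  obtain j where j: "j \<in> Ring.ring_hom (alg_cl F) (alg_cl E)" "\<And>u. u \<in> to_cl F ` carrier F ==> j u = to_cl E (f (?i u))" by blast
  then have "j \<in> Ring.ring_hom (alg_cl F) (alg_cl E) \<and> (\<forall>x\<in>carrier F. j (to_cl F x) = to_cl E (f x))" using i by simp
  then have "\<exists>j. j \<in> Ring.ring_hom (alg_cl F) (alg_cl E) \<and> (\<forall>x\<in>carrier F. j (to_cl F x) = to_cl E (f x))" by blast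
  from someI_ex[OF this]
  have "cl_embedding F E f \<in> Ring.ring_hom (alg_cl F) (alg_cl E) \<and> (\<forall>x\<in>carrier F. cl_embedding F E f (to_cl F x) = to_cl E (f x))"
    unfolding cl_embedding_def .
  then show "cl_embedding F E f \<in> Ring.ring_hom (alg_cl F) (alg_cl E)"
    "x \<in> carrier F ==> cl_embedding F E f (to_cl F x) = to_cl E (f x)" by auto
qed

text \<open>An automorphism \<open>s\<close> over \<open>E\<close> fixes the coefficients of the
  image of a minimal polynomial over \<open>F\<close>, so it sends j x to a root of the same
  polynomial, which lies in the image of \<open>j\<close> by \<open>image_root\<close>. This gives
  meaning to the \<open>inv_into\<close> in \<open>gal_res\<close>.\<close>

lemma gal_res_props:
  assumes s: "s \<in> abs_gal E"
  shows "gal_res F E f s \<in> abs_gal F"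
    and "x \<in> carrier (alg_cl F) ==> cl_embedding F E f (gal_res F E f s x) = s (cl_embedding F E f x)"
proof -
  define j where "j = cl_embedding F E f"
  note j = cl_embedding_hom(1)[folded j_def] and jx = cl_embedding_hom(2)[folded j_def]
  interpret J: ring_hom_cring "alg_cl F" "alg_cl E" j by (intro hom_cringI A.is_cring B.is_cring j)
  have sG: "s \<in> B.Gal" using s by (simp add: abs_gal_eq[OF E two'])
  interpret S: ring_hom_ring "alg_cl E" "alg_cl E" s
    using B.Gal_hom[OF sG] by (intro ring_hom_ringI2 B.ring_axioms) (auto simp: ring_hom_cring_def ring_hom_cring_axioms_def)
  have inj: "inj_on j (carrier (alg_cl F))" using non_trivial_field_hom_is_inj[OF j A.field_axioms B.field_axioms] .
  have img: "s (j x) \<in> j ` carrier (alg_cl F)" if x: "x \<in> carrier (alg_cl F)" for x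
  proof -
    let ?p = "A.Irr (to_cl F ` carrier F) x"
    note I = A.Irr_K[OF x]
    have set: "set ?p \<subseteq> carrier (alg_cl F)" "set (map j ?p) \<subseteq> carrier (alg_cl E)" using I(5) A.K_carrier by auto
    have "B.eval (map j ?p) (j x) = \<zero>\<^bsub>alg_cl E\<^esub>" using ring_hom_ring.eval_hom'[OF ring_hom_ringI2[OF A.ring_axioms B.ring_axioms j] x set(1)] I(4) by simp
    then have "B.eval (map s (map j ?p)) (s (j x)) = \<zero>\<^bsub>alg_cl E\<^esub>"
      using S.eval_hom'[OF J.hom_closed[OF x] set(2)] by simp
    moreover have "map s (map j ?p) = map j ?p"
    proof -
      have "s (j u) = j u" if "u \<in> set ?p" for u
      proof -
        from that I(5) obtain y where y: "y \<in> carrier F" "u = to_cl F y" by auto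
        then have "j u \<in> to_cl E ` carrier E" using jx ring_hom_closed[OF f y(1)] by simp
        then show ?thesis using B.Gal_fix[OF sG] by simp
      qed
      then show ?thesis by simp
    qed
    ultimately have "B.eval (map j ?p) (s (j x)) = \<zero>\<^bsub>alg_cl E\<^esub>" by (simp only:)
    then show ?thesis
      by (rule image_root[OF A.algebraic_closure_axioms B.field_axioms j I(2,3) S.hom_closed[OF J.hom_closed[OF x]]])
  qed
  define t where "t = (\<lambda>x. inv_into (carrier (alg_cl F)) j (s (j x)))"
  have t: "t x \<in> carrier (alg_cl F)" "j (t x) = s (j x)" if "x \<in> carrier (alg_cl F)" for x
    using img[OF that] unfolding t_def by (auto simp: inv_into_into f_inv_into_f)
  have gr: "gal_res F E f s = restrict t (carrier (alg_cl F))" by (simp add: gal_res_def Let_def t_def j_def)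
  have teq: "t x = y" if "x \<in> carrier (alg_cl F)" "y \<in> carrier (alg_cl F)" "s (j x) = j y" for x y
    using inj_onD[OF inj, of "t x" y] t[OF that(1)] that by simp
  show "gal_res F E f s \<in> abs_gal F"
    unfolding abs_gal_eq[OF F two] gr
  proof (rule A.endo_Gal)
    show "t \<in> Ring.ring_hom (alg_cl F) (alg_cl F)"
    proof (rule ring_hom_memI)
      fix x y assume xy: "x \<in> carrier (alg_cl F)" "y \<in> carrier (alg_cl F)"
      show "t (x \<otimes>\<^bsub>alg_cl F\<^esub> y) = t x \<otimes>\<^bsub>alg_cl F\<^esub> t y" "t (x \<oplus>\<^bsub>alg_cl F\<^esub> y) = t x \<oplus>\<^bsub>alg_cl F\<^esub> t y"
        using xy t[OF xy(1)] t[OF xy(2)] by (auto intro!: teq)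
    qed (use t in \<open>auto intro!: teq\<close>)
    show "t x = x" if "x \<in> to_cl F ` carrier F" for x
    proof -
      from that obtain y where y: "y \<in> carrier F" "x = to_cl F y" by auto
      then have "j x \<in> to_cl E ` carrier E" using jx ring_hom_closed[OF f y(1)] by simp
      then have "s (j x) = j x" using B.Gal_fix[OF sG] by simp
      then show ?thesis using that A.K_carrier by (intro teq) auto
    qed
  qed
  show "x \<in> carrier (alg_cl F) ==> cl_embedding F E f (gal_res F E f s x) = s (cl_embedding F E f x)"
    using t by (simp add: gr j_def)
qed

text \<open>The embedding carries a square root of \<open>d\<close> to one of \<open>f d\<close>,
  and by injectivity \<open>s\<close> fixes the latter exactly when its restriction fixes the
  former. So the sign cocycles correspond, whatever embedding was chosen.\<close>

lemma H1_res_kummer: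
  assumes d: "d \<in> Units F"
  shows "H1_res 2 F E f (kummer_class 2 F d) = kummer_class 2 E (f d)"
proof -
  define j where "j = cl_embedding F E f"
  note j = cl_embedding_hom(1)[folded j_def] and jx = cl_embedding_hom(2)[folded j_def]
  interpret J: ring_hom_cring "alg_cl F" "alg_cl E" j by (intro hom_cringI A.is_cring B.is_cring j)
  have inj: "inj_on j (carrier (alg_cl F))" using non_trivial_field_hom_is_inj[OF j A.field_axioms B.field_axioms] .
  obtain r where r: "sqrt_of F d r" using exists_sqrt[OF F two d] by metis
  have rc: "r \<in> carrier (alg_cl F)" "r \<otimes>\<^bsub>alg_cl F\<^esub> r = to_cl F d" using r by (auto simp: sqrt_of_def[OF F two])
  have "f d \<in> carrier E" "f d \<noteq> \<zero>\<^bsub>E\<^esub>"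
  proof -
    show "f d \<in> carrier E" using ring_hom_closed[OF f] d F.Units_closed by auto
    have "inj_on f (carrier F)" using non_trivial_field_hom_is_inj[OF f F E] .
    then have "f d = f \<zero> ==> d = \<zero>" by (rule inj_onD) (use d F.Units_closed in auto)
    then show "f d \<noteq> \<zero>\<^bsub>E\<^esub>" using d F.field_Units ring_hom_zero[OF f F.is_ring E.is_ring] by auto
  qed
  then have sq: "sqrt_of E (f d) (j r)"
    using rc J.hom_mult[OF rc(1) rc(1)] jx[of d] d F.Units_closed E.field_Units by (auto simp: sqrt_of_def[OF E two'])
  have "cocycle_res F E f (kcoc F r) = kcoc E (j r)"
    unfolding cocycle_res_def unfolding kcoc_def[OF E two']
  proof (rule restrict_ext)
    fix s assume s: "s \<in> abs_gal E"
    note g = gal_res_props[OF s, folded j_def]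
    have grc: "gal_res F E f s r \<in> carrier (alg_cl F)"
      using A.Gal_closed[of "gal_res F E f s"] g(1) rc(1) by (simp add: abs_gal_eq[OF F two])
    have "gal_res F E f s r = r \<longleftrightarrow> s (j r) = j r"
      using g(2)[OF rc(1)] inj_onD[OF inj _ grc rc(1)] by metis
    then show "cl_embedding F E f (kcoc F r (gal_res F E f s)) = (if s (j r) = j r then \<one>\<^bsub>alg_cl E\<^esub> else \<ominus>\<^bsub>alg_cl E\<^esub> \<one>\<^bsub>alg_cl E\<^esub>)"
      using g(1) by (simp add: kcoc_def[OF F two] j_def[symmetric])
  qed
  then show ?thesis
    using kummer_class_eq[OF F two r] kummer_class_eq[OF E two' sq] cocycle_coset[OF E two' kcoc_PiE[OF E two']]
    by (simp add: H1_res_def)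
qed

end

section \<open>Matrix algebra, invertibility, orthogonal sums and base change over commutative
  rings\<close>

section \<open>Matrices over commutative rings with carriers\<close>

text \<open>
  All commutative rings carried by subsets of a type \<open>'a\<close> are quotients of one ring that is
  a type, namely their product. Polynomial identities between matrices are transported along the
  projections. The factor \<^typ>\<open>int\<close> ensures \<open>0 \<noteq> 1\<close>.
\<close>

typedef 'a cfam =
  "(\<Pi>\<^sub>E R \<in> {R :: 'a ring. cring R}. carrier R) \<times> (UNIV :: int set)"
proof -
  have "((\<lambda>R\<in>{R :: 'a ring. cring R}. \<zero>\<^bsub>R\<^esub>), 0::int) \<in> (\<Pi>\<^sub>E R \<in> {R. cring R}. carrier R) \<times> UNIV"
    by (auto intro!: ring.ring_simprules cring.axioms(1))
  then show ?thesis by blast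
qed

setup_lifting type_definition_cfam

instantiation cfam :: (type) comm_ring_1
begin

lift_definition zero_cfam :: "'a cfam" is
  "((\<lambda>R\<in>{R :: 'a ring. cring R}. \<zero>\<^bsub>R\<^esub>), 0::int)"
  by (auto intro!: ring.ring_simprules cring.axioms(1))
lift_definition one_cfam :: "'a cfam" is
  "((\<lambda>R\<in>{R :: 'a ring. cring R}. \<one>\<^bsub>R\<^esub>), 1::int)"
  by (auto intro!: ring.ring_simprules cring.axioms(1))
lift_definition plus_cfam :: "'a cfam => 'a cfam => 'a cfam" is
  "\<lambda>(f, a) (g, b). ((\<lambda>R\<in>{R :: 'a ring. cring R}. f R \<oplus>\<^bsub>R\<^esub> g R), a + b)"
  by (auto intro!: ring.ring_simprules cring.axioms(1) simp: PiE_mem)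
lift_definition times_cfam :: "'a cfam => 'a cfam => 'a cfam" is
  "\<lambda>(f, a) (g, b). ((\<lambda>R\<in>{R :: 'a ring. cring R}. f R \<otimes>\<^bsub>R\<^esub> g R), a * b)"
  by (auto intro!: ring.ring_simprules cring.axioms(1) simp: PiE_mem)
lift_definition uminus_cfam :: "'a cfam => 'a cfam" is
  "\<lambda>(f, a). ((\<lambda>R\<in>{R :: 'a ring. cring R}. \<ominus>\<^bsub>R\<^esub> f R), - a)"
  by (auto intro!: ring.ring_simprules cring.axioms(1) simp: PiE_mem)
definition minus_cfam :: "'a cfam => 'a cfam => 'a cfam" where
  "minus_cfam x y = x + - y"

instance
proof
  fix a b c :: "'a cfam"
  show "a * b * c = a * (b * c)"
    by transfer (auto intro!: ext simp: cring.cring_simprules(11) PiE_mem)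
  show "a * b = b * a"
    by transfer (clarsimp, intro conjI restrict_ext cring.cring_simprules(14), auto simp: PiE_mem)
  obtain f z where a: "Rep_cfam a = (f, z)" "f \<in> (\<Pi>\<^sub>E R \<in> {R :: 'a ring. cring R}. carrier R)"
    using Rep_cfam[of a] by (metis mem_Times_iff prod.collapse)
  have "(\<lambda>R\<in>{R :: 'a ring. cring R}. \<one>\<^bsub>R\<^esub> \<otimes>\<^bsub>R\<^esub> f R) = f"
  proof
    fix R :: "'a ring"
    show "(\<lambda>R\<in>{R :: 'a ring. cring R}. \<one>\<^bsub>R\<^esub> \<otimes>\<^bsub>R\<^esub> f R) R = f R"
    proof (cases "cring R")
      case True
      then have "f R \<in> carrier R" using a(2) by (metis PiE_mem mem_Collect_eq)
      from cring.cring_simprules(12)[OF True this] show ?thesis using True by simp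
    next
      case False
      then show ?thesis using PiE_arb[OF a(2), of R] by simp
    qed
  qed
  then show "1 * a = a"
    by (subst Rep_cfam_inject[symmetric])
      (simp add: times_cfam.rep_eq one_cfam.rep_eq a cong: restrict_cong)
  show "a + b + c = a + (b + c)"
    by transfer (auto intro!: ext simp: cring.cring_simprules(7) PiE_mem)
  show "a + b = b + a"
    by transfer (clarsimp, intro conjI restrict_ext cring.cring_simprules(10), auto simp: PiE_mem)
  have "(\<lambda>R\<in>{R :: 'a ring. cring R}. \<zero>\<^bsub>R\<^esub> \<oplus>\<^bsub>R\<^esub> f R) = f"
  proof
    fix R :: "'a ring"
    show "(\<lambda>R\<in>{R :: 'a ring. cring R}. \<zero>\<^bsub>R\<^esub> \<oplus>\<^bsub>R\<^esub> f R) R = f R"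
    proof (cases "cring R")
      case True
      then have "f R \<in> carrier R" using a(2) by (metis PiE_mem mem_Collect_eq)
      from cring.cring_simprules(8)[OF True this] show ?thesis using True by simp
    next
      case False
      then show ?thesis using PiE_arb[OF a(2), of R] by simp
    qed
  qed
  then show "0 + a = a"
    by (subst Rep_cfam_inject[symmetric])
      (simp add: plus_cfam.rep_eq zero_cfam.rep_eq a cong: restrict_cong)
  show "- a + a = 0"
    by transfer (auto intro!: ext simp: cring.cring_simprules(9) PiE_mem)
  show "a - b = a + - b"
    by (simp add: minus_cfam_def)
  show "(a + b) * c = a * c + b * c"
    by transfer (auto intro!: ext simp: cring.cring_simprules(13) PiE_mem distrib_right)
  show "(0 :: 'a cfam) \<noteq> 1"
    by transfer auto
qed

end

lift_definition cproj :: "'a ring => 'a cfam => 'a" is "\<lambda>R (f, a). f R" .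

lemma cproj_closed: "cring R ==> cproj R x \<in> carrier R"
  by transfer (auto simp: PiE_mem)

lemma cproj_zero: "cring R ==> cproj R 0 = \<zero>\<^bsub>R\<^esub>" by transfer auto
lemma cproj_one: "cring R ==> cproj R 1 = \<one>\<^bsub>R\<^esub>" by transfer auto
lemma cproj_add: "cring R ==> cproj R (x + y) = cproj R x \<oplus>\<^bsub>R\<^esub> cproj R y"
  by transfer auto
lemma cproj_mult: "cring R ==> cproj R (x * y) = cproj R x \<otimes>\<^bsub>R\<^esub> cproj R y"
  by transfer auto
lemma cproj_uminus: "cring R ==> cproj R (- x) = \<ominus>\<^bsub>R\<^esub> cproj R x"
  by transfer auto

lemma cproj_sum:
  assumes "cring R"
  shows "cproj R (sum f A) = finsum R (\<lambda>i. cproj R (f i)) A"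
proof -
  interpret cring R by fact
  show ?thesis
    by (induction A rule: infinite_finite_induct)
      (auto simp: cproj_zero cproj_add assms cproj_closed)
qed

lemma cproj_prod:
  assumes "cring R"
  shows "cproj R (prod f A) = finprod R (\<lambda>i. cproj R (f i)) A"
proof -
  interpret cring R by fact
  show ?thesis
    by (induction A rule: infinite_finite_induct)
      (auto simp: cproj_one cproj_mult assms cproj_closed)
qed

text \<open>The lift is the family supported at \<open>R\<close> alone.\<close>

lemma cproj_surj:
  assumes "cring R" "x \<in> carrier R"
  shows "\<exists>y. cproj R y = x"
proof -
  have "(\<lambda>S\<in>{S :: 'a ring. cring S}. if S = R then x else \<zero>\<^bsub>S\<^esub>, 0::int)
      \<in> (\<Pi>\<^sub>E R \<in> {R. cring R}. carrier R) \<times> UNIV"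
    using assms by (auto intro!: ring.ring_simprules cring.axioms(1))
  note eq = Abs_cfam_inverse[OF this]
  show ?thesis
    by (rule exI[of _ "Abs_cfam (\<lambda>S\<in>{S :: 'a ring. cring S}. if S = R then x else \<zero>\<^bsub>S\<^esub>, 0::int)"])
      (use assms in \<open>simp add: cproj.rep_eq eq\<close>)
qed

subsection \<open>Matrix algebra\<close>

definition rmat :: "('a, 'm) ring_scheme => nat => nat => 'a mat set" where
  "rmat R n m = {A \<in> carrier_mat n m. elements_mat A \<subseteq> carrier R}"

abbreviation mat_prod_infix :: "('a, 'm) ring_scheme => 'a mat => 'a mat => 'a mat"
  (infixl \<open>\<star>\<index>\<close> 70) where
  "A \<star>\<^bsub>R\<^esub> B \<equiv> mat_prod R A B"

definition one_m :: "('a, 'm) ring_scheme => nat => 'a mat" where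
  "one_m R n = mat n n (\<lambda>(i, j). if i = j then \<one>\<^bsub>R\<^esub> else \<zero>\<^bsub>R\<^esub>)"

definition zero_m :: "('a, 'm) ring_scheme => nat => nat => 'a mat" where
  "zero_m R n m = mat n m (\<lambda>_. \<zero>\<^bsub>R\<^esub>)"

definition add_m :: "('a, 'm) ring_scheme => 'a mat => 'a mat => 'a mat" where
  "add_m R A B = mat (dim_row A) (dim_col A) (\<lambda>ij. A $$ ij \<oplus>\<^bsub>R\<^esub> B $$ ij)"

definition smult_m :: "('a, 'm) ring_scheme => 'a => 'a mat => 'a mat" where
  "smult_m R c A = mat (dim_row A) (dim_col A) (\<lambda>ij. c \<otimes>\<^bsub>R\<^esub> A $$ ij)"

lemma rmat_iff: "A \<in> rmat R n m \<longleftrightarrow>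
    dim_row A = n \<and> dim_col A = m \<and> (\<forall>i<n. \<forall>j<m. A $$ (i, j) \<in> carrier R)"
  unfolding rmat_def elements_mat_def carrier_mat_def by fastforce

lemma rmat_dims: "A \<in> rmat R n m ==> dim_row A = n" "A \<in> rmat R n m ==> dim_col A = m"
  by (auto simp: rmat_iff)

lemma rmat_carrier_mat: "A \<in> rmat R n m ==> A \<in> carrier_mat n m"
  by (auto simp: rmat_def)

lemma rmat_index: "A \<in> rmat R n m ==> i < n ==> j < m ==> A $$ (i, j) \<in> carrier R"
  by (auto simp: rmat_iff)

lemma rmat_transpose: "A \<in> rmat R n m ==> transpose_mat A \<in> rmat R m n"
  by (auto simp: rmat_iff)

lemma rmat_four_block:
  "A \<in> rmat R n m ==> B \<in> rmat R n m' ==> C \<in> rmat R n' m ==> D \<in> rmat R n' m' ==>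
   four_block_mat A B C D \<in> rmat R (n + n') (m + m')"
  by (auto simp: rmat_iff)

lemma rmat_blocks:
  assumes "A \<in> rmat R (n + n') (m + m')"
  obtains A1 A2 A3 A4 where "A1 \<in> rmat R n m" "A2 \<in> rmat R n m'" "A3 \<in> rmat R n' m"
    "A4 \<in> rmat R n' m'" "A = four_block_mat A1 A2 A3 A4"
proof
  show "mat n m (\<lambda>(i, j). A $$ (i, j)) \<in> rmat R n m" "mat n m' (\<lambda>(i, j). A $$ (i, j + m)) \<in> rmat R n m'"
    "mat n' m (\<lambda>(i, j). A $$ (i + n, j)) \<in> rmat R n' m"
    "mat n' m' (\<lambda>(i, j). A $$ (i + n, j + m)) \<in> rmat R n' m'"
    using assms by (auto simp: rmat_iff)
  show "A = four_block_mat (mat n m (\<lambda>(i, j). A $$ (i, j))) (mat n m' (\<lambda>(i, j). A $$ (i, j + m)))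
     (mat n' m (\<lambda>(i, j). A $$ (i + n, j))) (mat n' m' (\<lambda>(i, j). A $$ (i + n, j + m)))"
    using assms by (intro eq_matI) (auto simp: rmat_iff)
qed

lemma four_block_inject:
  assumes "A \<in> rmat R n m" "B \<in> rmat R n m'" "C \<in> rmat R n' m" "D \<in> rmat R n' m'"
    "A' \<in> rmat R n m" "B' \<in> rmat R n m'" "C' \<in> rmat R n' m" "D' \<in> rmat R n' m'"
    "four_block_mat A B C D = four_block_mat A' B' C' D'"
  shows "A = A' \<and> B = B' \<and> C = C' \<and> D = D'"
proof -
  have *: "four_block_mat A B C D $$ (i, j) = four_block_mat A' B' C' D' $$ (i, j)" for i j
    using assms by simp
  have 1: "A $$ (i, j) = A' $$ (i, j)" if "i < n" "j < m" for i j
    using *[of i j] that assms(1-8) by (auto simp: rmat_iff)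
  have 2: "B $$ (i, j) = B' $$ (i, j)" if "i < n" "j < m'" for i j
    using *[of i "j + m"] that assms(1-8) by (auto simp: rmat_iff)
  have 3: "C $$ (i, j) = C' $$ (i, j)" if "i < n'" "j < m" for i j
    using *[of "i + n" j] that assms(1-8) by (auto simp: rmat_iff)
  have 4: "D $$ (i, j) = D' $$ (i, j)" if "i < n'" "j < m'" for i j
    using *[of "i + n" "j + m"] that assms(1-8) by (auto simp: rmat_iff)
  have "A = A'" by (rule eq_matI) (use 1 assms(1,5) in \<open>auto simp: rmat_iff\<close>)
  moreover have "B = B'" by (rule eq_matI) (use 2 assms(2,6) in \<open>auto simp: rmat_iff\<close>)
  moreover have "C = C'" by (rule eq_matI) (use 3 assms(3,7) in \<open>auto simp: rmat_iff\<close>)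
  moreover have "D = D'" by (rule eq_matI) (use 4 assms(4,8) in \<open>auto simp: rmat_iff\<close>)
  ultimately show ?thesis by blast
qed

lemma dim_mat_prod [simp]: "dim_row (mat_prod R A B) = dim_row A" "dim_col (mat_prod R A B) = dim_col B"
  by (auto simp: mat_prod_def)

lemma dim_one_m [simp]: "dim_row (one_m R n) = n" "dim_col (one_m R n) = n"
  by (auto simp: one_m_def)

lemma dim_zero_m [simp]: "dim_row (zero_m R n m) = n" "dim_col (zero_m R n m) = m"
  by (auto simp: zero_m_def)

lemma dim_add_m [simp]: "dim_row (add_m R A B) = dim_row A" "dim_col (add_m R A B) = dim_col A"
  by (auto simp: add_m_def)

lemma dim_smult_m [simp]: "dim_row (smult_m R c A) = dim_row A" "dim_col (smult_m R c A) = dim_col A"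
  by (auto simp: smult_m_def)

context cring
begin

lemma rmat_one: "one_m R n \<in> rmat R n n" by (auto simp: rmat_iff one_m_def)
lemma rmat_zero: "zero_m R n m \<in> rmat R n m" by (auto simp: rmat_iff zero_m_def)
lemma rmat_add: "A \<in> rmat R n m ==> B \<in> rmat R n m ==> add_m R A B \<in> rmat R n m"
  by (auto simp: rmat_iff add_m_def)
lemma rmat_smult: "c \<in> carrier R ==> A \<in> rmat R n m ==> smult_m R c A \<in> rmat R n m"
  by (auto simp: rmat_iff smult_m_def)
lemma rmat_prod: "A \<in> rmat R n m ==> B \<in> rmat R m k ==> A \<star> B \<in> rmat R n k"
  by (auto simp: rmat_iff mat_prod_def intro!: finsum_closed)

end

lemma mat_proj_surj:
  assumes "cring R" "A \<in> rmat R n m"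
  obtains M where "M \<in> carrier_mat n m" "A = map_mat (cproj R) M"
proof -
  have "\<forall>i j. \<exists>y. i < n \<longrightarrow> j < m \<longrightarrow> cproj R y = A $$ (i, j)"
    using cproj_surj[OF assms(1)] assms(2) by (auto simp: rmat_iff)
  then obtain f where "\<And>i j. i < n ==> j < m ==> cproj R (f i j) = A $$ (i, j)"
    by metis
  then show ?thesis
    using assms(2) by (intro that[of "mat n m (\<lambda>(i, j). f i j)"]) (auto simp: rmat_iff)
qed

lemma mat_proj_ex:
  assumes "cring R" "A \<in> rmat R n m"
  shows "\<exists>M. M \<in> carrier_mat n m \<and> A = map_mat (cproj R) M"
  using mat_proj_surj[OF assms] by blast

context
  fixes R :: "'a ring" (structure)
  assumes R: "cring R"
begin

lemma mat_proj_mult: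
  assumes "dim_col M = dim_row N"
  shows "map_mat (cproj R) M \<star> map_mat (cproj R) N = map_mat (cproj R) (M * N)"
proof (intro eq_matI)
  fix i j assume ij: "i < dim_row (map_mat (cproj R) (M * N))" "j < dim_col (map_mat (cproj R) (M * N))"
  interpret cring R by (rule R)
  show "(map_mat (cproj R) M \<star> map_mat (cproj R) N) $$ (i, j) = map_mat (cproj R) (M * N) $$ (i, j)"
    using ij assms
    by (auto simp: mat_prod_def scalar_prod_def cproj_sum[OF R] cproj_mult[OF R] lessThan_atLeast0
        intro!: finsum_cong' cproj_closed[OF R] m_closed)
qed auto

lemma mat_proj_add:
  assumes "dim_row M = dim_row N" "dim_col M = dim_col N"
  shows "add_m R (map_mat (cproj R) M) (map_mat (cproj R) N) = map_mat (cproj R) (M + N)"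
  using assms by (intro eq_matI) (auto simp: add_m_def cproj_add[OF R])

lemma mat_proj_smult:
  "smult_m R (cproj R c) (map_mat (cproj R) M) = map_mat (cproj R) (c \<cdot>\<^sub>m M)"
  by (intro eq_matI) (auto simp: smult_m_def cproj_mult[OF R])

lemma mat_proj_one: "one_m R n = map_mat (cproj R) (1\<^sub>m n)"
  by (intro eq_matI) (auto simp: one_m_def cproj_zero[OF R] cproj_one[OF R])

lemma mat_proj_zero: "zero_m R n m = map_mat (cproj R) (0\<^sub>m n m)"
  by (intro eq_matI) (auto simp: zero_m_def cproj_zero[OF R])

lemma mat_proj_transpose: "transpose_mat (map_mat f M) = map_mat f (transpose_mat M)"
  by (intro eq_matI) auto

lemma mat_proj_det:
  assumes "dim_row M = dim_col M"
  shows "mat_det R (map_mat (cproj R) M) = cproj R (det M)"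
proof -
  interpret cring R by (rule R)
  have *: "M \<in> carrier_mat (dim_row M) (dim_row M)" using assms by auto
  have sgn: "cproj R (signof p) = (if evenperm p then \<one> else \<ominus> \<one>)" for p :: "nat => nat"
    by (auto simp: sign_def cproj_one[OF R] cproj_uminus[OF R])
  show ?thesis
    using assms
    unfolding mat_det_def det_def'[OF *] cproj_sum[OF R] cproj_mult[OF R]
      cproj_prod[OF R] sgn
    by (auto simp: lessThan_atLeast0 permutes_in_image
        intro!: finsum_cong' finprod_closed m_closed cproj_closed[OF R] arg_cong2[where f = "(\<otimes>)"] finprod_cong')
qed

lemma mat_assoc:
  assumes "A \<in> rmat R n m" "B \<in> rmat R m k" "C \<in> rmat R k l"
  shows "A \<star> B \<star> C = A \<star> (B \<star> C)"
proof -
  obtain M N L where M: "M \<in> carrier_mat n m" "A = map_mat (cproj R) M"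
    and N: "N \<in> carrier_mat m k" "B = map_mat (cproj R) N"
    and L: "L \<in> carrier_mat k l" "C = map_mat (cproj R) L"
    using assms mat_proj_ex[OF R] by metis
  show ?thesis
    using M(1) N(1) L(1) unfolding M(2) N(2) L(2) by (simp add: mat_proj_mult assoc_mult_mat)
qed

lemma mat_one_left: "A \<in> rmat R n m ==> one_m R n \<star> A = A"
  by (erule mat_proj_surj[OF R]) (simp add: mat_proj_one mat_proj_mult)

lemma mat_one_right: "A \<in> rmat R n m ==> A \<star> one_m R m = A"
  by (erule mat_proj_surj[OF R]) (simp add: mat_proj_one mat_proj_mult)

lemma mat_zero_left: "A \<in> rmat R n m ==> zero_m R k n \<star> A = zero_m R k m"
  by (erule mat_proj_surj[OF R]) (simp add: mat_proj_zero mat_proj_mult)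

lemma mat_zero_right: "A \<in> rmat R n m ==> A \<star> zero_m R m k = zero_m R n k"
  by (erule mat_proj_surj[OF R]) (simp add: mat_proj_zero mat_proj_mult)

lemma mat_transpose_mult:
  assumes "A \<in> rmat R n m" "B \<in> rmat R m k"
  shows "transpose_mat (A \<star> B) = transpose_mat B \<star> transpose_mat A"
proof -
  obtain M N where M: "M \<in> carrier_mat n m" "A = map_mat (cproj R) M"
    and N: "N \<in> carrier_mat m k" "B = map_mat (cproj R) N"
    using assms mat_proj_ex[OF R] by metis
  show ?thesis
    using M(1) N(1) unfolding M(2) N(2)
    by (simp add: mat_proj_mult mat_proj_transpose transpose_mult)
qed

lemma transpose_one_m: "transpose_mat (one_m R n) = one_m R n"
  by (auto simp: mat_proj_one mat_proj_transpose)

lemma mat_smult_left: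
  assumes "A \<in> rmat R n m" "B \<in> rmat R m k" "c \<in> carrier R"
  shows "smult_m R c A \<star> B = smult_m R c (A \<star> B)"
proof -
  obtain M N z where M: "M \<in> carrier_mat n m" "A = map_mat (cproj R) M"
    and N: "N \<in> carrier_mat m k" "B = map_mat (cproj R) N" and z: "c = cproj R z"
    using assms mat_proj_ex[OF R] cproj_surj[OF R] by metis
  show ?thesis
    using M(1) N(1) unfolding M(2) N(2) z
    by (simp add: mat_proj_mult mat_proj_smult mult_smult_assoc_mat[of _ n m _ k])
qed

lemma mat_smult_right:
  assumes "A \<in> rmat R n m" "B \<in> rmat R m k" "c \<in> carrier R"
  shows "A \<star> smult_m R c B = smult_m R c (A \<star> B)"
proof -
  obtain M N z where M: "M \<in> carrier_mat n m" "A = map_mat (cproj R) M"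
    and N: "N \<in> carrier_mat m k" "B = map_mat (cproj R) N" and z: "c = cproj R z"
    using assms mat_proj_ex[OF R] cproj_surj[OF R] by metis
  show ?thesis
    using M(1) N(1) unfolding M(2) N(2) z
    by (simp add: mat_proj_mult mat_proj_smult mult_smult_distrib[of _ n m _ k])
qed

lemma mat_distrib_left:
  assumes "A \<in> rmat R n m" "B \<in> rmat R m k" "C \<in> rmat R m k"
  shows "A \<star> add_m R B C = add_m R (A \<star> B) (A \<star> C)"
proof -
  obtain M N L where M: "M \<in> carrier_mat n m" "A = map_mat (cproj R) M"
    and N: "N \<in> carrier_mat m k" "B = map_mat (cproj R) N"
    and L: "L \<in> carrier_mat m k" "C = map_mat (cproj R) L"
    using assms mat_proj_ex[OF R] by metis
  show ?thesis
    using M(1) N(1) L(1) unfolding M(2) N(2) L(2)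
    by (simp add: mat_proj_mult mat_proj_add mat_proj_add mult_add_distrib_mat[of _ n m _ k])
qed

lemma mat_distrib_right:
  assumes "A \<in> rmat R n m" "B \<in> rmat R n m" "C \<in> rmat R m k"
  shows "add_m R A B \<star> C = add_m R (A \<star> C) (B \<star> C)"
proof -
  obtain M N L where M: "M \<in> carrier_mat n m" "A = map_mat (cproj R) M"
    and N: "N \<in> carrier_mat n m" "B = map_mat (cproj R) N"
    and L: "L \<in> carrier_mat m k" "C = map_mat (cproj R) L"
    using assms mat_proj_ex[OF R] by metis
  show ?thesis
    using M(1) N(1) L(1) unfolding M(2) N(2) L(2)
    by (simp add: mat_proj_mult mat_proj_add mat_proj_add add_mult_distrib_mat[of _ n m _ _ k])
qed

lemma mat_prod_four_block:
  assumes "A1 \<in> rmat R n1 m1" "B1 \<in> rmat R n1 m2" "C1 \<in> rmat R n2 m1" "D1 \<in> rmat R n2 m2"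
    and "A2 \<in> rmat R m1 k1" "B2 \<in> rmat R m1 k2" "C2 \<in> rmat R m2 k1" "D2 \<in> rmat R m2 k2"
  shows "four_block_mat A1 B1 C1 D1 \<star> four_block_mat A2 B2 C2 D2 =
    four_block_mat (add_m R (A1 \<star> A2) (B1 \<star> C2)) (add_m R (A1 \<star> B2) (B1 \<star> D2))
      (add_m R (C1 \<star> A2) (D1 \<star> C2)) (add_m R (C1 \<star> B2) (D1 \<star> D2))"
proof -
  obtain a1 where a1: "a1 \<in> carrier_mat n1 m1" "A1 = map_mat (cproj R) a1" using assms mat_proj_ex[OF R] by metis
  obtain b1 where b1: "b1 \<in> carrier_mat n1 m2" "B1 = map_mat (cproj R) b1" using assms mat_proj_ex[OF R] by metis
  obtain c1 where c1: "c1 \<in> carrier_mat n2 m1" "C1 = map_mat (cproj R) c1" using assms mat_proj_ex[OF R] by metis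
  obtain d1 where d1: "d1 \<in> carrier_mat n2 m2" "D1 = map_mat (cproj R) d1" using assms mat_proj_ex[OF R] by metis
  obtain a2 where a2: "a2 \<in> carrier_mat m1 k1" "A2 = map_mat (cproj R) a2" using assms mat_proj_ex[OF R] by metis
  obtain b2 where b2: "b2 \<in> carrier_mat m1 k2" "B2 = map_mat (cproj R) b2" using assms mat_proj_ex[OF R] by metis
  obtain c2 where c2: "c2 \<in> carrier_mat m2 k1" "C2 = map_mat (cproj R) c2" using assms mat_proj_ex[OF R] by metis
  obtain d2 where d2: "d2 \<in> carrier_mat m2 k2" "D2 = map_mat (cproj R) d2" using assms mat_proj_ex[OF R] by metis
  note c = a1(1) b1(1) c1(1) d1(1) and c' = a2(1) b2(1) c2(1) d2(1)
  have "four_block_mat A1 B1 C1 D1 \<star> four_block_mat A2 B2 C2 D2 =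
     map_mat (cproj R) (four_block_mat a1 b1 c1 d1 * four_block_mat a2 b2 c2 d2)"
    unfolding a1 b1 c1 d1 a2 b2 c2 d2 map_four_block_mat[OF c, symmetric] map_four_block_mat[OF c', symmetric]
    using c c' by (intro mat_proj_mult) auto
  also have "\<dots> = map_mat (cproj R) (four_block_mat (a1 * a2 + b1 * c2) (a1 * b2 + b1 * d2)
     (c1 * a2 + d1 * c2) (c1 * b2 + d1 * d2))"
    by (simp add: mult_four_block_mat[OF c c'])
  also have "\<dots> = four_block_mat (map_mat (cproj R) (a1 * a2 + b1 * c2)) (map_mat (cproj R) (a1 * b2 + b1 * d2))
     (map_mat (cproj R) (c1 * a2 + d1 * c2)) (map_mat (cproj R) (c1 * b2 + d1 * d2))"
    using c c' by (intro map_four_block_mat[of _ n1 k1 _ k2 _ n2]) auto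
  finally show ?thesis
    using c c' unfolding a1 b1 c1 d1 a2 b2 c2 d2
    by (simp add: mat_proj_mult mat_proj_mult mat_proj_add mat_proj_add
        mat_proj_add mat_proj_add)
qed

lemma mat_add_zero_right: "A \<in> rmat R n m ==> add_m R A (zero_m R n m) = A"
  by (erule mat_proj_surj[OF R]) (simp add: mat_proj_zero mat_proj_add)

lemma mat_add_zero_left: "A \<in> rmat R n m ==> add_m R (zero_m R n m) A = A"
  by (erule mat_proj_surj[OF R]) (simp add: mat_proj_zero mat_proj_add)

lemma mat_det_closed: "A \<in> rmat R n n ==> mat_det R A \<in> carrier R"
  by (erule mat_proj_surj[OF R]) (simp add: mat_proj_det cproj_closed[OF R])

lemma mat_det_mult:
  assumes "A \<in> rmat R n n" "B \<in> rmat R n n"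
  shows "mat_det R (A \<star> B) = mat_det R A \<otimes> mat_det R B"
proof -
  obtain M N where M: "M \<in> carrier_mat n n" "A = map_mat (cproj R) M"
    and N: "N \<in> carrier_mat n n" "B = map_mat (cproj R) N"
    using assms mat_proj_ex[OF R] by metis
  show ?thesis
    using M(1) N(1) unfolding M(2) N(2)
    by (simp add: mat_proj_mult mat_proj_det det_mult[of _ n] cproj_mult[OF R])
qed

lemma mat_det_one: "mat_det R (one_m R n) = \<one>"
  by (simp add: mat_proj_one mat_proj_det cproj_one[OF R])

lemma mat_det_transpose: "A \<in> rmat R n n ==> mat_det R (transpose_mat A) = mat_det R A"
  by (erule mat_proj_surj[OF R]) (simp add: mat_proj_transpose mat_proj_det det_transpose)

lemma mat_det_1x1: "c \<in> carrier R ==> mat_det R (mat 1 1 (\<lambda>_. c)) = c"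
proof -
  assume "c \<in> carrier R"
  then obtain z where z: "c = cproj R z" by (metis cproj_surj[OF R])
  have "mat 1 1 (\<lambda>_. c) = map_mat (cproj R) (mat 1 1 (\<lambda>_. z))" by (auto simp: z)
  then show ?thesis using z by (simp add: mat_proj_det det_single)
qed

lemma mat_adjugate:
  assumes "A \<in> rmat R n n"
  obtains B where "B \<in> rmat R n n" "A \<star> B = smult_m R (mat_det R A) (one_m R n)"
    "B \<star> A = smult_m R (mat_det R A) (one_m R n)"
proof -
  obtain M where M: "M \<in> carrier_mat n n" "A = map_mat (cproj R) M"
    using assms mat_proj_ex[OF R] by metis
  show ?thesis
    using M(1) adj_mat[OF M(1)]
    by (intro that[of "map_mat (cproj R) (adj_mat M)"])
      (auto simp: M(2) rmat_iff cproj_closed[OF R] mat_proj_mult mat_proj_det mat_proj_one mat_proj_smult)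
qed

end

subsection \<open>Invertible matrices\<close>

lemma carrier_mat_monoid: "carrier (mat_monoid R n) = rmat R n n"
  by (simp add: mat_monoid_def rmat_def)

lemma one_mat_monoid: "one (mat_monoid R n) = one_m R n"
  by (simp add: mat_monoid_def one_m_def)

lemma mult_mat_monoid: "monoid.mult (mat_monoid R n) = mat_prod R"
  by (simp add: mat_monoid_def)

lemma mult_GL: "monoid.mult (GL n R) = mat_prod R"
  by (simp add: GL_def units_of_def mult_mat_monoid)

lemma GL_iff: "A \<in> carrier (GL n R) \<longleftrightarrow>
    A \<in> rmat R n n \<and> (\<exists>B\<in>rmat R n n. B \<star>\<^bsub>R\<^esub> A = one_m R n \<and> A \<star>\<^bsub>R\<^esub> B = one_m R n)"
  by (simp add: GL_def units_of_def Units_def carrier_mat_monoid one_mat_monoid mult_mat_monoid)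

lemma GL_rmat: "A \<in> carrier (GL n R) ==> A \<in> rmat R n n"
  by (simp add: GL_iff)

text \<open>The Gram matrix of the form after the substitution \<open>C\<close>. Since
  \<open>C\<close> may be rectangular, a single column gives the value of the form at a vector, as a
  one by one matrix.\<close>

definition pullback :: "('a, 'm) ring_scheme => 'a mat => 'a mat => 'a mat" where
  "pullback R Q C = transpose_mat C \<star>\<^bsub>R\<^esub> Q \<star>\<^bsub>R\<^esub> C"

lemma dim_pullback [simp]: "dim_row (pullback R Q C) = dim_col C" "dim_col (pullback R Q C) = dim_col C"
  by (auto simp: pullback_def)

definition oppos :: "('a, 'm) ring_scheme => 'a mat => 'a mat" where
  "oppos R Q = map_mat (a_inv R) Q"

abbreviation perp :: "('a, 'm) ring_scheme => 'a mat => 'a mat => 'a mat"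
  (infixr \<open>\<bottom>\<index>\<close> 65) where
  "A \<bottom>\<^bsub>R\<^esub> B \<equiv> orth_sum R A B"

lemma perp_def: "A \<bottom>\<^bsub>R\<^esub> B =
    four_block_mat A (zero_m R (dim_row A) (dim_col B)) (zero_m R (dim_row B) (dim_col A)) B"
  by (simp add: orth_sum_def zero_m_def)

lemma dim_perp [simp]: "dim_row (A \<bottom>\<^bsub>R\<^esub> B) = dim_row A + dim_row B"
  "dim_col (A \<bottom>\<^bsub>R\<^esub> B) = dim_col A + dim_col B"
  by (auto simp: perp_def)

lemma perp_index:
  "i < dim_row A + dim_row B ==> j < dim_col A + dim_col B ==> (A \<bottom>\<^bsub>R\<^esub> B) $$ (i, j) =
    (if i < dim_row A then if j < dim_col A then A $$ (i, j) else \<zero>\<^bsub>R\<^esub>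
     else if j < dim_col A then \<zero>\<^bsub>R\<^esub> else B $$ (i - dim_row A, j - dim_col A))"
  by (auto simp: perp_def zero_m_def)

text \<open>The matrix is the product of the block diagonal matrices with blocks A, 1 and 1, B. Each
  of these is reduced to its nontrivial block by peeling off one diagonal entry 1 at a time.\<close>

lemma det_four_block_diag:
  fixes A B :: "'a :: comm_ring_1 mat"
  assumes "A \<in> carrier_mat n n" "B \<in> carrier_mat m m"
  shows "det (four_block_mat A (0\<^sub>m n m) (0\<^sub>m m n) B) = det A * det B"
proof -
  have one_left: "det (four_block_mat (1\<^sub>m k) (0\<^sub>m k m) (0\<^sub>m m k) B) = det B" for k
  proof (induction k)
    case 0
    have "four_block_mat (1\<^sub>m 0) (0\<^sub>m 0 m) (0\<^sub>m m 0) B = B"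
      using assms by (intro eq_matI) auto
    then show ?case by simp
  next
    case (Suc k)
    let ?M = "four_block_mat (1\<^sub>m k) (0\<^sub>m k m) (0\<^sub>m m k) B"
    have "four_block_mat (1\<^sub>m (Suc k)) (0\<^sub>m (Suc k) m) (0\<^sub>m m (Suc k)) B =
        four_block_mat (1\<^sub>m 1) (0\<^sub>m 1 (k + m)) (0\<^sub>m (k + m) 1) ?M"
      using assms by (intro eq_matI) auto
    moreover have "det (four_block_mat (1\<^sub>m 1) (0\<^sub>m 1 (k + m)) (0\<^sub>m (k + m) 1) ?M) = det (1\<^sub>m 1) * det ?M"
      using assms by (intro det_four_block_mat_lower_left_zero_col) auto
    ultimately show ?case using Suc by simp
  qed
  have one_right: "det (four_block_mat A (0\<^sub>m n k) (0\<^sub>m k n) (1\<^sub>m k)) = det A" for k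
  proof (induction k)
    case 0
    have "four_block_mat A (0\<^sub>m n 0) (0\<^sub>m 0 n) (1\<^sub>m 0) = A"
      using assms by (intro eq_matI) auto
    then show ?case by simp
  next
    case (Suc k)
    let ?M = "four_block_mat A (0\<^sub>m n k) (0\<^sub>m k n) (1\<^sub>m k)"
    have "four_block_mat A (0\<^sub>m n (Suc k)) (0\<^sub>m (Suc k) n) (1\<^sub>m (Suc k)) =
        four_block_mat ?M (0\<^sub>m (n + k) 1) (0\<^sub>m 1 (n + k)) (1\<^sub>m 1)"
      using assms by (intro eq_matI) auto
    moreover have "det (four_block_mat ?M (0\<^sub>m (n + k) 1) (0\<^sub>m 1 (n + k)) (1\<^sub>m 1)) = det ?M * det (1\<^sub>m 1)"
      using assms by (intro det_four_block_mat_upper_right_zero_col) auto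
    ultimately show ?case using Suc by simp
  qed
  have "four_block_mat A (0\<^sub>m n m) (0\<^sub>m m n) B =
      four_block_mat A (0\<^sub>m n m) (0\<^sub>m m n) (1\<^sub>m m) * four_block_mat (1\<^sub>m n) (0\<^sub>m n m) (0\<^sub>m m n) B"
    using assms by (subst mult_four_block_mat[of _ n n _ m _ m _ _ n _ m]) auto
  also have "det \<dots> = det A * det B"
    using assms one_left[of n] one_right[of m] by (subst det_mult[of _ "n + m"]) auto
  finally show ?thesis .
qed

context
  fixes R :: "'a ring" (structure)
  assumes R: "cring R"
begin

interpretation cring R by (rule R)

lemma GL_one: "one_m R n \<in> carrier (GL n R)"
  using mat_one_left[OF R rmat_one] rmat_one by (auto simp: GL_iff)

lemma GL_mult:
  assumes "A \<in> carrier (GL n R)" "B \<in> carrier (GL n R)"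
  shows "A \<star> B \<in> carrier (GL n R)"
proof -
  obtain A' B' where A: "A \<in> rmat R n n" "A' \<in> rmat R n n" "A' \<star> A = one_m R n" "A \<star> A' = one_m R n"
    and B: "B \<in> rmat R n n" "B' \<in> rmat R n n" "B' \<star> B = one_m R n" "B \<star> B' = one_m R n"
    using assms unfolding GL_iff by blast
  have "A' \<star> (A \<star> B) = B" "B \<star> (B' \<star> A') = A'"
    using A(3) B(4) mat_assoc[OF R A(2,1) B(1)] mat_assoc[OF R B(1,2) A(2)]
      mat_one_left[OF R B(1)] mat_one_left[OF R A(2)] by metis+
  then have 1: "B' \<star> A' \<star> (A \<star> B) = one_m R n"
    and 2: "A \<star> B \<star> (B' \<star> A') = one_m R n"
    using mat_assoc[OF R B(2) A(2) rmat_prod[OF A(1) B(1)]] mat_assoc[OF R A(1) B(1) rmat_prod[OF B(2) A(2)]] A B by simp_all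
  show ?thesis
    unfolding GL_iff using 1 2 A B rmat_prod by blast
qed

lemma GL_inverse:
  assumes "A \<in> carrier (GL n R)"
  obtains B where "B \<in> carrier (GL n R)" "B \<star> A = one_m R n" "A \<star> B = one_m R n"
  using assms unfolding GL_iff by blast

lemma GL_transpose:
  assumes "A \<in> carrier (GL n R)"
  shows "transpose_mat A \<in> carrier (GL n R)"
proof -
  obtain B where B: "A \<in> rmat R n n" "B \<in> rmat R n n" "B \<star> A = one_m R n" "A \<star> B = one_m R n"
    using assms unfolding GL_iff by blast
  have "transpose_mat A \<star> transpose_mat B = one_m R n" "transpose_mat B \<star> transpose_mat A = one_m R n"
    using mat_transpose_mult[OF R B(1,2)] mat_transpose_mult[OF R B(2,1)] B(3,4) transpose_one_m[OF R] by metis+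
  then show ?thesis
    unfolding GL_iff using B rmat_transpose by blast
qed

lemma GL_det_unit:
  assumes "A \<in> carrier (GL n R)"
  shows "mat_det R A \<in> Units R"
proof -
  obtain B where B: "A \<in> rmat R n n" "B \<in> rmat R n n" "B \<star> A = one_m R n" "A \<star> B = one_m R n"
    using assms unfolding GL_iff by blast
  have "mat_det R B \<otimes> mat_det R A = \<one>" "mat_det R A \<otimes> mat_det R B = \<one>"
    using mat_det_mult[OF R B(1,2)] mat_det_mult[OF R B(2,1)] B mat_det_one[OF R] by auto
  then show ?thesis
    using mat_det_closed[OF R B(1)] mat_det_closed[OF R B(2)] by (auto simp: Units_def)
qed

lemma smult_one_m: "a \<in> carrier R ==> b \<in> carrier R ==> a \<otimes> b = \<one> ==>
    smult_m R a (smult_m R b (one_m R n)) = one_m R n"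
  by (intro eq_matI) (auto simp: smult_m_def one_m_def)

lemma GL_iff_det:
  assumes "A \<in> rmat R n n"
  shows "A \<in> carrier (GL n R) \<longleftrightarrow> mat_det R A \<in> Units R"
proof
  assume u: "mat_det R A \<in> Units R"
  let ?d = "inv mat_det R A"
  from assms obtain B where B: "B \<in> rmat R n n" "A \<star> B = smult_m R (mat_det R A) (one_m R n)"
    "B \<star> A = smult_m R (mat_det R A) (one_m R n)"
    by (rule mat_adjugate[OF R])
  have "A \<star> smult_m R ?d B = one_m R n" "smult_m R ?d B \<star> A = one_m R n"
    using u B assms by (simp_all add: mat_smult_right[OF R assms B(1)] mat_smult_left[OF R B(1) assms]
        smult_one_m mat_det_closed[OF R assms])
  then show "A \<in> carrier (GL n R)"
    unfolding GL_iff using assms B(1) u by (auto intro!: bexI[of _ "smult_m R ?d B"] rmat_smult)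
qed (rule GL_det_unit)

lemma GL_cancel:
  assumes "A \<in> carrier (GL n R)" "B \<in> rmat R n m" "C \<in> rmat R n m" "A \<star> B = A \<star> C"
  shows "B = C"
proof -
  obtain A' where A': "A' \<in> rmat R n n" "A' \<star> A = one_m R n"
    using assms(1) unfolding GL_iff by blast
  show ?thesis
    using mat_assoc[OF R A'(1) GL_rmat[OF assms(1)] assms(2)] mat_assoc[OF R A'(1) GL_rmat[OF assms(1)] assms(3)]
      mat_one_left[OF R assms(2)] mat_one_left[OF R assms(3)] A'(2) assms(4) by metis
qed

lemma rmat_pullback: "Q \<in> rmat R n n ==> C \<in> rmat R n m ==> pullback R Q C \<in> rmat R m m"
  unfolding pullback_def by (intro rmat_prod rmat_transpose)

lemma pullback_pullback:
  assumes "Q \<in> rmat R n n" "C \<in> rmat R n m" "D \<in> rmat R m k"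
  shows "pullback R (pullback R Q C) D = pullback R Q (C \<star> D)"
proof -
  note T = rmat_transpose[OF assms(2)] rmat_transpose[OF assms(3)]
  have "pullback R Q (C \<star> D) = transpose_mat D \<star> transpose_mat C \<star> Q \<star> (C \<star> D)"
    by (simp add: pullback_def mat_transpose_mult[OF R assms(2,3)])
  also have "\<dots> = transpose_mat D \<star> (transpose_mat C \<star> Q) \<star> (C \<star> D)"
    by (simp add: mat_assoc[OF R T(2,1) assms(1)])
  also have "\<dots> = transpose_mat D \<star> (transpose_mat C \<star> Q) \<star> C \<star> D"
    by (rule mat_assoc[OF R, symmetric, OF rmat_prod[OF T(2) rmat_prod[OF T(1) assms(1)]] assms(2,3)])
  also have "\<dots> = transpose_mat D \<star> (transpose_mat C \<star> Q \<star> C) \<star> D"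
    by (simp add: mat_assoc[OF R T(2) rmat_prod[OF T(1) assms(1)] assms(2)])
  finally show ?thesis by (simp add: pullback_def)
qed

lemma pullback_one: "Q \<in> rmat R n n ==> pullback R Q (one_m R n) = Q"
  by (simp add: pullback_def transpose_one_m[OF R] mat_one_left[OF R] mat_one_right[OF R])

lemma pullback_inverse:
  assumes "Q \<in> rmat R n n" "C \<in> rmat R n n" "B \<in> rmat R n n" "C \<star> B = one_m R n" "pullback R Q C = Q'"
  shows "pullback R Q' B = Q"
  using pullback_pullback[OF assms(1,2,3)] assms pullback_one by simp

lemma transpose_pullback:
  assumes "Q \<in> rmat R n n" "C \<in> rmat R n m" "transpose_mat Q = Q"
  shows "transpose_mat (pullback R Q C) = pullback R Q C"
proof -
  note T = rmat_transpose[OF assms(2)]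
  show ?thesis
    unfolding pullback_def mat_transpose_mult[OF R rmat_prod[OF T assms(1)] assms(2)]
      mat_transpose_mult[OF R T assms(1)] assms(3)
    using mat_assoc[OF R T assms(1,2)] by simp
qed

lemma det_pullback:
  assumes "Q \<in> rmat R n n" "C \<in> rmat R n n"
  shows "mat_det R (pullback R Q C) = mat_det R C \<otimes> mat_det R C \<otimes> mat_det R Q"
proof -
  note T = rmat_transpose[OF assms(2)]
  show ?thesis
    unfolding pullback_def mat_det_mult[OF R rmat_prod[OF T assms(1)] assms(2)]
      mat_det_mult[OF R T assms(1)] mat_det_transpose[OF R assms(2)]
    using mat_det_closed[OF R assms(1)] mat_det_closed[OF R assms(2)] by (simp add: m_ac)
qed

lemma GL_pullback: "Q \<in> carrier (GL n R) ==> C \<in> carrier (GL n R) ==> pullback R Q C \<in> carrier (GL n R)"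
  unfolding pullback_def by (intro GL_mult GL_transpose)

text \<open>The determinant of the pullback is det C det C det Q, and in a commutative ring a factor
  of a unit is a unit.\<close>

lemma GL_of_pullback:
  assumes "Q \<in> rmat R n n" "C \<in> rmat R n n" "pullback R Q C \<in> carrier (GL n R)"
  shows "C \<in> carrier (GL n R)" "Q \<in> carrier (GL n R)"
proof -
  have d: "mat_det R C \<in> carrier R" "mat_det R Q \<in> carrier R"
    using mat_det_closed[OF R] assms by auto
  have u: "mat_det R C \<otimes> mat_det R C \<otimes> mat_det R Q \<in> Units R"
    using GL_det_unit[OF assms(3)] det_pullback[OF assms(1,2)] by simp
  have "mat_det R C \<otimes> mat_det R C \<in> Units R" by (rule unit_factor[OF u]) (use d in auto)
  then have "mat_det R C \<in> Units R" by (rule unit_factor) (use d in auto)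
  then show "C \<in> carrier (GL n R)" using GL_iff_det[OF assms(2)] by simp
  have "mat_det R Q \<otimes> (mat_det R C \<otimes> mat_det R C) \<in> Units R" using u d by (simp add: m_ac)
  then have "mat_det R Q \<in> Units R" by (rule unit_factor) (use d in auto)
  then show "Q \<in> carrier (GL n R)" using GL_iff_det[OF assms(1)] by simp
qed

subsection \<open>Orthogonal sums\<close>

lemma rmat_perp: "A \<in> rmat R n n' ==> B \<in> rmat R m m' ==> A \<bottom> B \<in> rmat R (n + m) (n' + m')"
  unfolding perp_def by (auto intro!: rmat_four_block rmat_zero simp: rmat_dims)

lemma perp_prod:
  assumes "A \<in> rmat R n n'" "B \<in> rmat R m m'" "C \<in> rmat R n' n''" "D \<in> rmat R m' m''"
  shows "(A \<bottom> B) \<star> (C \<bottom> D) = (A \<star> C) \<bottom> (B \<star> D)"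
proof -
  have dims: "dim_row A = n" "dim_col A = n'" "dim_row B = m" "dim_col B = m'"
    "dim_row C = n'" "dim_col C = n''" "dim_row D = m'" "dim_col D = m''"
    using assms rmat_dims by auto
  note p = rmat_prod[OF assms(1,3)] rmat_prod[OF assms(2,4)]
  show ?thesis
    unfolding perp_def dims dim_mat_prod
    by (subst mat_prod_four_block[OF R assms(1) rmat_zero rmat_zero assms(2) assms(3) rmat_zero rmat_zero assms(4)])
      (simp add: mat_zero_left[OF R assms(4)] mat_zero_left[OF R assms(3)] mat_zero_right[OF R assms(1)] mat_zero_right[OF R assms(2)]
        mat_zero_left[OF R rmat_zero] mat_add_zero_right[OF R rmat_zero] mat_add_zero_right[OF R p(1)] mat_add_zero_left[OF R p(2)])
qed

lemma transpose_perp: "transpose_mat (A \<bottom> B) = transpose_mat A \<bottom> transpose_mat B"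
  by (intro eq_matI) (auto simp: perp_def zero_m_def)

lemma perp_one: "one_m R n \<bottom> one_m R m = one_m R (n + m)"
  by (intro eq_matI) (auto simp: perp_def one_m_def zero_m_def)

lemma perp_assoc: "(A \<bottom> B) \<bottom> C = A \<bottom> (B \<bottom> C)"
proof (intro eq_matI)
  fix i j assume "i < dim_row (A \<bottom> (B \<bottom> C))" "j < dim_col (A \<bottom> (B \<bottom> C))"
  then have ij: "i < dim_row A + (dim_row B + dim_row C)" "j < dim_col A + (dim_col B + dim_col C)" by simp_all
  have cases3: "k < a \<and> k < a + b \<or> \<not> k < a \<and> k < a + b \<and> k - a < b \<or>
      \<not> k < a \<and> \<not> k < a + b \<and> \<not> k - a < b \<and> k - a < b + c \<and> k - (a + b) = k - a - b"
    if "k < a + (b + c)" for k a b c :: nat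
    using that by linarith
  show "((A \<bottom> B) \<bottom> C) $$ (i, j) = (A \<bottom> (B \<bottom> C)) $$ (i, j)"
    using cases3[OF ij(1)] cases3[OF ij(2)] ij by (elim disjE) (simp_all add: perp_index)
qed simp_all

lemma dim_diag_form [simp]: "dim_row (diag_form R cs) = length cs" "dim_col (diag_form R cs) = length cs"
  by (auto simp: diag_form_def)

lemma perp_Nil_left: "diag_form R [] \<bottom> A = A"
  by (intro eq_matI) (auto simp: perp_def)

lemma perp_Nil_right: "A \<bottom> diag_form R [] = A"
  by (intro eq_matI) (auto simp: perp_def)

lemma pullback_perp:
  assumes "Q1 \<in> rmat R n n" "C1 \<in> rmat R n n'" "Q2 \<in> rmat R m m" "C2 \<in> rmat R m m'"
  shows "pullback R (Q1 \<bottom> Q2) (C1 \<bottom> C2) = pullback R Q1 C1 \<bottom> pullback R Q2 C2"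
  unfolding pullback_def transpose_perp
    perp_prod[OF rmat_transpose[OF assms(2)] rmat_transpose[OF assms(4)] assms(1,3)]
    perp_prod[OF rmat_prod[OF rmat_transpose[OF assms(2)] assms(1)] rmat_prod[OF rmat_transpose[OF assms(4)] assms(3)] assms(2,4)] ..

lemma GL_perp:
  assumes "A \<in> carrier (GL n R)" "B \<in> carrier (GL m R)"
  shows "A \<bottom> B \<in> carrier (GL (n + m) R)"
proof -
  obtain A' B' where A: "A \<in> rmat R n n" "A' \<in> rmat R n n" "A' \<star> A = one_m R n" "A \<star> A' = one_m R n"
    and B: "B \<in> rmat R m m" "B' \<in> rmat R m m" "B' \<star> B = one_m R m" "B \<star> B' = one_m R m"
    using assms unfolding GL_iff by blast
  show ?thesis
    unfolding GL_iff
    using rmat_perp[OF A(1) B(1)] rmat_perp[OF A(2) B(2)] perp_prod[OF A(1) B(1) A(2) B(2)]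
      perp_prod[OF A(2) B(2) A(1) B(1)] A B perp_one
    by (auto intro!: bexI[of _ "A' \<bottom> B'"])
qed

lemma det_perp:
  assumes "A \<in> rmat R n n" "B \<in> rmat R m m"
  shows "mat_det R (A \<bottom> B) = mat_det R A \<otimes> mat_det R B"
proof -
  obtain M N where M: "M \<in> carrier_mat n n" "A = map_mat (cproj R) M"
    and N: "N \<in> carrier_mat m m" "B = map_mat (cproj R) N"
    using assms mat_proj_ex[OF R] by metis
  have "A \<bottom> B = map_mat (cproj R) (four_block_mat M (0\<^sub>m n m) (0\<^sub>m m n) N)"
    using M N by (simp add: perp_def mat_proj_zero[OF R] map_four_block_mat[of _ n n _ m _ m])
  then show ?thesis
    using M N det_four_block_diag[OF M(1) N(1)]
    by (simp add: mat_proj_det[OF R] cproj_mult[OF R])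
qed

lemma GL_of_perp:
  assumes "A \<in> rmat R n n" "B \<in> rmat R m m" "A \<bottom> B \<in> carrier (GL (n + m) R)"
  shows "A \<in> carrier (GL n R)" "B \<in> carrier (GL m R)"
proof -
  have d: "mat_det R A \<in> carrier R" "mat_det R B \<in> carrier R"
    using mat_det_closed[OF R] assms by auto
  have u: "mat_det R A \<otimes> mat_det R B \<in> Units R"
    using GL_det_unit[OF assms(3)] det_perp[OF assms(1,2)] by simp
  show "A \<in> carrier (GL n R)"
    using GL_iff_det[OF assms(1)] unit_factor[OF u] d by simp
  have "mat_det R B \<otimes> mat_det R A \<in> Units R" using u d by (simp add: m_comm)
  from unit_factor[OF this] show "B \<in> carrier (GL m R)"
    using GL_iff_det[OF assms(2)] d by simp
qed

subsection \<open>Isometries\<close>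

lemma isometric_iff: "isometric R Q Q' \<longleftrightarrow> dim_row Q = dim_row Q' \<and>
    (\<exists>C\<in>carrier (GL (dim_row Q') R). pullback R Q' C = Q)"
  by (auto simp: isometric_def pullback_def)

lemma isometricI: "C \<in> carrier (GL n R) ==> Q' \<in> rmat R n n ==> pullback R Q' C = Q ==> isometric R Q Q'"
  unfolding isometric_iff by (auto simp: rmat_dims dest: GL_rmat)

lemma isometricE:
  assumes "isometric R Q Q'" "Q' \<in> rmat R n n"
  obtains C where "C \<in> carrier (GL n R)" "pullback R Q' C = Q" "Q \<in> rmat R n n"
  using assms rmat_pullback[OF assms(2) GL_rmat] unfolding isometric_iff by (auto simp: rmat_dims)

lemma isometric_dim: "isometric R Q Q' ==> dim_row Q = dim_row Q'"
  by (simp add: isometric_iff)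

lemma isometric_refl: "Q \<in> rmat R n n ==> isometric R Q Q"
  by (rule isometricI[OF GL_one _ pullback_one])

lemma isometric_sym:
  assumes "isometric R Q Q'" "Q' \<in> rmat R n n"
  shows "isometric R Q' Q"
proof -
  from assms obtain C where C: "C \<in> carrier (GL n R)" "pullback R Q' C = Q" "Q \<in> rmat R n n"
    by (rule isometricE)
  from C(1) obtain B where B: "B \<in> carrier (GL n R)" "C \<star> B = one_m R n" by (rule GL_inverse)
  show ?thesis
    by (rule isometricI[OF B(1) C(3) pullback_inverse[OF assms(2) GL_rmat[OF C(1)] GL_rmat[OF B(1)] B(2) C(2)]])
qed

lemma isometric_trans:
  assumes "isometric R Q Q'" "isometric R Q' Q''" "Q'' \<in> rmat R n n"
  shows "isometric R Q Q''"
proof -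
  from assms(2,3) obtain C where C: "C \<in> carrier (GL n R)" "pullback R Q'' C = Q'" "Q' \<in> rmat R n n"
    by (rule isometricE)
  from assms(1) C(3) obtain D where D: "D \<in> carrier (GL n R)" "pullback R Q' D = Q"
    by (rule isometricE)
  show ?thesis
    by (rule isometricI[OF GL_mult[OF C(1) D(1)] assms(3)])
      (use pullback_pullback[OF assms(3) GL_rmat[OF C(1)] GL_rmat[OF D(1)]] C D in simp)
qed

lemma isometric_perp:
  assumes "isometric R Q1 Q1'" "isometric R Q2 Q2'" "Q1' \<in> rmat R n n" "Q2' \<in> rmat R m m"
  shows "isometric R (Q1 \<bottom> Q2) (Q1' \<bottom> Q2')"
proof -
  from assms(1,3) obtain C where C: "C \<in> carrier (GL n R)" "pullback R Q1' C = Q1" by (rule isometricE)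
  from assms(2,4) obtain D where D: "D \<in> carrier (GL m R)" "pullback R Q2' D = Q2" by (rule isometricE)
  show ?thesis
    by (rule isometricI[OF GL_perp[OF C(1) D(1)] rmat_perp[OF assms(3,4)]])
      (simp add: pullback_perp[OF assms(3) GL_rmat[OF C(1)] assms(4) GL_rmat[OF D(1)]] C D)
qed

lemma isometric_perp_comm:
  assumes "Q1 \<in> rmat R n n" "Q2 \<in> rmat R m m"
  shows "isometric R (Q1 \<bottom> Q2) (Q2 \<bottom> Q1)"
proof -
  \<comment> \<open>The permutation matrix that interchanges the two blocks; its transpose is its
    inverse.\<close>
  define C where "C = four_block_mat (zero_m R m n) (one_m R m) (one_m R n) (zero_m R n m)"
  have trC: "transpose_mat C = four_block_mat (zero_m R n m) (one_m R n) (one_m R m) (zero_m R m n)"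
    unfolding C_def by (intro eq_matI) (auto simp: zero_m_def one_m_def)
  have C: "C \<in> rmat R (m + n) (m + n)" "transpose_mat C \<in> rmat R (m + n) (m + n)"
    using rmat_four_block[OF rmat_zero rmat_one rmat_one rmat_zero, of m n] unfolding C_def
    by (simp_all add: add.commute rmat_transpose)
  have dims: "dim_row Q1 = n" "dim_col Q1 = n" "dim_row Q2 = m" "dim_col Q2 = m"
    using assms rmat_dims by auto
  note simps = mat_one_left[OF R] mat_one_right[OF R] mat_zero_left[OF R] mat_zero_right[OF R] mat_add_zero_right[OF R] mat_add_zero_left[OF R]
  have "transpose_mat C \<star> C = one_m R n \<bottom> one_m R m"
    unfolding trC unfolding C_def perp_def
    by (subst mat_prod_four_block[OF R rmat_zero rmat_one rmat_one rmat_zero rmat_zero rmat_one rmat_one rmat_zero])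
      (simp add: simps[OF rmat_zero] simps[OF rmat_one])
  then have 1: "transpose_mat C \<star> C = one_m R (m + n)" by (simp add: perp_one add.commute)
  have "C \<star> transpose_mat C = one_m R m \<bottom> one_m R n"
    unfolding trC unfolding C_def perp_def
    by (subst mat_prod_four_block[OF R rmat_zero rmat_one rmat_one rmat_zero rmat_zero rmat_one rmat_one rmat_zero])
      (simp add: simps[OF rmat_zero] simps[OF rmat_one])
  then have 2: "C \<star> transpose_mat C = one_m R (m + n)" by (simp add: perp_one add.commute)
  have "transpose_mat C \<star> (Q2 \<bottom> Q1) = four_block_mat (zero_m R n m) Q1 Q2 (zero_m R m n)"
    unfolding trC perp_def dims
    by (subst mat_prod_four_block[OF R rmat_zero rmat_one rmat_one rmat_zero assms(2) rmat_zero rmat_zero assms(1)])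
      (simp add: simps[OF rmat_zero] simps[OF rmat_one] simps[OF assms(1)] simps[OF assms(2)])
  then have 3: "pullback R (Q2 \<bottom> Q1) C = Q1 \<bottom> Q2"
    unfolding pullback_def unfolding C_def perp_def dims
    by (subst mat_prod_four_block[OF R rmat_zero assms(1) assms(2) rmat_zero rmat_zero rmat_one rmat_one rmat_zero] |
        simp add: simps[OF rmat_zero] simps[OF rmat_one] simps[OF assms(1)] simps[OF assms(2)])+
  have "C \<in> carrier (GL (m + n) R)"
    unfolding GL_iff using C 1 2 by blast
  then show ?thesis
    by (rule isometricI[OF _ rmat_perp[OF assms(2,1)] 3])
qed

end

declare One_nat_def [simp del]

lemma lessThan_1_eq: "{..<1::nat} = {0}"
  by auto

subsection \<open>Symmetric and regular forms\<close>

definition symm :: "('a, 'm) ring_scheme => nat => 'a mat set" where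
  "symm R n = {Q \<in> rmat R n n. transpose_mat Q = Q}"

definition reg :: "('a, 'm) ring_scheme => nat => 'a mat set" where
  "reg R n = {Q \<in> carrier (GL n R). transpose_mat Q = Q}"

lemma quad_form_iff: "quad_form R Q \<longleftrightarrow> Q \<in> symm R (dim_row Q)"
  unfolding quad_form_def symm_def rmat_def carrier_mat_def by blast

lemma reg_symm: "Q \<in> reg R n ==> Q \<in> symm R n"
  by (auto simp: reg_def symm_def GL_iff)

lemma symm_rmat: "Q \<in> symm R n ==> Q \<in> rmat R n n"
  by (auto simp: symm_def)

lemma reg_rmat: "Q \<in> reg R n ==> Q \<in> rmat R n n"
  by (auto simp: reg_def GL_iff)

lemma reg_GL: "Q \<in> reg R n ==> Q \<in> carrier (GL n R)"
  by (auto simp: reg_def)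

lemma reg_dim: "Q \<in> reg R n ==> dim_row Q = n"
  using reg_rmat rmat_dims by blast

lemma regular_iff: "Q \<in> regular_forms R \<longleftrightarrow> Q \<in> reg R (dim_row Q)"
  by (auto simp: regular_forms_def quad_form_iff reg_def symm_def GL_iff)

lemma reg_regular: "Q \<in> reg R n ==> Q \<in> regular_forms R"
  unfolding regular_iff by (simp add: reg_dim)

lemma transpose_map_mat: "transpose_mat (map_mat f M) = map_mat f (transpose_mat M)"
  by (intro eq_matI) auto

context
  fixes R :: "'a ring" (structure)
  assumes R: "cring R"
begin

interpretation cring R by (rule R)

lemma symm_perp: "A \<in> symm R n ==> B \<in> symm R m ==> A \<bottom> B \<in> symm R (n + m)"
  by (auto simp: symm_def transpose_perp[OF R] intro!: rmat_perp[OF R])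

lemma reg_perp: "A \<in> reg R n ==> B \<in> reg R m ==> A \<bottom> B \<in> reg R (n + m)"
  by (auto simp: reg_def transpose_perp[OF R] intro!: GL_perp[OF R])

lemma symm_pullback: "Q \<in> symm R n ==> C \<in> rmat R n m ==> pullback R Q C \<in> symm R m"
  by (auto simp: symm_def transpose_pullback[OF R] intro!: rmat_pullback[OF R])

lemma reg_pullback: "Q \<in> reg R n ==> C \<in> carrier (GL n R) ==> pullback R Q C \<in> reg R n"
  using symm_pullback[OF reg_symm GL_rmat] GL_pullback[OF R reg_GL] by (auto simp: reg_def symm_def)

lemma isometric_reg: "isometric R Q Q' ==> Q' \<in> reg R n ==> Q \<in> reg R n"
  by (metis isometricE[OF R] reg_pullback reg_rmat)

lemma rmat_diag_form: "set cs \<subseteq> carrier R ==> diag_form R cs \<in> rmat R (length cs) (length cs)"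
  by (auto simp: rmat_iff diag_form_def)

lemma diag_form_Cons: "diag_form R (c # cs) = diag_form R [c] \<bottom> diag_form R cs"
  by (intro eq_matI) (auto simp: perp_def diag_form_def zero_m_def nth_Cons' less_Suc_eq_0_disj)

lemma det_diag1: "c \<in> carrier R ==> mat_det R (diag_form R [c]) = c"
proof -
  assume "c \<in> carrier R"
  moreover have "diag_form R [c] = mat 1 1 (\<lambda>_. c)" by (intro eq_matI) (auto simp: diag_form_def)
  ultimately show ?thesis using mat_det_1x1[OF R, of c] by simp
qed

lemma reg_diag1: "c \<in> Units R ==> diag_form R [c] \<in> reg R 1"
proof -
  assume c: "c \<in> Units R"
  then have m: "diag_form R [c] \<in> rmat R 1 1" using rmat_diag_form[of "[c]"] by (simp add: Units_closed One_nat_def)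
  have "transpose_mat (diag_form R [c]) = diag_form R [c]" by (intro eq_matI) (auto simp: diag_form_def)
  then show ?thesis using GL_iff_det[OF R m] c m det_diag1[of c] by (simp add: reg_def Units_closed)
qed

lemma one_m_0: "diag_form R [] = one_m R 0"
  by (intro eq_matI) (auto simp: diag_form_def)

lemma reg_Nil: "diag_form R [] \<in> reg R 0"
  using GL_one[OF R, of 0] transpose_one_m[OF R, of 0] by (simp add: reg_def one_m_0)

lemma uminus_one_Unit: "\<ominus> \<one> \<in> Units R"
  unfolding Units_def by (auto intro!: bexI[of _ "\<ominus> \<one>"] simp: l_minus)

lemma reg_hyperbolic_plane: "hyperbolic_plane R \<in> reg R 2"
  unfolding hyperbolic_plane_def diag_form_Cons[of _ "[_]"]
  using reg_perp[OF reg_diag1[OF Units_one_closed] reg_diag1[OF uminus_one_Unit]] by simp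

lemma hyperbolic_space_0 [simp]: "hyperbolic_space R 0 = diag_form R []"
  by (simp add: hyperbolic_space_def)

lemma hyperbolic_space_Suc: "hyperbolic_space R (Suc n) = hyperbolic_plane R \<bottom> hyperbolic_space R n"
  by (simp add: hyperbolic_space_def)

lemma reg_hyperbolic_space: "hyperbolic_space R n \<in> reg R (2 * n)"
  by (induction n) (use reg_Nil reg_perp[OF reg_hyperbolic_plane] in \<open>auto simp: hyperbolic_space_Suc\<close>)

lemma hyperbolic_space_add: "hyperbolic_space R (m + n) = hyperbolic_space R m \<bottom> hyperbolic_space R n"
  by (induction m) (auto simp: hyperbolic_space_Suc perp_Nil_left[OF R] perp_assoc[OF R])

lemma reg_oppos:
  assumes "Q \<in> reg R n" shows "oppos R Q \<in> reg R n"
proof -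
  have Q: "Q \<in> rmat R n n" using assms by (rule reg_rmat)
  have eq: "oppos R Q = smult_m R (\<ominus> \<one>) Q"
    using Q by (intro eq_matI) (auto simp: oppos_def smult_m_def l_minus rmat_iff)
  obtain B where B: "B \<in> rmat R n n" "B \<star> Q = one_m R n" "Q \<star> B = one_m R n"
    using reg_GL[OF assms] unfolding GL_iff by blast
  have "smult_m R (\<ominus> \<one>) (smult_m R (\<ominus> \<one>) (one_m R n)) = one_m R n"
    by (rule smult_one_m[OF R]) (auto simp: l_minus)
  then have "oppos R Q \<in> carrier (GL n R)"
    unfolding GL_iff eq using B Q
    by (auto intro!: rmat_smult bexI[of _ "smult_m R (\<ominus> \<one>) B"]
      simp: mat_smult_left[OF R, where n=n and m=n and k=n] mat_smult_right[OF R, where n=n and m=n and k=n] rmat_smult)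
  then show ?thesis
    using assms by (auto simp: reg_def oppos_def transpose_map_mat)
qed

end

subsection \<open>Base change\<close>

context
  fixes R :: "'a ring" (structure) and S :: "'b ring" and h
  assumes R: "cring R" and S: "cring S" and h: "h \<in> Ring.ring_hom R S"
begin

interpretation ring_hom_cring R S h
  by (intro hom_cringI R S h)

lemma rmat_map: "A \<in> rmat R n m ==> map_mat h A \<in> rmat S n m"
  by (auto simp: rmat_iff)

lemma map_mat_prod:
  assumes "A \<in> rmat R n m" "B \<in> rmat R m k"
  shows "map_mat h (A \<star> B) = map_mat h A \<star>\<^bsub>S\<^esub> map_mat h B"
proof (intro eq_matI)
  fix i j assume ij: "i < dim_row (map_mat h A \<star>\<^bsub>S\<^esub> map_mat h B)" "j < dim_col (map_mat h A \<star>\<^bsub>S\<^esub> map_mat h B)"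
  have "h (\<Oplus>k\<in>{..<m}. A $$ (i, k) \<otimes> B $$ (k, j)) =
      (\<Oplus>\<^bsub>S\<^esub>k\<in>{..<m}. map_mat h A $$ (i, k) \<otimes>\<^bsub>S\<^esub> map_mat h B $$ (k, j))"
    using ij assms by (subst hom_finsum) (auto simp: rmat_iff intro!: S.finsum_cong')
  then show "map_mat h (A \<star> B) $$ (i, j) = (map_mat h A \<star>\<^bsub>S\<^esub> map_mat h B) $$ (i, j)"
    using ij assms by (auto simp: mat_prod_def rmat_iff)
qed auto

lemma map_one_m: "map_mat h (one_m R n) = one_m S n"
  by (intro eq_matI) (auto simp: one_m_def)

lemma map_zero_m: "map_mat h (zero_m R n m) = zero_m S n m"
  by (intro eq_matI) (auto simp: zero_m_def)

lemma map_GL: "A \<in> carrier (GL n R) ==> map_mat h A \<in> carrier (GL n S)"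
  unfolding GL_iff using map_mat_prod map_one_m rmat_map by metis

lemma map_mat_det:
  assumes "A \<in> rmat R n n"
  shows "h (mat_det R A) = mat_det S (map_mat h A)"
proof -
  have dims: "dim_row A = n" "dim_row (map_mat h A) = n" using assms by (auto simp: rmat_iff)
  have pr: "(\<Otimes>i\<in>{..<n}. A $$ (i, p i)) \<in> carrier R"
    "h (\<Otimes>i\<in>{..<n}. A $$ (i, p i)) = (\<Otimes>\<^bsub>S\<^esub>i\<in>{..<n}. map_mat h A $$ (i, p i))"
    "(\<Otimes>\<^bsub>S\<^esub>i\<in>{..<n}. map_mat h A $$ (i, p i)) \<in> carrier S"
    if "p permutes {..<n}" for p
  proof -
    have p: "i < n ==> p i < n" for i using permutes_in_image[OF that, of i] by auto
    show "(\<Otimes>i\<in>{..<n}. A $$ (i, p i)) \<in> carrier R"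
      using assms p by (intro R.finprod_closed) (auto simp: rmat_iff)
    show "h (\<Otimes>i\<in>{..<n}. A $$ (i, p i)) = (\<Otimes>\<^bsub>S\<^esub>i\<in>{..<n}. map_mat h A $$ (i, p i))"
      using assms p by (subst hom_finprod) (auto simp: rmat_iff intro!: S.finprod_cong')
    show "(\<Otimes>\<^bsub>S\<^esub>i\<in>{..<n}. map_mat h A $$ (i, p i)) \<in> carrier S"
      using rmat_map[OF assms] p by (intro S.finprod_closed) (auto simp: rmat_iff)
  qed
  have "h (mat_det R A) = finsum S (h \<circ> (\<lambda>p. (if evenperm p then \<one> else \<ominus> \<one>) \<otimes>
      (\<Otimes>i\<in>{..<n}. A $$ (i, p i)))) {p. p permutes {..<n}}"
    unfolding mat_det_def dims by (subst hom_finsum) (auto simp: pr)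
  also have "\<dots> = mat_det S (map_mat h A)"
    unfolding mat_det_def dims by (intro S.finsum_cong') (auto simp: pr)
  finally show ?thesis .
qed

lemma map_pullback:
  assumes "Q \<in> rmat R n n" "C \<in> rmat R n m"
  shows "map_mat h (pullback R Q C) = pullback S (map_mat h Q) (map_mat h C)"
  unfolding pullback_def map_mat_prod[OF R.rmat_prod[OF rmat_transpose[OF assms(2)] assms(1)] assms(2)]
    map_mat_prod[OF rmat_transpose[OF assms(2)] assms(1)] transpose_map_mat ..

lemma map_perp: "map_mat h (A \<bottom> B) = map_mat h A \<bottom>\<^bsub>S\<^esub> map_mat h B"
  by (intro eq_matI) (auto simp: perp_index)

lemma map_diag_form: "map_mat h (diag_form R cs) = diag_form S (map h cs)"
  by (intro eq_matI) (auto simp: diag_form_def)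

lemma map_hyperbolic_space: "map_mat h (hyperbolic_space R n) = hyperbolic_space S n"
  by (induction n) (auto simp: hyperbolic_space_0[OF R] hyperbolic_space_0[OF S]
    hyperbolic_space_Suc[OF R] hyperbolic_space_Suc[OF S] map_perp map_diag_form hyperbolic_plane_def)

lemma map_oppos: "Q \<in> rmat R n n ==> map_mat h (oppos R Q) = oppos S (map_mat h Q)"
  by (intro eq_matI) (auto simp: oppos_def rmat_iff)

lemma reg_map: "Q \<in> reg R n ==> map_mat h Q \<in> reg S n"
  by (auto simp: reg_def transpose_map_mat intro!: map_GL)

lemma isometric_map:
  assumes "isometric R Q Q'" "Q' \<in> rmat R n n"
  shows "isometric S (map_mat h Q) (map_mat h Q')"
proof -
  from isometricE[OF R assms] obtain C where C: "C \<in> carrier (GL n R)" "pullback R Q' C = Q" .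
  show ?thesis
    by (rule isometricI[OF S map_GL[OF C(1)] rmat_map[OF assms(2)]])
      (simp add: map_pullback[OF assms(2) GL_rmat[OF C(1)], symmetric] C(2))
qed

end

section \<open>Splitting off vectors and hyperbolic planes; cancellation\<close>

section \<open>Quadratic forms over a field of characteristic not two\<close>

locale form_field = field R for R :: "'a ring" (structure) +
  assumes two: "\<one> \<oplus> \<one> \<noteq> \<zero>"
begin

lemma R: "cring R" by (rule is_cring)

abbreviation sc :: "'a => 'a mat" where "sc c \<equiv> diag_form R [c]"

text \<open>Vectors are one-column matrices throughout, so that base change, gluing and descent of
  matrices apply to them unchanged.\<close>

definition bil :: "'a mat => 'a mat => 'a mat => 'a" where
  "bil Q x y = (transpose_mat x \<star> Q \<star> y) $$ (0, 0)"

text \<open>Vertical stacking, encoded with empty right-hand blocks so that the rules for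
  \<open>four_block_mat\<close> can be used.\<close>

definition colv :: "'a mat => 'a mat => 'a mat" where
  "colv a b = four_block_mat a (zero_m R (dim_row a) 0) b (zero_m R (dim_row b) 0)"

definition e0 :: "nat => 'a mat" where
  "e0 m = colv (one_m R 1) (zero_m R m 1)"

lemma rmat_sc: "c \<in> carrier R ==> sc c \<in> rmat R 1 1"
  using rmat_diag_form[OF R, of "[c]"] by (simp add: One_nat_def)

lemma sc_index [simp]: "sc c $$ (0, 0) = c"
  by (simp add: diag_form_def)

lemma sc_eq_iff [simp]: "sc c = sc d \<longleftrightarrow> c = d"
  by (metis sc_index)

lemma rmat11_sc: "A \<in> rmat R 1 1 ==> A = sc (A $$ (0, 0))"
  by (intro eq_matI) (auto simp: rmat_iff diag_form_def)

lemma sc_one: "sc \<one> = one_m R 1" and sc_zero: "sc \<zero> = zero_m R 1 1"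
  by (intro eq_matI; auto simp: diag_form_def one_m_def zero_m_def)+

lemma sc_mult_left: "c \<in> carrier R ==> W \<in> rmat R 1 m ==> sc c \<star> W = smult_m R c W"
  by (intro eq_matI) (auto simp: mat_prod_def smult_m_def rmat_iff diag_form_def lessThan_1_eq lessThan_Suc)

lemma sc_mult_right: "c \<in> carrier R ==> W \<in> rmat R m 1 ==> W \<star> sc c = smult_m R c W"
  by (intro eq_matI) (auto simp: mat_prod_def smult_m_def rmat_iff diag_form_def lessThan_1_eq lessThan_Suc m_comm)

lemma sc_mult: "c \<in> carrier R ==> d \<in> carrier R ==> sc c \<star> sc d = sc (c \<otimes> d)"
  by (intro eq_matI) (auto simp: mat_prod_def diag_form_def lessThan_1_eq lessThan_Suc)

lemma rmat_colv: "a \<in> rmat R n k ==> b \<in> rmat R m k ==> colv a b \<in> rmat R (n + m) k"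
  using rmat_four_block[of a R n k _ 0 b m, OF _ rmat_zero _ rmat_zero]
  by (simp add: colv_def rmat_dims)

lemma colv_split:
  assumes "u \<in> rmat R (n + m) k"
  obtains a b where "a \<in> rmat R n k" "b \<in> rmat R m k" "u = colv a b"
proof -
  from assms have "u \<in> rmat R (n + m) (k + 0)" by simp
  then obtain A1 A2 A3 A4 where A: "A1 \<in> rmat R n k" "A2 \<in> rmat R n 0" "A3 \<in> rmat R m k"
    "A4 \<in> rmat R m 0" "u = four_block_mat A1 A2 A3 A4"
    by (rule rmat_blocks)
  have "A2 = zero_m R n 0" "A4 = zero_m R m 0"
    using A by (auto intro!: eq_matI simp: rmat_iff)
  then show ?thesis
    using A by (intro that[of A1 A3]) (auto simp: colv_def rmat_dims)
qed

lemma colv_inject: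
  assumes "a \<in> rmat R n k" "b \<in> rmat R m k" "a' \<in> rmat R n k" "b' \<in> rmat R m k" "colv a b = colv a' b'"
  shows "a = a' \<and> b = b'"
  using four_block_inject[OF assms(1) rmat_zero assms(2) rmat_zero assms(3) rmat_zero assms(4) rmat_zero] assms
  by (simp add: colv_def rmat_dims)

lemma block_colv:
  assumes "A \<in> rmat R n1 m1" "B \<in> rmat R n1 m2" "C \<in> rmat R n2 m1" "D \<in> rmat R n2 m2"
    "a \<in> rmat R m1 k" "b \<in> rmat R m2 k"
  shows "four_block_mat A B C D \<star> colv a b =
    colv (add_m R (A \<star> a) (B \<star> b)) (add_m R (C \<star> a) (D \<star> b))"
proof -
  have z: "M = zero_m R n 0" if "M \<in> rmat R n 0" for M n
    using that by (auto intro!: eq_matI simp: rmat_iff)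
  have dims: "dim_row a = m1" "dim_row b = m2" "dim_row A = n1" "dim_row C = n2"
    using assms rmat_dims by auto
  have 1: "add_m R (A \<star> zero_m R m1 0) (B \<star> zero_m R m2 0) = zero_m R n1 0"
    "add_m R (C \<star> zero_m R m1 0) (D \<star> zero_m R m2 0) = zero_m R n2 0"
    by (intro z rmat_add rmat_prod[OF assms(1)] rmat_prod[OF assms(2)] rmat_prod[OF assms(3)] rmat_prod[OF assms(4)] rmat_zero)+
  show ?thesis
    unfolding colv_def dims
    by (subst mat_prod_four_block[OF R assms(1-4) assms(5) rmat_zero assms(6) rmat_zero]) (simp add: 1 dims)
qed

lemmas zero_one_simps = mat_one_left[OF R] mat_one_right[OF R] mat_zero_left[OF R] mat_zero_right[OF R]
  mat_add_zero_right[OF R] mat_add_zero_left[OF R]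

lemma perp_colv:
  assumes "A \<in> rmat R n n'" "B \<in> rmat R m m'" "a \<in> rmat R n' k" "b \<in> rmat R m' k"
  shows "(A \<bottom> B) \<star> colv a b = colv (A \<star> a) (B \<star> b)"
proof -
  have dims: "dim_row A = n" "dim_col A = n'" "dim_row B = m" "dim_col B = m'"
    using assms rmat_dims by auto
  show ?thesis
    unfolding perp_def dims
    by (subst block_colv[OF assms(1) rmat_zero rmat_zero assms(2) assms(3,4)])
      (simp add: zero_one_simps(3)[OF assms(3)] zero_one_simps(3)[OF assms(4)]
        zero_one_simps(5)[OF rmat_prod[OF assms(1,3)]] zero_one_simps(6)[OF rmat_prod[OF assms(2,4)]])
qed

lemma rmat_e0: "e0 m \<in> rmat R (1 + m) 1"
  unfolding e0_def by (rule rmat_colv[OF rmat_one rmat_zero])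

lemma Units_iff: "a \<in> Units R \<longleftrightarrow> a \<in> carrier R \<and> a \<noteq> \<zero>"
  using field_Units by auto

lemma GL_right_inverse:
  assumes "A \<in> rmat R n n" "B \<in> rmat R n n" "A \<star> B = one_m R n"
  shows "A \<in> carrier (GL n R)"
proof -
  have "mat_det R A \<otimes> mat_det R B = \<one>"
    using mat_det_mult[OF R assms(1,2)] assms(3) mat_det_one[OF R] by simp
  then have "mat_det R A \<in> Units R"
    using mat_det_closed[OF R assms(1)] mat_det_closed[OF R assms(2)] unfolding Units_iff
    by (metis l_null one_not_zero)
  then show ?thesis using GL_iff_det[OF R assms(1)] by simp
qed

lemma GL_lower:
  assumes "a \<in> carrier R" "a \<noteq> \<zero>" "w \<in> rmat R m 1"
  shows "four_block_mat (sc a) (zero_m R 1 m) w (one_m R m) \<in> carrier (GL (1 + m) R)"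
proof (rule GL_right_inverse)
  let ?b = "inv a"
  have a: "a \<in> Units R" using assms Units_iff by auto
  then have b: "?b \<in> carrier R" "\<ominus> ?b \<in> carrier R" by auto
  show "four_block_mat (sc a) (zero_m R 1 m) w (one_m R m) \<in> rmat R (1 + m) (1 + m)"
    by (intro rmat_four_block rmat_sc rmat_zero rmat_one assms)
  show "four_block_mat (sc ?b) (zero_m R 1 m) (smult_m R (\<ominus> ?b) w) (one_m R m) \<in> rmat R (1 + m) (1 + m)"
    by (intro rmat_four_block rmat_sc rmat_zero rmat_one assms rmat_smult b)
  have 1: "sc a \<star> sc ?b = one_m R 1"
    using a by (simp add: sc_mult b Units_closed sc_one)
  have 2: "add_m R (smult_m R ?b w) (smult_m R (\<ominus> ?b) w) = zero_m R m 1"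
    using assms(3) b by (intro eq_matI) (auto simp: rmat_iff add_m_def smult_m_def zero_m_def l_minus r_neg)
  have 3: "add_m R (zero_m R 1 m) (zero_m R 1 m) = zero_m R 1 m"
    by (rule zero_one_simps(5)[OF rmat_zero])
  show "four_block_mat (sc a) (zero_m R 1 m) w (one_m R m) \<star>
      four_block_mat (sc ?b) (zero_m R 1 m) (smult_m R (\<ominus> ?b) w) (one_m R m) = one_m R (1 + m)"
    apply (subst mat_prod_four_block[OF R rmat_sc rmat_zero assms(3) rmat_one rmat_sc rmat_zero rmat_smult[OF b(2) assms(3)] rmat_one])
      apply (use assms b in auto)[2]
    using 1 2 3 perp_one[OF R, of 1 m] unfolding perp_def
    by (simp add: zero_one_simps(3)[OF rmat_smult[OF b(2) assms(3)]] zero_one_simps(4)[OF rmat_sc[OF assms(1)]] zero_one_simps(4)[OF assms(3)]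
       zero_one_simps(1)[OF rmat_smult[OF b(2) assms(3)]] zero_one_simps(1)[OF rmat_one] zero_one_simps(3)[OF rmat_one]
       sc_mult_right[OF b(1) assms(3)] zero_one_simps(5)[OF rmat_one] zero_one_simps(6)[OF rmat_one])
qed

lemma GL_upper:
  assumes "w \<in> rmat R 1 m"
  shows "four_block_mat (one_m R 1) w (zero_m R m 1) (one_m R m) \<in> carrier (GL (1 + m) R)"
proof -
  have "transpose_mat (four_block_mat (sc \<one>) (zero_m R 1 m) (transpose_mat w) (one_m R m)) =
      four_block_mat (one_m R 1) w (zero_m R m 1) (one_m R m)"
    using assms by (intro eq_matI) (auto simp: rmat_iff diag_form_def zero_m_def one_m_def One_nat_def)
  then show ?thesis
    using GL_transpose[OF R GL_lower[OF one_closed one_not_zero rmat_transpose[OF assms]]] by simp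
qed

text \<open>With a nonzero first coordinate a lower triangular matrix will do. Otherwise a unipotent
  \<open>E\<close> adds a nonzero coordinate to the first one, and the matrix found for the image of
  \<open>u\<close> is multiplied by the inverse of \<open>E\<close>.\<close>

lemma first_column:
  assumes "u \<in> rmat R (1 + m) 1" "u \<noteq> zero_m R (1 + m) 1"
  obtains C where "C \<in> carrier (GL (1 + m) R)" "C \<star> e0 m = u"
proof -
  have case1: "\<exists>C\<in>carrier (GL (1 + m) R). C \<star> e0 m = colv (sc a) b"
    if "a \<in> carrier R" "a \<noteq> \<zero>" "b \<in> rmat R m 1" for a b
  proof (intro bexI[of _ "four_block_mat (sc a) (zero_m R 1 m) b (one_m R m)"] GL_lower that)
    show "four_block_mat (sc a) (zero_m R 1 m) b (one_m R m) \<star> e0 m = colv (sc a) b"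
      unfolding e0_def
      by (subst block_colv[OF rmat_sc[OF that(1)] rmat_zero that(3) rmat_one rmat_one rmat_zero])
       (simp add: zero_one_simps(2)[OF rmat_sc[OF that(1)]] zero_one_simps(2)[OF that(3)] zero_one_simps(3)[OF rmat_zero] zero_one_simps(4)[OF rmat_one]
         zero_one_simps(5)[OF rmat_sc[OF that(1)]] zero_one_simps(5)[OF that(3)])
  qed
  from assms(1) obtain a b where ab: "a \<in> rmat R 1 1" "b \<in> rmat R m 1" "u = colv a b" by (rule colv_split)
  define \<alpha> where "\<alpha> = a $$ (0, 0)"
  have \<alpha>: "\<alpha> \<in> carrier R" "a = sc \<alpha>" using ab rmat11_sc by (auto simp: \<alpha>_def rmat_iff)
  show ?thesis
  proof (cases "\<alpha> = \<zero>")
    case False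
    then show ?thesis using case1[OF \<alpha>(1) _ ab(2)] that ab \<alpha> by auto
  next
    case True
    have "\<exists>i<m. b $$ (i, 0) \<noteq> \<zero>"
    proof (rule ccontr)
      assume "\<not> ?thesis"
      then have "b = zero_m R m 1" using ab(2) by (intro eq_matI) (auto simp: rmat_iff zero_m_def)
      moreover have "a = zero_m R 1 1" using True \<alpha> sc_zero by simp
      ultimately have "u = zero_m R (1 + m) 1"
        unfolding ab(3) colv_def by (intro eq_matI) (auto simp: zero_m_def)
      then show False using assms by simp
    qed
    then obtain i where i: "i < m" "b $$ (i, 0) \<noteq> \<zero>" by blast
    define w where "w = mat 1 m (\<lambda>(_, j). if j = i then \<one> else \<zero>)"
    have w: "w \<in> rmat R 1 m" by (auto simp: w_def rmat_iff)
    have bi: "b $$ (i, 0) \<in> carrier R" using i ab by (auto simp: rmat_iff)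
    have "(\<Oplus>k\<in>{..<m}. (if k = i then \<one> else \<zero>) \<otimes> b $$ (k, 0)) = (\<Oplus>k\<in>{..<m}. if i = k then b $$ (k, 0) else \<zero>)"
      using ab(2) by (intro finsum_cong') (auto simp: rmat_iff)
    also have "\<dots> = b $$ (i, 0)"
      using ab(2) i by (intro finsum_singleton) (auto simp: rmat_iff)
    finally have wb: "w \<star> b = sc (b $$ (i, 0))"
      using ab(2) i by (intro eq_matI) (auto simp: mat_prod_def w_def rmat_iff diag_form_def cong: finsum_cong)
    define E where "E = four_block_mat (one_m R 1) w (zero_m R m 1) (one_m R m)"
    have E: "E \<in> carrier (GL (1 + m) R)" unfolding E_def by (rule GL_upper[OF w])
    have "E \<star> u = colv (sc (b $$ (i, 0))) b"
      unfolding E_def ab(3)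
      by (subst block_colv[OF rmat_one w rmat_zero rmat_one ab(1,2)])
       (use True \<alpha> sc_zero in \<open>simp add: wb zero_one_simps(4)[OF rmat_one] zero_one_simps(6)[OF rmat_sc[OF bi]]
        zero_one_simps(1)[OF ab(2)] zero_one_simps(3)[OF rmat_zero] zero_one_simps(1)[OF rmat_zero] zero_one_simps(6)[OF ab(2)]\<close>)
    with case1[OF bi i(2) ab(2)] obtain C where C: "C \<in> carrier (GL (1 + m) R)" "C \<star> e0 m = E \<star> u" by auto
    from GL_inverse[OF R E] obtain E' where E': "E' \<in> carrier (GL (1 + m) R)" "E' \<star> E = one_m R (1 + m)" .
    have "E' \<star> C \<star> e0 m = E' \<star> (E \<star> u)"
      using mat_assoc[OF R GL_rmat[OF E'(1)] GL_rmat[OF C(1)] rmat_e0] C by simp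
    also have "\<dots> = u"
      using mat_assoc[OF R GL_rmat[OF E'(1)] GL_rmat[OF E] assms(1)] E'(2) zero_one_simps(1)[OF assms(1)] by simp
    finally show ?thesis using that GL_mult[OF R E'(1) C(1)] by blast
  qed
qed

lemma bil_closed: "Q \<in> rmat R n n ==> x \<in> rmat R n 1 ==> y \<in> rmat R n 1 ==> bil Q x y \<in> carrier R"
  unfolding bil_def by (meson rmat_index rmat_prod rmat_transpose less_numeral_extra(1))

lemma sc_bil: "Q \<in> rmat R n n ==> x \<in> rmat R n 1 ==> y \<in> rmat R n 1 ==>
    transpose_mat x \<star> Q \<star> y = sc (bil Q x y)"
  unfolding bil_def by (intro rmat11_sc rmat_prod[of _ 1 n] rmat_prod rmat_transpose)

lemma pullback_vec: "Q \<in> rmat R n n ==> x \<in> rmat R n 1 ==> pullback R Q x = sc (bil Q x x)"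
  unfolding pullback_def by (rule sc_bil)

lemma transpose_sc: "transpose_mat (sc c) = sc c"
  by (intro eq_matI) (auto simp: diag_form_def)

lemma bil_sym:
  assumes "Q \<in> symm R n" "x \<in> rmat R n 1" "y \<in> rmat R n 1"
  shows "bil Q x y = bil Q y x"
proof -
  have Q: "Q \<in> rmat R n n" "transpose_mat Q = Q" using assms by (auto simp: symm_def)
  note T = rmat_transpose[OF assms(2)] rmat_transpose[OF assms(3)]
  have "transpose_mat (transpose_mat x \<star> Q \<star> y) = transpose_mat y \<star> Q \<star> x"
    using mat_transpose_mult[OF R rmat_prod[OF T(1) Q(1)] assms(3)] mat_transpose_mult[OF R T(1) Q(1)] Q(2)
      mat_assoc[OF R T(2) Q(1) assms(2)] by simp
  then have "sc (bil Q x y) = sc (bil Q y x)"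
    using sc_bil[OF Q(1) assms(2,3)] sc_bil[OF Q(1) assms(3,2)] transpose_sc by metis
  then show ?thesis by simp
qed

lemma bil_add_right:
  assumes "Q \<in> rmat R n n" "x \<in> rmat R n 1" "y \<in> rmat R n 1" "z \<in> rmat R n 1"
  shows "bil Q x (add_m R y z) = bil Q x y \<oplus> bil Q x z"
proof -
  note p = rmat_prod[OF rmat_transpose[OF assms(2)] assms(1)]
  have "dim_row (transpose_mat x \<star> Q \<star> y) = 1" "dim_col (transpose_mat x \<star> Q \<star> y) = 1"
    using assms by (auto simp: rmat_iff)
  then show ?thesis
    unfolding bil_def mat_distrib_left[OF R p assms(3,4)] by (simp add: add_m_def)
qed

lemma bil_smult_right:
  assumes "Q \<in> rmat R n n" "x \<in> rmat R n 1" "y \<in> rmat R n 1" "c \<in> carrier R"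
  shows "bil Q x (smult_m R c y) = c \<otimes> bil Q x y"
proof -
  note p = rmat_prod[OF rmat_transpose[OF assms(2)] assms(1)]
  have "dim_row (transpose_mat x \<star> Q \<star> y) = 1" "dim_col (transpose_mat x \<star> Q \<star> y) = 1"
    using assms by (auto simp: rmat_iff)
  then show ?thesis
    unfolding bil_def mat_smult_right[OF R p assms(3,4)] by (simp add: smult_m_def)
qed

lemma bil_add_left:
  assumes "Q \<in> symm R n" "x \<in> rmat R n 1" "y \<in> rmat R n 1" "z \<in> rmat R n 1"
  shows "bil Q (add_m R y z) x = bil Q y x \<oplus> bil Q z x"
  using bil_add_right[OF symm_rmat[OF assms(1)] assms(2-4)] bil_sym[OF assms(1)] assms rmat_add by metis

lemma bil_smult_left:
  assumes "Q \<in> symm R n" "x \<in> rmat R n 1" "y \<in> rmat R n 1" "c \<in> carrier R"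
  shows "bil Q (smult_m R c y) x = c \<otimes> bil Q y x"
  using bil_smult_right[OF symm_rmat[OF assms(1)] assms(2-4)] bil_sym[OF assms(1)] assms rmat_smult by metis

lemma bil_pullback:
  assumes "Q \<in> rmat R n n" "C \<in> rmat R n m" "x \<in> rmat R m 1" "y \<in> rmat R m 1"
  shows "bil (pullback R Q C) x y = bil Q (C \<star> x) (C \<star> y)"
proof -
  note T = rmat_transpose[OF assms(2)] rmat_transpose[OF assms(3)]
  have "transpose_mat x \<star> (transpose_mat C \<star> Q \<star> C) \<star> y =
      transpose_mat x \<star> (transpose_mat C \<star> Q) \<star> C \<star> y"
    using mat_assoc[OF R T(2) rmat_prod[OF T(1) assms(1)] assms(2)] by simp
  also have "\<dots> = transpose_mat x \<star> (transpose_mat C \<star> Q) \<star> (C \<star> y)"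
    using mat_assoc[OF R rmat_prod[OF T(2) rmat_prod[OF T(1) assms(1)]] assms(2,4)] by simp
  also have "\<dots> = transpose_mat (C \<star> x) \<star> Q \<star> (C \<star> y)"
    using mat_assoc[OF R T(2) T(1) assms(1)] mat_transpose_mult[OF R assms(2,3)] by simp
  finally show ?thesis by (simp add: bil_def pullback_def)
qed

lemma bil_colv:
  assumes "A \<in> rmat R n n" "B \<in> rmat R m m" "a \<in> rmat R n 1" "b \<in> rmat R m 1" "a' \<in> rmat R n 1" "b' \<in> rmat R m 1"
  shows "bil (A \<bottom> B) (colv a b) (colv a' b') = bil A a a' \<oplus> bil B b b'"
proof -
  note c = rmat_colv[OF assms(3,4)]
  have tr: "transpose_mat (colv a b) =
      four_block_mat (transpose_mat a) (transpose_mat b) (zero_m R 0 n) (zero_m R 0 m)"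
    using assms unfolding colv_def by (intro eq_matI) (auto simp: rmat_iff zero_m_def)
  have "transpose_mat (colv a b) \<star> (A \<bottom> B) \<star> colv a' b' =
      transpose_mat (colv a b) \<star> colv (A \<star> a') (B \<star> b')"
    using mat_assoc[OF R rmat_transpose[OF c] rmat_perp[OF R assms(1,2)] rmat_colv[OF assms(5,6)]]
      perp_colv[OF assms(1,2,5,6)] by simp
  also have "\<dots> = colv (add_m R (transpose_mat a \<star> (A \<star> a')) (transpose_mat b \<star> (B \<star> b')))
      (add_m R (zero_m R 0 n \<star> (A \<star> a')) (zero_m R 0 m \<star> (B \<star> b')))"
    unfolding tr by (rule block_colv[OF rmat_transpose[OF assms(3)] rmat_transpose[OF assms(4)] rmat_zero rmat_zero
          rmat_prod[OF assms(1,5)] rmat_prod[OF assms(2,6)]])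
  also have "\<dots> $$ (0, 0) = bil A a a' \<oplus> bil B b b'"
    unfolding mat_assoc[OF R rmat_transpose[OF assms(3)] assms(1,5), symmetric]
      mat_assoc[OF R rmat_transpose[OF assms(4)] assms(2,6), symmetric]
      sc_bil[OF assms(1,3,5)] sc_bil[OF assms(2,4,6)]
    by (simp add: colv_def add_m_def diag_form_def)
  finally show ?thesis by (simp add: bil_def)
qed

lemma bil_sc: "c \<in> carrier R ==> a \<in> carrier R ==> b \<in> carrier R ==> bil (sc c) (sc a) (sc b) = a \<otimes> c \<otimes> b"
  unfolding bil_def transpose_sc by (simp add: sc_mult)

lemma bil_zero_right: "Q \<in> rmat R n n ==> x \<in> rmat R n 1 ==> bil Q x (zero_m R n 1) = \<zero>"
  unfolding bil_def using mat_zero_right[OF R rmat_prod[OF rmat_transpose], of x n 1 Q n 1] by (simp add: zero_m_def)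

end

context form_field
begin

lemma dim_sc [simp]: "dim_row (sc c) = 1" "dim_col (sc c) = 1"
  by (simp_all add: diag_form_def One_nat_def)

text \<open>The entry condition of \<open>rmat\<close> without the sizes. With the sizes left to
  \<open>dim_row\<close> and \<open>dim_col\<close>, the block rules become conditional rewrite
  rules whose side conditions the simplifier can compute.\<close>

definition rm :: "'a mat => bool" where
  "rm A \<longleftrightarrow> elements_mat A \<subseteq> carrier R"

lemma rm_iff: "A \<in> rmat R n m \<longleftrightarrow> rm A \<and> dim_row A = n \<and> dim_col A = m"
  by (auto simp: rmat_def rm_def)

lemma rm_closed:
  "rm (one_m R n)" "rm (zero_m R n m)" "c \<in> carrier R ==> rm (sc c)"
  "rm A ==> rm B ==> dim_col A = dim_row B ==> rm (A \<star> B)"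
  "rm A ==> rm B ==> dim_row A = dim_row B ==> dim_col A = dim_col B ==> rm (add_m R A B)"
  "rm A ==> c \<in> carrier R ==> rm (smult_m R c A)"
  "rm A ==> rm (transpose_mat A)"
  subgoal using rmat_one[of n] by (simp add: rm_iff)
  subgoal using rmat_zero[of n m] by (simp add: rm_iff)
  subgoal using rmat_sc[of c] by (simp add: rm_iff)
  subgoal using rmat_prod[of A "dim_row A" "dim_col A" B "dim_col B"] by (simp add: rm_iff)
  subgoal using rmat_add[of A "dim_row A" "dim_col A" B] by (simp add: rm_iff)
  subgoal using rmat_smult[of c A "dim_row A" "dim_col A"] by (simp add: rm_iff)
  subgoal using rmat_transpose[of A R "dim_row A" "dim_col A"] by (simp add: rm_iff)
  done

lemma block_laws:
  "rm A ==> n = dim_row A ==> one_m R n \<star> A = A"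
  "rm A ==> n = dim_col A ==> A \<star> one_m R n = A"
  "rm A ==> n = dim_row A ==> zero_m R k n \<star> A = zero_m R k (dim_col A)"
  "rm A ==> n = dim_col A ==> A \<star> zero_m R n k = zero_m R (dim_row A) k"
  "rm A ==> n = dim_row A ==> m = dim_col A ==> add_m R A (zero_m R n m) = A"
  "rm A ==> n = dim_row A ==> m = dim_col A ==> add_m R (zero_m R n m) A = A"
  using zero_one_simps by (metis rm_iff)+

lemma block_prod:
  assumes "rm A1" "rm B1" "rm C1" "rm D1" "rm A2" "rm B2" "rm C2" "rm D2"
    "dim_row B1 = dim_row A1" "dim_col C1 = dim_col A1" "dim_row D1 = dim_row C1" "dim_col D1 = dim_col B1"
    "dim_row B2 = dim_row A2" "dim_col C2 = dim_col A2" "dim_row D2 = dim_row C2" "dim_col D2 = dim_col B2"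
    "dim_row A2 = dim_col A1" "dim_row C2 = dim_col B1"
  shows "four_block_mat A1 B1 C1 D1 \<star> four_block_mat A2 B2 C2 D2 =
    four_block_mat (add_m R (A1 \<star> A2) (B1 \<star> C2)) (add_m R (A1 \<star> B2) (B1 \<star> D2))
      (add_m R (C1 \<star> A2) (D1 \<star> C2)) (add_m R (C1 \<star> B2) (D1 \<star> D2))"
  using assms by (intro mat_prod_four_block[OF R]) (auto simp: rm_iff)

lemma block_colv':
  assumes "rm A" "rm B" "rm C" "rm D" "rm a" "rm b"
    "dim_row B = dim_row A" "dim_col C = dim_col A" "dim_row D = dim_row C" "dim_col D = dim_col B"
    "dim_row a = dim_col A" "dim_row b = dim_col B" "dim_col a = dim_col b"
  shows "four_block_mat A B C D \<star> colv a b =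
    colv (add_m R (A \<star> a) (B \<star> b)) (add_m R (C \<star> a) (D \<star> b))"
  using assms by (intro block_colv) (auto simp: rm_iff)

lemmas block_simps = rm_closed block_laws block_prod block_colv'

lemma transpose_colv:
  "dim_col b = dim_col a ==> transpose_mat (colv a b) =
    four_block_mat (transpose_mat a) (transpose_mat b) (zero_m R 0 (dim_row a)) (zero_m R 0 (dim_row b))"
  unfolding colv_def by (intro eq_matI) (auto simp: zero_m_def)

lemma transpose_zero_m: "transpose_mat (zero_m R n m) = zero_m R m n"
  by (intro eq_matI) (auto simp: zero_m_def)

lemma bil_block_e0:
  assumes "A \<in> rmat R 1 1" "w \<in> rmat R 1 m" "v \<in> rmat R m 1" "D \<in> rmat R m m"
  shows "bil (four_block_mat A w v D) (e0 m) (e0 m) = A $$ (0, 0)"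
proof -
  have M: "four_block_mat A w v D \<in> rmat R (1 + m) (1 + m)"
    by (rule rmat_four_block[OF assms])
  have "transpose_mat (e0 m) \<star> four_block_mat A w v D \<star> e0 m =
      transpose_mat (e0 m) \<star> (four_block_mat A w v D \<star> e0 m)"
    by (rule mat_assoc[OF R rmat_transpose[OF rmat_e0] M rmat_e0])
  also have "four_block_mat A w v D \<star> e0 m = colv A v"
    using assms by (simp add: e0_def rm_iff block_simps)
  also have "transpose_mat (e0 m) \<star> colv A v = colv A (zero_m R 0 1)"
    using assms by (simp add: e0_def rm_iff block_simps transpose_colv transpose_one_m[OF R] transpose_zero_m)
  finally show ?thesis
    using assms by (simp add: bil_def colv_def rmat_iff)
qed

lemma block_e0: "rm w ==> dim_row w = 1 ==> dim_col w = m ==>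
    four_block_mat (one_m R 1) w (zero_m R m 1) (one_m R m) \<star> e0 m = e0 m"
  by (simp add: e0_def block_simps)

text \<open>Orthogonal splitting at an anisotropic vector: \<open>u\<close> is completed to a basis,
  and multiples of \<open>u\<close> are subtracted from the other basis vectors to make them
  orthogonal to it.\<close>

lemma split_vector:
  assumes "Q \<in> symm R (1 + m)" "u \<in> rmat R (1 + m) 1" "bil Q u u = a" "a \<noteq> \<zero>"
  obtains C q where "C \<in> carrier (GL (1 + m) R)" "C \<star> e0 m = u" "q \<in> symm R m"
    "pullback R Q C = sc a \<bottom> q"
proof -
  have Q: "Q \<in> rmat R (1 + m) (1 + m)" using assms by (auto simp: symm_def)
  have a: "a \<in> Units R" "a \<in> carrier R" using bil_closed[OF Q assms(2,2)] assms by (auto simp: Units_iff)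
  have "u \<noteq> zero_m R (1 + m) 1" using bil_zero_right[OF Q assms(2)] assms by auto
  with assms(2) obtain C0 where C0: "C0 \<in> carrier (GL (1 + m) R)" "C0 \<star> e0 m = u" by (rule first_column)
  define M where "M = pullback R Q C0"
  have MS: "M \<in> symm R (1 + m)" unfolding M_def by (rule symm_pullback[OF R assms(1) GL_rmat[OF C0(1)]])
  from symm_rmat[OF this] obtain A w v D where bl: "A \<in> rmat R 1 1" "w \<in> rmat R 1 m" "v \<in> rmat R m 1" "D \<in> rmat R m m"
    "M = four_block_mat A w v D"
    by (rule rmat_blocks)
  have "bil M (e0 m) (e0 m) = a"
    unfolding M_def bil_pullback[OF Q GL_rmat[OF C0(1)] rmat_e0 rmat_e0] C0(2) by (rule assms)
  then have A: "A = sc a"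
    using bil_block_e0[OF bl(1-4)] rmat11_sc[OF bl(1)] unfolding bl(5) by simp
  \<comment> \<open>The column operation with coefficients -w/a clears the rest of the first row of
    the Gram matrix.\<close>
  define W where "W = smult_m R (\<ominus> (inv a)) w"
  define E where "E = four_block_mat (one_m R 1) W (zero_m R m 1) (one_m R m)"
  have W: "W \<in> rmat R 1 m" unfolding W_def by (intro rmat_smult bl) (use a in auto)
  have E: "E \<in> carrier (GL (1 + m) R)" unfolding E_def by (rule GL_upper[OF W])
  have tE: "transpose_mat E = four_block_mat (one_m R 1) (zero_m R 1 m) (transpose_mat W) (one_m R m)"
    using W unfolding E_def
    by (subst transpose_four_block_mat[of _ 1 1 _ m _ m])
      (auto simp: transpose_one_m[OF R] transpose_zero_m rmat_iff)
  have cancel: "add_m R (sc a \<star> W) w = zero_m R 1 m"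
    unfolding sc_mult_left[OF a(2) W] unfolding W_def using bl(2) a
    by (intro eq_matI) (auto simp: add_m_def smult_m_def zero_m_def rmat_iff l_minus r_minus m_assoc[symmetric] l_neg)
  define q where "q = add_m R (v \<star> W) D"
  have q: "q \<in> rmat R m m" unfolding q_def by (intro rmat_add rmat_prod[OF bl(3) W] bl)
  have ME: "M \<star> E = four_block_mat (sc a) (zero_m R 1 m) v q"
    using bl W A cancel a unfolding bl(5) E_def q_def by (simp add: rm_iff block_simps)
  define L where "L = add_m R (transpose_mat W \<star> sc a) v"
  have L: "L \<in> rmat R m 1" unfolding L_def
    by (intro rmat_add rmat_prod[OF rmat_transpose[OF W]] rmat_sc bl a)
  have pb: "pullback R M E = four_block_mat (sc a) (zero_m R 1 m) L q"
  proof -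
    have "pullback R M E = transpose_mat E \<star> (M \<star> E)"
      unfolding pullback_def
      by (rule mat_assoc[OF R rmat_transpose[OF GL_rmat[OF E]] symm_rmat[OF MS] GL_rmat[OF E]])
    also have "\<dots> = four_block_mat (sc a) (zero_m R 1 m) L q"
      using bl W a q unfolding tE ME L_def by (simp add: rm_iff block_simps)
    finally show ?thesis .
  qed
  have S: "pullback R M E \<in> symm R (1 + m)" by (rule symm_pullback[OF R MS GL_rmat[OF E]])
  have sca: "sc a \<in> rmat R 1 1" using a rmat_sc by auto
  \<comment> \<open>\<open>L\<close> is not computed: the matrix is symmetric with upper right block
    zero, so its lower left block vanishes as well.\<close>
  have "four_block_mat (transpose_mat (sc a)) (transpose_mat L) (zero_m R m 1) (transpose_mat q) =
      four_block_mat (sc a) (zero_m R 1 m) L q"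
    using S transpose_four_block_mat[OF rmat_carrier_mat[OF sca] rmat_carrier_mat[OF rmat_zero] rmat_carrier_mat[OF L] rmat_carrier_mat[OF q]]
    unfolding pb symm_def by (simp add: transpose_zero_m)
  then have "transpose_mat L = zero_m R 1 m \<and> zero_m R m 1 = L \<and> transpose_mat q = q"
    using four_block_inject[OF rmat_transpose[OF sca] rmat_transpose[OF L] rmat_zero rmat_transpose[OF q] sca rmat_zero L q]
    by auto
  then have "L = zero_m R m 1" "transpose_mat q = q" by auto
  then have fin: "pullback R M E = sc a \<bottom> q"
    unfolding pb perp_def using q by (simp add: rmat_iff One_nat_def)
  show ?thesis
  proof (rule that[of "C0 \<star> E" q])
    show "C0 \<star> E \<in> carrier (GL (1 + m) R)" by (rule GL_mult[OF R C0(1) E])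
    show "C0 \<star> E \<star> e0 m = u"
      using mat_assoc[OF R GL_rmat[OF C0(1)] GL_rmat[OF E] rmat_e0] block_e0[of W m] W C0
      unfolding E_def by (simp add: rm_iff)
    show "q \<in> symm R m" using q \<open>transpose_mat q = q\<close> by (simp add: symm_def)
    show "pullback R Q (C0 \<star> E) = sc a \<bottom> q"
      using pullback_pullback[OF R Q GL_rmat[OF C0(1)] GL_rmat[OF E]] fin unfolding M_def by simp
  qed
qed

text \<open>By regularity Q x is nonzero, hence the first column of an invertible \<open>C\<close>;
  the first row of the inverse of \<open>C\<close> pairs with it to one.\<close>

lemma dual_vector:
  assumes "Q \<in> reg R n" "x \<in> rmat R n 1" "x \<noteq> zero_m R n 1"
  obtains z where "z \<in> rmat R n 1" "bil Q x z = \<one>"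
proof -
  have Q: "Q \<in> rmat R n n" using assms reg_rmat by auto
  have y: "Q \<star> x \<in> rmat R n 1" by (rule rmat_prod[OF Q assms(2)])
  have ny: "Q \<star> x \<noteq> zero_m R n 1"
    using GL_cancel[OF R reg_GL[OF assms(1)] assms(2) rmat_zero] mat_zero_right[OF R Q] assms(3) by metis
  have "n \<noteq> 0"
  proof
    assume "n = 0"
    then have "x = zero_m R n 1" using assms(2) by (intro eq_matI) (auto simp: rmat_iff)
    then show False using assms by simp
  qed
  then obtain m where n: "n = 1 + m" by (metis add.commute Suc_eq_plus1 not0_implies_Suc)
  from y ny obtain C where C: "C \<in> carrier (GL n R)" "C \<star> e0 m = Q \<star> x"
    unfolding n by (rule first_column)
  from GL_inverse[OF R C(1)] obtain B where B: "B \<in> carrier (GL n R)" "B \<star> C = one_m R n" .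
  define z where "z = transpose_mat B \<star> e0 m"
  have e: "e0 m \<in> rmat R n 1" using rmat_e0 n by simp
  have Bm: "B \<in> rmat R n n" "C \<in> rmat R n n" using B C GL_rmat by auto
  have z: "z \<in> rmat R n 1" unfolding z_def by (intro rmat_prod[OF rmat_transpose[OF Bm(1)] e])
  have "transpose_mat z = transpose_mat (e0 m) \<star> B"
    unfolding z_def mat_transpose_mult[OF R rmat_transpose[OF Bm(1)] e] by simp
  then have "transpose_mat z \<star> Q \<star> x = transpose_mat (e0 m) \<star> B \<star> (C \<star> e0 m)"
    using mat_assoc[OF R rmat_transpose[OF z] Q assms(2)] C by simp
  also have "\<dots> = transpose_mat (e0 m) \<star> (B \<star> C \<star> e0 m)"
    using mat_assoc[OF R rmat_transpose[OF e] Bm(1) rmat_prod[OF Bm(2) e]] mat_assoc[OF R Bm e] by simp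
  also have "\<dots> = transpose_mat (e0 m) \<star> e0 m"
    unfolding B(2) by (simp add: zero_one_simps(1)[OF e])
  also have "\<dots> = colv (one_m R 1) (zero_m R 0 1)"
    by (simp add: e0_def rm_iff block_simps transpose_colv transpose_one_m[OF R] transpose_zero_m)
  finally have "bil Q z x = \<one>" by (simp add: bil_def colv_def one_m_def)
  then show ?thesis using that[OF z] bil_sym[OF reg_symm[OF assms(1)] z assms(2)] by simp
qed

text \<open>The vector (1,1,0,...,0), isotropic for any form <1,-1> + q. It is the normal position
  into which isotropic vectors are brought.\<close>

definition fvec :: "nat => 'a mat" where "fvec m = colv (one_m R 1) (e0 m)"

lemma rmat_fvec: "fvec m \<in> rmat R (2 + m) 1"
  using rmat_colv[OF rmat_one rmat_e0, of m] by (simp add: fvec_def One_nat_def)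

lemma half: obtains t where "t \<in> carrier R" "t \<oplus> t = \<one>"
proof -
  have u: "\<one> \<oplus> \<one> \<in> Units R" using two by (simp add: Units_iff)
  show ?thesis
  proof (rule that[of "inv (\<one> \<oplus> \<one>)"])
    show "inv (\<one> \<oplus> \<one>) \<in> carrier R" using u by simp
    have "(\<one> \<oplus> \<one>) \<otimes> inv (\<one> \<oplus> \<one>) = \<one>" using u by simp
    then show "inv (\<one> \<oplus> \<one>) \<oplus> inv (\<one> \<oplus> \<one>) = \<one>" using u l_distr[OF one_closed one_closed, of "inv (\<one> \<oplus> \<one>)"] by simp
  qed
qed

lemma hyperbolic_plane_eq: "hyperbolic_plane R = sc \<one> \<bottom> sc (\<ominus> \<one>)"
  unfolding hyperbolic_plane_def by (rule diag_form_Cons[OF R])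

lemma uminus_one_neq_zero: "\<ominus> \<one> \<noteq> \<zero>"
  by (metis l_neg minus_zero one_closed one_not_zero minus_minus)

text \<open>A dual vector of \<open>x\<close> is corrected to an isotropic \<open>z\<close> that
  pairs with \<open>x\<close> to one. With t = 1/2, the vectors t x + z and t x - z are orthogonal,
  have values 1 and -1, and sum to \<open>x\<close>; in a basis beginning with them the form is
  <1,-1> + q and \<open>x\<close> has coordinates (1,1,0,...,0).\<close>

lemma split_hyperbolic:
  assumes "Q \<in> reg R n" "x \<in> rmat R n 1" "x \<noteq> zero_m R n 1" "bil Q x x = \<zero>"
  obtains m C q where "n = 2 + m" "C \<in> carrier (GL n R)" "q \<in> reg R m"
    "pullback R Q C = hyperbolic_plane R \<bottom> q" "C \<star> fvec m = x"
proof -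
  have S: "Q \<in> symm R n" and Q: "Q \<in> rmat R n n" using assms reg_symm reg_rmat by auto
  obtain t where t: "t \<in> carrier R" "t \<oplus> t = \<one>" by (rule half)
  from dual_vector[OF assms(1-3)] obtain z0 where z0: "z0 \<in> rmat R n 1" "bil Q x z0 = \<one>" .
  define b where "b = bil Q z0 z0"
  have b: "b \<in> carrier R" unfolding b_def by (rule bil_closed[OF Q z0(1) z0(1)])
  \<comment> \<open>The value of \<open>Q\<close> at z0 + s x is b + 2 s, so s = -b/2 makes
    \<open>z\<close> isotropic.\<close>
  define s where "s = \<ominus> (t \<otimes> b)"
  have s: "s \<in> carrier R" unfolding s_def using t b by simp
  have tb: "t \<otimes> b \<oplus> t \<otimes> b = b" using l_distr[OF t(1) t(1) b] t(2) b by simp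
  have bss: "b \<oplus> s \<oplus> s = \<zero>"
  proof -
    have "s \<oplus> s = \<ominus> b" unfolding s_def using tb t b by (metis m_closed minus_add)
    then show ?thesis using b s by (simp add: a_assoc r_neg)
  qed
  define z where "z = add_m R z0 (smult_m R s x)"
  have sx: "smult_m R s x \<in> rmat R n 1" by (rule rmat_smult[OF s assms(2)])
  have z: "z \<in> rmat R n 1" unfolding z_def by (rule rmat_add[OF z0(1) sx])
  have z0x: "bil Q z0 x = \<one>" using bil_sym[OF S z0(1) assms(2)] z0(2) by simp
  have xz: "bil Q x z = \<one>"
    unfolding z_def bil_add_right[OF Q assms(2) z0(1) sx] bil_smult_right[OF Q assms(2) assms(2) s] assms(4) z0(2)
    using s by simp
  then have zx: "bil Q z x = \<one>" using bil_sym[OF S z assms(2)] by simp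
  have "bil Q z z = bil Q z z0 \<oplus> s \<otimes> bil Q z x"
    unfolding z_def bil_add_right[OF Q z[unfolded z_def] z0(1) sx] bil_smult_right[OF Q z[unfolded z_def] assms(2) s] ..
  also have "bil Q z z0 = b \<oplus> s \<otimes> bil Q x z0"
    unfolding z_def bil_add_left[OF S z0(1) z0(1) sx] bil_smult_left[OF S z0(1) assms(2) s] b_def ..
  finally have zz: "bil Q z z = \<zero>" using zx z0(2) s bss by simp
  define u1 where "u1 = add_m R (smult_m R t x) z"
  define u2 where "u2 = add_m R (smult_m R t x) (smult_m R (\<ominus> \<one>) z)"
  have m1: "\<ominus> \<one> \<in> carrier R" by simp
  have tx: "smult_m R t x \<in> rmat R n 1" and mz: "smult_m R (\<ominus> \<one>) z \<in> rmat R n 1"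
    by (intro rmat_smult t assms z m1)+
  have u: "u1 \<in> rmat R n 1" "u2 \<in> rmat R n 1" unfolding u1_def u2_def by (intro rmat_add tx z mz)+
  have bu: "bil Q u1 x = \<one>" "bil Q u1 z = t" "bil Q u2 x = \<ominus> \<one>" "bil Q u2 z = t"
    unfolding u1_def u2_def
    using t assms(4) by (simp_all add: bil_add_left[OF S assms(2) tx z] bil_add_left[OF S z tx z] bil_add_left[OF S assms(2) tx mz] bil_add_left[OF S z tx mz]
      bil_smult_left[OF S assms(2) assms(2) t(1)] bil_smult_left[OF S z assms(2) t(1)] bil_smult_left[OF S assms(2) z m1] bil_smult_left[OF S z z m1] xz zx zz)
  have r: "bil Q y u1 = t \<otimes> bil Q y x \<oplus> bil Q y z" "bil Q y u2 = t \<otimes> bil Q y x \<oplus> (\<ominus> \<one>) \<otimes> bil Q y z" if "y \<in> rmat R n 1" for y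
    unfolding u1_def u2_def bil_add_right[OF Q that tx z] bil_add_right[OF Q that tx mz]
      bil_smult_right[OF Q that assms(2) t(1)] bil_smult_right[OF Q that z m1] by auto
  have b11: "bil Q u1 u1 = \<one>" using r(1)[OF u(1)] bu t by simp
  have b12: "bil Q u1 u2 = \<zero>" using r(2)[OF u(1)] bu t by (simp add: l_minus r_neg)
  have b22: "bil Q u2 u2 = \<ominus> \<one>"
  proof -
    have "bil Q u2 u2 = \<ominus> t \<oplus> \<ominus> t" using r(2)[OF u(2)] bu t by (simp add: l_minus r_minus)
    also have "\<dots> = \<ominus> \<one>" using t by (metis minus_add)
    finally show ?thesis .
  qed
  have u12: "add_m R u1 u2 = x"
  proof (intro eq_matI)
    fix i j assume "i < dim_row x" "j < dim_col x"
    then have ij: "i < n" "j < 1" and dims: "dim_row x = n" "dim_col x = 1" "dim_row z = n" "dim_col z = 1"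
      using assms(2) z by (auto simp: rmat_iff)
    define \<xi> \<zeta> where "\<xi> = x $$ (i, j)" "\<zeta> = z $$ (i, j)"
    have c: "\<xi> \<in> carrier R" "\<zeta> \<in> carrier R" unfolding \<xi>_\<zeta>_def using rmat_index[OF assms(2) ij] rmat_index[OF z ij] .
    have "add_m R u1 u2 $$ (i, j) = (t \<otimes> \<xi> \<oplus> \<zeta>) \<oplus> (t \<otimes> \<xi> \<oplus> (\<ominus> \<one>) \<otimes> \<zeta>)"
      using ij dims by (simp add: u1_def u2_def add_m_def smult_m_def \<xi>_\<zeta>_def)
    also have "\<dots> = (t \<otimes> \<xi> \<oplus> t \<otimes> \<xi>) \<oplus> (\<zeta> \<oplus> \<ominus> \<zeta>)" using c t by (simp add: l_minus a_ac)
    also have "\<dots> = \<xi>" using c t l_distr[OF t(1) t(1) c(1)] by (simp add: r_neg)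
    finally show "add_m R u1 u2 $$ (i, j) = x $$ (i, j)" by (simp add: \<xi>_\<zeta>_def)
  qed (use assms(2) z in \<open>auto simp: u1_def rmat_iff\<close>)
  have "n \<noteq> 0"
  proof
    assume "n = 0"
    then have "x = zero_m R n 1" using assms(2) by (intro eq_matI) (auto simp: rmat_iff)
    then show False using assms by simp
  qed
  then obtain k where n: "n = 1 + k" by (metis add.commute Suc_eq_plus1 not0_implies_Suc)
  from split_vector[OF S[unfolded n] u(1)[unfolded n] b11 one_not_zero] obtain C1 q1 where
    C1: "C1 \<in> carrier (GL (1 + k) R)" "C1 \<star> e0 k = u1" "q1 \<in> symm R k" "pullback R Q C1 = sc \<one> \<bottom> q1" .
  from GL_inverse[OF R C1(1)] obtain B where B: "B \<in> carrier (GL (1 + k) R)" "C1 \<star> B = one_m R (1 + k)" .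
  have C1m: "C1 \<in> rmat R n n" "B \<in> rmat R n n" using C1 B GL_rmat n by auto
  \<comment> \<open>The coordinates of \<open>u2\<close> in the basis given by \<open>C1\<close>.
    Their first entry \<gamma> vanishes because \<open>u2\<close> is orthogonal to
    \<open>u1\<close>, so the second splitting takes place inside the complement
    \<open>q1\<close>.\<close>
  define y where "y = B \<star> u2"
  have y: "y \<in> rmat R (1 + k) 1" unfolding y_def using rmat_prod[OF C1m(2) u(2)] n by simp
  have Cy: "C1 \<star> y = u2"
    unfolding y_def using mat_assoc[OF R C1m u(2)] B(2) zero_one_simps(1)[OF u(2)] n by simp
  from y obtain c y' where cy: "c \<in> rmat R 1 1" "y' \<in> rmat R k 1" "y = colv c y'" by (rule colv_split)
  define \<gamma> where "\<gamma> = c $$ (0, 0)"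
  have \<gamma>: "c = sc \<gamma>" "\<gamma> \<in> carrier R" using rmat11_sc[OF cy(1)] cy(1) by (auto simp: \<gamma>_def rmat_iff)
  have q1: "q1 \<in> rmat R k k" using C1(3) symm_rmat by auto
  have bp: "bil (sc \<one> \<bottom> q1) v v' = bil Q (C1 \<star> v) (C1 \<star> v')" if "v \<in> rmat R (1 + k) 1" "v' \<in> rmat R (1 + k) 1" for v v'
    using bil_pullback[OF Q C1m(1)] that n C1(4) by simp
  have "bil (sc \<one> \<bottom> q1) (e0 k) y = \<zero>"
    using bp[OF rmat_e0 y] C1(2) Cy b12 by simp
  moreover have "bil (sc \<one> \<bottom> q1) (e0 k) y = \<gamma>"
  proof -
    have "bil (sc \<one> \<bottom> q1) (e0 k) y = bil (sc \<one>) (sc \<one>) (sc \<gamma>) \<oplus> bil q1 (zero_m R k 1) y'"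
      unfolding e0_def cy(3) \<gamma>(1) sc_one[symmetric]
      by (rule bil_colv[OF rmat_sc q1 rmat_sc rmat_zero rmat_sc cy(2)]) (use \<gamma> in auto)
    then show ?thesis
      using \<gamma> bil_sym[OF C1(3) rmat_zero cy(2)] bil_zero_right[OF q1 cy(2)] by (simp add: bil_sc)
  qed
  ultimately have g0: "\<gamma> = \<zero>" by simp
  have bby: "bil q1 y' y' = \<ominus> \<one>"
  proof -
    have "bil (sc \<one> \<bottom> q1) y y = \<ominus> \<one>" using bp[OF y y] Cy b22 by simp
    moreover have "bil (sc \<one> \<bottom> q1) y y = bil (sc \<one>) (sc \<zero>) (sc \<zero>) \<oplus> bil q1 y' y'"
      unfolding cy(3) \<gamma>(1) g0 by (rule bil_colv[OF rmat_sc q1 rmat_sc cy(2) rmat_sc cy(2)]) auto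
    ultimately show ?thesis using bil_closed[OF q1 cy(2) cy(2)] by (simp add: bil_sc)
  qed
  have "k \<noteq> 0"
  proof
    assume "k = 0"
    then have "y' = zero_m R k 1" using cy(2) by (intro eq_matI) (auto simp: rmat_iff)
    then have "bil q1 y' y' = \<zero>" using bil_zero_right[OF q1 cy(2)] by simp
    then show False using bby uminus_one_neq_zero by simp
  qed
  then obtain m where k: "k = 1 + m" by (metis add.commute Suc_eq_plus1 not0_implies_Suc)
  from split_vector[OF C1(3)[unfolded k] cy(2)[unfolded k] bby uminus_one_neq_zero] obtain C2 q where
    C2: "C2 \<in> carrier (GL (1 + m) R)" "C2 \<star> e0 m = y'" "q \<in> symm R m" "pullback R q1 C2 = sc (\<ominus> \<one>) \<bottom> q" .
  have C2m: "C2 \<in> rmat R k k" using C2 GL_rmat k by auto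
  define C where "C = C1 \<star> (one_m R 1 \<bottom> C2)"
  have E: "one_m R 1 \<bottom> C2 \<in> carrier (GL n R)" unfolding n k by (rule GL_perp[OF R GL_one[OF R] C2(1)])
  have C: "C \<in> carrier (GL n R)" unfolding C_def by (rule GL_mult[OF R _ E]) (use C1 n in simp)
  have "pullback R Q C = pullback R (sc \<one> \<bottom> q1) (one_m R 1 \<bottom> C2)"
    unfolding C_def pullback_pullback[OF R Q C1m(1) GL_rmat[OF E], symmetric] C1(4) ..
  also have "\<dots> = sc \<one> \<bottom> (sc (\<ominus> \<one>) \<bottom> q)"
    using pullback_perp[OF R rmat_sc[OF one_closed] rmat_one q1 C2m] pullback_one[OF R rmat_sc[OF one_closed]] C2(4) by simp
  also have "\<dots> = hyperbolic_plane R \<bottom> q"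
    unfolding hyperbolic_plane_eq perp_assoc[OF R] ..
  finally have pb: "pullback R Q C = hyperbolic_plane R \<bottom> q" .
  have "hyperbolic_plane R \<bottom> q \<in> carrier (GL (2 + m) R)"
    using GL_pullback[OF R reg_GL[OF assms(1)] C] pb n k by (simp add: One_nat_def)
  then have "q \<in> carrier (GL m R)"
    by (rule GL_of_perp(2)[OF R reg_rmat[OF reg_hyperbolic_plane[OF R]] symm_rmat[OF C2(3)]])
  then have qreg: "q \<in> reg R m" using C2(3) by (simp add: reg_def symm_def)
  have "C \<star> fvec m = C1 \<star> colv (one_m R 1) y'"
  proof -
    have "(one_m R 1 \<bottom> C2) \<star> fvec m = colv (one_m R 1) y'"
      unfolding fvec_def using perp_colv[OF rmat_one C2m rmat_one rmat_e0[of m, folded k]] C2(2)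
      by (simp add: zero_one_simps(1)[OF rmat_one])
    then show ?thesis
      unfolding C_def using mat_assoc[OF R C1m(1) GL_rmat[OF E], of "fvec m" 1] rmat_fvec[of m] n k by (simp add: One_nat_def)
  qed
  also have "colv (one_m R 1) y' = add_m R (e0 k) y"
    unfolding e0_def cy(3) \<gamma>(1) g0 using cy(2)
    by (intro eq_matI) (auto simp: colv_def add_m_def one_m_def zero_m_def diag_form_def rmat_iff One_nat_def)
  also have "C1 \<star> add_m R (e0 k) y = x"
    using mat_distrib_left[OF R C1m(1), of "e0 k" 1 y] rmat_e0[of k] y n C1(2) Cy u12 by simp
  finally have "C \<star> fvec m = x" .
  then show ?thesis using that[of m C q] C qreg pb n k by (simp add: One_nat_def)
qed

end

context form_field
begin

subsection \<open>Isotropy\<close>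

text \<open>Passage from the double sum over a \<open>vec\<close>, in which isotropy is defined, to
  one-column matrices; the symmetry of \<open>Q\<close> brings the indices into the right
  order.\<close>

lemma quad_value_bil:
  assumes "Q \<in> symm R n" "x \<in> rmat R n 1"
  shows "quad_value R Q (vec n (\<lambda>i. x $$ (i, 0))) = bil Q x x"
proof -
  have Q: "Q \<in> rmat R n n" "transpose_mat Q = Q" using assms by (auto simp: symm_def)
  have dims: "dim_row Q = n" "dim_col Q = n" "dim_row x = n" "dim_col x = 1" using Q(1) assms(2) by (auto simp: rmat_iff)
  have sym: "Q $$ (i, j) = Q $$ (j, i)" if "i < n" "j < n" for i j
    using arg_cong[OF Q(2), of "\<lambda>M. M $$ (i, j)"] that dims by simp
  have Qc: "Q $$ (i, j) \<in> carrier R" if "i < n" "j < n" for i j using Q(1) that by (auto simp: rmat_iff)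
  have xc: "x $$ (i, 0) \<in> carrier R" if "i < n" for i using assms(2) that by (auto simp: rmat_iff)
  have row: "(transpose_mat x \<star> Q) $$ (0, i) = (\<Oplus>j\<in>{..<n}. x $$ (j, 0) \<otimes> Q $$ (j, i))" if "i < n" for i
    using that dims by (auto simp: mat_prod_def Qc xc intro!: finsum_cong')
  have "bil Q x x = (\<Oplus>i\<in>{..<n}. (transpose_mat x \<star> Q) $$ (0, i) \<otimes> x $$ (i, 0))"
    using dims unfolding bil_def by (subst mat_prod_def) simp
  also have "\<dots> = (\<Oplus>i\<in>{..<n}. \<Oplus>j\<in>{..<n}. Q $$ (i, j) \<otimes> x $$ (i, 0) \<otimes> x $$ (j, 0))"
  proof (rule finsum_cong')
    show "(\<lambda>i. \<Oplus>j\<in>{..<n}. Q $$ (i, j) \<otimes> x $$ (i, 0) \<otimes> x $$ (j, 0)) \<in> {..<n} \<rightarrow> carrier R"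
      by (auto intro!: finsum_closed simp: Qc xc)
    fix i assume i: "i \<in> {..<n}"
    have "(transpose_mat x \<star> Q) $$ (0, i) \<otimes> x $$ (i, 0) = (\<Oplus>j\<in>{..<n}. x $$ (j, 0) \<otimes> Q $$ (j, i) \<otimes> x $$ (i, 0))"
      using i by (simp add: row, subst finsum_ldistr) (auto simp: Qc xc)
    also have "\<dots> = (\<Oplus>j\<in>{..<n}. Q $$ (i, j) \<otimes> x $$ (i, 0) \<otimes> x $$ (j, 0))"
      using i by (intro finsum_cong') (auto simp: Qc xc sym[of _ i] m_ac)
    finally show "(transpose_mat x \<star> Q) $$ (0, i) \<otimes> x $$ (i, 0) = \<dots>" .
  qed simp
  also have "\<dots> = quad_value R Q (vec n (\<lambda>i. x $$ (i, 0)))"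
    unfolding quad_value_def dims by (intro finsum_cong') (auto intro!: finsum_closed finsum_cong' simp: Qc xc)
  finally show ?thesis by simp
qed

lemma isotropic_iff:
  assumes "Q \<in> symm R n"
  shows "isotropic R Q \<longleftrightarrow> (\<exists>x\<in>rmat R n 1. x \<noteq> zero_m R n 1 \<and> bil Q x x = \<zero>)"
proof
  have dim: "dim_row Q = n" using symm_rmat[OF assms] by (simp add: rmat_iff)
  assume "isotropic R Q"
  then obtain v where v: "v \<in> carrier_vec n" "set\<^sub>v v \<subseteq> carrier R" "v \<noteq> vec n (\<lambda>_. \<zero>)" "quad_value R Q v = \<zero>"
    unfolding isotropic_def dim by blast
  define x where "x = mat n 1 (\<lambda>(i, _). v $ i)"
  have vx: "v = vec n (\<lambda>i. x $$ (i, 0))" using v(1) by (intro eq_vecI) (auto simp: x_def)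
  have "v $ i \<in> carrier R" if "i < n" for i using v(1,2) that by (auto simp: vec_set_def)
  then have x: "x \<in> rmat R n 1" by (auto simp: x_def rmat_iff)
  moreover have "x \<noteq> zero_m R n 1" using v(3) unfolding vx by (auto simp: zero_m_def intro!: eq_vecI)
  ultimately show "\<exists>x\<in>rmat R n 1. x \<noteq> zero_m R n 1 \<and> bil Q x x = \<zero>"
    using quad_value_bil[OF assms x] v(4) vx by auto
next
  have dim: "dim_row Q = n" using symm_rmat[OF assms] by (simp add: rmat_iff)
  assume "\<exists>x\<in>rmat R n 1. x \<noteq> zero_m R n 1 \<and> bil Q x x = \<zero>"
  then obtain x where x: "x \<in> rmat R n 1" "x \<noteq> zero_m R n 1" "bil Q x x = \<zero>" by blast
  let ?v = "vec n (\<lambda>i. x $$ (i, 0))"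
  have "?v \<noteq> vec n (\<lambda>_. \<zero>)"
  proof
    assume eq: "?v = vec n (\<lambda>_. \<zero>)"
    have "x = zero_m R n 1"
    proof (intro eq_matI)
      fix i j assume "i < dim_row (zero_m R n 1)" "j < dim_col (zero_m R n 1)"
      then show "x $$ (i, j) = zero_m R n 1 $$ (i, j)"
        using arg_cong[OF eq, of "\<lambda>v. v $ i"] by (simp add: zero_m_def)
    qed (use x in \<open>auto simp: rmat_iff\<close>)
    then show False using x by simp
  qed
  moreover have "set\<^sub>v ?v \<subseteq> carrier R" using x(1) by (auto simp: vec_set_def rmat_iff)
  ultimately show "isotropic R Q"
    unfolding isotropic_def dim using quad_value_bil[OF assms x(1)] x(3) by (intro bexI[of _ ?v]) auto
qed

lemma rmat_0_zero: "x \<in> rmat R 0 m ==> x = zero_m R 0 m"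
  by (intro eq_matI) (auto simp: rmat_iff)

lemma not_isotropic_0: "Q \<in> symm R 0 ==> \<not> isotropic R Q"
  using isotropic_iff rmat_0_zero by blast

lemma isotropic_isometric:
  assumes "isometric R Q Q'" "Q' \<in> symm R n" "isotropic R Q"
  shows "isotropic R Q'"
proof -
  from isometricE[OF R assms(1) symm_rmat[OF assms(2)]] obtain C where
    C: "C \<in> carrier (GL n R)" "pullback R Q' C = Q" .
  have Q: "Q \<in> symm R n" using symm_pullback[OF R assms(2) GL_rmat[OF C(1)]] C(2) by simp
  from assms(3) obtain x where x: "x \<in> rmat R n 1" "x \<noteq> zero_m R n 1" "bil Q x x = \<zero>"
    using isotropic_iff[OF Q] by blast
  have "C \<star> x \<noteq> zero_m R n 1"
    using GL_cancel[OF R C(1) x(1) rmat_zero] mat_zero_right[OF R GL_rmat[OF C(1)]] x(2) by metis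
  then show ?thesis
    unfolding isotropic_iff[OF assms(2)]
    using rmat_prod[OF GL_rmat[OF C(1)] x(1)] bil_pullback[OF symm_rmat[OF assms(2)] GL_rmat[OF C(1)] x(1) x(1)] C(2) x(3)
    by (intro bexI[of _ "C \<star> x"]) auto
qed

lemma isotropic_perp:
  assumes "Q \<in> symm R n" "Q' \<in> symm R m" "isotropic R Q"
  shows "isotropic R (Q \<bottom> Q')"
proof -
  from assms(3) obtain x where x: "x \<in> rmat R n 1" "x \<noteq> zero_m R n 1" "bil Q x x = \<zero>"
    using isotropic_iff[OF assms(1)] by blast
  have z: "bil Q' (zero_m R m 1) (zero_m R m 1) = \<zero>"
    by (rule bil_zero_right[OF symm_rmat[OF assms(2)] rmat_zero])
  have zc: "zero_m R (n + m) 1 = colv (zero_m R n 1) (zero_m R m 1)"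
    by (intro eq_matI) (auto simp: colv_def zero_m_def)
  have "colv x (zero_m R m 1) \<noteq> zero_m R (n + m) 1"
    unfolding zc using colv_inject[OF x(1) rmat_zero rmat_zero rmat_zero] x(2) by blast
  then show ?thesis
    unfolding isotropic_iff[OF symm_perp[OF R assms(1,2)]]
    using rmat_colv[OF x(1) rmat_zero] x z
      bil_colv[OF symm_rmat[OF assms(1)] symm_rmat[OF assms(2)] x(1) rmat_zero x(1) rmat_zero]
    by (intro bexI[of _ "colv x (zero_m R m 1)"]) auto
qed

text \<open>The first basis vector has a nonzero value, so a regular line splits off, and the
  complement stays anisotropic. The complements in \<open>witt_index\<close> and the forms in the
  local-global principle for isotropy are mere quadratic forms; this brings the anisotropic ones
  among them into \<open>reg\<close>.\<close>

lemma anisotropic_reg: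
  assumes "Q \<in> symm R n" "\<not> isotropic R Q"
  shows "Q \<in> reg R n"
  using assms
proof (induction n arbitrary: Q)
  case 0
  have "Q = diag_form R []" using symm_rmat[OF 0(1)] by (intro eq_matI) (auto simp: rmat_iff diag_form_def)
  then show ?case using reg_Nil[OF R] by simp
next
  case (Suc m)
  then have S: "Q \<in> symm R (1 + m)" by (simp add: One_nat_def)
  have ne: "e0 m \<noteq> zero_m R (1 + m) 1"
  proof
    assume "e0 m = zero_m R (1 + m) 1"
    then have "e0 m $$ (0, 0) = zero_m R (1 + m) 1 $$ (0, 0)" by simp
    then show False by (simp add: e0_def colv_def zero_m_def one_m_def)
  qed
  have "bil Q (e0 m) (e0 m) \<noteq> \<zero>" using Suc(3) isotropic_iff[OF S] rmat_e0 ne by blast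
  from split_vector[OF S rmat_e0 refl this] obtain C q where C: "C \<in> carrier (GL (1 + m) R)" "q \<in> symm R m"
    "pullback R Q C = sc (bil Q (e0 m) (e0 m)) \<bottom> q" (is "_ = sc ?a \<bottom> q") .
  have a: "?a \<in> Units R" using \<open>?a \<noteq> \<zero>\<close> bil_closed[OF symm_rmat[OF S] rmat_e0 rmat_e0] by (simp add: Units_iff)
  have iso: "isometric R (sc ?a \<bottom> q) Q" by (rule isometricI[OF R C(1) symm_rmat[OF S] C(3)])
  have "\<not> isotropic R q"
  proof
    assume "isotropic R q"
    then have "isotropic R (q \<bottom> sc ?a)" by (rule isotropic_perp[OF C(2) reg_symm[OF reg_diag1[OF R a]]])
    then have "isotropic R (sc ?a \<bottom> q)"
      by (rule isotropic_isometric[OF isometric_perp_comm[OF R symm_rmat[OF C(2)] reg_rmat[OF reg_diag1[OF R a]]]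
            symm_perp[OF R reg_symm[OF reg_diag1[OF R a]] C(2)]])
    then have "isotropic R Q" by (rule isotropic_isometric[OF iso S])
    then show False using Suc by simp
  qed
  then have "q \<in> reg R m" using Suc C by simp
  then have "sc ?a \<bottom> q \<in> reg R (1 + m)" by (rule reg_perp[OF R reg_diag1[OF R a]])
  moreover have "isometric R Q (sc ?a \<bottom> q)" by (rule isometric_sym[OF R iso symm_rmat[OF S]])
  ultimately show ?case using isometric_reg[OF R, of Q "sc ?a \<bottom> q" "1 + m"] by (simp add: One_nat_def)
qed

subsection \<open>Witt cancellation\<close>

text \<open>A regular form of positive dimension takes a nonzero value: if all values vanished,
  polarisation at \<open>e0\<close> and a dual vector would give the value 1 + 1 at their
  sum.\<close>

lemma diagonal_step:
  assumes "Q \<in> reg R (1 + m)"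
  obtains a q where "a \<in> Units R" "q \<in> reg R m" "isometric R (sc a \<bottom> q) Q"
proof -
  have S: "Q \<in> symm R (1 + m)" and Q: "Q \<in> rmat R (1 + m) (1 + m)" using assms reg_symm reg_rmat by auto
  have "\<exists>u\<in>rmat R (1 + m) 1. bil Q u u \<noteq> \<zero>"
  proof (rule ccontr)
    assume "\<not> ?thesis"
    then have z: "bil Q u u = \<zero>" if "u \<in> rmat R (1 + m) 1" for u using that by blast
    have ne: "e0 m \<noteq> zero_m R (1 + m) 1"
    proof
      assume "e0 m = zero_m R (1 + m) 1"
      then have "e0 m $$ (0, 0) = zero_m R (1 + m) 1 $$ (0, 0)" by simp
      then show False by (simp add: e0_def colv_def zero_m_def one_m_def)
    qed
    from dual_vector[OF assms rmat_e0 ne] obtain y where y: "y \<in> rmat R (1 + m) 1" "bil Q (e0 m) y = \<one>" .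
    let ?s = "add_m R (e0 m) y"
    have s: "?s \<in> rmat R (1 + m) 1" by (rule rmat_add[OF rmat_e0 y(1)])
    have "bil Q ?s ?s = bil Q ?s (e0 m) \<oplus> bil Q ?s y" by (rule bil_add_right[OF Q s rmat_e0 y(1)])
    also have "\<dots> = \<one> \<oplus> \<one>"
      unfolding bil_add_left[OF S rmat_e0 rmat_e0 y(1)] bil_add_left[OF S y(1) rmat_e0 y(1)]
      using z[OF rmat_e0] z[OF y(1)] y(2) bil_sym[OF S y(1) rmat_e0] by simp
    finally show False using z[OF s] two by simp
  qed
  then obtain u where u: "u \<in> rmat R (1 + m) 1" "bil Q u u \<noteq> \<zero>" by blast
  from split_vector[OF S u(1) refl u(2)] obtain C q where C: "C \<in> carrier (GL (1 + m) R)" "q \<in> symm R m"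
    "pullback R Q C = sc (bil Q u u) \<bottom> q" (is "_ = sc ?a \<bottom> q") .
  have a: "?a \<in> Units R" using u bil_closed[OF Q u(1) u(1)] by (simp add: Units_iff)
  have "sc ?a \<bottom> q \<in> carrier (GL (1 + m) R)" using GL_pullback[OF R reg_GL[OF assms] C(1)] C(3) by simp
  then have "q \<in> carrier (GL m R)" by (rule GL_of_perp(2)[OF R reg_rmat[OF reg_diag1[OF R a]] symm_rmat[OF C(2)]])
  then have "q \<in> reg R m" using C(2) by (simp add: reg_def symm_def)
  then show ?thesis using that[OF a _ isometricI[OF R C(1) Q C(3)]] by simp
qed

lemma unit_column:
  assumes "A \<in> rmat R n m" "i < n" "j < m"
  shows "(A \<star> mat m 1 (\<lambda>(k, _). if k = j then \<one> else \<zero>)) $$ (i, 0) = A $$ (i, j)"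
proof -
  have "(\<Oplus>k\<in>{..<m}. A $$ (i, k) \<otimes> (if k = j then \<one> else \<zero>)) = (\<Oplus>k\<in>{..<m}. if j = k then A $$ (i, k) else \<zero>)"
    using assms by (intro finsum_cong') (auto simp: rmat_iff)
  also have "\<dots> = A $$ (i, j)"
    using assms by (intro finsum_singleton) (auto simp: rmat_iff)
  finally have 1: "(\<Oplus>k\<in>{..<m}. A $$ (i, k) \<otimes> (if k = j then \<one> else \<zero>)) = A $$ (i, j)" .
  have "(\<Oplus>k\<in>{..<m}. A $$ (i, k) \<otimes> mat m 1 (\<lambda>(k, _). if k = j then \<one> else \<zero>) $$ (k, 0)) =
      (\<Oplus>k\<in>{..<m}. A $$ (i, k) \<otimes> (if k = j then \<one> else \<zero>))"
    using assms by (intro finsum_cong') (auto simp: rmat_iff)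
  then show ?thesis using assms 1 by (simp add: mat_prod_def rmat_dims)
qed

lemma bil_ext:
  assumes "Q \<in> rmat R n n" "Q' \<in> rmat R n n"
    and eq: "\<And>x y. x \<in> rmat R n 1 ==> y \<in> rmat R n 1 ==> bil Q x y = bil Q' x y"
  shows "Q = Q'"
proof (intro eq_matI)
  define e where "e = (\<lambda>j. mat n 1 (\<lambda>(k, _). if k = j then \<one> else \<zero>))"
  have e: "e j \<in> rmat R n 1" for j by (auto simp: e_def rmat_iff)
  have "bil P (e i) (e j) = P $$ (i, j)" if "P \<in> rmat R n n" "i < n" "j < n" for P i j
  proof -
    have row: "(transpose_mat (e i) \<star> P) $$ (0, j) = P $$ (i, j)"
    proof -
      have "(transpose_mat (transpose_mat P \<star> e i)) $$ (0, j) = (transpose_mat P \<star> e i) $$ (j, 0)"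
        using that e[of i] by (simp add: rmat_iff)
      also have "\<dots> = P $$ (i, j)"
        using unit_column[OF rmat_transpose[OF that(1)] that(3,2)] that by (simp add: e_def rmat_iff)
      finally show ?thesis using mat_transpose_mult[OF R rmat_transpose[OF that(1)] e] by simp
    qed
    show ?thesis
      unfolding bil_def
      using unit_column[OF rmat_prod[OF rmat_transpose[OF e[of i]] that(1)], of 0 j] that(3) row by (simp add: e_def)
  qed
  then show "Q $$ (i, j) = Q' $$ (i, j)" if "i < dim_row Q'" "j < dim_col Q'" for i j
    using that assms e by (metis rmat_dims)
qed (use assms in \<open>auto simp: rmat_iff\<close>)

text \<open>
  If \<open>(\<alpha> w; v D)\<close> is an isometry from \<open>\<langle>a\<rangle> \<bottom> q1\<close> to \<open>\<langle>a\<rangle> \<bottom> q2\<close> and \<open>s = \<plusminus>1\<close> differs from \<open>\<alpha>\<close>, then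
  \<open>D + (s - \<alpha>)\<inverse> v w\<close> is an isometry from \<open>q1\<close> to \<open>q2\<close>: it is the lower right block of the product
  with the reflection that moves the first column to \<open>s e\<^sub>0\<close>.
\<close>

lemma cancel_scalar_identity:
  fixes A a p q k :: "'b :: comm_ring_1"
  shows "(A - a * p * q) + k * q * (- (a * \<alpha> * p)) + k * p * (- (a * \<alpha> * q)) + k * p * (k * q * (a - a * \<alpha> * \<alpha>)) =
    A + a * p * q * k * k * (1 - s * s) + a * p * q * (k * s - k * \<alpha> - 1) * (k * s + k * \<alpha> + 1)"
  by (simp add: algebra_simps)

text \<open>In the application \<open>A\<close> is the value of \<open>q1\<close> at x and y,
  \<open>p\<close> and \<open>q\<close> are w x and w y, and \<open>k\<close> is the inverse of s -
  \<alpha>. The left side is the value of \<open>q2\<close> at the corrected images; both error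
  terms of the polynomial identity contain a vanishing factor, 1 - s s or k s - k \<alpha> -
  1.\<close>

lemma cancel_scalar:
  assumes c: "A \<in> carrier R" "a \<in> carrier R" "p \<in> carrier R" "q \<in> carrier R" "k \<in> carrier R" "s \<in> carrier R" "\<alpha> \<in> carrier R"
    and ks: "k \<otimes> s \<ominus> k \<otimes> \<alpha> = \<one>" and ss: "s \<otimes> s = \<one>"
  shows "(A \<ominus> a \<otimes> p \<otimes> q) \<oplus> k \<otimes> q \<otimes> (\<ominus> (a \<otimes> \<alpha> \<otimes> p)) \<oplus> k \<otimes> p \<otimes> (\<ominus> (a \<otimes> \<alpha> \<otimes> q)) \<oplus>
    k \<otimes> p \<otimes> (k \<otimes> q \<otimes> (a \<ominus> a \<otimes> \<alpha> \<otimes> \<alpha>)) = A"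
proof -
  obtain A' a' p' q' k' s' \<alpha>' where l: "cproj R A' = A" "cproj R a' = a" "cproj R p' = p"
    "cproj R q' = q" "cproj R k' = k" "cproj R s' = s" "cproj R \<alpha>' = \<alpha>"
    using c cproj_surj[OF R] by metis
  have mns: "cproj R (x - y) = cproj R x \<ominus> cproj R y" for x y
    by (simp add: diff_conv_add_uminus cproj_add[OF R] cproj_uminus[OF R] a_minus_def del: add_uminus_conv_diff)
  note pr = mns cproj_add[OF R] cproj_uminus[OF R] cproj_mult[OF R] cproj_one[OF R] l
  have k1: "k \<otimes> s \<ominus> k \<otimes> \<alpha> \<ominus> \<one> = \<zero>" using ks by (simp add: minus_eq r_neg)
  have k3: "\<one> \<ominus> s \<otimes> s = \<zero>" using ss by (simp add: minus_eq r_neg)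
  from arg_cong[OF cancel_scalar_identity[of A' a' p' q' k' \<alpha>' s'], of "cproj R"]
  show ?thesis unfolding pr k1 k3 using c by simp
qed

lemma cancel_scalar_form:
  assumes "a \<in> Units R" "q1 \<in> reg R m" "q2 \<in> reg R m" "isometric R (sc a \<bottom> q1) (sc a \<bottom> q2)"
  shows "isometric R q1 q2"
proof -
  have a: "a \<in> carrier R" using assms(1) by (rule Units_closed)
  have S: "q2 \<in> symm R m" and q: "q1 \<in> rmat R m m" "q2 \<in> rmat R m m" using assms reg_rmat reg_symm by auto
  note sca = rmat_sc[OF a]
  note P2 = rmat_perp[OF R sca q(2)]
  from isometricE[OF R assms(4) P2] obtain C where C: "C \<in> carrier (GL (1 + m) R)"
    "pullback R (sc a \<bottom> q2) C = sc a \<bottom> q1" .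
  from GL_rmat[OF C(1)] obtain al w v D where bl: "al \<in> rmat R 1 1" "w \<in> rmat R 1 m" "v \<in> rmat R m 1" "D \<in> rmat R m m"
    "C = four_block_mat al w v D" by (rule rmat_blocks)
  define \<alpha> where "\<alpha> = al $$ (0, 0)"
  have al: "al = sc \<alpha>" "\<alpha> \<in> carrier R" using rmat11_sc[OF bl(1)] bl(1) by (auto simp: \<alpha>_def rmat_iff)
  define om where "om = (\<lambda>x. (w \<star> x) $$ (0, 0))"
  have om: "om x \<in> carrier R" "w \<star> x = sc (om x)" if "x \<in> rmat R m 1" for x
    using rmat_prod[OF bl(2) that] rmat11_sc by (auto simp: om_def rmat_iff)
  have Cx: "C \<star> colv (sc \<zero>) x = colv (sc (om x)) (D \<star> x)" if x: "x \<in> rmat R m 1" for x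
    unfolding bl(5) block_colv[OF bl(1-4) rmat_sc[OF zero_closed] x] unfolding om(2)[OF x] sc_zero mat_zero_right[OF R bl(1)] mat_zero_right[OF R bl(3)]
    by (simp add: mat_add_zero_left[OF R rmat_sc[OF om(1)[OF x]]] mat_add_zero_left[OF R rmat_prod[OF bl(4) x]])
  have Ce: "C \<star> colv (sc \<one>) (zero_m R m 1) = colv (sc \<alpha>) v"
    unfolding bl(5) block_colv[OF bl(1-4) rmat_sc[OF one_closed] rmat_zero] unfolding sc_one mat_one_right[OF R bl(1)] mat_one_right[OF R bl(3)]
      mat_zero_right[OF R bl(2)] mat_zero_right[OF R bl(4)]
    using mat_add_zero_right[OF R bl(1)] mat_add_zero_right[OF R bl(3)] al by simp
  have pb: "bil (sc a \<bottom> q1) x y = bil (sc a \<bottom> q2) (C \<star> x) (C \<star> y)"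
    if "x \<in> rmat R (1 + m) 1" "y \<in> rmat R (1 + m) 1" for x y
    using bil_pullback[OF P2 GL_rmat[OF C(1)] that] C(2) by simp
  have Dx: "D \<star> x \<in> rmat R m 1" if "x \<in> rmat R m 1" for x by (rule rmat_prod[OF bl(4) that])
  have z: "sc \<zero> \<in> rmat R 1 1" "sc \<one> \<in> rmat R 1 1" using rmat_sc by auto
  \<comment> \<open>The relations \<open>eq1\<close> to \<open>eq3\<close> express the isometry on
    the three kinds of pairs of blocks. Together they give all values of \<open>q2\<close> that
    occur in the expansion for \<open>D'\<close>.\<close>
  have eq1: "bil q1 x y = a \<otimes> om x \<otimes> om y \<oplus> bil q2 (D \<star> x) (D \<star> y)"
    if x: "x \<in> rmat R m 1" and y: "y \<in> rmat R m 1" for x y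
  proof -
    have "bil (sc a \<bottom> q1) (colv (sc \<zero>) x) (colv (sc \<zero>) y) = bil q1 x y"
      unfolding bil_colv[OF sca q(1) z(1) x z(1) y] using a bil_closed[OF q(1) x y] by (simp add: bil_sc)
    moreover have "bil (sc a \<bottom> q2) (colv (sc (om x)) (D \<star> x)) (colv (sc (om y)) (D \<star> y)) =
        a \<otimes> om x \<otimes> om y \<oplus> bil q2 (D \<star> x) (D \<star> y)"
      unfolding bil_colv[OF sca q(2) rmat_sc[OF om(1)[OF x]] Dx[OF x] rmat_sc[OF om(1)[OF y]] Dx[OF y]]
      using a om(1) x y by (simp add: bil_sc m_comm)
    ultimately show ?thesis
      using pb[OF rmat_colv[OF z(1) x] rmat_colv[OF z(1) y]] Cx[OF x] Cx[OF y] by simp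
  qed
  have eq2: "a \<otimes> \<alpha> \<otimes> om x \<oplus> bil q2 v (D \<star> x) = \<zero>" if x: "x \<in> rmat R m 1" for x
  proof -
    have "bil (sc a \<bottom> q1) (colv (sc \<one>) (zero_m R m 1)) (colv (sc \<zero>) x) = \<zero>"
      unfolding bil_colv[OF sca q(1) z(2) rmat_zero z(1) x]
      using a bil_sym[OF reg_symm[OF assms(2)] rmat_zero x] bil_zero_right[OF q(1) x] by (simp add: bil_sc)
    moreover have "bil (sc a \<bottom> q2) (colv (sc \<alpha>) v) (colv (sc (om x)) (D \<star> x)) =
        a \<otimes> \<alpha> \<otimes> om x \<oplus> bil q2 v (D \<star> x)"
      unfolding bil_colv[OF sca q(2) rmat_sc[OF al(2)] bl(3) rmat_sc[OF om(1)[OF x]] Dx[OF x]]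
      using a om(1) x al by (simp add: bil_sc m_comm)
    ultimately show ?thesis
      using pb[OF rmat_colv[OF z(2) rmat_zero] rmat_colv[OF z(1) x]] Cx[OF x] Ce by simp
  qed
  have eq3: "a \<otimes> \<alpha> \<otimes> \<alpha> \<oplus> bil q2 v v = a"
  proof -
    have "bil (sc a \<bottom> q1) (colv (sc \<one>) (zero_m R m 1)) (colv (sc \<one>) (zero_m R m 1)) = a"
      unfolding bil_colv[OF sca q(1) z(2) rmat_zero z(2) rmat_zero]
      using a bil_zero_right[OF q(1) rmat_zero] by (simp add: bil_sc)
    moreover have "bil (sc a \<bottom> q2) (colv (sc \<alpha>) v) (colv (sc \<alpha>) v) = a \<otimes> \<alpha> \<otimes> \<alpha> \<oplus> bil q2 v v"
      unfolding bil_colv[OF sca q(2) rmat_sc[OF al(2)] bl(3) rmat_sc[OF al(2)] bl(3)]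
      using a al by (simp add: bil_sc m_comm)
    ultimately show ?thesis
      using pb[OF rmat_colv[OF z(2) rmat_zero] rmat_colv[OF z(2) rmat_zero]] Ce by simp
  qed
  \<comment> \<open>A sign different from \<alpha> exists because 1 and -1 differ in characteristic
    not two.\<close>
  obtain s where s: "s \<in> carrier R" "s \<otimes> s = \<one>" "s \<noteq> \<alpha>"
  proof (cases "\<alpha> = \<one>")
    case False
    then show ?thesis using that[of \<one>] by simp
  next
    case True
    have "\<ominus> \<one> \<noteq> \<one>" using two by (metis l_neg one_closed)
    then show ?thesis using that[of "\<ominus> \<one>"] True by (simp add: l_minus)
  qed
  define k where "k = inv (s \<ominus> \<alpha>)"
  have "s \<ominus> \<alpha> \<noteq> \<zero>" using s al r_right_minus_eq by auto
  then have sa: "s \<ominus> \<alpha> \<in> Units R" using s al by (simp add: Units_iff)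
  then have k: "k \<in> carrier R" by (simp add: k_def)
  have "k \<otimes> (s \<ominus> \<alpha>) = \<one>" unfolding k_def using sa by simp
  then have ks: "k \<otimes> s \<ominus> k \<otimes> \<alpha> = \<one>" using k s al by (simp add: minus_eq r_distr r_minus)
  define D' where "D' = add_m R D (smult_m R k (v \<star> w))"
  note vw = rmat_prod[OF bl(3,2)]
  have D': "D' \<in> rmat R m m" unfolding D'_def by (intro rmat_add bl rmat_smult k vw)
  have D'x: "D' \<star> x = add_m R (D \<star> x) (smult_m R (k \<otimes> om x) v)" if x: "x \<in> rmat R m 1" for x
  proof -
    have "v \<star> w \<star> x = smult_m R (om x) v"
      unfolding mat_assoc[OF R bl(3,2) x] om(2)[OF x] by (rule sc_mult_right[OF om(1)[OF x] bl(3)])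
    moreover have "smult_m R k (smult_m R (om x) v) = smult_m R (k \<otimes> om x) v"
      using k om(1)[OF x] bl(3) by (intro eq_matI) (auto simp: smult_m_def rmat_iff m_assoc)
    ultimately show ?thesis
      unfolding D'_def mat_distrib_right[OF R bl(4) rmat_smult[OF k vw] x] mat_smult_left[OF R vw x k] by simp
  qed
  have "pullback R q2 D' = q1"
  proof (rule bil_ext[OF rmat_pullback[OF R q(2) D'] q(1)])
    fix x y assume x: "x \<in> rmat R m 1" and y: "y \<in> rmat R m 1"
    have kx: "k \<otimes> om x \<in> carrier R" "k \<otimes> om y \<in> carrier R" using k om(1) x y by auto
    note sv = rmat_smult[OF kx(1) bl(3)] rmat_smult[OF kx(2) bl(3)]
    define B where "B = bil q2 (D \<star> x) (D \<star> y)"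
    have B: "B \<in> carrier R" unfolding B_def by (rule bil_closed[OF q(2) Dx[OF x] Dx[OF y]])
    have A: "bil q1 x y \<in> carrier R" by (rule bil_closed[OF q(1) x y])
    have omc: "om x \<in> carrier R" "om y \<in> carrier R" using om(1) x y by auto
    have t1: "B = bil q1 x y \<ominus> a \<otimes> om x \<otimes> om y"
      using eq1[OF x y] A B a omc unfolding B_def[symmetric] by (simp add: minus_eq a_ac r_neg2 r_neg1 r_neg)
    have t2: "bil q2 v (D \<star> z) = \<ominus> (a \<otimes> \<alpha> \<otimes> om z)" if z: "z \<in> rmat R m 1" for z
      using eq2[OF z] bil_closed[OF q(2) bl(3) Dx[OF z]] a al om(1)[OF z] by (metis a_comm m_closed minus_equality)
    have t3: "bil q2 v v = a \<ominus> a \<otimes> \<alpha> \<otimes> \<alpha>"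
      using eq3 bil_closed[OF q(2) bl(3) bl(3)] a al by (metis a_comm add.inv_solve_right' m_closed minus_eq)
    have "bil (pullback R q2 D') x y = bil q2 (D' \<star> x) (D' \<star> y)"
      by (rule bil_pullback[OF q(2) D' x y])
    also have "\<dots> = (B \<oplus> k \<otimes> om x \<otimes> bil q2 v (D \<star> y)) \<oplus>
       k \<otimes> om y \<otimes> (bil q2 (D \<star> x) v \<oplus> k \<otimes> om x \<otimes> bil q2 v v)"
      unfolding D'x[OF x] D'x[OF y] bil_add_right[OF q(2) rmat_add[OF Dx[OF x] sv(1)] Dx[OF y] sv(2)]
        bil_smult_right[OF q(2) rmat_add[OF Dx[OF x] sv(1)] bl(3) kx(2)]
        bil_add_left[OF S Dx[OF y] Dx[OF x] sv(1)] bil_add_left[OF S bl(3) Dx[OF x] sv(1)]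
        bil_smult_left[OF S Dx[OF y] bl(3) kx(1)] bil_smult_left[OF S bl(3) bl(3) kx(1)] B_def ..
    also have "bil q2 (D \<star> x) v = bil q2 v (D \<star> x)" by (rule bil_sym[OF S Dx[OF x] bl(3)])
    also have "(B \<oplus> k \<otimes> om x \<otimes> bil q2 v (D \<star> y)) \<oplus>
       k \<otimes> om y \<otimes> (bil q2 v (D \<star> x) \<oplus> k \<otimes> om x \<otimes> bil q2 v v) =
       B \<oplus> k \<otimes> om y \<otimes> bil q2 v (D \<star> x) \<oplus> k \<otimes> om x \<otimes> bil q2 v (D \<star> y) \<oplus> k \<otimes> om x \<otimes> (k \<otimes> om y \<otimes> bil q2 v v)"
      using B k omc bil_closed[OF q(2) bl(3) Dx[OF x]] bil_closed[OF q(2) bl(3) Dx[OF y]] bil_closed[OF q(2) bl(3) bl(3)]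
      by (simp add: r_distr a_ac m_ac)
    also have "\<dots> = bil q1 x y"
      unfolding t1 t2[OF x] t2[OF y] t3 by (rule cancel_scalar[OF A a omc k s(1) al(2) ks s(2)])
    finally show "bil (pullback R q2 D') x y = bil q1 x y" .
  qed
  moreover have "D' \<in> carrier (GL m R)"
    by (rule GL_of_pullback(1)[OF R q(2) D']) (use calculation assms(2) reg_GL in simp)
  ultimately show ?thesis by (rule isometricI[OF R _ q(2), rotated])
qed

text \<open>Diagonalising the common summand reduces this to the cancellation of one line at a
  time.\<close>

theorem witt_cancellation:
  assumes "Q \<in> reg R n" "q1 \<in> reg R m" "q2 \<in> reg R m'" "isometric R (Q \<bottom> q1) (Q \<bottom> q2)"
  shows "isometric R q1 q2"
  using assms
proof (induction n arbitrary: Q m m' q1 q2)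
  case 0
  have "Q = diag_form R []" using reg_rmat[OF 0(1)] by (intro eq_matI) (auto simp: rmat_iff diag_form_def)
  then show ?case using 0 by (simp add: perp_Nil_left[OF R])
next
  case (Suc n)
  have [simp]: "m' = m"
    using isometric_dim[OF R Suc.prems(4)] reg_dim[OF Suc.prems(2)] reg_dim[OF Suc.prems(3)] by simp
  from Suc have Q: "Q \<in> reg R (1 + n)" by (simp add: One_nat_def)
  from diagonal_step[OF this] obtain a q where aq: "a \<in> Units R" "q \<in> reg R n" "isometric R (sc a \<bottom> q) Q" .
  note sca = reg_diag1[OF R aq(1)]
  have iso: "isometric R (sc a \<bottom> q) Q" "isometric R Q (sc a \<bottom> q)"
    using aq(3) isometric_sym[OF R aq(3) reg_rmat[OF Q]] by auto
  have 1: "isometric R ((sc a \<bottom> q) \<bottom> q1) (Q \<bottom> q1)"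
    by (rule isometric_perp[OF R iso(1) isometric_refl[OF R] reg_rmat[OF Q]]) (use Suc.prems reg_rmat in auto)
  have 2: "isometric R (Q \<bottom> q2) ((sc a \<bottom> q) \<bottom> q2)"
    by (rule isometric_perp[OF R iso(2) isometric_refl[OF R] reg_rmat[OF reg_perp[OF R sca aq(2)]]]) (use Suc.prems reg_rmat in auto)
  have q: "q1 \<in> reg R m" "q2 \<in> reg R m" using Suc.prems by auto
  have "isometric R ((sc a \<bottom> q) \<bottom> q1) ((sc a \<bottom> q) \<bottom> q2)"
    using isometric_trans[OF R isometric_trans[OF R 1 Suc.prems(4)] 2]
      reg_rmat[OF reg_perp[OF R Q q(2)]] reg_rmat[OF reg_perp[OF R reg_perp[OF R sca aq(2)] q(2)]] by blast
  then have "isometric R (q \<bottom> q1) (q \<bottom> q2)"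
    unfolding perp_assoc[OF R]
    by (rule cancel_scalar_form[OF aq(1) reg_perp[OF R aq(2) q(1)] reg_perp[OF R aq(2) q(2)]])
  then show ?case by (rule Suc.IH[OF aq(2) q])
qed

end

section \<open>Hyperbolic spaces, Witt decomposition and the Witt index\<close>

context form_field
begin

subsection \<open>Witt decomposition\<close>

text \<open>Isometry bundled with regularity and dimension, so that symmetry and transitivity hold
  without side conditions and steps can be chained.\<close>

definition eqv :: "nat => 'a mat => 'a mat => bool" where
  "eqv n A B \<longleftrightarrow> A \<in> reg R n \<and> B \<in> reg R n \<and> isometric R A B"

lemma eqvD: "eqv n A B ==> A \<in> reg R n" "eqv n A B ==> B \<in> reg R n" "eqv n A B ==> isometric R A B"
  by (auto simp: eqv_def)

lemma eqvI: "isometric R A B ==> B \<in> reg R n ==> eqv n A B"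
  using isometric_reg[OF R] by (auto simp: eqv_def)

lemma eqv_refl: "A \<in> reg R n ==> eqv n A A"
  using isometric_refl[OF R reg_rmat] by (auto simp: eqv_def)

lemma eqv_sym: "eqv n A B ==> eqv n B A"
  using isometric_sym[OF R _ reg_rmat] by (auto simp: eqv_def)

lemma eqv_trans [trans]: "eqv n A B ==> eqv n B C ==> eqv n A C"
  using isometric_trans[OF R _ _ reg_rmat] by (auto simp: eqv_def)

lemma eqv_perp: "eqv n A A' ==> eqv m B B' ==> eqv (n + m) (A \<bottom> B) (A' \<bottom> B')"
  using isometric_perp[OF R _ _ reg_rmat reg_rmat] reg_perp[OF R] by (auto simp: eqv_def)

lemma eqv_comm: "A \<in> reg R n ==> B \<in> reg R m ==> eqv (n + m) (A \<bottom> B) (B \<bottom> A)"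
  using isometric_perp_comm[OF R reg_rmat reg_rmat] reg_perp[OF R, of A n B m] reg_perp[OF R, of B m A n]
  by (auto simp: eqv_def add.commute)

lemma eqv_swap:
  assumes "A \<in> reg R n" "B \<in> reg R m" "C \<in> reg R k" "D \<in> reg R l"
  shows "eqv (n + m + (k + l)) ((A \<bottom> B) \<bottom> (C \<bottom> D)) ((A \<bottom> C) \<bottom> (B \<bottom> D))"
proof -
  have "eqv (n + (m + k) + l) ((A \<bottom> (B \<bottom> C)) \<bottom> D) ((A \<bottom> (C \<bottom> B)) \<bottom> D)"
    by (intro eqv_perp eqv_refl eqv_comm assms)
  then show ?thesis by (simp add: perp_assoc[OF R] add.assoc)
qed

lemma eqv_cancel: "eqv (n + m) (A \<bottom> B) (A \<bottom> C) ==> A \<in> reg R n ==> B \<in> reg R m ==> C \<in> reg R m ==> eqv m B C"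
  using witt_cancellation by (auto simp: eqv_def)

lemma eqv_cancel_right:
  assumes "eqv (m + n) (B \<bottom> A) (C \<bottom> A)" "A \<in> reg R n" "B \<in> reg R m" "C \<in> reg R m"
  shows "eqv m B C"
proof (rule eqv_cancel[OF _ assms(2-4)])
  have "eqv (n + m) (A \<bottom> B) (B \<bottom> A)" by (rule eqv_comm[OF assms(2,3)])
  also have "eqv (n + m) (B \<bottom> A) (C \<bottom> A)" using assms(1) by (simp add: add.commute)
  also have "eqv (n + m) (C \<bottom> A) (A \<bottom> C)" using eqv_comm[OF assms(4,2)] by (simp add: add.commute)
  finally show "eqv (n + m) (A \<bottom> B) (A \<bottom> C)" .
qed

abbreviation H :: "nat => 'a mat" where "H n \<equiv> hyperbolic_space R n"

lemma reg_H: "H n \<in> reg R (2 * n)" by (rule reg_hyperbolic_space[OF R])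

lemma reg_0_eq: "Q \<in> reg R 0 ==> Q = diag_form R []"
  by (intro eq_matI) (auto simp: diag_form_def dest!: reg_rmat simp: rmat_iff)

lemma isotropic_split:
  assumes "Q \<in> reg R n" "isotropic R Q"
  obtains m q where "n = 2 + m" "q \<in> reg R m" "eqv n Q (hyperbolic_plane R \<bottom> q)"
proof -
  from assms(2) obtain x where x: "x \<in> rmat R n 1" "x \<noteq> zero_m R n 1" "bil Q x x = \<zero>"
    using isotropic_iff[OF reg_symm[OF assms(1)]] by blast
  from split_hyperbolic[OF assms(1) x] obtain m C q where C: "n = 2 + m" "C \<in> carrier (GL n R)" "q \<in> reg R m"
    "pullback R Q C = hyperbolic_plane R \<bottom> q" .
  show ?thesis
    by (rule that[OF C(1,3) eqv_sym[OF eqvI[OF isometricI[OF R C(2) reg_rmat[OF assms(1)] C(4)] assms(1)]]])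
qed

lemma isotropic_binary:
  assumes "Q \<in> reg R 2" "isotropic R Q"
  shows "eqv 2 Q (hyperbolic_plane R)"
proof -
  from isotropic_split[OF assms] obtain m q where mq: "2 = 2 + m" "q \<in> reg R m" "eqv 2 Q (hyperbolic_plane R \<bottom> q)" .
  have "q = diag_form R []" using mq reg_0_eq by simp
  then show ?thesis using mq(3) by (simp add: perp_Nil_right[OF R])
qed

lemma isotropic_antidiagonal:
  assumes "a \<in> Units R"
  shows "eqv 2 (sc a \<bottom> sc (\<ominus> a)) (hyperbolic_plane R)"
proof -
  have a: "a \<in> carrier R" using assms by (rule Units_closed)
  have ma: "\<ominus> a \<in> Units R" using assms a by (simp add: Units_iff)
  have r: "sc a \<bottom> sc (\<ominus> a) \<in> reg R 2"
    using reg_perp[OF R reg_diag1[OF R assms] reg_diag1[OF R ma]] by (simp add: One_nat_def numeral_2_eq_2)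
  have z: "zero_m R 2 1 = colv (sc \<zero>) (sc \<zero>)"
    unfolding sc_zero by (intro eq_matI) (auto simp: colv_def zero_m_def)
  have one: "sc \<one> \<in> rmat R 1 1" "sc \<zero> \<in> rmat R 1 1" using rmat_sc by auto
  have "colv (sc \<one>) (sc \<one>) \<noteq> zero_m R 2 1"
    unfolding z using colv_inject[OF one(1) one(1) one(2) one(2)] one_not_zero by auto
  moreover have "colv (sc \<one>) (sc \<one>) \<in> rmat R 2 1" using rmat_colv[OF one(1) one(1)] by simp
  moreover have "bil (sc a \<bottom> sc (\<ominus> a)) (colv (sc \<one>) (sc \<one>)) (colv (sc \<one>) (sc \<one>)) = \<zero>"
    unfolding bil_colv[OF rmat_sc[OF a] rmat_sc[OF Units_closed[OF ma]] one(1) one(1) one(1) one(1)]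
    using a by (simp add: bil_sc r_neg)
  ultimately have "isotropic R (sc a \<bottom> sc (\<ominus> a))"
    unfolding isotropic_iff[OF reg_symm[OF r]] by blast
  then show ?thesis by (rule isotropic_binary[OF r])
qed

lemma isotropic_hyperbolic_plane: "isotropic R (hyperbolic_plane R)"
proof -
  have one: "sc \<one> \<in> rmat R 1 1" "sc \<zero> \<in> rmat R 1 1" using rmat_sc by auto
  have z: "zero_m R 2 1 = colv (sc \<zero>) (sc \<zero>)"
    unfolding sc_zero by (intro eq_matI) (auto simp: colv_def zero_m_def)
  have "colv (sc \<one>) (sc \<one>) \<noteq> zero_m R 2 1"
    unfolding z using colv_inject[OF one(1) one(1) one(2) one(2)] one_not_zero by auto
  moreover have "colv (sc \<one>) (sc \<one>) \<in> rmat R 2 1" using rmat_colv[OF one(1) one(1)] by simp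
  moreover have "bil (hyperbolic_plane R) (colv (sc \<one>) (sc \<one>)) (colv (sc \<one>) (sc \<one>)) = \<zero>"
    unfolding hyperbolic_plane_eq bil_colv[OF rmat_sc[OF one_closed] rmat_sc[OF a_inv_closed[OF one_closed]] one(1) one(1) one(1) one(1)]
    by (simp add: bil_sc r_neg)
  ultimately show ?thesis
    unfolding isotropic_iff[OF reg_symm[OF reg_hyperbolic_plane[OF R]]] by blast
qed

lemma oppos_eq_smult: "Q \<in> rmat R n m ==> oppos R Q = smult_m R (\<ominus> \<one>) Q"
  by (intro eq_matI) (auto simp: oppos_def smult_m_def l_minus rmat_iff)

lemma pullback_oppos:
  assumes "Q \<in> rmat R n n" "C \<in> rmat R n m"
  shows "pullback R (oppos R Q) C = oppos R (pullback R Q C)"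
proof -
  have m1: "\<ominus> \<one> \<in> carrier R" by simp
  note T = rmat_transpose[OF assms(2)]
  show ?thesis
    unfolding oppos_eq_smult[OF assms(1)] oppos_eq_smult[OF rmat_pullback[OF R assms]]
    unfolding pullback_def mat_smult_right[OF R T assms(1) m1] mat_smult_left[OF R rmat_prod[OF T assms(1)] assms(2) m1] ..
qed

lemma eqv_oppos: "eqv n A B ==> eqv n (oppos R A) (oppos R B)"
proof -
  assume e: "eqv n A B"
  note B = eqvD(2)[OF e]
  from isometricE[OF R eqvD(3)[OF e] reg_rmat[OF B]] obtain C where C: "C \<in> carrier (GL n R)" "pullback R B C = A" .
  show ?thesis
    by (rule eqvI[OF isometricI[OF R C(1) reg_rmat[OF reg_oppos[OF R B]]] reg_oppos[OF R B]])
      (use pullback_oppos[OF reg_rmat[OF B] GL_rmat[OF C(1)]] C in simp)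
qed

lemma oppos_perp: "A \<in> rmat R n n ==> B \<in> rmat R m m ==> oppos R (A \<bottom> B) = oppos R A \<bottom> oppos R B"
  by (intro eq_matI) (auto simp: oppos_def perp_index rmat_iff)

lemma oppos_sc: "oppos R (sc a) = sc (\<ominus> a)"
  by (intro eq_matI) (auto simp: oppos_def diag_form_def)

lemma H_Suc: "H (Suc n) = hyperbolic_plane R \<bottom> H n" by (rule hyperbolic_space_Suc[OF R])
lemma H_0: "H 0 = diag_form R []" by (rule hyperbolic_space_0[OF R])
lemma H_add: "H (m + n) = H m \<bottom> H n" by (rule hyperbolic_space_add[OF R])

text \<open>After diagonalisation this is the fact that <a,-a> has the isotropic vector (1,1) and so
  is a hyperbolic plane.\<close>

lemma perp_oppos_hyperbolic:
  assumes "Q \<in> reg R n" shows "eqv (2 * n) (Q \<bottom> oppos R Q) (H n)"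
  using assms
proof (induction n arbitrary: Q)
  case 0
  have "oppos R (diag_form R []) = diag_form R []" by (intro eq_matI) (auto simp: oppos_def diag_form_def)
  then show ?case using reg_0_eq[OF 0] eqv_refl[OF reg_Nil[OF R]] by (simp add: H_0 perp_Nil_left[OF R])
next
  case (Suc n)
  then have Q: "Q \<in> reg R (1 + n)" by (simp add: One_nat_def)
  from diagonal_step[OF this] obtain a q where aq: "a \<in> Units R" "q \<in> reg R n" "isometric R (sc a \<bottom> q) Q" .
  have ma: "\<ominus> a \<in> Units R" using aq(1) by (simp add: Units_iff)
  note sca = reg_diag1[OF R aq(1)] reg_diag1[OF R ma]
  have e: "eqv (1 + n) Q (sc a \<bottom> q)" by (rule eqv_sym[OF eqvI[OF aq(3) Q]])
  have "eqv (1 + n + (1 + n)) (Q \<bottom> oppos R Q) ((sc a \<bottom> q) \<bottom> oppos R (sc a \<bottom> q))"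
    by (intro eqv_perp eqv_oppos e)
  also have "oppos R (sc a \<bottom> q) = sc (\<ominus> a) \<bottom> oppos R q"
    using oppos_perp[OF reg_rmat[OF sca(1)] reg_rmat[OF aq(2)]] by (simp add: oppos_sc)
  also have "eqv (1 + n + (1 + n)) ((sc a \<bottom> q) \<bottom> (sc (\<ominus> a) \<bottom> oppos R q))
      ((sc a \<bottom> sc (\<ominus> a)) \<bottom> (q \<bottom> oppos R q))"
    by (rule eqv_swap[OF sca(1) aq(2) sca(2) reg_oppos[OF R aq(2)]])
  also have "eqv (1 + n + (1 + n)) ((sc a \<bottom> sc (\<ominus> a)) \<bottom> (q \<bottom> oppos R q)) (hyperbolic_plane R \<bottom> H n)"
    using eqv_perp[OF isotropic_antidiagonal[OF aq(1)] Suc.IH[OF aq(2)]] by (simp add: One_nat_def mult_2)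
  finally show ?case by (simp add: H_Suc One_nat_def mult_2)
qed

lemma witt_decomposition:
  assumes "Q \<in> reg R n"
  obtains i m q where "n = 2 * i + m" "q \<in> reg R m" "\<not> isotropic R q" "eqv n Q (H i \<bottom> q)"
proof -
  have "\<exists>i m q. n = 2 * i + m \<and> q \<in> reg R m \<and> \<not> isotropic R q \<and> eqv n Q (H i \<bottom> q)"
    using assms
  proof (induction n arbitrary: Q rule: less_induct)
    case (less n)
    show ?case
    proof (cases "isotropic R Q")
      case False
      then show ?thesis
        using less.prems eqv_refl[OF less.prems] by (intro exI[of _ 0] exI[of _ n] exI[of _ Q]) (simp add: H_0 perp_Nil_left[OF R])
    next
      case True
      from isotropic_split[OF less.prems this] obtain k p where kp: "n = 2 + k" "p \<in> reg R k" "eqv n Q (hyperbolic_plane R \<bottom> p)" .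
      from less.IH[OF _ kp(2)] kp(1) obtain i m q where imq: "k = 2 * i + m" "q \<in> reg R m" "\<not> isotropic R q" "eqv k p (H i \<bottom> q)"
        by auto
      have "eqv n Q (H (Suc i) \<bottom> q)"
        using eqv_trans[OF kp(3)] eqv_perp[OF eqv_refl[OF reg_hyperbolic_plane[OF R]] imq(4)] kp(1)
        by (simp add: H_Suc perp_assoc[OF R])
      then show ?thesis using imq kp by (intro exI[of _ "Suc i"] exI[of _ m] exI[of _ q]) simp
    qed
  qed
  then show ?thesis using that by blast
qed

lemma isotropic_eqv: "eqv n A B ==> isotropic R A \<longleftrightarrow> isotropic R B"
  using isotropic_isometric reg_symm eqv_sym by (metis eqvD)

lemma isotropic_H_Suc_perp:
  assumes "q \<in> reg R m" shows "isotropic R (H (Suc k) \<bottom> q)"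
  unfolding H_Suc perp_assoc[OF R]
  by (rule isotropic_perp[OF reg_symm[OF reg_hyperbolic_plane[OF R]] reg_symm[OF reg_perp[OF R reg_H assms]] isotropic_hyperbolic_plane])

text \<open>If one side had more hyperbolic planes, cancelling the common ones would make an
  anisotropic form isometric to one that contains a hyperbolic plane.\<close>

lemma witt_decomposition_unique:
  assumes "eqv n (H i \<bottom> q) (H j \<bottom> p)" "q \<in> reg R m" "p \<in> reg R k" "\<not> isotropic R q" "\<not> isotropic R p"
  shows "i = j" "m = k" "eqv m q p"
proof -
  have le: "j' \<le> i'" if e: "eqv n (H i' \<bottom> q') (H j' \<bottom> p')" and q': "q' \<in> reg R m'" and p': "p' \<in> reg R k'" and ni: "\<not> isotropic R q'"
    for i' j' q' p' m' k'
  proof (rule ccontr)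
    assume "\<not> j' \<le> i'"
    then obtain d where d: "j' = i' + Suc d" by (metis add_Suc_right less_imp_Suc_add not_le)
    have n: "n = 2 * i' + m'" "n = 2 * j' + k'"
      using reg_dim[OF eqvD(1)[OF e]] reg_dim[OF eqvD(2)[OF e]] reg_dim[OF reg_H] reg_dim[OF q'] reg_dim[OF p'] by auto
    have r: "H (Suc d) \<bottom> p' \<in> reg R m'" using reg_perp[OF R reg_H p', of "Suc d"] n d by simp
    have "H j' \<bottom> p' = H i' \<bottom> (H (Suc d) \<bottom> p')" unfolding d H_add perp_assoc[OF R] ..
    then have "eqv (2 * i' + m') (H i' \<bottom> q') (H i' \<bottom> (H (Suc d) \<bottom> p'))" using e n(1) by simp
    then have "eqv m' q' (H (Suc d) \<bottom> p')"
      by (rule eqv_cancel[OF _ reg_H q' r])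
    then show False using isotropic_eqv isotropic_H_Suc_perp[OF p'] ni by blast
  qed
  show ij: "i = j" using le[OF assms(1-4)] le[OF eqv_sym[OF assms(1)] assms(3,2,5)] by simp
  have n: "n = 2 * i + m" "n = 2 * j + k"
    using reg_dim[OF eqvD(1)[OF assms(1)]] reg_dim[OF eqvD(2)[OF assms(1)]] reg_dim[OF reg_H] reg_dim[OF assms(2)] reg_dim[OF assms(3)] by auto
  then show mk: "m = k" using ij by simp
  show "eqv m q p" by (rule eqv_cancel[OF _ reg_H assms(2), of i]) (use assms n ij mk in auto)
qed

text \<open>Evaluates the \<open>THE\<close> in \<open>witt_index\<close> from any decomposition. A
  competing complement is only known to be an anisotropic quadratic form;
  \<open>anisotropic_reg\<close> makes uniqueness applicable to it.\<close>

lemma witt_index_eq: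
  assumes "eqv n Q (H i \<bottom> q)" "q \<in> reg R m" "\<not> isotropic R q"
  shows "witt_index R Q = i"
  unfolding witt_index_def
proof (rule the_equality)
  show "\<exists>Q'. quad_form R Q' \<and> \<not> isotropic R Q' \<and> isometric R Q (H i \<bottom> Q')"
    using assms reg_symm[OF assms(2)] reg_dim[OF assms(2)] by (intro exI[of _ q]) (auto simp: quad_form_iff eqv_def)
next
  fix j assume "\<exists>Q'. quad_form R Q' \<and> \<not> isotropic R Q' \<and> isometric R Q (H j \<bottom> Q')"
  then obtain p where p: "p \<in> symm R (dim_row p)" "\<not> isotropic R p" "isometric R Q (H j \<bottom> p)"
    by (auto simp: quad_form_iff)
  have pr: "p \<in> reg R (dim_row p)" by (rule anisotropic_reg[OF p(1,2)])
  have "eqv (2 * j + dim_row p) Q (H j \<bottom> p)" by (rule eqvI[OF p(3) reg_perp[OF R reg_H pr]])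
  moreover have "n = 2 * j + dim_row p"
    using isometric_dim[OF R p(3)] reg_dim[OF eqvD(1)[OF assms(1)]] reg_dim[OF reg_H] by simp
  ultimately have "eqv n (H i \<bottom> q) (H j \<bottom> p)" using eqv_trans[OF eqv_sym[OF assms(1)]] by simp
  from witt_decomposition_unique(1)[OF this assms(2) pr assms(3) p(2)] show "j = i" by simp
qed

section \<open>Reflections, determinants of isometries, and transitivity of SO on isotropic
  vectors\<close>

subsection \<open>Determinants of isometries\<close>

lemma square_eqD:
  assumes "a \<in> carrier R" "b \<in> carrier R" "a \<otimes> a = b \<otimes> b"
  shows "a = b \<or> a = \<ominus> b"
proof -
  have "(a \<ominus> b) \<otimes> (a \<oplus> b) = \<zero>"
  proof -
    have "(a \<ominus> b) \<otimes> (a \<oplus> b) = a \<otimes> a \<oplus> (a \<otimes> b \<oplus> \<ominus> (a \<otimes> b)) \<oplus> \<ominus> (b \<otimes> b)"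
      using assms(1,2) by (simp add: minus_eq l_distr r_distr l_minus r_minus a_ac m_ac)
    then show ?thesis using assms by (simp add: r_neg)
  qed
  from integral[OF this] have "a \<ominus> b = \<zero> \<or> a \<oplus> b = \<zero>" using assms(1,2) by blast
  then show ?thesis
    using assms by (metis minus_equality r_right_minus_eq)
qed

text \<open>The reflection in a vector of nonzero value: diag(-1,1,...,1) in coordinates where
  \<open>Q\<close> is <a> + q, conjugated back.\<close>

lemma isometry_det_minus_one:
  assumes "Q \<in> reg R n" "n \<noteq> 0"
  obtains T where "T \<in> carrier (GL n R)" "pullback R Q T = Q" "mat_det R T = \<ominus> \<one>"
proof -
  obtain m where n: "n = 1 + m" using assms(2) by (metis add.commute Suc_eq_plus1 not0_implies_Suc)
  from diagonal_step[OF assms(1)[unfolded n]] obtain a q where aq: "a \<in> Units R" "q \<in> reg R m" "isometric R (sc a \<bottom> q) Q" .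
  have Q: "Q \<in> rmat R n n" using assms reg_rmat by auto
  from isometricE[OF R aq(3) Q] obtain C where C: "C \<in> carrier (GL n R)" "pullback R Q C = sc a \<bottom> q" .
  from GL_inverse[OF R C(1)] obtain B where B: "B \<in> carrier (GL n R)" "C \<star> B = one_m R n" .
  have ca: "a \<in> carrier R" and m1: "\<ominus> \<one> \<in> carrier R" using aq(1) Units_closed by auto
  define E where "E = sc (\<ominus> \<one>) \<bottom> one_m R m"
  have E: "E \<in> carrier (GL n R)" unfolding E_def n by (rule GL_perp[OF R reg_GL[OF reg_diag1[OF R uminus_one_Unit[OF R]]] GL_one[OF R]])
  have "pullback R (sc a) (sc (\<ominus> \<one>)) = sc a"
    unfolding pullback_vec[OF rmat_sc[OF ca] rmat_sc[OF m1]] using ca by (simp add: bil_sc l_minus r_minus)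
  then have pE: "pullback R (sc a \<bottom> q) E = sc a \<bottom> q"
    unfolding E_def pullback_perp[OF R rmat_sc[OF ca] rmat_sc[OF m1] reg_rmat[OF aq(2)] rmat_one] pullback_one[OF R reg_rmat[OF aq(2)]] by simp
  have dE: "mat_det R E = \<ominus> \<one>"
    unfolding E_def det_perp[OF R rmat_sc[OF m1] rmat_one] by (simp add: det_diag1[OF R] mat_det_one[OF R])
  note CE = GL_mult[OF R C(1) E]
  note m = GL_rmat[OF C(1)] GL_rmat[OF E] GL_rmat[OF B(1)]
  show ?thesis
  proof (rule that[of "C \<star> E \<star> B"])
    show "C \<star> E \<star> B \<in> carrier (GL n R)" by (rule GL_mult[OF R CE B(1)])
    have "pullback R Q (C \<star> E) = sc a \<bottom> q"
      using pullback_pullback[OF R Q m(1,2)] C(2) pE by simp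
    then show "pullback R Q (C \<star> E \<star> B) = Q"
      using pullback_pullback[OF R Q GL_rmat[OF CE] m(3)] pullback_inverse[OF R Q m(1,3) B(2) C(2)] by simp
    have "mat_det R C \<otimes> mat_det R B = \<one>"
      using mat_det_mult[OF R m(1,3)] B(2) mat_det_one[OF R] by simp
    moreover have "mat_det R C \<in> carrier R" "mat_det R B \<in> carrier R" using mat_det_closed[OF R] m by auto
    ultimately show "mat_det R (C \<star> E \<star> B) = \<ominus> \<one>"
      unfolding mat_det_mult[OF R GL_rmat[OF CE] m(3)] mat_det_mult[OF R m(1,2)] dE
      by (simp add: l_minus r_minus)
  qed
qed

text \<open>Two elements of a field with the same square differ by a sign, and a reflection changes
  the sign of the determinant without changing the pulled back form. Over a product of fields this
  correction is made factor by factor, before gluing.\<close>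

lemma adjust_det:
  assumes "Q \<in> reg R n" "n \<noteq> 0" "C \<in> carrier (GL n R)" "c \<in> carrier R" "mat_det R C \<otimes> mat_det R C = c \<otimes> c"
  obtains C' where "C' \<in> carrier (GL n R)" "pullback R Q C' = pullback R Q C" "mat_det R C' = c"
proof (cases "mat_det R C = c")
  case True
  then show ?thesis using that assms by blast
next
  case False
  have dC: "mat_det R C \<in> carrier R" using mat_det_closed[OF R GL_rmat[OF assms(3)]] .
  have neg: "mat_det R C = \<ominus> c" using square_eqD[OF dC assms(4,5)] False by simp
  from isometry_det_minus_one[OF assms(1,2)] obtain T where T: "T \<in> carrier (GL n R)" "pullback R Q T = Q" "mat_det R T = \<ominus> \<one>" .
  show ?thesis
  proof (rule that[of "T \<star> C"])
    show "T \<star> C \<in> carrier (GL n R)" by (rule GL_mult[OF R T(1) assms(3)])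
    show "pullback R Q (T \<star> C) = pullback R Q C"
      using pullback_pullback[OF R reg_rmat[OF assms(1)] GL_rmat[OF T(1)] GL_rmat[OF assms(3)]] T(2) by simp
    show "mat_det R (T \<star> C) = c"
      unfolding mat_det_mult[OF R GL_rmat[OF T(1)] GL_rmat[OF assms(3)]] T(3) neg
      using assms(4) by (simp add: l_minus)
  qed
qed

text \<open>Splitting off hyperbolic planes brings \<open>x\<close> and \<open>y\<close> to the same
  position \<open>fvec\<close>; by Witt cancellation the complements are isometric, which gives an
  isometry taking \<open>x\<close> to \<open>y\<close>. For n at least 3 the complement is nonzero,
  and a reflection there corrects the determinant without moving the vector.\<close>

lemma SO_transitive_isotropic:
  assumes "Q \<in> reg R n" "n \<ge> 3"
    and x: "x \<in> rmat R n 1" "x \<noteq> zero_m R n 1" "bil Q x x = \<zero>"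
    and y: "y \<in> rmat R n 1" "y \<noteq> zero_m R n 1" "bil Q y y = \<zero>"
  obtains g where "g \<in> carrier (GL n R)" "pullback R Q g = Q" "mat_det R g = \<one>" "g \<star> x = y"
proof -
  have Q: "Q \<in> rmat R n n" using assms reg_rmat by auto
  from split_hyperbolic[OF assms(1) x] obtain m C q where C: "n = 2 + m" "C \<in> carrier (GL n R)" "q \<in> reg R m"
    "pullback R Q C = hyperbolic_plane R \<bottom> q" "C \<star> fvec m = x" .
  from split_hyperbolic[OF assms(1) y] obtain m' D p where D0: "n = 2 + m'" "D \<in> carrier (GL n R)" "p \<in> reg R m'"
    "pullback R Q D = hyperbolic_plane R \<bottom> p" "D \<star> fvec m' = y" .
  have "m' = m" using C D0 by simp
  note D = D0[unfolded this]
  have "eqv n (hyperbolic_plane R \<bottom> q) (hyperbolic_plane R \<bottom> p)"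
    using eqvI[OF isometricI[OF R C(2) Q C(4)] assms(1)] eqv_sym[OF eqvI[OF isometricI[OF R D(2) Q D(4)] assms(1)]] eqv_trans by blast
  then have "eqv m q p" using eqv_cancel[OF _ reg_hyperbolic_plane[OF R] C(3) D(3)] C(1) by simp
  then have "isometric R q p" by (simp add: eqv_def)
  from isometricE[OF R this reg_rmat[OF D(3)]] obtain E0 where E0: "E0 \<in> carrier (GL m R)" "pullback R p E0 = q" .
  from GL_inverse[OF R C(2)] obtain B where B: "B \<in> carrier (GL n R)" "B \<star> C = one_m R n" "C \<star> B = one_m R n" .
  \<comment> \<open>\<open>E\<close> is left free: every isometry between the complements gives a
    \<open>g E\<close> that moves \<open>x\<close> to \<open>y\<close>, with determinant
    proportional to that of \<open>E\<close>. This leaves room to change the sign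
    afterwards.\<close>
  define g where "g = (\<lambda>E. D \<star> (one_m R 2 \<bottom> E) \<star> B)"
  note mm = GL_rmat[OF C(2)] GL_rmat[OF D(2)] GL_rmat[OF B(1)]
  have props: "g E \<in> carrier (GL n R) \<and> pullback R Q (g E) = Q \<and> g E \<star> x = y \<and>
      mat_det R (g E) = mat_det R D \<otimes> mat_det R E \<otimes> mat_det R B"
    if E: "E \<in> carrier (GL m R)" "pullback R p E = q" for E
  proof -
    have oE: "one_m R 2 \<bottom> E \<in> carrier (GL n R)" unfolding C(1) by (rule GL_perp[OF R GL_one[OF R] E(1)])
    note DE = GL_mult[OF R D(2) oE]
    have "pullback R Q (D \<star> (one_m R 2 \<bottom> E)) = hyperbolic_plane R \<bottom> q"
      using pullback_pullback[OF R Q mm(2) GL_rmat[OF oE]] D(4) E(2)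
        pullback_perp[OF R reg_rmat[OF reg_hyperbolic_plane[OF R]] rmat_one reg_rmat[OF D(3)] GL_rmat[OF E(1)]]
        pullback_one[OF R reg_rmat[OF reg_hyperbolic_plane[OF R]]] by simp
    then have 1: "pullback R Q (g E) = Q"
      unfolding g_def using pullback_pullback[OF R Q GL_rmat[OF DE] mm(3)] pullback_inverse[OF R Q mm(1,3) B(3) C(4)] by simp
    have f: "(one_m R 2 \<bottom> E) \<star> fvec m = fvec m"
    proof -
      have "one_m R 2 \<bottom> E = one_m R 1 \<bottom> (one_m R 1 \<bottom> E)"
        unfolding perp_assoc[OF R, symmetric] perp_one[OF R] by simp
      moreover have "(one_m R 1 \<bottom> E) \<star> e0 m = e0 m"
        unfolding e0_def perp_colv[OF rmat_one GL_rmat[OF E(1)] rmat_one rmat_zero]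
        by (simp add: zero_one_simps(1)[OF rmat_one] zero_one_simps(4)[OF GL_rmat[OF E(1)]])
      ultimately show ?thesis
        unfolding fvec_def using perp_colv[OF rmat_one rmat_perp[OF R rmat_one GL_rmat[OF E(1)]] rmat_one rmat_e0]
        by (simp add: zero_one_simps(1)[OF rmat_one])
    qed
    have Bx: "B \<star> x = fvec m"
      using mat_assoc[OF R mm(3,1), of "fvec m" 1] rmat_fvec[of m] C(1,5) B(2) zero_one_simps(1)[of "fvec m" n 1] by simp
    have "g E \<star> x = D \<star> ((one_m R 2 \<bottom> E) \<star> fvec m)"
      unfolding g_def using mat_assoc[OF R GL_rmat[OF DE] mm(3) x(1)] Bx
        mat_assoc[OF R mm(2) GL_rmat[OF oE], of "fvec m" 1] rmat_fvec[of m] C(1) by simp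
    then have 2: "g E \<star> x = y" using f D(5) by simp
    have "mat_det R (g E) = mat_det R D \<otimes> mat_det R E \<otimes> mat_det R B"
      unfolding g_def mat_det_mult[OF R GL_rmat[OF DE] mm(3)] mat_det_mult[OF R mm(2) GL_rmat[OF oE]]
        det_perp[OF R rmat_one GL_rmat[OF E(1)]] mat_det_one[OF R]
      using mat_det_closed[OF R GL_rmat[OF E(1)]] by simp
    then show ?thesis using 1 2 GL_mult[OF R DE B(1)] unfolding g_def by simp
  qed
  have dets: "mat_det R Q \<in> Units R" "mat_det R (g E0) \<in> carrier R" "mat_det R D \<in> Units R" "mat_det R B \<in> Units R" "mat_det R E0 \<in> carrier R"
    using GL_det_unit[OF R reg_GL[OF assms(1)]] GL_det_unit[OF R D(2)] GL_det_unit[OF R B(1)] mat_det_closed[OF R GL_rmat] props[OF E0] E0 by auto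
  have "mat_det R (g E0) \<otimes> mat_det R (g E0) \<otimes> mat_det R Q = \<one> \<otimes> mat_det R Q"
  proof -
    have "pullback R Q (g E0) = Q" "g E0 \<in> rmat R n n" using props[OF E0] GL_rmat by auto
    from det_pullback[OF R Q this(2), unfolded this(1)] show ?thesis using dets(1) by (simp add: Units_closed)
  qed
  then have "mat_det R (g E0) \<otimes> mat_det R (g E0) = \<one>"
    using dets(1,2) Units_closed[OF dets(1)] Units_iff m_rcancel by (metis m_closed one_closed)
  then consider "mat_det R (g E0) = \<one>" | "mat_det R (g E0) = \<ominus> \<one>"
    using square_eqD[OF dets(2) one_closed] by auto
  then show ?thesis
  proof cases
    case 1
    then show ?thesis using props[OF E0] that by blast
  next
    case 2
    have "m \<noteq> 0" using assms(2) C(1) by simp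
    from isometry_det_minus_one[OF D(3) this] obtain T where T: "T \<in> carrier (GL m R)" "pullback R p T = p" "mat_det R T = \<ominus> \<one>" .
    have TE: "T \<star> E0 \<in> carrier (GL m R)" "pullback R p (T \<star> E0) = q"
      using GL_mult[OF R T(1) E0(1)] pullback_pullback[OF R reg_rmat[OF D(3)] GL_rmat[OF T(1)] GL_rmat[OF E0(1)]] T(2) E0(2) by auto
    have "mat_det R (g (T \<star> E0)) = \<ominus> (mat_det R D \<otimes> mat_det R E0 \<otimes> mat_det R B)"
      using props[OF TE] mat_det_mult[OF R GL_rmat[OF T(1)] GL_rmat[OF E0(1)]] T(3) dets Units_closed by (simp add: l_minus r_minus)
    also have "\<dots> = \<one>" using 2 props[OF E0] by simp
    finally show ?thesis using props[OF TE] that by blast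
  qed
qed

end

section \<open>Witt equivalence and the additive group of Witt classes\<close>

section \<open>Witt groups\<close>

context form_field
begin

abbreviation weq :: "'a mat => 'a mat => bool" where "weq Q Q' \<equiv> (Q, Q') \<in> witt_rel R"

lemma weqI:
  assumes "Q \<in> reg R n" "Q' \<in> reg R n'" "eqv k (Q \<bottom> H m) (Q' \<bottom> H m')"
  shows "weq Q Q'"
  using assms reg_regular eqvD(3)[OF assms(3)] unfolding witt_rel_def by blast

lemma weqE:
  assumes "weq Q Q'"
  obtains n n' m m' where "Q \<in> reg R n" "Q' \<in> reg R n'" "n + 2 * m = n' + 2 * m'"
    "eqv (n + 2 * m) (Q \<bottom> H m) (Q' \<bottom> H m')"
proof -
  obtain m m' where Q: "Q \<in> reg R (dim_row Q)" "Q' \<in> reg R (dim_row Q')"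
    and iso: "isometric R (Q \<bottom> H m) (Q' \<bottom> H m')"
    using assms by (auto simp: witt_rel_def regular_iff)
  have d: "dim_row Q + 2 * m = dim_row Q' + 2 * m'"
    using isometric_dim[OF R iso] reg_dim[OF reg_H] by simp
  show ?thesis
    by (rule that[OF Q d]) (use eqvI[OF iso reg_perp[OF R Q(2) reg_H]] d in simp)
qed

lemma weq_refl: "Q \<in> reg R n ==> weq Q Q"
  by (rule weqI[OF _ _ eqv_refl[OF reg_perp[OF R _ reg_H, of _ n 0]]])

lemma weq_of_eqv: "eqv n Q Q' ==> weq Q Q'"
  using weqI[OF eqvD(1) eqvD(2) eqv_perp[OF _ eqv_refl[OF reg_H[of 0]]]] by blast

lemma weq_sym: "weq Q Q' ==> weq Q' Q"
  by (erule weqE) (rule weqI, assumption, assumption, erule eqv_sym)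

lemma weq_trans:
  assumes "weq A B" "weq B C" shows "weq A C"
proof -
  from weqE[OF assms(1)] obtain n n' m m' where A: "A \<in> reg R n" "B \<in> reg R n'" "n + 2 * m = n' + 2 * m'"
    "eqv (n + 2 * m) (A \<bottom> H m) (B \<bottom> H m')" .
  from weqE[OF assms(2)] obtain p p' k k' where C: "B \<in> reg R p" "C \<in> reg R p'" "p + 2 * k = p' + 2 * k'"
    "eqv (p + 2 * k) (B \<bottom> H k) (C \<bottom> H k')" .
  have p: "p = n'" using reg_dim[OF A(2)] reg_dim[OF C(1)] by simp
  have "eqv (n + 2 * m + 2 * k) (A \<bottom> H (m + k)) (B \<bottom> H (m' + k))"
    using eqv_perp[OF A(4) eqv_refl[OF reg_H[of k]]] by (simp add: H_add perp_assoc[OF R])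
  also have "eqv (n + 2 * m + 2 * k) (B \<bottom> H (m' + k)) (C \<bottom> H (k' + m'))"
  proof -
    have Hk: "H (m' + k) = H k \<bottom> H m'" using H_add[of k m'] by (simp add: add.commute)
    have sz: "n + 2 * m + 2 * k = p + 2 * k + 2 * m'" using A(3) p by simp
    show ?thesis
      unfolding sz Hk H_add[of k' m'] perp_assoc[OF R, symmetric] by (rule eqv_perp[OF C(4) eqv_refl[OF reg_H]])
  qed
  finally show ?thesis by (rule weqI[OF A(1) C(2)])
qed

lemma equiv_witt_rel: "equiv (regular_forms R) (witt_rel R)"
proof (rule equivI)
  show "witt_rel R \<subseteq> regular_forms R \<times> regular_forms R" by (auto simp: witt_rel_def)
  show "refl_on (regular_forms R) (witt_rel R)"
    using weq_refl by (auto simp: refl_on_def regular_iff)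
  show "sym (witt_rel R)" using weq_sym by (auto intro: symI)
  show "trans (witt_rel R)" using weq_trans by (auto intro: transI)
qed

lemma weq_perp:
  assumes "weq A A'" "weq B B'" shows "weq (A \<bottom> B) (A' \<bottom> B')"
proof -
  from weqE[OF assms(1)] obtain n n' m m' where A: "A \<in> reg R n" "A' \<in> reg R n'" "n + 2 * m = n' + 2 * m'"
    "eqv (n + 2 * m) (A \<bottom> H m) (A' \<bottom> H m')" .
  from weqE[OF assms(2)] obtain p p' k k' where B: "B \<in> reg R p" "B' \<in> reg R p'" "p + 2 * k = p' + 2 * k'"
    "eqv (p + 2 * k) (B \<bottom> H k) (B' \<bottom> H k')" .
  have 1: "eqv (n + p + (2 * m + 2 * k)) ((A \<bottom> B) \<bottom> H (m + k)) ((A \<bottom> H m) \<bottom> (B \<bottom> H k))"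
    unfolding H_add by (rule eqv_swap[OF A(1) B(1) reg_H reg_H])
  have 2: "eqv (n' + p' + (2 * m' + 2 * k')) ((A' \<bottom> B') \<bottom> H (m' + k')) ((A' \<bottom> H m') \<bottom> (B' \<bottom> H k'))"
    unfolding H_add by (rule eqv_swap[OF A(2) B(2) reg_H reg_H])
  have 3: "eqv (n + 2 * m + (p + 2 * k)) ((A \<bottom> H m) \<bottom> (B \<bottom> H k)) ((A' \<bottom> H m') \<bottom> (B' \<bottom> H k'))"
    by (rule eqv_perp[OF A(4) B(4)])
  have n: "n + 2 * m + (p + 2 * k) = n + p + (2 * m + 2 * k)" "n' + p' + (2 * m' + 2 * k') = n + p + (2 * m + 2 * k)"
    using A(3) B(3) by auto
  have "eqv (n + p + (2 * m + 2 * k)) ((A \<bottom> B) \<bottom> H (m + k)) ((A' \<bottom> B') \<bottom> H (m' + k'))"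
    by (rule eqv_trans[OF eqv_trans[OF 1 3[unfolded n]] eqv_sym[OF 2[unfolded n]]])
  then show ?thesis by (rule weqI[OF reg_perp[OF R A(1) B(1)] reg_perp[OF R A(2) B(2)]])
qed

text \<open>In equal dimension the same number of hyperbolic planes has been added on both sides,
  and they cancel.\<close>

lemma weq_same_dim:
  assumes "weq Q Q'" "Q \<in> reg R n" "Q' \<in> reg R n" shows "eqv n Q Q'"
proof -
  from weqE[OF assms(1)] obtain p p' m m' where A: "Q \<in> reg R p" "Q' \<in> reg R p'" "p + 2 * m = p' + 2 * m'"
    "eqv (p + 2 * m) (Q \<bottom> H m) (Q' \<bottom> H m')" .
  have "p = n" "p' = n" using reg_dim[OF A(1)] reg_dim[OF A(2)] reg_dim[OF assms(2)] reg_dim[OF assms(3)] by simp_all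
  then show ?thesis using eqv_cancel_right[OF _ reg_H assms(2,3), of m] A by simp
qed

lemma weq_perp_H: "Q \<in> reg R n ==> weq Q (Q \<bottom> H m)"
proof -
  assume Q: "Q \<in> reg R n"
  have "H m \<bottom> H 0 = H m" by (simp add: H_0 perp_Nil_right[OF R])
  then have "eqv (n + 2 * m) (Q \<bottom> H m) ((Q \<bottom> H m) \<bottom> H 0)"
    using eqv_refl[OF reg_perp[OF R Q reg_H]] by (simp add: perp_assoc[OF R])
  then show ?thesis by (rule weqI[OF Q reg_perp[OF R Q reg_H]])
qed

lemma weq_even: "weq Q Q' ==> Q \<in> reg R n ==> Q' \<in> reg R n' ==> even n \<longleftrightarrow> even n'"
proof -
  assume a: "weq Q Q'" "Q \<in> reg R n" "Q' \<in> reg R n'"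
  from weqE[OF a(1)] obtain p p' m m' where A: "Q \<in> reg R p" "Q' \<in> reg R p'" "p + 2 * m = p' + 2 * m'"
    "eqv (p + 2 * m) (Q \<bottom> H m) (Q' \<bottom> H m')" .
  have "p = n" "p' = n'" using reg_dim[OF A(1)] reg_dim[OF A(2)] reg_dim[OF a(2)] reg_dim[OF a(3)] by simp_all
  then show ?thesis using A(3) by presburger
qed

abbreviation cls :: "'a mat => 'a mat set" where "cls \<equiv> witt_class R"

lemma cls_eq_iff: "Q \<in> reg R n ==> Q' \<in> reg R n' ==> cls Q = cls Q' \<longleftrightarrow> weq Q Q'"
  unfolding witt_class_def using eq_equiv_class_iff[OF equiv_witt_rel] reg_regular by blast

lemma cls_self: "Q \<in> reg R n ==> Q \<in> cls Q"
  unfolding witt_class_def using weq_refl by blast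

lemma cls_memD: "A \<in> cls Q ==> weq Q A"
  unfolding witt_class_def by blast

lemma carrier_witt: "carrier (witt_ring R) = regular_forms R // witt_rel R"
  by (simp add: witt_ring_def)

lemma cls_carrier: "Q \<in> reg R n ==> cls Q \<in> carrier (witt_ring R)"
  unfolding carrier_witt witt_class_def by (rule quotientI[OF reg_regular])

lemma witt_carrierE:
  assumes "Z \<in> carrier (witt_ring R)"
  obtains Q n where "Q \<in> reg R n" "Z = cls Q"
  using assms unfolding carrier_witt witt_class_def quotient_def by (auto simp: regular_iff)

text \<open>Operations on Witt classes are defined as unions over all representatives; when the
  members of such a union coincide, it collapses to their common value.\<close>

lemma UN_cls:
  assumes "Q \<in> reg R n" "\<And>A. weq Q A ==> f A = c"
  shows "(\<Union>A\<in>cls Q. f A) = c"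
  using cls_self[OF assms(1)] assms(2) cls_memD by blast

lemma witt_add:
  assumes "A \<in> reg R n" "B \<in> reg R m"
  shows "cls A \<oplus>\<^bsub>witt_ring R\<^esub> cls B = cls (A \<bottom> B)"
proof -
  have "cls (A' \<bottom> B') = cls (A \<bottom> B)" if w: "weq A A'" "weq B B'" for A' B'
  proof -
    have "weq (A' \<bottom> B') (A \<bottom> B)" by (rule weq_sym[OF weq_perp[OF w]])
    then show ?thesis
      using eq_equiv_class_iff[OF equiv_witt_rel] unfolding witt_class_def by (auto simp: witt_rel_def)
  qed
  then have "(\<Union>A'\<in>cls A. \<Union>B'\<in>cls B. cls (A' \<bottom> B')) = cls (A \<bottom> B)"
    by (intro UN_cls[OF assms(1)] UN_cls[OF assms(2)])
  then show ?thesis by (simp add: witt_ring_def)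
qed

lemma witt_zero: "\<zero>\<^bsub>witt_ring R\<^esub> = cls (diag_form R [])"
  by (simp add: witt_ring_def)

lemma reg_nil: "diag_form R [] \<in> reg R 0" by (rule reg_Nil[OF R])

text \<open>By cancellation a form that becomes hyperbolic after adding hyperbolic planes is already
  hyperbolic.\<close>

lemma cls_zero_iff:
  assumes "Q \<in> reg R n"
  shows "cls Q = \<zero>\<^bsub>witt_ring R\<^esub> \<longleftrightarrow> (\<exists>k. n = 2 * k \<and> eqv n Q (H k))"
proof
  assume "cls Q = \<zero>\<^bsub>witt_ring R\<^esub>"
  then have "weq Q (diag_form R [])" using cls_eq_iff[OF assms reg_nil] by (simp add: witt_zero)
  from weqE[OF this] obtain p p' m m' where A: "Q \<in> reg R p" "diag_form R [] \<in> reg R p'" "p + 2 * m = p' + 2 * m'"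
    "eqv (p + 2 * m) (Q \<bottom> H m) (diag_form R [] \<bottom> H m')" .
  have p: "p = n" "p' = 0" using reg_dim[OF A(1)] reg_dim[OF A(2)] reg_dim[OF assms] reg_dim[OF reg_nil] by simp_all
  have k: "m' = (m' - m) + m" "n = 2 * (m' - m)" using A(3) p by linarith+
  define k where "k = m' - m"
  note k = k[folded k_def]
  have "eqv (n + 2 * m) (Q \<bottom> H m) (H k \<bottom> H m)"
    using A(4) p k(1) by (simp add: perp_Nil_left[OF R] H_add)
  then have "eqv n Q (H k)" using eqv_cancel_right[OF _ reg_H assms] reg_H[of k] k by simp
  then show "\<exists>k. n = 2 * k \<and> eqv n Q (H k)" using k by blast
next
  assume "\<exists>k. n = 2 * k \<and> eqv n Q (H k)"
  then obtain k where k: "n = 2 * k" "eqv n Q (H k)" by blast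
  have "weq (diag_form R []) (H k)" using weq_perp_H[OF reg_nil, of k] by (simp add: perp_Nil_left[OF R])
  then have "weq Q (diag_form R [])" using weq_trans[OF weq_of_eqv[OF k(2)]] weq_sym by blast
  then show "cls Q = \<zero>\<^bsub>witt_ring R\<^esub>" using cls_eq_iff[OF assms reg_nil] by (simp add: witt_zero)
qed

lemma witt_neg: "Q \<in> reg R n ==> cls (oppos R Q) \<oplus>\<^bsub>witt_ring R\<^esub> cls Q = \<zero>\<^bsub>witt_ring R\<^esub>"
proof -
  assume Q: "Q \<in> reg R n"
  note O = reg_oppos[OF R Q]
  have "eqv (n + n) (oppos R Q \<bottom> Q) (H n)"
    using eqv_trans[OF eqv_comm[OF O Q]] perp_oppos_hyperbolic[OF Q] by (simp add: mult_2)
  then show ?thesis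
    using witt_add[OF O Q] cls_zero_iff[OF reg_perp[OF R O Q]] by (auto simp: mult_2)
qed

lemma comm_group_witt: "comm_group (witt_group R)"
proof (rule comm_groupI, simp_all)
  fix x y assume "x \<in> carrier (witt_ring R)" "y \<in> carrier (witt_ring R)"
  then obtain A n B m where A: "A \<in> reg R n" "x = cls A" and B: "B \<in> reg R m" "y = cls B"
    using witt_carrierE by metis
  show "x \<oplus>\<^bsub>witt_ring R\<^esub> y \<in> carrier (witt_ring R)"
    using witt_add[OF A(1) B(1)] cls_carrier[OF reg_perp[OF R A(1) B(1)]] A B by simp
  show "x \<oplus>\<^bsub>witt_ring R\<^esub> y = y \<oplus>\<^bsub>witt_ring R\<^esub> x"
  proof -
    have "cls (A \<bottom> B) = cls (B \<bottom> A)"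
      using cls_eq_iff[OF reg_perp[OF R A(1) B(1)] reg_perp[OF R B(1) A(1)]] weq_of_eqv[OF eqv_comm[OF A(1) B(1)]] by simp
    then show ?thesis using A B witt_add by simp
  qed
  fix z assume "z \<in> carrier (witt_ring R)"
  then obtain C k where C: "C \<in> reg R k" "z = cls C" by (rule witt_carrierE)
  show "x \<oplus>\<^bsub>witt_ring R\<^esub> y \<oplus>\<^bsub>witt_ring R\<^esub> z = x \<oplus>\<^bsub>witt_ring R\<^esub> (y \<oplus>\<^bsub>witt_ring R\<^esub> z)"
    using A B C by (simp add: witt_add[OF A(1) B(1)] witt_add[OF B(1) C(1)] witt_add[OF A(1) reg_perp[OF R B(1) C(1)]]
      witt_add[OF reg_perp[OF R A(1) B(1)] C(1)] perp_assoc[OF R])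
next
  show "\<zero>\<^bsub>witt_ring R\<^esub> \<in> carrier (witt_ring R)" using cls_carrier[OF reg_nil] by (simp add: witt_zero)
  fix x assume "x \<in> carrier (witt_ring R)"
  then obtain A n where A: "A \<in> reg R n" "x = cls A" by (rule witt_carrierE)
  show "\<zero>\<^bsub>witt_ring R\<^esub> \<oplus>\<^bsub>witt_ring R\<^esub> x = x"
    using witt_add[OF reg_nil A(1)] A by (simp add: witt_zero perp_Nil_left[OF R])
  show "\<exists>y\<in>carrier (witt_ring R). y \<oplus>\<^bsub>witt_ring R\<^esub> x = \<zero>\<^bsub>witt_ring R\<^esub>"
    using witt_neg[OF A(1)] cls_carrier[OF reg_oppos[OF R A(1)]] A by blast
qed

end

context
  fixes R :: "'a ring" (structure) and S :: "'b ring" and h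
  assumes R: "form_field R" and S: "form_field S" and h: "h \<in> Ring.ring_hom R S"
begin

interpretation R: form_field R by (rule R)
interpretation S: form_field S by (rule S)

lemma map_weq:
  assumes "(Q, Q') \<in> witt_rel R" shows "(map_mat h Q, map_mat h Q') \<in> witt_rel S"
proof -
  from R.weqE[OF assms] obtain p p' m m' where A: "Q \<in> reg R p" "Q' \<in> reg R p'" "p + 2 * m = p' + 2 * m'"
    "R.eqv (p + 2 * m) (Q \<bottom> R.H m) (Q' \<bottom> R.H m')" .
  have "isometric S (map_mat h (Q \<bottom> R.H m)) (map_mat h (Q' \<bottom> R.H m'))"
    by (rule isometric_map[OF R.R S.R h R.eqvD(3)[OF A(4)] reg_rmat[OF R.eqvD(2)[OF A(4)]]])
  then have iso: "isometric S (map_mat h Q \<bottom>\<^bsub>S\<^esub> S.H m) (map_mat h Q' \<bottom>\<^bsub>S\<^esub> S.H m')"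
    unfolding map_perp[OF R.R S.R h] map_hyperbolic_space[OF R.R S.R h] .
  show ?thesis
    by (rule S.weqI[OF reg_map[OF R.R S.R h A(1)] reg_map[OF R.R S.R h A(2)]
          S.eqvI[OF iso reg_perp[OF S.R reg_map[OF R.R S.R h A(2)] S.reg_H]]])
qed

lemma witt_res_cls:
  assumes "Q \<in> reg R n" shows "witt_res S h (witt_class R Q) = witt_class S (map_mat h Q)"
  unfolding witt_res_def
proof (rule R.UN_cls[OF assms])
  fix A assume "(Q, A) \<in> witt_rel R"
  from map_weq[OF this] have "(map_mat h A, map_mat h Q) \<in> witt_rel S" by (rule S.weq_sym)
  then show "witt_class S (map_mat h A) = witt_class S (map_mat h Q)"
    using eq_equiv_class_iff[OF S.equiv_witt_rel] unfolding witt_class_def by (auto simp: witt_rel_def)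
qed

lemma witt_res_hom: "witt_res S h \<in> hom (witt_group R) (witt_group S)"
proof (rule homI)
  fix x assume "x \<in> carrier (witt_group R)"
  then obtain A n where A: "A \<in> reg R n" "x = witt_class R A" using R.witt_carrierE by auto
  show "witt_res S h x \<in> carrier (witt_group S)"
    using witt_res_cls[OF A(1)] S.cls_carrier[OF reg_map[OF R.R S.R h A(1)]] A by simp
  fix y assume "y \<in> carrier (witt_group R)"
  then obtain B m where B: "B \<in> reg R m" "y = witt_class R B" using R.witt_carrierE by auto
  show "witt_res S h (x \<otimes>\<^bsub>witt_group R\<^esub> y) = witt_res S h x \<otimes>\<^bsub>witt_group S\<^esub> witt_res S h y"
    using A B by (simp add: R.witt_add[OF A(1) B(1)] witt_res_cls[OF A(1)] witt_res_cls[OF B(1)]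
      witt_res_cls[OF reg_perp[OF R.R A(1) B(1)]] map_perp[OF R.R S.R h]
      S.witt_add[OF reg_map[OF R.R S.R h A(1)] reg_map[OF R.R S.R h B(1)]])
qed

end

section \<open>Matrices over products of fields as families, and maps between such products\<close>

section \<open>Products of fields\<close>

lemma product_ring_simps [simp]:
  "carrier (product_ring V K) = (\<Pi>\<^sub>E v\<in>V. carrier (K v))"
  "x \<otimes>\<^bsub>product_ring V K\<^esub> y = (\<lambda>v\<in>V. x v \<otimes>\<^bsub>K v\<^esub> y v)"
  "x \<oplus>\<^bsub>product_ring V K\<^esub> y = (\<lambda>v\<in>V. x v \<oplus>\<^bsub>K v\<^esub> y v)"
  "\<one>\<^bsub>product_ring V K\<^esub> = (\<lambda>v\<in>V. \<one>\<^bsub>K v\<^esub>)"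
  "\<zero>\<^bsub>product_ring V K\<^esub> = (\<lambda>v\<in>V. \<zero>\<^bsub>K v\<^esub>)"
  by (simp_all add: product_ring_def)

definition glue :: "'v set => nat => nat => ('v => 'k mat) => ('v => 'k) mat" where
  "glue V n m M = mat n m (\<lambda>ij. \<lambda>v\<in>V. M v $$ ij)"

abbreviation cp :: "'v => ('v => 'k) mat => 'k mat" where
  "cp v M \<equiv> map_mat (\<lambda>x. x v) M"

context
  fixes V :: "'v set" and K :: "'v => 'k ring"
  assumes rg: "ring (product_ring V K)" and fld: "\<And>v. v \<in> V ==> field (K v)"
begin

lemma Kcring: "v \<in> V ==> cring (K v)"
  using fld by (simp add: field.axioms(1) domain.axioms(1))

lemma cring_product: "cring (product_ring V K)"
proof -
  interpret ring "product_ring V K" by (rule rg)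
  show ?thesis
  proof unfold_locales
    fix x y assume "x \<in> carrier (product_ring V K)" "y \<in> carrier (product_ring V K)"
    then show "x \<otimes>\<^bsub>product_ring V K\<^esub> y = y \<otimes>\<^bsub>product_ring V K\<^esub> x"
      by (auto intro!: restrict_ext cring.cring_simprules(14)[OF Kcring])
  qed
qed

lemma proj_hom: "v \<in> V ==> (\<lambda>x. x v) \<in> Ring.ring_hom (product_ring V K) (K v)"
  by (rule ring_hom_memI) auto

lemma cp_ext:
  assumes "M \<in> rmat (product_ring V K) n m" "N \<in> rmat (product_ring V K) n m" "\<And>v. v \<in> V ==> cp v M = cp v N"
  shows "M = N"
proof (intro eq_matI)
  fix i j assume "i < dim_row N" "j < dim_col N"
  then have ij: "i < n" "j < m" and d: "dim_row M = n" "dim_col M = m" "dim_row N = n" "dim_col N = m"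
    using assms by (auto simp: rmat_dims)
  have c: "M $$ (i, j) \<in> (\<Pi>\<^sub>E v\<in>V. carrier (K v))" "N $$ (i, j) \<in> (\<Pi>\<^sub>E v\<in>V. carrier (K v))"
    using rmat_index[OF assms(1) ij] rmat_index[OF assms(2) ij] by simp_all
  have "(M $$ (i, j)) v = (N $$ (i, j)) v" if "v \<in> V" for v
    using arg_cong[OF assms(3)[OF that], of "\<lambda>A. A $$ (i, j)"] ij d by simp
  then show "M $$ (i, j) = N $$ (i, j)" using PiE_ext[OF c] by blast
qed (use assms in \<open>auto simp: rmat_dims\<close>)

lemma glue_rmat: "(\<And>v. v \<in> V ==> M v \<in> rmat (K v) n m) ==> glue V n m M \<in> rmat (product_ring V K) n m"
  by (auto simp: glue_def rmat_iff)

lemma cp_glue: "v \<in> V ==> M v \<in> rmat (K v) n m ==> cp v (glue V n m M) = M v"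
  by (intro eq_matI) (auto simp: glue_def rmat_iff)

lemma cp_rmat: "v \<in> V ==> M \<in> rmat (product_ring V K) n m ==> cp v M \<in> rmat (K v) n m"
  by (rule rmat_map[OF cring_product Kcring proj_hom])

text \<open>Inverses are chosen in the factors and glued; equality of matrices over the product is
  tested in the factors.\<close>

lemma GL_glue:
  assumes "\<And>v. v \<in> V ==> M v \<in> carrier (GL n (K v))"
  shows "glue V n n M \<in> carrier (GL n (product_ring V K))"
proof -
  have "\<forall>v\<in>V. \<exists>B. B \<in> rmat (K v) n n \<and> B \<star>\<^bsub>K v\<^esub> M v = one_m (K v) n \<and> M v \<star>\<^bsub>K v\<^esub> B = one_m (K v) n"
    using assms unfolding GL_iff by blast
  then obtain B where B: "\<And>v. v \<in> V ==> B v \<in> rmat (K v) n n" "\<And>v. v \<in> V ==> B v \<star>\<^bsub>K v\<^esub> M v = one_m (K v) n"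
    "\<And>v. v \<in> V ==> M v \<star>\<^bsub>K v\<^esub> B v = one_m (K v) n" by metis
  have M: "M v \<in> rmat (K v) n n" if "v \<in> V" for v using assms[OF that] by (rule GL_rmat)
  have gM: "glue V n n M \<in> rmat (product_ring V K) n n" and gB: "glue V n n B \<in> rmat (product_ring V K) n n"
    using glue_rmat[of M] glue_rmat[of B] M B(1) by auto
  have cg: "cp v (glue V n n M) = M v" "cp v (glue V n n B) = B v" if "v \<in> V" for v
    using cp_glue[of v M n n] cp_glue[of v B n n] M B(1) that by auto
  interpret P: cring "product_ring V K" by (rule cring_product)
  have "glue V n n B \<star>\<^bsub>product_ring V K\<^esub> glue V n n M = one_m (product_ring V K) n"
    by (rule cp_ext[OF P.rmat_prod[OF gB gM] P.rmat_one])
      (simp add: map_mat_prod[OF cring_product Kcring proj_hom gB gM] map_one_m[OF cring_product Kcring proj_hom] cg B(2))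
  moreover have "glue V n n M \<star>\<^bsub>product_ring V K\<^esub> glue V n n B = one_m (product_ring V K) n"
    by (rule cp_ext[OF P.rmat_prod[OF gM gB] P.rmat_one])
      (simp add: map_mat_prod[OF cring_product Kcring proj_hom gM gB] map_one_m[OF cring_product Kcring proj_hom] cg B(3))
  ultimately show ?thesis unfolding GL_iff using gM gB by blast
qed

lemma GL_cp: "v \<in> V ==> M \<in> carrier (GL n (product_ring V K)) ==> cp v M \<in> carrier (GL n (K v))"
  by (rule map_GL[OF cring_product Kcring proj_hom])

lemma cp_pullback: "v \<in> V ==> Q \<in> rmat (product_ring V K) n n ==> C \<in> rmat (product_ring V K) n m ==>
    cp v (pullback (product_ring V K) Q C) = pullback (K v) (cp v Q) (cp v C)"
  by (rule map_pullback[OF cring_product Kcring proj_hom])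

lemma cp_det: "v \<in> V ==> M \<in> rmat (product_ring V K) n n ==> mat_det (product_ring V K) M v = mat_det (K v) (cp v M)"
  by (rule map_mat_det[OF cring_product Kcring proj_hom])

end

text \<open>The map to the field at \<open>w\<close> induced by \<open>b\<close> on the one factor
  that it sees, spelled as in \<open>witt_res_prod\<close>.\<close>

definition factor_hom :: "'v set => ('v => 'k ring) => (('v => 'k) => 'v => 'k) => 'v => 'k => 'k" where
  "factor_hom V K b w x = b (factor_incl V K (factor_below V K b w) x) w"

text \<open>The idempotents \<open>e v\<close> go to pairwise orthogonal idempotents of the field at
  \<open>w\<close> with sum one, so exactly one of them goes to one and the others to zero.
  Multiplying by that idempotent does not change the w-component of the image, which therefore
  depends on one coordinate only.\<close>

lemma factor_below_props:
  assumes rg: "ring (product_ring V K)" "ring (product_ring W K)"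
    and fld: "\<And>v. v \<in> V ==> field (K v)" "\<And>v. v \<in> W ==> field (K v)"
    and fin: "finite V" and b: "b \<in> Ring.ring_hom (product_ring V K) (product_ring W K)" and w: "w \<in> W"
  shows "factor_below V K b w \<in> V"
    and "factor_hom V K b w \<in> Ring.ring_hom (K (factor_below V K b w)) (K w)"
    and "x \<in> carrier (product_ring V K) ==> b x w = factor_hom V K b w (x (factor_below V K b w))"
proof -
  let ?P = "product_ring V K"
  interpret P: cring ?P by (rule cring_product[OF rg(1) fld(1)])
  interpret Kw: field "K w" by (rule fld(2)[OF w])
  define \<phi> where "\<phi> = (\<lambda>x. b x w)"
  have \<phi>hom: "\<phi> \<in> Ring.ring_hom ?P (K w)"
    using ring_hom_trans[OF b proj_hom[OF rg(2) fld(2) w]] by (simp add: \<phi>_def comp_def)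
  interpret \<phi>: ring_hom_cring ?P "K w" \<phi> by (intro hom_cringI P.is_cring Kw.is_cring \<phi>hom)
  have Kr: "ring (K v)" "monoid (K v)" "cring (K v)" if "v \<in> V" for v
    using fld(1)[OF that] by (simp_all add: field.is_ring ring.is_monoid field.axioms(1) domain.axioms(1))
  define e where "e = (\<lambda>v. factor_incl V K v \<one>\<^bsub>K v\<^esub>)"
  have incl: "factor_incl V K v x \<in> carrier ?P" if "v \<in> V" "x \<in> carrier (K v)" for v x
    using that Kr by (auto simp: factor_incl_def ring.ring_simprules(2))
  have ec: "e v \<in> carrier ?P" if "v \<in> V" for v
    unfolding e_def using that Kr by (intro incl) (auto simp: ring.ring_simprules(6))
  have ee: "e v \<otimes>\<^bsub>?P\<^esub> e v = e v" if "v \<in> V" for v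
    using that Kr by (auto simp: e_def factor_incl_def cring.cring_simprules(2,6,12,26) intro!: restrict_ext)
  have eu: "e u \<otimes>\<^bsub>?P\<^esub> e v = \<zero>\<^bsub>?P\<^esub>" if "v \<in> V" "u \<in> V" "u \<noteq> v" for u v
    using that Kr by (auto simp: e_def factor_incl_def cring.cring_simprules(2,6,26,27) intro!: restrict_ext)
  have "\<exists>v\<in>V. \<phi> (e v) \<noteq> \<zero>\<^bsub>K w\<^esub>"
  proof (rule ccontr)
    assume neg: "\<not> ?thesis"
    \<comment> \<open>Additivity, one index at a time; with all of the finite set \<open>V\<close>
      it would follow that one goes to zero.\<close>
    have "\<phi> (\<lambda>v\<in>V. if v \<in> S then \<one>\<^bsub>K v\<^esub> else \<zero>\<^bsub>K v\<^esub>) = \<zero>\<^bsub>K w\<^esub>" if "S \<subseteq> V" for S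
      using finite_subset[OF that fin] that
    proof (induction S rule: finite_induct)
      case empty
      then show ?case using \<phi>.hom_zero by (simp add: restrict_def)
    next
      case (insert u S)
      have "(\<lambda>v\<in>V. if v \<in> insert u S then \<one>\<^bsub>K v\<^esub> else \<zero>\<^bsub>K v\<^esub>) = (\<lambda>v\<in>V. if v \<in> S then \<one>\<^bsub>K v\<^esub> else \<zero>\<^bsub>K v\<^esub>) \<oplus>\<^bsub>?P\<^esub> e u"
        using insert Kr by (auto simp: e_def factor_incl_def cring.cring_simprules(2,6,8,16) intro!: restrict_ext)
      moreover have "(\<lambda>v\<in>V. if v \<in> S then \<one>\<^bsub>K v\<^esub> else \<zero>\<^bsub>K v\<^esub>) \<in> carrier ?P"
        using Kr by (auto simp: cring.cring_simprules(2,6))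
      moreover have "u \<in> V" "\<phi> (e u) = \<zero>\<^bsub>K w\<^esub>" "\<phi> (\<lambda>v\<in>V. if v \<in> S then \<one>\<^bsub>K v\<^esub> else \<zero>\<^bsub>K v\<^esub>) = \<zero>\<^bsub>K w\<^esub>"
        using insert.prems neg insert.IH by blast+
      ultimately show ?case using \<phi>.hom_add[OF _ ec[of u]] Kw.zero_closed Kw.r_zero by metis
    qed
    from this[of V] have "\<phi> (\<lambda>v\<in>V. \<one>\<^bsub>K v\<^esub>) = \<zero>\<^bsub>K w\<^esub>" by (simp cong: restrict_cong)
    then show False using \<phi>.hom_one by simp
  qed
  then obtain v where v: "v \<in> V" "\<phi> (e v) \<noteq> \<zero>\<^bsub>K w\<^esub>" by blast
  have uniq: "u = v" if "u \<in> V" "\<phi> (e u) \<noteq> \<zero>\<^bsub>K w\<^esub>" for u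
  proof (rule ccontr)
    assume "u \<noteq> v"
    then have "\<phi> (e u) \<otimes>\<^bsub>K w\<^esub> \<phi> (e v) = \<zero>\<^bsub>K w\<^esub>"
      using eu[OF v(1) that(1)] \<phi>.hom_mult[OF ec[OF that(1)] ec[OF v(1)]] \<phi>.hom_zero by simp
    then show False using Kw.integral[of "\<phi> (e u)" "\<phi> (e v)"] that v ec by auto
  qed
  have "factor_below V K b w = (THE v. v \<in> V \<and> \<phi> (e v) \<noteq> \<zero>\<^bsub>K w\<^esub>)"
    unfolding factor_below_def \<phi>_def e_def ..
  also have "\<dots> = v" by (rule the_equality) (use v uniq in blast)+
  finally have fb: "factor_below V K b w = v" .
  have "\<phi> (e v) \<otimes>\<^bsub>K w\<^esub> \<phi> (e v) = \<phi> (e v) \<otimes>\<^bsub>K w\<^esub> \<one>\<^bsub>K w\<^esub>"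
    using ee[OF v(1)] \<phi>.hom_mult[OF ec[OF v(1)] ec[OF v(1)]] ec[OF v(1)] by simp
  then have ev1: "\<phi> (e v) = \<one>\<^bsub>K w\<^esub>" using v(2) ec[OF v(1)] Kw.m_lcancel[of "\<phi> (e v)" "\<phi> (e v)" "\<one>\<^bsub>K w\<^esub>"] by simp
  show "factor_below V K b w \<in> V" using fb v by simp
  have fh: "factor_hom V K b w y = \<phi> (factor_incl V K v y)" for y by (simp add: factor_hom_def fb \<phi>_def)
  show "factor_hom V K b w \<in> Ring.ring_hom (K (factor_below V K b w)) (K w)"
    unfolding fb
  proof (rule ring_hom_memI)
    fix x assume x: "x \<in> carrier (K v)"
    show "factor_hom V K b w x \<in> carrier (K w)" using fh incl[OF v(1) x] by simp
    fix y assume y: "y \<in> carrier (K v)"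
    have "factor_incl V K v (x \<otimes>\<^bsub>K v\<^esub> y) = factor_incl V K v x \<otimes>\<^bsub>?P\<^esub> factor_incl V K v y"
      using Kr x y by (auto simp: factor_incl_def cring.cring_simprules(2,26) intro!: restrict_ext)
    then show "factor_hom V K b w (x \<otimes>\<^bsub>K v\<^esub> y) = factor_hom V K b w x \<otimes>\<^bsub>K w\<^esub> factor_hom V K b w y"
      using fh \<phi>.hom_mult[OF incl[OF v(1) x] incl[OF v(1) y]] by simp
    have "factor_incl V K v (x \<oplus>\<^bsub>K v\<^esub> y) = factor_incl V K v x \<oplus>\<^bsub>?P\<^esub> factor_incl V K v y"
      using Kr x y by (auto simp: factor_incl_def cring.cring_simprules(2,8) intro!: restrict_ext)
    then show "factor_hom V K b w (x \<oplus>\<^bsub>K v\<^esub> y) = factor_hom V K b w x \<oplus>\<^bsub>K w\<^esub> factor_hom V K b w y"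
      using fh \<phi>.hom_add[OF incl[OF v(1) x] incl[OF v(1) y]] by simp
  next
    show "factor_hom V K b w \<one>\<^bsub>K v\<^esub> = \<one>\<^bsub>K w\<^esub>" using fh ev1 by (simp add: e_def)
  qed
  assume x: "x \<in> carrier ?P"
  have xv: "x v \<in> carrier (K v)" using x v by auto
  have "x u \<in> carrier (K u)" if "u \<in> V" for u using x that by auto
  then have "factor_incl V K v (x v) = x \<otimes>\<^bsub>?P\<^esub> e v"
    using Kr v(1) by (auto simp: e_def factor_incl_def cring.cring_simprules(2,6,27) cring.cring_simprules(2,6,12) monoid.r_one intro!: restrict_ext)
  then have "\<phi> (factor_incl V K v (x v)) = \<phi> x"
    using \<phi>.hom_mult[OF x ec[OF v(1)]] ev1 x by simp
  then show "b x w = factor_hom V K b w (x (factor_below V K b w))" using fh fb by (simp add: \<phi>_def)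
qed

declare product_ring_simps [simp del]

section \<open>The patching diamond: descent of matrices and of single elements\<close>

section \<open>Patching quadratic forms\<close>

lemma SO_carrier: "g \<in> carrier (SO S Q) \<longleftrightarrow> g \<in> carrier (GL (dim_row Q) S) \<and> pullback S Q g = Q \<and> mat_det S g = \<one>\<^bsub>S\<^esub>"
  by (auto simp: SO_def pullback_def)

lemma mult_SO: "monoid.mult (SO S Q) = mat_prod S"
  by (simp add: SO_def mult_GL)

lemma map_mat_inj:
  assumes "inj_on h (carrier R)" "A \<in> rmat R n m" "B \<in> rmat R n m" "map_mat h A = map_mat h B"
  shows "A = B"
proof (intro eq_matI)
  fix i j assume "i < dim_row B" "j < dim_col B"
  then have ij: "i < n" "j < m" using assms(3) by (auto simp: rmat_dims)
  have "h (A $$ (i, j)) = h (B $$ (i, j))"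
    using arg_cong[OF assms(4), of "\<lambda>M. M $$ (i, j)"] ij assms(2,3) by (simp add: rmat_dims)
  then show "A $$ (i, j) = B $$ (i, j)"
    using inj_onD[OF assms(1)] rmat_index[OF assms(2) ij] rmat_index[OF assms(3) ij] by blast
qed (use assms in \<open>auto simp: rmat_dims\<close>)

locale patching_diamond =
  fixes F :: "'f ring" (structure) and K :: "'v => 'k ring" and V0 V1 V2 :: "'v set"
    and a1 a2 :: "'f => 'v => 'k" and b1 b2 :: "('v => 'k) => 'v => 'k"
  assumes field_F: "field F" and two_F: "\<one> \<oplus> \<one> \<noteq> \<zero>"
    and fin: "finite V0" "finite V1" "finite V2"
    and disj: "V0 \<inter> V1 = {}" "V0 \<inter> V2 = {}" "V1 \<inter> V2 = {}"
    and field_K: "\<And>v. v \<in> V0 \<union> V1 \<union> V2 ==> field (K v)"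
    and diamond: "injective_diamond F (product_ring V1 K) (product_ring V2 K) (product_ring V0 K) a1 a2 b1 b2"
    and patch: "patching F (product_ring V1 K) (product_ring V2 K) (product_ring V0 K) a1 a2 b1 b2"
    and SO_fact: "\<And>n. n > 0 ==>
      SO_factorization (hyperbolic_space F n) (product_ring V1 K) (product_ring V2 K) (product_ring V0 K) a1 a2 b1 b2"
begin

abbreviation "V12 \<equiv> V1 \<union> V2"
abbreviation "VV \<equiv> V0 \<union> V1 \<union> V2"
abbreviation "F0 \<equiv> product_ring V0 K"
abbreviation "F1 \<equiv> product_ring V1 K"
abbreviation "F2 \<equiv> product_ring V2 K"

text \<open>One notation for the embeddings of \<open>F\<close> into the fields at all three index
  sets, which are disjoint. At \<open>V0\<close> the route is through \<open>F1\<close>; by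
  commutativity it agrees with the one through \<open>F2\<close>.\<close>

definition e :: "'v => 'f => 'k" where
  "e = (\<lambda>v x. if v \<in> V1 then a1 x v else if v \<in> V2 then a2 x v else b1 (a1 x) v)"

lemma rings: "ring F" "ring F1" "ring F2" "ring F0"
  and homs: "a1 \<in> Ring.ring_hom F F1" "a2 \<in> Ring.ring_hom F F2" "b1 \<in> Ring.ring_hom F1 F0" "b2 \<in> Ring.ring_hom F2 F0"
  and injs: "inj_on a1 (carrier F)" "inj_on a2 (carrier F)" "inj_on b1 (carrier F1)" "inj_on b2 (carrier F2)"
  and commutes: "x \<in> carrier F ==> b1 (a1 x) = b2 (a2 x)"
  using diamond by (auto simp: injective_diamond_def)

lemma cr: "cring F" "cring F1" "cring F2" "cring F0"
  using field_F cring_product[OF rings(2)] cring_product[OF rings(3)] cring_product[OF rings(4)] field_K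
  by (auto simp: field.axioms(1) domain.axioms(1))

lemmas ha1 = cr(1,2) homs(1) and ha2 = cr(1,3) homs(2) and hb1 = cr(2,4) homs(3) and hb2 = cr(3,4) homs(4)

lemma hom_b1a1: "b1 \<circ> a1 \<in> Ring.ring_hom F F0"
  by (rule ring_hom_trans[OF homs(1,3)])

lemma e_hom: "v \<in> VV ==> e v \<in> Ring.ring_hom F (K v)"
proof -
  assume v: "v \<in> VV"
  consider "v \<in> V1" | "v \<in> V2" "v \<notin> V1" | "v \<in> V0" "v \<notin> V1" "v \<notin> V2" using v by blast
  then show ?thesis
  proof cases
    case 1
    then have "e v = (\<lambda>x. x v) \<circ> a1" by (auto simp: e_def)
    then show ?thesis using ring_hom_trans[OF homs(1) proj_hom[OF rings(2) field_K]] 1 by auto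
  next
    case 2
    then have "e v = (\<lambda>x. x v) \<circ> a2" by (auto simp: e_def)
    then show ?thesis using ring_hom_trans[OF homs(2) proj_hom[OF rings(3) field_K]] 2 by auto
  next
    case 3
    then have "e v = (\<lambda>x. x v) \<circ> (b1 \<circ> a1)" by (auto simp: e_def)
    then show ?thesis using ring_hom_trans[OF hom_b1a1 proj_hom[OF rings(4) field_K]] 3 by auto
  qed
qed

lemma form_F: "form_field F"
  by (intro form_field.intro form_field_axioms.intro field_F two_F)

lemma form_K: "v \<in> VV ==> form_field (K v)"
proof -
  assume v: "v \<in> VV"
  interpret F: field F by (rule field_F)
  interpret Kv: field "K v" by (rule field_K[OF v])
  have inj: "inj_on (e v) (carrier F)" using non_trivial_field_hom_is_inj[OF e_hom[OF v] field_F field_K[OF v]] .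
  have "e v (\<one> \<oplus> \<one>) \<noteq> e v \<zero>"
    using inj_onD[OF inj, of "\<one> \<oplus> \<one>" "\<zero>"] two_F by auto
  then have "\<one>\<^bsub>K v\<^esub> \<oplus>\<^bsub>K v\<^esub> \<one>\<^bsub>K v\<^esub> \<noteq> \<zero>\<^bsub>K v\<^esub>"
    using ring_hom_add[OF e_hom[OF v], of "\<one>" "\<one>"] ring_hom_one[OF e_hom[OF v]] ring_hom_zero[OF e_hom[OF v] F.is_ring Kv.is_ring] by simp
  then show ?thesis by (intro form_field.intro form_field_axioms.intro field_K[OF v])
qed

lemma Kcr: "v \<in> VV ==> cring (K v)"
  using field_K by (simp add: field.axioms(1) domain.axioms(1))

lemma cp_a1: "v \<in> V1 ==> cp v (map_mat a1 M) = map_mat (e v) M"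
  and cp_a2: "v \<in> V2 ==> cp v (map_mat a2 M) = map_mat (e v) M"
  using disj by (auto simp: e_def intro!: eq_matI)

lemma map_commutes: "M \<in> rmat F n m ==> map_mat b1 (map_mat a1 M) = map_mat b2 (map_mat a2 M)"
  by (intro eq_matI) (auto simp: rmat_iff commutes)

lemma map_comp: "map_mat (b1 \<circ> a1) M = map_mat b1 (map_mat a1 M)"
  by (intro eq_matI) auto

text \<open>Patching gives a matrix over \<open>F\<close> with the right image in \<open>F0\<close>;
  injectivity of \<open>b1\<close> and \<open>b2\<close> lifts this equality back to
  \<open>F1\<close> and \<open>F2\<close>.\<close>

lemma GL_descent:
  assumes "n \<ge> 1" "M1 \<in> carrier (GL n F1)" "M2 \<in> carrier (GL n F2)" "map_mat b1 M1 = map_mat b2 M2"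
  obtains M where "M \<in> carrier (GL n F)" "map_mat a1 M = M1" "map_mat a2 M = M2"
proof -
  have "map_mat b1 M1 \<in> map_mat b1 ` carrier (GL n F1) \<inter> map_mat b2 ` carrier (GL n F2)"
    using imageI[OF assms(2), of "map_mat b1"] imageI[OF assms(3), of "map_mat b2"] assms(4) by simp
  then have "map_mat b1 M1 \<in> map_mat (b1 \<circ> a1) ` carrier (GL n F)" using patch assms(1) by (simp add: patching_def)
  then obtain M where M: "M \<in> carrier (GL n F)" "map_mat b1 M1 = map_mat b1 (map_mat a1 M)" by (auto simp: map_comp)
  note Mr = GL_rmat[OF M(1)]
  have "map_mat a1 M = M1"
    by (rule map_mat_inj[OF injs(3) rmat_map[OF ha1 Mr] GL_rmat[OF assms(2)]]) (use M(2) in simp)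
  moreover have "map_mat a2 M = M2"
    by (rule map_mat_inj[OF injs(4) rmat_map[OF ha2 Mr] GL_rmat[OF assms(3)]])
      (use M(2) assms(4) map_commutes[OF Mr] in simp)
  ultimately show ?thesis using that M by blast
qed

lemma GL_factor:
  assumes "n \<ge> 1" "g \<in> carrier (GL n F0)"
  obtains g1 g2 where "g1 \<in> carrier (GL n F1)" "g2 \<in> carrier (GL n F2)" "g = map_mat b1 g1 \<star>\<^bsub>F0\<^esub> map_mat b2 g2"
proof -
  have "factorization (GL n F1) (GL n F2) (GL n F0) (map_mat b1) (map_mat b2)"
    using patch assms(1) by (simp add: patching_def)
  then show ?thesis using that assms(2) unfolding factorization_def mult_GL by blast
qed

text \<open>Patching speaks of invertible matrices only. The element is therefore placed in the
  corner of a unipotent two by two matrix, and descent of that matrix brings the element down to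
  \<open>F\<close>.\<close>

lemma element_descent:
  assumes "x \<in> carrier F1" "y \<in> carrier F2" "b1 x = b2 y"
  obtains z where "z \<in> carrier F" "a1 z = x" "a2 z = y"
proof -
  have U: "four_block_mat (one_m R 1) (mat 1 1 (\<lambda>_. u)) (zero_m R 1 1) (one_m R 1) \<in> carrier (GL 2 R)"
    if R: "cring R" and u: "u \<in> carrier R" for R :: "'r ring" and u
  proof -
    interpret cring R by (rule R)
    let ?U = "\<lambda>u. four_block_mat (one_m R 1) (mat 1 1 (\<lambda>_. u)) (zero_m R 1 1) (one_m R 1)"
    have m: "mat 1 1 (\<lambda>_. v) \<in> rmat R 1 1" if "v \<in> carrier R" for v using that by (auto simp: rmat_iff)
    have r: "?U v \<in> rmat R 2 2" if "v \<in> carrier R" for v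
      using rmat_four_block[OF rmat_one m[OF that] rmat_zero rmat_one] by simp
    have p: "?U v \<star>\<^bsub>R\<^esub> ?U (\<ominus>\<^bsub>R\<^esub> v) = one_m R 2" if v: "v \<in> carrier R" for v
    proof -
      have nv: "\<ominus>\<^bsub>R\<^esub> v \<in> carrier R" using v by simp
      have "add_m R (mat 1 1 (\<lambda>_. \<ominus>\<^bsub>R\<^esub> v)) (mat 1 1 (\<lambda>_. v)) = zero_m R 1 1"
        using v by (intro eq_matI) (auto simp: add_m_def zero_m_def l_neg)
      then have "?U v \<star>\<^bsub>R\<^esub> ?U (\<ominus>\<^bsub>R\<^esub> v) = four_block_mat (one_m R 1) (zero_m R 1 1) (zero_m R 1 1) (one_m R 1)"
        by (subst mat_prod_four_block[OF R rmat_one m[OF v] rmat_zero rmat_one rmat_one m[OF nv] rmat_zero rmat_one])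
          (simp add: mat_one_left[OF R rmat_one] mat_one_left[OF R m[OF nv]] mat_one_right[OF R m[OF v]] mat_zero_right[OF R m[OF v]]
            mat_zero_left[OF R m[OF nv]] mat_one_left[OF R rmat_zero] mat_zero_right[OF R rmat_one] mat_zero_left[OF R rmat_one]
            mat_add_zero_right[OF R rmat_one] mat_add_zero_left[OF R rmat_one] mat_add_zero_right[OF R rmat_zero])
      also have "\<dots> = one_m R 2" using perp_one[OF R, of 1 1] unfolding perp_def by simp
      finally show ?thesis .
    qed
    have nu: "\<ominus>\<^bsub>R\<^esub> u \<in> carrier R" "\<ominus>\<^bsub>R\<^esub> (\<ominus>\<^bsub>R\<^esub> u) = u" using u by auto
    show ?thesis
      unfolding GL_iff using r[OF u] r[OF nu(1)] p[OF u] p[OF nu(1)] nu(2) by auto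
  qed
  define M1 where "M1 = four_block_mat (one_m F1 1) (mat 1 1 (\<lambda>_. x)) (zero_m F1 1 1) (one_m F1 1)"
  define M2 where "M2 = four_block_mat (one_m F2 1) (mat 1 1 (\<lambda>_. y)) (zero_m F2 1 1) (one_m F2 1)"
  have M: "M1 \<in> carrier (GL 2 F1)" "M2 \<in> carrier (GL 2 F2)"
    unfolding M1_def M2_def using U[OF cr(2) assms(1)] U[OF cr(3) assms(2)] by auto
  have "map_mat b1 M1 = four_block_mat (map_mat b1 (one_m F1 1)) (map_mat b1 (mat 1 1 (\<lambda>_. x))) (map_mat b1 (zero_m F1 1 1)) (map_mat b1 (one_m F1 1))"
    unfolding M1_def by (rule map_four_block_mat[of _ 1 1 _ 1 _ 1]) auto
  also have "\<dots> = four_block_mat (map_mat b2 (one_m F2 1)) (map_mat b2 (mat 1 1 (\<lambda>_. y))) (map_mat b2 (zero_m F2 1 1)) (map_mat b2 (one_m F2 1))"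
  proof -
    have "map_mat b1 (mat 1 1 (\<lambda>_. x)) = map_mat b2 (mat 1 1 (\<lambda>_. y))" using assms(3) by (intro eq_matI) auto
    then show ?thesis
      unfolding map_one_m[OF hb1] map_one_m[OF hb2] map_zero_m[OF hb1] map_zero_m[OF hb2] by simp
  qed
  also have "\<dots> = map_mat b2 M2"
    unfolding M2_def by (rule map_four_block_mat[of _ 1 1 _ 1 _ 1, symmetric]) auto
  finally have "map_mat b1 M1 = map_mat b2 M2" .
  from GL_descent[OF _ M this] obtain N where N: "N \<in> carrier (GL 2 F)" "map_mat a1 N = M1" "map_mat a2 N = M2" by auto
  have Nr: "N \<in> rmat F 2 2" using N GL_rmat by auto
  then have d: "dim_row N = 2" "dim_col N = 2" by (auto simp: rmat_dims)
  have "a1 (N $$ (0, 1)) = M1 $$ (0, 1)" "a2 (N $$ (0, 1)) = M2 $$ (0, 1)"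
    using arg_cong[OF N(2), of "\<lambda>M. M $$ (0, 1)"] arg_cong[OF N(3), of "\<lambda>M. M $$ (0, 1)"] d by auto
  then have "a1 (N $$ (0, 1)) = x" "a2 (N $$ (0, 1)) = y" by (auto simp: M1_def M2_def)
  then show ?thesis using that[of "N $$ (0, 1)"] rmat_index[OF Nr, of 0 1] by simp
qed

lemma hyperbolic_SO_factor:
  assumes "n > 0" "g \<in> carrier (GL (2 * n) F0)" "pullback F0 (hyperbolic_space F0 n) g = hyperbolic_space F0 n" "mat_det F0 g = \<one>\<^bsub>F0\<^esub>"
  obtains s1 s2 where "s1 \<in> carrier (GL (2 * n) F1)" "pullback F1 (hyperbolic_space F1 n) s1 = hyperbolic_space F1 n" "mat_det F1 s1 = \<one>\<^bsub>F1\<^esub>"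
    "s2 \<in> carrier (GL (2 * n) F2)" "pullback F2 (hyperbolic_space F2 n) s2 = hyperbolic_space F2 n" "mat_det F2 s2 = \<one>\<^bsub>F2\<^esub>"
    "g = map_mat b1 s1 \<star>\<^bsub>F0\<^esub> map_mat b2 s2"
proof -
  have maps: "map_mat a1 (hyperbolic_space F n) = hyperbolic_space F1 n" "map_mat a2 (hyperbolic_space F n) = hyperbolic_space F2 n"
    "map_mat (b1 \<circ> a1) (hyperbolic_space F n) = hyperbolic_space F0 n"
    using map_hyperbolic_space[OF ha1] map_hyperbolic_space[OF ha2] map_hyperbolic_space[OF cr(1,4) hom_b1a1] by auto
  have dims: "dim_row (hyperbolic_space F1 n) = 2 * n" "dim_row (hyperbolic_space F2 n) = 2 * n" "dim_row (hyperbolic_space F0 n) = 2 * n"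
    using reg_dim[OF reg_hyperbolic_space[OF cr(2)]] reg_dim[OF reg_hyperbolic_space[OF cr(3)]] reg_dim[OF reg_hyperbolic_space[OF cr(4)]] by auto
  have "g \<in> carrier (SO F0 (hyperbolic_space F0 n))" using assms by (simp add: SO_carrier dims)
  then obtain s1 s2 where s: "s1 \<in> carrier (SO F1 (hyperbolic_space F1 n))" "s2 \<in> carrier (SO F2 (hyperbolic_space F2 n))"
    "g = map_mat b1 s1 \<star>\<^bsub>F0\<^esub> map_mat b2 s2"
    using SO_fact[OF assms(1)] unfolding SO_factorization_def factorization_def maps mult_SO by blast
  then show ?thesis using that unfolding SO_carrier dims by blast
qed

end

context
  fixes V :: "'v set" and K :: "'v => 'k ring"
  assumes rg: "ring (product_ring V K)" and fld: "\<And>v. v \<in> V ==> field (K v)"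
begin

lemma glue_choice:
  assumes "\<And>v. v \<in> V ==> \<exists>C\<in>carrier (GL n (K v)). P v C"
  obtains C where "C \<in> carrier (GL n (product_ring V K))" "\<And>v. v \<in> V ==> P v (cp v C)"
proof -
  from assms have "\<forall>v\<in>V. \<exists>C. C \<in> carrier (GL n (K v)) \<and> P v C" by blast
  then obtain C where C: "\<And>v. v \<in> V ==> C v \<in> carrier (GL n (K v))" "\<And>v. v \<in> V ==> P v (C v)" by metis
  have g: "cp v (glue V n n C) = C v" if "v \<in> V" for v
    using cp_glue[OF rg fld that, of C n n] GL_rmat[OF C(1)[OF that]] by simp
  show ?thesis using that[OF GL_glue[OF rg fld C(1)]] g C(2) by simp
qed

lemma glue_vec_choice:
  assumes "\<And>v. v \<in> V ==> \<exists>x\<in>rmat (K v) n m. P v x"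
  obtains x where "x \<in> rmat (product_ring V K) n m" "\<And>v. v \<in> V ==> P v (cp v x)"
proof -
  from assms have "\<forall>v\<in>V. \<exists>x. x \<in> rmat (K v) n m \<and> P v x" by blast
  then obtain x where x: "\<And>v. v \<in> V ==> x v \<in> rmat (K v) n m" "\<And>v. v \<in> V ==> P v (x v)" by metis
  have g: "cp v (glue V n m x) = x v" if "v \<in> V" for v
    using cp_glue[OF rg fld that, of x n m] x(1)[OF that] by simp
  show ?thesis using that[OF glue_rmat[OF rg fld x(1)]] g x(2) by simp
qed

lemma product_pullback_eqI:
  assumes "Q \<in> rmat (product_ring V K) n n" "C \<in> rmat (product_ring V K) n m" "Q' \<in> rmat (product_ring V K) m m"
    and "\<And>v. v \<in> V ==> pullback (K v) (cp v Q) (cp v C) = cp v Q'"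
  shows "pullback (product_ring V K) Q C = Q'"
  by (rule cp_ext[OF rg fld rmat_pullback[OF cring_product[OF rg fld] assms(1,2)] assms(3)])
    (simp_all add: cp_pullback[OF rg fld _ assms(1,2)] assms(4))

lemma product_det_eqI:
  assumes "C \<in> rmat (product_ring V K) n n" "x \<in> carrier (product_ring V K)" "\<And>v. v \<in> V ==> mat_det (K v) (cp v C) = x v"
  shows "mat_det (product_ring V K) C = x"
proof -
  have m: "mat_det (product_ring V K) C \<in> (\<Pi>\<^sub>E v\<in>V. carrier (K v))" "x \<in> (\<Pi>\<^sub>E v\<in>V. carrier (K v))"
    using mat_det_closed[OF cring_product[OF rg fld] assms(1)] assms(2) by (auto simp: product_ring_simps)
  have "mat_det (product_ring V K) C v = x v" if "v \<in> V" for v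
    using cp_det[OF rg fld that assms(1)] assms(3)[OF that] by simp
  then show ?thesis using PiE_ext[OF m] by blast
qed

end

lemma map_cancel_left:
  fixes R :: "'a ring" and S :: "'b ring"
  assumes "cring R" "cring S" "h \<in> Ring.ring_hom R S" "T \<in> rmat R n n" "s \<in> rmat R n n" "T \<star>\<^bsub>R\<^esub> s = one_m R n" "Y \<in> rmat S n m"
  shows "map_mat h T \<star>\<^bsub>S\<^esub> (map_mat h s \<star>\<^bsub>S\<^esub> Y) = Y"
proof -
  note r = rmat_map[OF assms(1-3)]
  have "map_mat h T \<star>\<^bsub>S\<^esub> (map_mat h s \<star>\<^bsub>S\<^esub> Y) = (map_mat h T \<star>\<^bsub>S\<^esub> map_mat h s) \<star>\<^bsub>S\<^esub> Y"
    using mat_assoc[OF assms(2) r[OF assms(4)] r[OF assms(5)] assms(7)] by simp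
  also have "map_mat h T \<star>\<^bsub>S\<^esub> map_mat h s = one_m S n"
    using map_mat_prod[OF assms(1-5)] assms(6) map_one_m[OF assms(1-3)] by simp
  finally show ?thesis using mat_one_left[OF assms(2,7)] by simp
qed

lemma det_inverse:
  fixes R :: "'a ring"
  assumes R: "cring R" and "A \<in> rmat R n n" "B \<in> rmat R n n" "A \<star>\<^bsub>R\<^esub> B = one_m R n"
  shows "mat_det R A \<otimes>\<^bsub>R\<^esub> mat_det R B = \<one>\<^bsub>R\<^esub>"
  using mat_det_mult[OF R assms(2,3)] assms(4) mat_det_one[OF R] by simp

section \<open>Descent of isometries, factorization for SO(q), and descent of isotropic
  vectors\<close>

context patching_diamond
begin

interpretation F: form_field F by (rule form_F)
interpretation A1: ring_hom_cring F F1 a1 by (intro hom_cringI cr homs)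
interpretation A2: ring_hom_cring F F2 a2 by (intro hom_cringI cr homs)
interpretation B1: ring_hom_cring F1 F0 b1 by (intro hom_cringI cr homs)
interpretation B2: ring_hom_cring F2 F0 b2 by (intro hom_cringI cr homs)

lemma rgf: "v \<in> V1 ==> field (K v)" "v \<in> V2 ==> field (K v)" "v \<in> V0 ==> field (K v)"
  using field_K by auto

lemmas pr1 = rings(2) rgf(1) and pr2 = rings(3) rgf(2) and pr0 = rings(4) rgf(3)

text \<open>The element \<open>c\<close> synchronises the determinants: the local isometries are
  chosen with determinant \<open>e v c\<close>, so the glued isometries over \<open>F1\<close> and
  \<open>F2\<close> have equal determinants in \<open>F0\<close>, and their quotient lies in SO
  rather than only in O.\<close>

lemma local_hyperbolic:
  assumes Q: "Q \<in> reg F (2 * n)" and n: "n > 0" and c: "c \<in> carrier F"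
    and det: "mat_det F Q = c \<otimes> c \<otimes> mat_det F (hyperbolic_space F n)"
    and loc: "\<And>v. v \<in> V12 ==> isometric (K v) (map_mat (e v) Q) (hyperbolic_space (K v) n)"
  shows "F.eqv (2 * n) Q (hyperbolic_space F n)"
proof -
  have C: "\<exists>C\<in>carrier (GL (2 * n) (K v)). pullback (K v) (hyperbolic_space (K v) n) C = map_mat (e v) Q \<and> mat_det (K v) C = e v c"
    if v: "v \<in> V12" for v
  proof -
    have v': "v \<in> VV" using v by auto
    interpret Kv: form_field "K v" by (rule form_K[OF v'])
    interpret E: ring_hom_cring F "K v" "e v" by (intro hom_cringI cr Kv.R e_hom[OF v'])
    note base = F.R Kv.R e_hom[OF v']
    obtain C where C: "C \<in> carrier (GL (2 * n) (K v))" "pullback (K v) (Kv.H n) C = map_mat (e v) Q"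
      using isometricE[OF Kv.R loc[OF v] reg_rmat[OF Kv.reg_H]] by blast
    have cc: "mat_det (K v) C \<in> carrier (K v)" using mat_det_closed[OF Kv.R GL_rmat[OF C(1)]] .
    have dH: "mat_det (K v) (Kv.H n) \<in> Units (K v)" using GL_det_unit[OF Kv.R reg_GL[OF Kv.reg_H]] .
    have "mat_det (K v) C \<otimes>\<^bsub>K v\<^esub> mat_det (K v) C \<otimes>\<^bsub>K v\<^esub> mat_det (K v) (Kv.H n) = mat_det (K v) (map_mat (e v) Q)"
      using det_pullback[OF Kv.R reg_rmat[OF Kv.reg_H] GL_rmat[OF C(1)]] C(2) by simp
    also have "\<dots> = e v (mat_det F Q)" using map_mat_det[OF base reg_rmat[OF Q]] by simp
    also have "\<dots> = e v c \<otimes>\<^bsub>K v\<^esub> e v c \<otimes>\<^bsub>K v\<^esub> e v (mat_det F (F.H n))"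
      unfolding det using c mat_det_closed[OF F.R reg_rmat[OF F.reg_H]] by simp
    also have "e v (mat_det F (F.H n)) = mat_det (K v) (Kv.H n)"
      using map_mat_det[OF base reg_rmat[OF F.reg_H]] map_hyperbolic_space[OF base] by simp
    \<comment> \<open>Both squares times the determinant of the hyperbolic space give the
      determinant of \<open>Q\<close>; the determinant of the hyperbolic space is a unit and
      cancels.\<close>
    finally have "mat_det (K v) C \<otimes>\<^bsub>K v\<^esub> mat_det (K v) C = e v c \<otimes>\<^bsub>K v\<^esub> e v c"
      using cc c dH Kv.m_rcancel[of "mat_det (K v) (Kv.H n)"] by (simp add: Kv.Units_iff)
    then obtain C' where "C' \<in> carrier (GL (2 * n) (K v))" "pullback (K v) (Kv.H n) C' = pullback (K v) (Kv.H n) C" "mat_det (K v) C' = e v c"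
      using Kv.adjust_det[OF Kv.reg_H _ C(1), of "e v c"] n c by auto
    then show ?thesis using C(2) by auto
  qed
  have H: "hyperbolic_space R n \<in> rmat R (2 * n) (2 * n)" if "cring R" for R :: "'r ring"
    using reg_rmat[OF reg_hyperbolic_space[OF that]] .
  have cpH: "cp v (hyperbolic_space (product_ring V K) n) = hyperbolic_space (K v) n"
    if "ring (product_ring V K)" "\<And>v. v \<in> V ==> field (K v)" "v \<in> V" for v V
    using map_hyperbolic_space[OF cring_product[OF that(1,2)] Kcring[OF that(1,2)] proj_hom[OF that(1,2)]] that(3) by blast
  note Qr = reg_rmat[OF Q]
  obtain M1 where M1: "M1 \<in> carrier (GL (2 * n) F1)" "\<And>v. v \<in> V1 ==>
      pullback (K v) (hyperbolic_space (K v) n) (cp v M1) = map_mat (e v) Q \<and> mat_det (K v) (cp v M1) = e v c"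
    using glue_choice[OF pr1, of "2 * n" "\<lambda>v C. pullback (K v) (hyperbolic_space (K v) n) C = map_mat (e v) Q \<and> mat_det (K v) C = e v c"]
      C by auto
  obtain M2 where M2: "M2 \<in> carrier (GL (2 * n) F2)" "\<And>v. v \<in> V2 ==>
      pullback (K v) (hyperbolic_space (K v) n) (cp v M2) = map_mat (e v) Q \<and> mat_det (K v) (cp v M2) = e v c"
    using glue_choice[OF pr2, of "2 * n" "\<lambda>v C. pullback (K v) (hyperbolic_space (K v) n) C = map_mat (e v) Q \<and> mat_det (K v) C = e v c"]
      C by auto
  note M1r = GL_rmat[OF M1(1)] and M2r = GL_rmat[OF M2(1)]
  have p1: "pullback F1 (hyperbolic_space F1 n) M1 = map_mat a1 Q"
    by (rule product_pullback_eqI[OF pr1 H[OF cr(2)] M1r rmat_map[OF ha1 Qr]])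
      (simp_all add: cpH[OF pr1] M1(2) cp_a1)
  have p2: "pullback F2 (hyperbolic_space F2 n) M2 = map_mat a2 Q"
    by (rule product_pullback_eqI[OF pr2 H[OF cr(3)] M2r rmat_map[OF ha2 Qr]])
      (simp_all add: cpH[OF pr2] M2(2) cp_a2)
  have d1: "mat_det F1 M1 = a1 c"
    by (rule product_det_eqI[OF pr1 M1r A1.hom_closed[OF c]]) (simp_all add: M1(2) e_def)
  have d2: "mat_det F2 M2 = a2 c"
    by (rule product_det_eqI[OF pr2 M2r A2.hom_closed[OF c]]) (use disj in \<open>auto simp: M2(2) e_def\<close>)
  note b1r = rmat_map[OF hb1] and b2r = rmat_map[OF hb2]
  have q1: "pullback F0 (hyperbolic_space F0 n) (map_mat b1 M1) = map_mat b1 (map_mat a1 Q)"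
    using map_pullback[OF hb1 H[OF cr(2)] M1r] p1 map_hyperbolic_space[OF hb1] by simp
  have q2: "pullback F0 (hyperbolic_space F0 n) (map_mat b2 M2) = map_mat b1 (map_mat a1 Q)"
    using map_pullback[OF hb2 H[OF cr(3)] M2r] p2 map_hyperbolic_space[OF hb2] map_commutes[OF Qr] by simp
  have e12: "mat_det F0 (map_mat b1 M1) = mat_det F0 (map_mat b2 M2)"
    using map_mat_det[OF hb1 M1r] map_mat_det[OF hb2 M2r] d1 d2 commutes[OF c] by simp
  obtain N where N: "N \<in> carrier (GL (2 * n) F2)" "N \<star>\<^bsub>F2\<^esub> M2 = one_m F2 (2 * n)" "M2 \<star>\<^bsub>F2\<^esub> N = one_m F2 (2 * n)"
    using GL_inverse[OF cr(3) M2(1)] .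
  note Nr = GL_rmat[OF N(1)]
  \<comment> \<open>The quotient of the two glued isometries over \<open>F0\<close>, an isometry of
    the hyperbolic space with itself.\<close>
  define g where "g = map_mat b1 M1 \<star>\<^bsub>F0\<^esub> map_mat b2 N"
  have gGL: "g \<in> carrier (GL (2 * n) F0)"
    unfolding g_def by (rule GL_mult[OF cr(4) map_GL[OF hb1 M1(1)] map_GL[OF hb2 N(1)]])
  have inv0: "map_mat b2 M2 \<star>\<^bsub>F0\<^esub> map_mat b2 N = one_m F0 (2 * n)"
    using map_mat_prod[OF hb2 M2r Nr] N(3) map_one_m[OF hb2] by simp
  have "pullback F0 (hyperbolic_space F0 n) g = pullback F0 (map_mat b1 (map_mat a1 Q)) (map_mat b2 N)"
    unfolding g_def using pullback_pullback[OF cr(4) H[OF cr(4)] b1r[OF M1r] b2r[OF Nr]] q1 by simp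
  also have "\<dots> = hyperbolic_space F0 n"
    by (rule pullback_inverse[OF cr(4) H[OF cr(4)] b2r[OF M2r] b2r[OF Nr] inv0 q2])
  finally have gH: "pullback F0 (hyperbolic_space F0 n) g = hyperbolic_space F0 n" .
  have gd: "mat_det F0 g = \<one>\<^bsub>F0\<^esub>"
    unfolding g_def using mat_det_mult[OF cr(4) b1r[OF M1r] b2r[OF Nr]] e12 det_inverse[OF cr(4) b2r[OF M2r] b2r[OF Nr] inv0] by simp
  obtain s1 s2 where s: "s1 \<in> carrier (GL (2 * n) F1)" "pullback F1 (hyperbolic_space F1 n) s1 = hyperbolic_space F1 n"
    "s2 \<in> carrier (GL (2 * n) F2)" "g = map_mat b1 s1 \<star>\<^bsub>F0\<^esub> map_mat b2 s2"
    using hyperbolic_SO_factor[OF n gGL gH gd] by metis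
  note s1r = GL_rmat[OF s(1)] and s2r = GL_rmat[OF s(3)]
  obtain T where T: "T \<in> carrier (GL (2 * n) F1)" "T \<star>\<^bsub>F1\<^esub> s1 = one_m F1 (2 * n)" "s1 \<star>\<^bsub>F1\<^esub> T = one_m F1 (2 * n)"
    using GL_inverse[OF cr(2) s(1)] .
  note Tr = GL_rmat[OF T(1)]
  have "map_mat b1 M1 = g \<star>\<^bsub>F0\<^esub> map_mat b2 M2"
    unfolding g_def mat_assoc[OF cr(4) b1r[OF M1r] b2r[OF Nr] b2r[OF M2r]]
    using map_mat_prod[OF hb2 Nr M2r] N(2) map_one_m[OF hb2] mat_one_right[OF cr(4) b1r[OF M1r]] by simp
  also have "\<dots> = map_mat b1 s1 \<star>\<^bsub>F0\<^esub> map_mat b2 (s2 \<star>\<^bsub>F2\<^esub> M2)"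
    unfolding s(4) using mat_assoc[OF cr(4) b1r[OF s1r] b2r[OF s2r] b2r[OF M2r]] map_mat_prod[OF hb2 s2r M2r] by simp
  \<comment> \<open>From M1 = s1 s2 M2 over \<open>F0\<close>, the matrices s1^-1 M1 and s2 M2 have
    a common image in \<open>F0\<close> and come from one matrix over \<open>F\<close>. Since
    \<open>s1\<close> is an isometry of the hyperbolic space, the correction does not change the
    pulled back form.\<close>
  finally have "map_mat b1 (T \<star>\<^bsub>F1\<^esub> M1) = map_mat b2 (s2 \<star>\<^bsub>F2\<^esub> M2)"
    using map_mat_prod[OF hb1 Tr M1r] map_cancel_left[OF hb1 Tr s1r T(2) b2r[OF GL_rmat[OF GL_mult[OF cr(3) s(3) M2(1)]]]] by simp
  then obtain M where M: "M \<in> carrier (GL (2 * n) F)" "map_mat a1 M = T \<star>\<^bsub>F1\<^esub> M1"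
    using GL_descent[OF _ GL_mult[OF cr(2) T(1) M1(1)] GL_mult[OF cr(3) s(3) M2(1)]] n by auto
  note Mr = GL_rmat[OF M(1)]
  have "map_mat a1 (pullback F (F.H n) M) = pullback F1 (hyperbolic_space F1 n) (T \<star>\<^bsub>F1\<^esub> M1)"
    using map_pullback[OF ha1 H[OF cr(1)] Mr] M(2) map_hyperbolic_space[OF ha1] by simp
  also have "\<dots> = pullback F1 (pullback F1 (hyperbolic_space F1 n) T) M1"
    using pullback_pullback[OF cr(2) H[OF cr(2)] Tr M1r] by simp
  also have "\<dots> = map_mat a1 Q"
    using pullback_inverse[OF cr(2) H[OF cr(2)] s1r Tr T(3) s(2)] p1 by simp
  finally have "pullback F (F.H n) M = Q"
    using map_mat_inj[OF injs(1) rmat_pullback[OF cr(1) H[OF cr(1)] Mr] Qr] by simp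
  then show ?thesis using isometricI[OF cr(1) M(1) H[OF cr(1)]] F.reg_H by (intro F.eqvI)
qed

text \<open>The hyperbolic case is applied to the sum of p and -q, which is locally isometric to the
  hyperbolic sum of q and -q; in the end -q is cancelled.\<close>

lemma local_isometry_global:
  assumes p: "p \<in> reg F n" and q: "q \<in> reg F n" and n: "n > 0" and c: "c \<in> carrier F"
    and det: "mat_det F p = c \<otimes> c \<otimes> mat_det F q"
    and loc: "\<And>v. v \<in> V12 ==> isometric (K v) (map_mat (e v) p) (map_mat (e v) q)"
  shows "F.eqv n p q"
proof -
  have oq: "oppos F q \<in> reg F n" using reg_oppos[OF cr(1) q] .
  note hyp = F.perp_oppos_hyperbolic[OF q]
  \<comment> \<open>The determinants of q + (-q) and of the hyperbolic space differ by the square of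
    det D, whence the constant c det D below.\<close>
  obtain D where D: "D \<in> carrier (GL (2 * n) F)" "pullback F (F.H n) D = q \<bottom> oppos F q"
    using isometricE[OF cr(1) F.eqvD(3)[OF hyp] reg_rmat[OF F.reg_H]] by blast
  have cl: "mat_det F D \<in> carrier F" "mat_det F q \<in> carrier F" "mat_det F (oppos F q) \<in> carrier F" "mat_det F (F.H n) \<in> carrier F"
    using mat_det_closed[OF cr(1)] GL_rmat[OF D(1)] reg_rmat[OF q] reg_rmat[OF oq] reg_rmat[OF F.reg_H] by auto
  have "mat_det F (q \<bottom> oppos F q) = mat_det F D \<otimes> mat_det F D \<otimes> mat_det F (F.H n)"
    using det_pullback[OF cr(1) reg_rmat[OF F.reg_H] GL_rmat[OF D(1)]] D(2) by simp
  then have dq: "mat_det F q \<otimes> mat_det F (oppos F q) = mat_det F D \<otimes> mat_det F D \<otimes> mat_det F (F.H n)"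
    using det_perp[OF cr(1) reg_rmat[OF q] reg_rmat[OF oq]] by simp
  have "mat_det F (p \<bottom> oppos F q) = c \<otimes> c \<otimes> (mat_det F q \<otimes> mat_det F (oppos F q))"
    using det_perp[OF cr(1) reg_rmat[OF p] reg_rmat[OF oq]] det cl c by (simp add: F.m_assoc)
  also have "\<dots> = (c \<otimes> mat_det F D) \<otimes> (c \<otimes> mat_det F D) \<otimes> mat_det F (F.H n)"
    unfolding dq using cl c by (simp add: F.m_ac)
  finally have dpq: "mat_det F (p \<bottom> oppos F q) = (c \<otimes> mat_det F D) \<otimes> (c \<otimes> mat_det F D) \<otimes> mat_det F (F.H n)" .
  have rpq: "p \<bottom> oppos F q \<in> reg F (2 * n)" using reg_perp[OF cr(1) p oq] by (simp add: mult_2)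
  have "F.eqv (2 * n) (p \<bottom> oppos F q) (F.H n)"
  proof (rule local_hyperbolic[OF rpq n _ dpq])
    show "c \<otimes> mat_det F D \<in> carrier F" using c cl by simp
    fix v assume v: "v \<in> V12"
    then have v': "v \<in> VV" by auto
    interpret Kv: form_field "K v" by (rule form_K[OF v'])
    note base = F.R Kv.R e_hom[OF v']
    have qv: "map_mat (e v) q \<in> reg (K v) n" using reg_map[OF base q] .
    have "Kv.eqv (n + n) (map_mat (e v) p \<bottom>\<^bsub>K v\<^esub> oppos (K v) (map_mat (e v) q)) (map_mat (e v) q \<bottom>\<^bsub>K v\<^esub> oppos (K v) (map_mat (e v) q))"
      by (rule Kv.eqv_perp[OF Kv.eqvI[OF loc[OF v] qv] Kv.eqv_refl[OF reg_oppos[OF Kv.R qv]]])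
    then have "Kv.eqv (2 * n) (map_mat (e v) p \<bottom>\<^bsub>K v\<^esub> oppos (K v) (map_mat (e v) q)) (Kv.H n)"
      using Kv.eqv_trans[OF _ Kv.perp_oppos_hyperbolic[OF qv]] by (simp add: mult_2)
    then show "isometric (K v) (map_mat (e v) (p \<bottom> oppos F q)) (Kv.H n)"
      unfolding map_perp[OF base] map_oppos[OF base reg_rmat[OF q]] by (rule Kv.eqvD(3))
  qed
  then have "F.eqv (n + n) (p \<bottom> oppos F q) (q \<bottom> oppos F q)"
    using F.eqv_trans[OF _ F.eqv_sym[OF hyp]] by (simp add: mult_2)
  then show ?thesis using F.eqv_cancel_right[OF _ oq p q] by simp
qed

text \<open>Patching gives g = h1 h2 in GL. Since \<open>g\<close> preserves \<open>q\<close>,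
  pulling \<open>q\<close> back by h1 over \<open>F1\<close> and by the inverse of h2 over
  \<open>F2\<close> gives forms that agree over \<open>F0\<close> and descend to a form
  \<open>p\<close> over \<open>F\<close>, locally isometric to \<open>q\<close>. An isometry
  \<open>A\<close> over \<open>F\<close> that pulls \<open>q\<close> back to \<open>p\<close>
  repairs the factors: h1 A^-1 and A h2 preserve \<open>q\<close>, and their product is still
  \<open>g\<close>.\<close>

theorem SO_factorization_regular:
  assumes q: "q \<in> reg F n" and g: "g \<in> carrier (GL n F0)"
    and gq: "pullback F0 (map_mat b1 (map_mat a1 q)) g = map_mat b1 (map_mat a1 q)" and gd: "mat_det F0 g = \<one>\<^bsub>F0\<^esub>" and n: "n > 0"
  obtains g1 g2 where "g1 \<in> carrier (GL n F1)" "pullback F1 (map_mat a1 q) g1 = map_mat a1 q" "mat_det F1 g1 = \<one>\<^bsub>F1\<^esub>"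
    "g2 \<in> carrier (GL n F2)" "pullback F2 (map_mat a2 q) g2 = map_mat a2 q" "mat_det F2 g2 = \<one>\<^bsub>F2\<^esub>"
    "g = map_mat b1 g1 \<star>\<^bsub>F0\<^esub> map_mat b2 g2"
proof -
  note a1r = rmat_map[OF ha1] and a2r = rmat_map[OF ha2]
  note b1r = rmat_map[OF hb1] and b2r = rmat_map[OF hb2]
  note qr = reg_rmat[OF q]
  obtain h1 h2 where h: "h1 \<in> carrier (GL n F1)" "h2 \<in> carrier (GL n F2)" "g = map_mat b1 h1 \<star>\<^bsub>F0\<^esub> map_mat b2 h2"
    using GL_factor[OF _ g] n by auto
  obtain k where k: "k \<in> carrier (GL n F2)" "k \<star>\<^bsub>F2\<^esub> h2 = one_m F2 n" "h2 \<star>\<^bsub>F2\<^esub> k = one_m F2 n"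
    using GL_inverse[OF cr(3) h(2)] .
  note h1r = GL_rmat[OF h(1)] and h2r = GL_rmat[OF h(2)] and kr = GL_rmat[OF k(1)]
  define p1 where "p1 = pullback F1 (map_mat a1 q) h1"
  define p2 where "p2 = pullback F2 (map_mat a2 q) k"
  have p1r: "p1 \<in> reg F1 n" unfolding p1_def by (rule reg_pullback[OF cr(2) reg_map[OF ha1 q] h(1)])
  have p2r: "p2 \<in> reg F2 n" unfolding p2_def by (rule reg_pullback[OF cr(3) reg_map[OF ha2 q] k(1)])
  have inv0: "map_mat b2 h2 \<star>\<^bsub>F0\<^esub> map_mat b2 k = one_m F0 n"
    using map_mat_prod[OF hb2 h2r kr] k(3) map_one_m[OF hb2] by simp
  note q0r = b1r[OF a1r[OF qr]]
  have "pullback F0 (pullback F0 (map_mat b1 (map_mat a1 q)) (map_mat b1 h1)) (map_mat b2 h2) = map_mat b1 (map_mat a1 q)"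
    using pullback_pullback[OF cr(4) q0r b1r[OF h1r] b2r[OF h2r]] gq h(3) by simp
  from pullback_inverse[OF cr(4) rmat_pullback[OF cr(4) q0r b1r[OF h1r]] b2r[OF h2r] b2r[OF kr] inv0 this]
  have "map_mat b1 p1 = map_mat b2 p2"
    unfolding p1_def p2_def
    using map_pullback[OF hb1 a1r[OF qr] h1r] map_pullback[OF hb2 a2r[OF qr] kr] map_commutes[OF qr] by simp
  then obtain p where p: "p \<in> carrier (GL n F)" "map_mat a1 p = p1" "map_mat a2 p = p2"
    using GL_descent[OF _ reg_GL[OF p1r] reg_GL[OF p2r]] n by auto
  have pT: "transpose_mat p = p"
    using map_mat_inj[OF injs(1) rmat_transpose[OF GL_rmat[OF p(1)]] GL_rmat[OF p(1)]] p(2) p1r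
    by (simp add: transpose_map_mat[symmetric] reg_def)
  have pr: "p \<in> reg F n" using p(1) pT by (simp add: reg_def)
  \<comment> \<open>Here det g = 1 enters: h1 and the inverse \<open>k\<close> of h2 have the same
    determinant over \<open>F0\<close>, so both determinants come from one element \<open>c\<close>
    of \<open>F\<close>, and det p = c c det q.\<close>
  have "b1 (mat_det F1 h1) = b2 (mat_det F2 k)"
  proof -
    have cl: "mat_det F0 (map_mat b1 h1) \<in> carrier F0" "mat_det F0 (map_mat b2 h2) \<in> carrier F0" "mat_det F0 (map_mat b2 k) \<in> carrier F0"
      using mat_det_closed[OF cr(4)] b1r[OF h1r] b2r[OF h2r] b2r[OF kr] by auto
    have 1: "mat_det F0 (map_mat b1 h1) \<otimes>\<^bsub>F0\<^esub> mat_det F0 (map_mat b2 h2) = \<one>\<^bsub>F0\<^esub>"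
      using mat_det_mult[OF cr(4) b1r[OF h1r] b2r[OF h2r]] gd h(3) by simp
    have 2: "mat_det F0 (map_mat b2 h2) \<otimes>\<^bsub>F0\<^esub> mat_det F0 (map_mat b2 k) = \<one>\<^bsub>F0\<^esub>"
      using det_inverse[OF cr(4) b2r[OF h2r] b2r[OF kr] inv0] .
    have "mat_det F0 (map_mat b1 h1) = mat_det F0 (map_mat b2 k)"
      using B1.S.m_assoc[OF cl] 1 2 cl(1,3) by simp
    then show ?thesis using map_mat_det[OF hb1 h1r] map_mat_det[OF hb2 kr] by simp
  qed
  then obtain c where c: "c \<in> carrier F" "a1 c = mat_det F1 h1" "a2 c = mat_det F2 k"
    using element_descent[OF mat_det_closed[OF cr(2) h1r] mat_det_closed[OF cr(3) kr]] by metis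
  have dqc: "mat_det F q \<in> carrier F" "mat_det F p \<in> carrier F" using mat_det_closed[OF cr(1)] qr reg_rmat[OF pr] by auto
  have "a1 (mat_det F p) = a1 (c \<otimes> c \<otimes> mat_det F q)"
    using map_mat_det[OF ha1 reg_rmat[OF pr]] map_mat_det[OF ha1 qr] p(2) c(1,2)
      det_pullback[OF cr(2) a1r[OF qr] h1r] dqc by (simp add: p1_def)
  then have dp: "mat_det F p = c \<otimes> c \<otimes> mat_det F q" using inj_onD[OF injs(1)] c(1) dqc by simp
  have "F.eqv n p q"
  proof (rule local_isometry_global[OF pr q n c(1) dp])
    fix v assume v: "v \<in> V12"
    then have v': "v \<in> VV" by auto
    note qv = rmat_map[OF cr(1) Kcr[OF v'] e_hom[OF v'] qr]
    show "isometric (K v) (map_mat (e v) p) (map_mat (e v) q)"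
    proof (cases "v \<in> V1")
      case True
      have "pullback (K v) (map_mat (e v) q) (cp v h1) = map_mat (e v) p"
        using cp_pullback[OF pr1 True a1r[OF qr] h1r] p(2) cp_a1[OF True, of p] cp_a1[OF True, of q] by (simp add: p1_def)
      then show ?thesis using isometricI[OF Kcr[OF v'] GL_cp[OF pr1 True h(1)] qv] by simp
    next
      case False
      then have v2: "v \<in> V2" using v by simp
      have "pullback (K v) (map_mat (e v) q) (cp v k) = map_mat (e v) p"
        using cp_pullback[OF pr2 v2 a2r[OF qr] kr] p(3) cp_a2[OF v2, of p] cp_a2[OF v2, of q] by (simp add: p2_def)
      then show ?thesis using isometricI[OF Kcr[OF v'] GL_cp[OF pr2 v2 k(1)] qv] by simp
    qed
  qed
  then obtain A0 where A0: "A0 \<in> carrier (GL n F)" "pullback F q A0 = p"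
    using isometricE[OF cr(1) F.eqvD(3) qr] by blast
  have "mat_det F A0 \<otimes> mat_det F A0 \<otimes> mat_det F q = c \<otimes> c \<otimes> mat_det F q"
    using det_pullback[OF cr(1) qr GL_rmat[OF A0(1)]] A0(2) dp by simp
  then have "mat_det F A0 \<otimes> mat_det F A0 = c \<otimes> c"
    using F.m_rcancel[of "mat_det F q"] GL_det_unit[OF cr(1) reg_GL[OF q]] mat_det_closed[OF cr(1) GL_rmat[OF A0(1)]] c(1) by (simp add: F.Units_iff)
  \<comment> \<open>The determinant of \<open>A\<close> has to be \<open>c\<close> itself and not
    its negative, so that both corrected factors get determinant one.\<close>
  then obtain A where A: "A \<in> carrier (GL n F)" "pullback F q A = p" "mat_det F A = c"
    using F.adjust_det[OF q _ A0(1) c(1)] n A0(2) by auto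
  obtain B where B: "B \<in> carrier (GL n F)" "B \<star> A = one_m F n" "A \<star> B = one_m F n"
    using GL_inverse[OF cr(1) A(1)] .
  note Ar = GL_rmat[OF A(1)] and Br = GL_rmat[OF B(1)]
  have pB: "pullback F p B = q" by (rule pullback_inverse[OF cr(1) qr Ar Br B(3) A(2)])
  define g1 where "g1 = h1 \<star>\<^bsub>F1\<^esub> map_mat a1 B"
  define g2 where "g2 = map_mat a2 A \<star>\<^bsub>F2\<^esub> h2"
  have "pullback F1 (map_mat a1 q) g1 = map_mat a1 (pullback F p B)"
    unfolding g1_def using pullback_pullback[OF cr(2) a1r[OF qr] h1r a1r[OF Br]] map_pullback[OF ha1 reg_rmat[OF pr] Br] p(2)
    by (simp add: p1_def)
  then have 1: "pullback F1 (map_mat a1 q) g1 = map_mat a1 q" using pB by simp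
  have "pullback F2 (map_mat a2 q) g2 = pullback F2 (map_mat a2 (pullback F q A)) h2"
    unfolding g2_def using pullback_pullback[OF cr(3) a2r[OF qr] a2r[OF Ar] h2r] map_pullback[OF ha2 qr Ar] by simp
  then have 2: "pullback F2 (map_mat a2 q) g2 = map_mat a2 q"
    using pullback_inverse[OF cr(3) a2r[OF qr] kr h2r k(2), of p2] A(2) p(3) by (simp add: p2_def)
  have "mat_det F1 g1 = a1 (mat_det F A \<otimes> mat_det F B)"
    unfolding g1_def using mat_det_mult[OF cr(2) h1r a1r[OF Br]] map_mat_det[OF ha1 Br] c A(3) mat_det_closed[OF cr(1) Br] by simp
  then have 3: "mat_det F1 g1 = \<one>\<^bsub>F1\<^esub>" using det_inverse[OF cr(1) Ar Br B(3)] by simp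
  have "mat_det F2 g2 = mat_det F2 k \<otimes>\<^bsub>F2\<^esub> mat_det F2 h2"
    unfolding g2_def using mat_det_mult[OF cr(3) a2r[OF Ar] h2r] map_mat_det[OF ha2 Ar] c A(3) by simp
  then have 4: "mat_det F2 g2 = \<one>\<^bsub>F2\<^esub>" using det_inverse[OF cr(3) kr h2r k(2)] by simp
  have "map_mat b1 g1 \<star>\<^bsub>F0\<^esub> map_mat b2 g2 =
      map_mat b1 h1 \<star>\<^bsub>F0\<^esub> (map_mat b1 (map_mat a1 B) \<star>\<^bsub>F0\<^esub> (map_mat b1 (map_mat a1 A) \<star>\<^bsub>F0\<^esub> map_mat b2 h2))"
    unfolding g1_def g2_def map_mat_prod[OF hb1 h1r a1r[OF Br]] map_mat_prod[OF hb2 a2r[OF Ar] h2r] map_commutes[OF Ar, symmetric]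
    by (rule mat_assoc[OF cr(4) b1r[OF h1r] b1r[OF a1r[OF Br]] cring.rmat_prod[OF cr(4) b1r[OF a1r[OF Ar]] b2r[OF h2r]]])
  also have "map_mat b1 (map_mat a1 B) \<star>\<^bsub>F0\<^esub> (map_mat b1 (map_mat a1 A) \<star>\<^bsub>F0\<^esub> map_mat b2 h2) = map_mat b2 h2"
    using map_cancel_left[OF cr(1,4) hom_b1a1 Br Ar B(2) b2r[OF h2r]] by (simp add: map_comp)
  finally have 5: "g = map_mat b1 g1 \<star>\<^bsub>F0\<^esub> map_mat b2 g2" using h(3) by simp
  have 6: "g1 \<in> carrier (GL n F1)" "g2 \<in> carrier (GL n F2)"
    unfolding g1_def g2_def using GL_mult[OF cr(2) h(1) map_GL[OF ha1 B(1)]] GL_mult[OF cr(3) map_GL[OF ha2 A(1)] h(2)] by auto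
  show ?thesis using that[OF 6(1) 1 3 6(2) 2 4 5] .
qed

lemma SO_factorization_all:
  assumes "q \<in> regular_forms F" shows "SO_factorization q F1 F2 F0 a1 a2 b1 b2"
proof -
  define n where "n = dim_row q"
  have q: "q \<in> reg F n" using assms by (simp add: regular_iff n_def)
  show ?thesis
    unfolding SO_factorization_def factorization_def
  proof
    fix g assume "g \<in> carrier (SO F0 (map_mat (b1 \<circ> a1) q))"
    then have g: "g \<in> carrier (GL n F0)" "pullback F0 (map_mat b1 (map_mat a1 q)) g = map_mat b1 (map_mat a1 q)" "mat_det F0 g = \<one>\<^bsub>F0\<^esub>"
      unfolding SO_carrier map_comp by (auto simp: n_def)
    have S: "g1 \<in> carrier (SO F1 (map_mat a1 q)) \<longleftrightarrow> g1 \<in> carrier (GL n F1) \<and> pullback F1 (map_mat a1 q) g1 = map_mat a1 q \<and> mat_det F1 g1 = \<one>\<^bsub>F1\<^esub>"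
      "g2 \<in> carrier (SO F2 (map_mat a2 q)) \<longleftrightarrow> g2 \<in> carrier (GL n F2) \<and> pullback F2 (map_mat a2 q) g2 = map_mat a2 q \<and> mat_det F2 g2 = \<one>\<^bsub>F2\<^esub>" for g1 g2
      unfolding SO_carrier by (auto simp: n_def)
    show "\<exists>g1\<in>carrier (SO F1 (map_mat a1 q)). \<exists>g2\<in>carrier (SO F2 (map_mat a2 q)).
        g = map_mat b1 g1 \<otimes>\<^bsub>SO F0 (map_mat (b1 \<circ> a1) q)\<^esub> map_mat b2 g2"
    proof (cases "n > 0")
      case True
      then show ?thesis unfolding mult_SO using SO_factorization_regular[OF q g True] S by metis
    next
      \<comment> \<open>In dimension zero, where patching says nothing, all matrices are empty and
        identity matrices serve on both sides.\<close>
      case False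
      then have n: "n = 0" by simp
      have 1: "one_m F1 0 \<in> carrier (SO F1 (map_mat a1 q))" "one_m F2 0 \<in> carrier (SO F2 (map_mat a2 q))"
        using S GL_one[OF cr(2), of 0] GL_one[OF cr(3), of 0] mat_det_one[OF cr(2), of 0] mat_det_one[OF cr(3), of 0]
          pullback_one[OF cr(2) reg_rmat[OF reg_map[OF ha1 q]]] pullback_one[OF cr(3) reg_rmat[OF reg_map[OF ha2 q]]] n by simp_all
      have "dim_row g = 0" "dim_col g = 0" using GL_rmat[OF g(1)] n by (auto simp: rmat_dims)
      then have "g = map_mat b1 (one_m F1 0) \<star>\<^bsub>F0\<^esub> map_mat b2 (one_m F2 0)" by (intro eq_matI) (auto simp: one_m_def mat_prod_def)
      then show ?thesis unfolding mult_SO using 1 by blast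
    qed
  qed
qed

text \<open>Over an empty index set the product is the zero ring, into which no field
  embeds.\<close>

lemma V1_nonempty: "V1 \<noteq> {}"
proof
  assume "V1 = {}"
  then have "\<one>\<^bsub>F1\<^esub> = \<zero>\<^bsub>F1\<^esub>" by (simp add: product_ring_simps fun_eq_iff)
  then have "a1 \<one> = a1 \<zero>" by simp
  then show False using inj_onD[OF injs(1), of "\<one>" "\<zero>"] by simp
qed

lemma matrix_descent:
  assumes "M1 \<in> rmat F1 n m" "M2 \<in> rmat F2 n m" "map_mat b1 M1 = map_mat b2 M2"
  obtains M where "M \<in> rmat F n m" "map_mat a1 M = M1" "map_mat a2 M = M2"
proof -
  have "\<exists>z\<in>carrier F. a1 z = M1 $$ (i, j) \<and> a2 z = M2 $$ (i, j)" if ij: "i < n" "j < m" for i j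
  proof -
    have "b1 (M1 $$ (i, j)) = b2 (M2 $$ (i, j))"
      using arg_cong[OF assms(3), of "\<lambda>M. M $$ (i, j)"] ij assms(1,2) by (simp add: rmat_dims)
    then show ?thesis using element_descent[OF rmat_index[OF assms(1) ij] rmat_index[OF assms(2) ij]] by metis
  qed
  then have "\<forall>i j. \<exists>z. i < n \<longrightarrow> j < m \<longrightarrow> z \<in> carrier F \<and> a1 z = M1 $$ (i, j) \<and> a2 z = M2 $$ (i, j)" by blast
  then obtain z where z: "\<And>i j. i < n ==> j < m ==> z i j \<in> carrier F \<and> a1 (z i j) = M1 $$ (i, j) \<and> a2 (z i j) = M2 $$ (i, j)" by metis
  show ?thesis
  proof (rule that[of "mat n m (\<lambda>(i, j). z i j)"])
    show "mat n m (\<lambda>(i, j). z i j) \<in> rmat F n m" using z by (auto simp: rmat_iff)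
    show "map_mat a1 (mat n m (\<lambda>(i, j). z i j)) = M1" "map_mat a2 (mat n m (\<lambda>(i, j). z i j)) = M2"
      using z rmat_dims[OF assms(1)] rmat_dims[OF assms(2)] by (auto intro!: eq_matI)
  qed
qed

lemma cp_b:
  assumes "V = V1 \<and> b = b1 \<or> V = V2 \<and> b = b2" "w \<in> V0" "x \<in> rmat (product_ring V K) n m"
  shows "cp w (map_mat b x) = map_mat (factor_hom V K b w) (cp (factor_below V K b w) x)"
proof -
  have fb: "z \<in> carrier (product_ring V K) ==> b z w = factor_hom V K b w (z (factor_below V K b w))" for z
    using factor_below_props(3)[of V K V0 b w z] assms(1,2) rings rgf fin homs by blast
  show ?thesis using assms(3) by (intro eq_matI) (auto simp: rmat_iff fb)
qed

lemma factor_props: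
  assumes "V = V1 \<and> b = b1 \<or> V = V2 \<and> b = b2" "w \<in> V0"
  shows "factor_below V K b w \<in> V" "factor_below V K b w \<in> VV"
    "factor_hom V K b w \<in> Ring.ring_hom (K (factor_below V K b w)) (K w)"
  using factor_below_props(1,2)[of V K V0 b w] assms(1,2) rings rgf fin homs by blast+

text \<open>Local isotropic vectors are glued to x1 over \<open>F1\<close> and x2 over
  \<open>F2\<close>. In each field of \<open>F0\<close> an element of SO takes the image of x2 to
  that of x1; the glued element factors as g1 g2, and then g1^-1 x1 and g2 x2 have the same image in
  \<open>F0\<close> and descend to a vector over \<open>F\<close>.\<close>

lemma isotropic_descent:
  assumes q: "q \<in> reg F n" and n: "n \<ge> 3" and loc: "\<And>v. v \<in> V12 ==> isotropic (K v) (map_mat (e v) q)"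
  shows "isotropic F q"
proof -
  note a1r = rmat_map[OF ha1] and a2r = rmat_map[OF ha2]
  note b1r = rmat_map[OF hb1] and b2r = rmat_map[OF hb2]
  note qr = reg_rmat[OF q]
  \<comment> \<open>Isotropy is phrased with one by one matrices, which pass through gluing and base
    change. The vectors have to be nonzero in each component and not merely as a whole, since
    transitivity is used in every field of \<open>F0\<close>.\<close>
  let ?P = "\<lambda>v x. x \<noteq> zero_m (K v) n 1 \<and> pullback (K v) (map_mat (e v) q) x = zero_m (K v) 1 1"
  have iso: "isotropic (K v) Q \<longleftrightarrow> (\<exists>x\<in>rmat (K v) n 1. x \<noteq> zero_m (K v) n 1 \<and> pullback (K v) Q x = zero_m (K v) 1 1)"
    if "form_field (K v)" "Q \<in> reg (K v) n" for v Q
  proof -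
    interpret Kv: form_field "K v" by (rule that)
    show ?thesis
      unfolding Kv.isotropic_iff[OF reg_symm[OF that(2)]] using Kv.pullback_vec[OF reg_rmat[OF that(2)]] by (auto simp: Kv.sc_zero[symmetric])
  qed
  have ex: "\<exists>x\<in>rmat (K v) n 1. ?P v x" if "v \<in> V12" for v
  proof -
    have v': "v \<in> VV" using that by auto
    show ?thesis using iso[OF form_K[OF v'] reg_map[OF cr(1) Kcr[OF v'] e_hom[OF v'] q]] loc[OF that] by blast
  qed
  obtain x1 where x1: "x1 \<in> rmat F1 n 1" "\<And>v. v \<in> V1 ==> ?P v (cp v x1)"
    using glue_vec_choice[OF pr1, of n 1 ?P] ex by blast
  obtain x2 where x2: "x2 \<in> rmat F2 n 1" "\<And>v. v \<in> V2 ==> ?P v (cp v x2)"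
    using glue_vec_choice[OF pr2, of n 1 ?P] ex by blast
  have z1: "pullback F1 (map_mat a1 q) x1 = zero_m F1 1 1"
    by (rule product_pullback_eqI[OF pr1 a1r[OF qr] x1(1) cring.rmat_zero[OF cr(2)]])
      (simp_all add: x1(2) cp_a1 map_zero_m[OF cr(2) Kcring[OF pr1] proj_hom[OF pr1]])
  have z2: "pullback F2 (map_mat a2 q) x2 = zero_m F2 1 1"
    by (rule product_pullback_eqI[OF pr2 a2r[OF qr] x2(1) cring.rmat_zero[OF cr(3)]])
      (simp_all add: x2(2) cp_a2 map_zero_m[OF cr(3) Kcring[OF pr2] proj_hom[OF pr2]])
  define q0 where "q0 = map_mat b1 (map_mat a1 q)"
  have q0r: "q0 \<in> reg F0 n" unfolding q0_def by (rule reg_map[OF hb1 reg_map[OF ha1 q]])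
  have z0: "pullback F0 q0 (map_mat b1 x1) = zero_m F0 1 1" "pullback F0 q0 (map_mat b2 x2) = zero_m F0 1 1"
    using map_pullback[OF hb1 a1r[OF qr] x1(1)] map_pullback[OF hb2 a2r[OF qr] x2(1)] z1 z2
      map_zero_m[OF hb1] map_zero_m[OF hb2] map_commutes[OF qr] by (simp_all add: q0_def)
  \<comment> \<open>The field at \<open>w\<close> sees one factor of the source through an injective
    map, so a vector that is nonzero in all components stays nonzero at \<open>w\<close>.\<close>
  have nz: "cp w (map_mat b x) \<noteq> zero_m (K w) n 1"
    if "V = V1 \<and> b = b1 \<or> V = V2 \<and> b = b2" "w \<in> V0" "x \<in> rmat (product_ring V K) n 1" "\<And>v. v \<in> V ==> cp v x \<noteq> zero_m (K v) n 1" for V b w x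
  proof
    assume eq: "cp w (map_mat b x) = zero_m (K w) n 1"
    let ?v = "factor_below V K b w" and ?h = "factor_hom V K b w"
    note fp = factor_props[OF that(1,2)]
    have w: "w \<in> VV" using that by auto
    have inj: "inj_on ?h (carrier (K ?v))" using non_trivial_field_hom_is_inj[OF fp(3) field_K[OF fp(2)] field_K[OF w]] .
    have rg: "ring (product_ring V K)" "\<And>v. v \<in> V ==> field (K v)" using that(1) rings rgf by auto
    have "map_mat ?h (cp ?v x) = map_mat ?h (zero_m (K ?v) n 1)"
      using eq cp_b[OF that(1-3)] map_zero_m[OF Kcr[OF fp(2)] Kcr[OF w] fp(3)] by simp
    then have "cp ?v x = zero_m (K ?v) n 1"
      using map_mat_inj[OF inj cp_rmat[OF rg fp(1) that(3)] cring.rmat_zero[OF Kcr[OF fp(2)]]] by simp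
    then show False using that(4)[OF fp(1)] by simp
  qed
  let ?G = "\<lambda>w g. pullback (K w) (cp w q0) g = cp w q0 \<and> mat_det (K w) g = \<one>\<^bsub>K w\<^esub> \<and> g \<star>\<^bsub>K w\<^esub> cp w (map_mat b2 x2) = cp w (map_mat b1 x1)"
  have "\<exists>g\<in>carrier (GL n (K w)). ?G w g" if w: "w \<in> V0" for w
  proof -
    have w': "w \<in> VV" using w by simp
    interpret Kw: form_field "K w" by (rule form_K[OF w'])
    note proj = cring_product[OF pr0] Kw.R proj_hom[OF pr0 w]
    have qw: "cp w q0 \<in> reg (K w) n" by (rule reg_map[OF proj q0r])
    note xw = cp_rmat[OF pr0 w b1r[OF x1(1)]] cp_rmat[OF pr0 w b2r[OF x2(1)]]
    have "pullback (K w) (cp w q0) (cp w (map_mat b1 x1)) = zero_m (K w) 1 1" "pullback (K w) (cp w q0) (cp w (map_mat b2 x2)) = zero_m (K w) 1 1"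
      using cp_pullback[OF pr0 w reg_rmat[OF q0r] b1r[OF x1(1)]] cp_pullback[OF pr0 w reg_rmat[OF q0r] b2r[OF x2(1)]]
        z0 map_zero_m[OF proj] by simp_all
    then have bz: "Kw.bil (cp w q0) (cp w (map_mat b1 x1)) (cp w (map_mat b1 x1)) = \<zero>\<^bsub>K w\<^esub>"
      "Kw.bil (cp w q0) (cp w (map_mat b2 x2)) (cp w (map_mat b2 x2)) = \<zero>\<^bsub>K w\<^esub>"
      using Kw.pullback_vec[OF reg_rmat[OF qw] xw(1)] Kw.pullback_vec[OF reg_rmat[OF qw] xw(2)] by (auto simp: Kw.sc_zero[symmetric])
    have "cp w (map_mat b1 x1) \<noteq> zero_m (K w) n 1" "cp w (map_mat b2 x2) \<noteq> zero_m (K w) n 1"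
      using nz[of V1 b1 w x1] nz[of V2 b2 w x2] w x1 x2 by blast+
    then show ?thesis using Kw.SO_transitive_isotropic[OF qw n xw(2) _ bz(2) xw(1) _ bz(1)] by metis
  qed
  then obtain g where g: "g \<in> carrier (GL n F0)" "\<And>w. w \<in> V0 ==> ?G w (cp w g)"
    using glue_choice[OF pr0, of n ?G] by blast
  note gr = GL_rmat[OF g(1)]
  have gq: "pullback F0 q0 g = q0"
    by (rule product_pullback_eqI[OF pr0 reg_rmat[OF q0r] gr reg_rmat[OF q0r]]) (simp_all add: g(2))
  have gd: "mat_det F0 g = \<one>\<^bsub>F0\<^esub>"
  proof (rule product_det_eqI[OF pr0 gr])
    show "\<one>\<^bsub>F0\<^esub> \<in> carrier F0" using cring.cring_simprules(6)[OF cr(4)] .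
  qed (simp_all add: g(2) product_ring_simps)
  have gx: "g \<star>\<^bsub>F0\<^esub> map_mat b2 x2 = map_mat b1 x1"
    by (rule cp_ext[OF pr0 cring.rmat_prod[OF cr(4) gr b2r[OF x2(1)]] b1r[OF x1(1)]])
      (simp_all add: map_mat_prod[OF cr(4) Kcring[OF pr0] proj_hom[OF pr0] gr b2r[OF x2(1)]] g(2))
  obtain g1 g2 where gg: "g1 \<in> carrier (GL n F1)" "pullback F1 (map_mat a1 q) g1 = map_mat a1 q" "g2 \<in> carrier (GL n F2)"
    "g = map_mat b1 g1 \<star>\<^bsub>F0\<^esub> map_mat b2 g2"
    by (rule SO_factorization_regular[OF q g(1) gq[unfolded q0_def] gd]) (use n in auto)
  obtain T where T: "T \<in> carrier (GL n F1)" "T \<star>\<^bsub>F1\<^esub> g1 = one_m F1 n" "g1 \<star>\<^bsub>F1\<^esub> T = one_m F1 n"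
    using GL_inverse[OF cr(2) gg(1)] .
  note g1r = GL_rmat[OF gg(1)] and g2r = GL_rmat[OF gg(3)] and Tr = GL_rmat[OF T(1)]
  have y1: "T \<star>\<^bsub>F1\<^esub> x1 \<in> rmat F1 n 1" and y2: "g2 \<star>\<^bsub>F2\<^esub> x2 \<in> rmat F2 n 1"
    using cring.rmat_prod[OF cr(2) Tr x1(1)] cring.rmat_prod[OF cr(3) g2r x2(1)] by auto
  have "map_mat b1 x1 = map_mat b1 g1 \<star>\<^bsub>F0\<^esub> map_mat b2 (g2 \<star>\<^bsub>F2\<^esub> x2)"
    using gx gg(4) mat_assoc[OF cr(4) b1r[OF g1r] b2r[OF g2r] b2r[OF x2(1)]] map_mat_prod[OF hb2 g2r x2(1)] by simp
  then have "map_mat b1 (T \<star>\<^bsub>F1\<^esub> x1) = map_mat b2 (g2 \<star>\<^bsub>F2\<^esub> x2)"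
    using map_mat_prod[OF hb1 Tr x1(1)] map_cancel_left[OF hb1 Tr g1r T(2) b2r[OF y2]] by simp
  then obtain y where y: "y \<in> rmat F n 1" "map_mat a1 y = T \<star>\<^bsub>F1\<^esub> x1"
    using matrix_descent[OF y1 y2] by metis
  have "map_mat a1 (pullback F q y) = pullback F1 (pullback F1 (map_mat a1 q) T) x1"
    using map_pullback[OF ha1 qr y(1)] y(2) pullback_pullback[OF cr(2) a1r[OF qr] Tr x1(1)] by simp
  also have "\<dots> = map_mat a1 (zero_m F 1 1)"
    using pullback_inverse[OF cr(2) a1r[OF qr] g1r Tr T(3) gg(2)] z1 map_zero_m[OF ha1] by simp
  finally have "pullback F q y = zero_m F 1 1"
    using map_mat_inj[OF injs(1) rmat_pullback[OF cr(1) qr y(1)] cring.rmat_zero[OF cr(1)]] by simp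
  then have by0: "F.bil q y y = \<zero>" using F.pullback_vec[OF qr y(1)] by (simp add: F.sc_zero[symmetric])
  have "y \<noteq> zero_m F n 1"
  proof
    assume "y = zero_m F n 1"
    then have "T \<star>\<^bsub>F1\<^esub> x1 = zero_m F1 n 1" using y(2) map_zero_m[OF ha1] by simp
    then have "g1 \<star>\<^bsub>F1\<^esub> (T \<star>\<^bsub>F1\<^esub> x1) = zero_m F1 n 1" using mat_zero_right[OF cr(2) g1r] by simp
    moreover have "g1 \<star>\<^bsub>F1\<^esub> (T \<star>\<^bsub>F1\<^esub> x1) = x1"
      using mat_assoc[OF cr(2) g1r Tr x1(1)] T(3) mat_one_left[OF cr(2) x1(1)] by simp
    ultimately have x0: "x1 = zero_m F1 n 1" by simp
    obtain v where v: "v \<in> V1" using V1_nonempty by auto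
    have "cp v x1 = zero_m (K v) n 1"
      unfolding x0 by (rule map_zero_m[OF cr(2) Kcring[OF pr1 v] proj_hom[OF pr1 v]])
    then show False using x1(2)[OF v] by simp
  qed
  then show ?thesis unfolding F.isotropic_iff[OF reg_symm[OF q]] using y(1) by0 by blast
qed

end

section \<open>The group P: discriminants of locally hyperbolic forms, isotropy and Witt
  index\<close>

section \<open>Locally hyperbolic Pfister forms\<close>

context form_field
begin

lemma H_1: "H 1 = hyperbolic_plane R"
  using H_Suc[of 0] perp_Nil_right[OF R] by (simp add: One_nat_def H_0)

lemma binary_pfister_eq: "binary_pfister R d = sc \<one> \<bottom> sc (\<ominus> d)"
  unfolding binary_pfister_def using diag_form_Cons[OF R, of \<one> "[\<ominus> d]"] .

lemma minus_Units: "d \<in> Units R ==> \<ominus> d \<in> Units R"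
  by (simp add: Units_iff)

lemma reg_binary_pfister: "d \<in> Units R ==> binary_pfister R d \<in> reg R 2"
  using reg_perp[OF R reg_diag1[OF R Units_one_closed] reg_diag1[OF R minus_Units]] by (simp add: binary_pfister_eq)

lemma det_binary_pfister:
  assumes "d \<in> Units R" shows "mat_det R (binary_pfister R d) = \<ominus> d"
proof -
  have "mat_det R (sc \<one> \<bottom> sc (\<ominus> d)) = mat_det R (sc \<one>) \<otimes> mat_det R (sc (\<ominus> d))"
    by (rule det_perp[OF R rmat_sc rmat_sc]) (use assms in auto)
  then show ?thesis using assms det_diag1[OF R, of \<one>] det_diag1[OF R, of "\<ominus> d"] by (simp add: binary_pfister_eq Units_closed)
qed

lemma binary_pfister_one: "binary_pfister R \<one> = H 1"
  by (simp add: binary_pfister_def H_1 hyperbolic_plane_def)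

lemma binary_pfister_square:
  assumes "c \<in> Units R" "d \<in> Units R"
  shows "eqv 2 (binary_pfister R (c \<otimes> c \<otimes> d)) (binary_pfister R d)"
proof -
  have c: "c \<in> carrier R" "d \<in> carrier R" using assms by auto
  have "pullback R (sc (\<ominus> d)) (sc c) = sc (\<ominus> (c \<otimes> c \<otimes> d))"
    using pullback_vec[OF rmat_sc rmat_sc, of "\<ominus> d" c] bil_sc[of "\<ominus> d" c c] c by (simp add: l_minus r_minus m_ac)
  moreover have "sc c \<in> carrier (GL 1 R)" using reg_GL[OF reg_diag1[OF R assms(1)]] .
  ultimately have "isometric R (sc (\<ominus> (c \<otimes> c \<otimes> d))) (sc (\<ominus> d))"
    using isometricI[OF R _ rmat_sc] c by simp
  then have 1: "eqv 1 (sc (\<ominus> (c \<otimes> c \<otimes> d))) (sc (\<ominus> d))"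
    by (rule eqvI[OF _ reg_diag1[OF R minus_Units[OF assms(2)]]])
  show ?thesis
    using eqv_perp[OF eqv_refl[OF reg_diag1[OF R Units_one_closed]] 1] by (simp add: binary_pfister_eq)
qed

text \<open>Comparison of determinants: \<open>c\<close> is the determinant of an isometry.\<close>

lemma binary_pfister_eqvD:
  assumes "eqv 2 (binary_pfister R d) (binary_pfister R d')" "d \<in> Units R" "d' \<in> Units R"
  obtains c where "c \<in> Units R" "d = c \<otimes> c \<otimes> d'"
proof -
  note r' = reg_rmat[OF reg_binary_pfister[OF assms(3)]]
  obtain C where C: "C \<in> carrier (GL 2 R)" "pullback R (binary_pfister R d') C = binary_pfister R d"
    using isometricE[OF R eqvD(3)[OF assms(1)] r'] by blast
  have u: "mat_det R C \<in> Units R" using GL_det_unit[OF R C(1)] .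
  have "\<ominus> d = mat_det R C \<otimes> mat_det R C \<otimes> \<ominus> d'"
    using det_pullback[OF R r' GL_rmat[OF C(1)]] C(2) det_binary_pfister assms(2,3) by simp
  also have "\<dots> = \<ominus> (mat_det R C \<otimes> mat_det R C \<otimes> d')" using u assms(3) by (simp add: r_minus Units_closed)
  finally have "\<ominus> (\<ominus> d) = \<ominus> (\<ominus> (mat_det R C \<otimes> mat_det R C \<otimes> d'))" by simp
  then have "d = mat_det R C \<otimes> mat_det R C \<otimes> d'" using u assms(2,3) by (simp add: Units_closed)
  then show ?thesis using that u by blast
qed

lemma binary_pfister_hyperbolic:
  assumes "d \<in> Units R" "is_square_in R d" shows "eqv 2 (binary_pfister R d) (H 1)"
proof -
  obtain y where y: "y \<in> carrier R" "d = y \<otimes> y" using assms(2) by (auto simp: is_square_in_def)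
  then have "y \<in> Units R" using assms(1) by (auto simp: Units_iff)
  from binary_pfister_square[OF this Units_one_closed] show ?thesis using y by (simp add: binary_pfister_one)
qed

lemma eqv_H_cls: "eqv (2 * k) Q (H k) ==> cls Q = \<zero>\<^bsub>witt_ring R\<^esub>"
  using cls_zero_iff[OF eqvD(1)] by blast

lemma witt_index_H_perp:
  assumes "Q \<in> reg R n" shows "witt_index R (H i \<bottom> Q) = i + witt_index R Q"
proof -
  obtain j m q where q: "n = 2 * j + m" "q \<in> reg R m" "\<not> isotropic R q" "eqv n Q (H j \<bottom> q)"
    using witt_decomposition[OF assms] .
  have "eqv (2 * i + n) (H i \<bottom> Q) (H i \<bottom> (H j \<bottom> q))"
    by (rule eqv_perp[OF eqv_refl[OF reg_H] q(4)])
  also have "H i \<bottom> (H j \<bottom> q) = H (i + j) \<bottom> q"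
    using perp_assoc[OF R, of "H i" "H j" q] by (simp add: H_add)
  finally show ?thesis using witt_index_eq[OF _ q(2,3)] witt_index_eq[OF q(4,2,3)] by simp
qed

lemma witt_index_eqv:
  assumes "eqv n A B" shows "witt_index R A = witt_index R B"
proof -
  obtain j m q where q: "n = 2 * j + m" "q \<in> reg R m" "\<not> isotropic R q" "eqv n B (H j \<bottom> q)"
    using witt_decomposition[OF eqvD(2)[OF assms]] .
  show ?thesis using witt_index_eq[OF q(4,2,3)] witt_index_eq[OF eqv_trans[OF assms q(4)] q(2,3)] by simp
qed

end

context patching_diamond
begin

interpretation F: form_field F by (rule form_F)

abbreviation "P \<equiv> pfister_classes F F1 F2 F0 a1 a2 b1"

text \<open>Stated at the indices where forms are compared; \<open>locsq_iff\<close> and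
  \<open>locsq_all\<close> relate it to the conditions in the three rings and at \<open>V0\<close>,
  pushing square roots forward along \<open>b1\<close>.\<close>

definition locsq :: "'f => bool" where
  "locsq d \<longleftrightarrow> d \<in> Units F \<and> (\<forall>v\<in>V12. is_square_in (K v) (e v d))"

lemma e_1: "v \<in> V1 ==> (\<lambda>x. a1 x v) = e v" and e_2: "v \<in> V2 ==> (\<lambda>x. a2 x v) = e v"
  using disj by (auto simp: e_def fun_eq_iff)

lemma e_0: "w \<in> V0 ==> e w x = b1 (a1 x) w"
  using disj by (auto simp: e_def)

lemma hom_square: "h \<in> Ring.ring_hom R S ==> is_square_in R x ==> is_square_in S (h x)"
  unfolding is_square_in_def using ring_hom_closed ring_hom_mult by metis

lemma square_product:
  assumes "x \<in> carrier (product_ring V K)"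
  shows "is_square_in (product_ring V K) x \<longleftrightarrow> (\<forall>v\<in>V. is_square_in (K v) (x v))"
proof
  assume "is_square_in (product_ring V K) x"
  then show "\<forall>v\<in>V. is_square_in (K v) (x v)"
    unfolding is_square_in_def by (auto simp: product_ring_simps)
next
  assume "\<forall>v\<in>V. is_square_in (K v) (x v)"
  then obtain y where y: "\<And>v. v \<in> V ==> y v \<in> carrier (K v) \<and> x v = y v \<otimes>\<^bsub>K v\<^esub> y v"
    unfolding is_square_in_def by metis
  have x: "x \<in> (\<Pi>\<^sub>E v\<in>V. carrier (K v))" using assms by (simp add: product_ring_simps)
  have "x = (\<lambda>v\<in>V. y v \<otimes>\<^bsub>K v\<^esub> y v)"
  proof
    fix v show "x v = (\<lambda>v\<in>V. y v \<otimes>\<^bsub>K v\<^esub> y v) v" using y[of v] PiE_arb[OF x, of v] by (cases "v \<in> V") auto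
  qed
  then have "x = (\<lambda>v\<in>V. y v) \<otimes>\<^bsub>product_ring V K\<^esub> (\<lambda>v\<in>V. y v)"
    by (simp add: product_ring_simps cong: restrict_cong)
  moreover have "(\<lambda>v\<in>V. y v) \<in> carrier (product_ring V K)" using y by (auto simp: product_ring_simps)
  ultimately show "is_square_in (product_ring V K) x" unfolding is_square_in_def by blast
qed

lemma locsq_iff: "locsq d \<longleftrightarrow> d \<in> Units F \<and> is_square_in F1 (a1 d) \<and> is_square_in F2 (a2 d) \<and> is_square_in F0 (b1 (a1 d))"
proof (cases "d \<in> Units F")
  case True
  then have d: "d \<in> carrier F" by auto
  have "is_square_in F1 (a1 d) \<longleftrightarrow> (\<forall>v\<in>V1. is_square_in (K v) (e v d))"
    using square_product[OF ring_hom_closed[OF homs(1) d]] by (simp add: e_def)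
  moreover have "is_square_in F2 (a2 d) \<longleftrightarrow> (\<forall>v\<in>V2. is_square_in (K v) (e v d))"
    using square_product[OF ring_hom_closed[OF homs(2) d]] disj by (auto simp: e_def)
  ultimately show ?thesis using True hom_square[OF homs(3), of "a1 d"] by (auto simp: locsq_def)
qed (simp add: locsq_def)

lemma locsq_all: "locsq d \<longleftrightarrow> d \<in> Units F \<and> (\<forall>v\<in>VV. is_square_in (K v) (e v d))"
proof (cases "d \<in> Units F")
  case True
  then have d: "d \<in> carrier F" by auto
  have "is_square_in F0 (b1 (a1 d)) \<longleftrightarrow> (\<forall>v\<in>V0. is_square_in (K v) (e v d))"
    using square_product[OF ring_hom_closed[OF homs(3) ring_hom_closed[OF homs(1) d]]] by (simp add: e_0)
  then show ?thesis using locsq_iff[of d] by (auto simp: locsq_def)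
qed (simp add: locsq_def)

lemma P_eq: "P = {witt_class F (binary_pfister F d) |d. locsq d}"
  unfolding pfister_classes_def locsq_iff ..

lemma e_Units: "v \<in> VV ==> d \<in> Units F ==> e v d \<in> Units (K v)"
proof -
  assume v: "v \<in> VV" and d: "d \<in> Units F"
  interpret Kv: form_field "K v" by (rule form_K[OF v])
  have inj: "inj_on (e v) (carrier F)" using non_trivial_field_hom_is_inj[OF e_hom[OF v] field_F field_K[OF v]] .
  have "e v d \<noteq> e v \<zero>" using inj_onD[OF inj, of d "\<zero>"] d by (auto simp: F.Units_iff)
  then show ?thesis
    using ring_hom_closed[OF e_hom[OF v]] d ring_hom_zero[OF e_hom[OF v] F.is_ring Kv.is_ring] by (auto simp: Kv.Units_iff)
qed

lemma map_binary_pfister: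
  assumes "v \<in> VV" "d \<in> carrier F"
  shows "map_mat (e v) (binary_pfister F d) = binary_pfister (K v) (e v d)"
proof -
  interpret Kv: form_field "K v" by (rule form_K[OF assms(1)])
  interpret E: ring_hom_cring F "K v" "e v" by (intro hom_cringI cr Kv.R e_hom[OF assms(1)])
  show ?thesis unfolding binary_pfister_def map_diag_form[OF F.R Kv.R e_hom[OF assms(1)]] using assms(2) by simp
qed

lemma locsq_local:
  assumes "locsq d" "v \<in> V12"
  shows "form_field.eqv (K v) 2 (map_mat (e v) (binary_pfister F d)) (hyperbolic_space (K v) 1)"
proof -
  have v: "v \<in> VV" using assms by auto
  have d: "d \<in> Units F" "is_square_in (K v) (e v d)" using assms by (auto simp: locsq_def)
  interpret Kv: form_field "K v" by (rule form_K[OF v])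
  show ?thesis
    using Kv.binary_pfister_hyperbolic[OF e_Units[OF v d(1)] d(2)] map_binary_pfister[OF v] d(1) by auto
qed

text \<open>Let \<delta> be the ratio of the determinant of \<open>p\<close>, which is h + q, to
  that of a hyperbolic space of the same dimension. Determinants of local isometries show that
  \<delta> is locally a square. Hence kh + <1,-\<delta>> is locally hyperbolic like
  \<open>p\<close>, and it has the same determinant, so the two are isometric over
  \<open>F\<close>.\<close>

lemma locally_hyperbolic_pfister:
  assumes q: "q \<in> reg F n" and loc: "\<And>v. v \<in> V12 ==> witt_class (K v) (map_mat (e v) q) = \<zero>\<^bsub>witt_ring (K v)\<^esub>"
  obtains d where "locsq d" "F.weq q (binary_pfister F d)"
proof -
  obtain u where u: "u \<in> V1" using V1_nonempty by auto
  then have u': "u \<in> V12" "u \<in> VV" by auto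
  obtain k where k: "n = 2 * k"
    using form_field.cls_zero_iff[OF form_K[OF u'(2)] reg_map[OF cr(1) Kcr[OF u'(2)] e_hom[OF u'(2)] q]] loc[OF u'(1)] by blast
  \<comment> \<open>The extra hyperbolic plane makes the dimension positive, as gluing requires,
    even if \<open>q\<close> has dimension zero, and leaves room for the binary summand.\<close>
  define p where "p = F.H 1 \<bottom> q"
  let ?m = "Suc k"
  have p: "p \<in> reg F (2 * ?m)" using reg_perp[OF F.R F.reg_H[of 1] q] k by (simp add: p_def)
  have qp: "F.weq q p"
    using F.weq_trans[OF F.weq_perp_H[OF q, of 1] F.weq_of_eqv[OF F.eqv_comm[OF q F.reg_H[of 1]]]] by (simp add: p_def)
  have locp: "form_field.eqv (K v) (2 * ?m) (map_mat (e v) p) (hyperbolic_space (K v) ?m)" if v: "v \<in> V12" for v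
  proof -
    have v': "v \<in> VV" using v by auto
    interpret Kv: form_field "K v" by (rule form_K[OF v'])
    note base = F.R Kv.R e_hom[OF v']
    have "Kv.eqv n (map_mat (e v) q) (Kv.H k)"
      using Kv.cls_zero_iff[OF reg_map[OF base q]] loc[OF v] k by auto
    from Kv.eqv_perp[OF Kv.eqv_refl[OF Kv.reg_H[of 1]] this]
    have "Kv.eqv (2 * 1 + n) (map_mat (e v) p) (Kv.H 1 \<bottom>\<^bsub>K v\<^esub> Kv.H k)"
      by (simp add: p_def map_perp[OF base] map_hyperbolic_space[OF base])
    then show ?thesis using Kv.H_add[of 1 k] k by (simp add: One_nat_def)
  qed
  have dHk: "mat_det F (F.H k) \<in> Units F" using GL_det_unit[OF F.R reg_GL[OF F.reg_H]] .
  have dp: "mat_det F p \<in> Units F" using GL_det_unit[OF F.R reg_GL[OF p]] .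
  have dH: "mat_det F (F.H ?m) \<in> Units F" using GL_det_unit[OF F.R reg_GL[OF F.reg_H]] .
  define \<delta> where "\<delta> = mat_det F p \<otimes> inv mat_det F (F.H ?m)"
  have \<delta>: "\<delta> \<in> Units F" using dp dH by (simp add: \<delta>_def)
  have dp\<delta>: "mat_det F p = \<delta> \<otimes> mat_det F (F.H ?m)" using dp dH by (simp add: \<delta>_def F.m_assoc F.Units_closed)
  have ls: "locsq \<delta>"
    unfolding locsq_def
  proof (intro conjI ballI \<delta>)
    fix v assume v: "v \<in> V12"
    then have v': "v \<in> VV" by auto
    interpret Kv: form_field "K v" by (rule form_K[OF v'])
    note base = F.R Kv.R e_hom[OF v']
    obtain C where C: "C \<in> carrier (GL (2 * ?m) (K v))" "pullback (K v) (Kv.H ?m) C = map_mat (e v) p"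
      using isometricE[OF Kv.R Kv.eqvD(3)[OF locp[OF v]] reg_rmat[OF Kv.reg_H]] by blast
    have cl: "mat_det (K v) C \<in> carrier (K v)" using mat_det_closed[OF Kv.R GL_rmat[OF C(1)]] .
    have dHv: "mat_det (K v) (Kv.H ?m) \<in> Units (K v)" using GL_det_unit[OF Kv.R reg_GL[OF Kv.reg_H]] .
    have "mat_det (K v) C \<otimes>\<^bsub>K v\<^esub> mat_det (K v) C \<otimes>\<^bsub>K v\<^esub> mat_det (K v) (Kv.H ?m) = e v (mat_det F p)"
      using det_pullback[OF Kv.R reg_rmat[OF Kv.reg_H] GL_rmat[OF C(1)]] C(2) map_mat_det[OF base reg_rmat[OF p]] by simp
    also have "\<dots> = e v \<delta> \<otimes>\<^bsub>K v\<^esub> mat_det (K v) (Kv.H ?m)"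
      using dp\<delta> ring_hom_mult[OF e_hom[OF v'], of \<delta> "mat_det F (F.H ?m)"] \<delta> dH map_mat_det[OF base reg_rmat[OF F.reg_H]] map_hyperbolic_space[OF base]
      by auto
    finally have "mat_det (K v) C \<otimes>\<^bsub>K v\<^esub> mat_det (K v) C = e v \<delta>"
      using Kv.m_rcancel[of "mat_det (K v) (Kv.H ?m)"] cl dHv e_Units[OF v' \<delta>] by (auto simp: Kv.Units_iff)
    then show "is_square_in (K v) (e v \<delta>)" unfolding is_square_in_def by (intro bexI[OF _ cl]) (rule sym)
  qed
  define r where "r = F.H k \<bottom> binary_pfister F \<delta>"
  note bp = F.reg_binary_pfister[OF \<delta>]
  have r: "r \<in> reg F (2 * ?m)" using reg_perp[OF F.R F.reg_H[of k] bp] by (simp add: r_def)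
  have "mat_det F (F.H ?m) = mat_det F (F.H 1) \<otimes> mat_det F (F.H k)"
    using det_perp[OF F.R reg_rmat[OF F.reg_H[of 1]] reg_rmat[OF F.reg_H[of k]]] F.H_add[of 1 k] by (simp add: One_nat_def)
  moreover have "mat_det F (F.H 1) = \<ominus> \<one>"
    using F.det_binary_pfister[of "\<one>"] by (simp add: F.binary_pfister_one)
  moreover have "mat_det F r = mat_det F (F.H k) \<otimes> \<ominus> \<delta>"
    using det_perp[OF F.R reg_rmat[OF F.reg_H[of k]] reg_rmat[OF bp]] F.det_binary_pfister[OF \<delta>] by (simp add: r_def)
  ultimately have dpr: "mat_det F p = \<one> \<otimes> \<one> \<otimes> mat_det F r"
    using dp\<delta> \<delta> dHk by (simp add: F.l_minus F.r_minus F.m_ac F.Units_closed)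
  have "F.eqv (2 * ?m) p r"
  proof (rule local_isometry_global[OF p r _ F.one_closed dpr])
    fix v assume v: "v \<in> V12"
    then have v': "v \<in> VV" by auto
    interpret Kv: form_field "K v" by (rule form_K[OF v'])
    note base = F.R Kv.R e_hom[OF v']
    have "Kv.eqv (2 * k + 2) (map_mat (e v) r) (Kv.H k \<bottom>\<^bsub>K v\<^esub> Kv.H 1)"
      unfolding r_def map_perp[OF base] map_hyperbolic_space[OF base]
      by (rule Kv.eqv_perp[OF Kv.eqv_refl[OF Kv.reg_H] locsq_local[OF ls v]])
    then have "Kv.eqv (2 * ?m) (map_mat (e v) r) (Kv.H ?m)" using Kv.H_add[of k 1] by (simp add: One_nat_def)
    then show "isometric (K v) (map_mat (e v) p) (map_mat (e v) r)"
      using Kv.eqvD(3)[OF Kv.eqv_trans[OF locp[OF v] Kv.eqv_sym]] by blast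
  qed simp
  then have "F.weq p r" by (rule F.weq_of_eqv)
  moreover have "F.weq r (binary_pfister F \<delta>)"
    unfolding r_def using F.weq_trans[OF F.weq_of_eqv[OF F.eqv_comm[OF F.reg_H bp]] F.weq_sym[OF F.weq_perp_H[OF bp]]] .
  ultimately have "F.weq q (binary_pfister F \<delta>)" using F.weq_trans[OF qp F.weq_trans] by blast
  then show ?thesis using that ls by blast
qed

text \<open>One direction holds because <1,-d> is a hyperbolic plane when \<open>d\<close> is a
  nonzero square; the other is \<open>locally_hyperbolic_pfister\<close>.\<close>

lemma P_iff:
  assumes q: "q \<in> reg F n"
  shows "witt_class F q \<in> P \<longleftrightarrow> (\<forall>v\<in>V12. witt_class (K v) (map_mat (e v) q) = \<zero>\<^bsub>witt_ring (K v)\<^esub>)"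
proof
  assume "witt_class F q \<in> P"
  then obtain d where d: "locsq d" "witt_class F q = witt_class F (binary_pfister F d)" unfolding P_eq by blast
  have b: "binary_pfister F d \<in> reg F 2" using d(1) F.reg_binary_pfister by (simp add: locsq_def)
  have w: "F.weq q (binary_pfister F d)" using F.cls_eq_iff[OF q b] d(2) by simp
  show "\<forall>v\<in>V12. witt_class (K v) (map_mat (e v) q) = \<zero>\<^bsub>witt_ring (K v)\<^esub>"
  proof
    fix v assume v: "v \<in> V12"
    then have v': "v \<in> VV" by auto
    interpret Kv: form_field "K v" by (rule form_K[OF v'])
    note base = F.R Kv.R e_hom[OF v']
    have "Kv.cls (map_mat (e v) q) = Kv.cls (map_mat (e v) (binary_pfister F d))"
      using Kv.cls_eq_iff[OF reg_map[OF base q] reg_map[OF base b]] map_weq[OF form_F form_K[OF v'] e_hom[OF v'] w] by simp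
    also have "\<dots> = \<zero>\<^bsub>witt_ring (K v)\<^esub>"
      using Kv.eqv_H_cls[of 1] locsq_local[OF d(1) v] by simp
    finally show "Kv.cls (map_mat (e v) q) = \<zero>\<^bsub>witt_ring (K v)\<^esub>" .
  qed
next
  assume "\<forall>v\<in>V12. witt_class (K v) (map_mat (e v) q) = \<zero>\<^bsub>witt_ring (K v)\<^esub>"
  then obtain d where d: "locsq d" "F.weq q (binary_pfister F d)" using locally_hyperbolic_pfister[OF q] by blast
  then have "witt_class F q = witt_class F (binary_pfister F d)"
    using F.cls_eq_iff[OF q F.reg_binary_pfister] by (simp add: locsq_def)
  then show "witt_class F q \<in> P" unfolding P_eq using d(1) by blast
qed

text \<open>In the Witt ring of a field the two sides in general differ by the class of
  <1,-d,-d',dd'>. Here <1,-d> + <1,-d'> and <1,-dd'> + h both have determinant dd' and are locally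
  hyperbolic, so they are isometric over \<open>F\<close>.\<close>

lemma pfister_add:
  assumes "locsq d" "locsq d'"
  shows "witt_class F (binary_pfister F d) \<oplus>\<^bsub>witt_ring F\<^esub> witt_class F (binary_pfister F d') = witt_class F (binary_pfister F (d \<otimes> d'))"
    and "locsq (d \<otimes> d')"
proof -
  have u: "d \<in> Units F" "d' \<in> Units F" "d \<otimes> d' \<in> Units F" using assms by (auto simp: locsq_def)
  show ls: "locsq (d \<otimes> d')"
    unfolding locsq_def
  proof (intro conjI ballI u(3))
    fix v assume v: "v \<in> V12"
    then have v': "v \<in> VV" by auto
    interpret Kv: form_field "K v" by (rule form_K[OF v'])
    obtain x y where xy: "x \<in> carrier (K v)" "y \<in> carrier (K v)" "e v d = x \<otimes>\<^bsub>K v\<^esub> x" "e v d' = y \<otimes>\<^bsub>K v\<^esub> y"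
      using assms v unfolding locsq_def is_square_in_def by meson
    then have "e v (d \<otimes> d') = (x \<otimes>\<^bsub>K v\<^esub> y) \<otimes>\<^bsub>K v\<^esub> (x \<otimes>\<^bsub>K v\<^esub> y)"
      using ring_hom_mult[OF e_hom[OF v'], of d d'] u by (simp add: Kv.m_ac F.Units_closed)
    then show "is_square_in (K v) (e v (d \<otimes> d'))" unfolding is_square_in_def using xy(1,2) by blast
  qed
  note b = F.reg_binary_pfister[OF u(1)] F.reg_binary_pfister[OF u(2)] F.reg_binary_pfister[OF u(3)]
  define p where "p = binary_pfister F d \<bottom> binary_pfister F d'"
  define r where "r = binary_pfister F (d \<otimes> d') \<bottom> F.H 1"
  have p: "p \<in> reg F 4" using reg_perp[OF F.R b(1,2)] by (simp add: p_def)
  have r: "r \<in> reg F 4" using reg_perp[OF F.R b(3) F.reg_H[of 1]] by (simp add: r_def)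
  have "mat_det F (F.H 1) = \<ominus> \<one>"
    using F.det_binary_pfister[of "\<one>"] by (simp add: F.binary_pfister_one)
  then have dpr: "mat_det F p = \<one> \<otimes> \<one> \<otimes> mat_det F r"
    using det_perp[OF F.R reg_rmat[OF b(1)] reg_rmat[OF b(2)]] det_perp[OF F.R reg_rmat[OF b(3)] reg_rmat[OF F.reg_H[of 1]]]
      F.det_binary_pfister u by (simp add: p_def r_def F.l_minus F.r_minus F.Units_closed)
  have "F.eqv 4 p r"
  proof (rule local_isometry_global[OF p r _ F.one_closed dpr])
    fix v assume v: "v \<in> V12"
    then have v': "v \<in> VV" by auto
    interpret Kv: form_field "K v" by (rule form_K[OF v'])
    note base = F.R Kv.R e_hom[OF v']
    have 1: "Kv.eqv (2 + 2) (map_mat (e v) p) (Kv.H 1 \<bottom>\<^bsub>K v\<^esub> Kv.H 1)"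
      unfolding p_def map_perp[OF base] by (rule Kv.eqv_perp[OF locsq_local[OF assms(1) v] locsq_local[OF assms(2) v]])
    have 2: "Kv.eqv (2 + 2 * 1) (map_mat (e v) r) (Kv.H 1 \<bottom>\<^bsub>K v\<^esub> Kv.H 1)"
      unfolding r_def map_perp[OF base] map_hyperbolic_space[OF base] by (rule Kv.eqv_perp[OF locsq_local[OF ls v] Kv.eqv_refl[OF Kv.reg_H]])
    show "isometric (K v) (map_mat (e v) p) (map_mat (e v) r)"
      using Kv.eqvD(3)[OF Kv.eqv_trans[OF 1 Kv.eqv_sym]] 2 by simp
  qed simp
  then have "F.weq p (binary_pfister F (d \<otimes> d'))"
    using F.weq_trans[OF F.weq_of_eqv F.weq_sym[OF F.weq_perp_H[OF b(3), of 1]]] by (simp add: r_def)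
  then show "witt_class F (binary_pfister F d) \<oplus>\<^bsub>witt_ring F\<^esub> witt_class F (binary_pfister F d') = witt_class F (binary_pfister F (d \<otimes> d'))"
    using F.witt_add[OF b(1,2)] F.cls_eq_iff[OF p b(3)] by (simp add: p_def)
qed

text \<open>Serves both square classes and Kummer classes: \<kappa> is multiplicative on units and
  trivial exactly on squares, while <1,-d> and the square class of \<open>d\<close> determine each
  other. \<open>T\<close> is an arbitrary structure, so classes are compared through units of
  \<open>F\<close> instead of inverses in \<open>T\<close>.\<close>

lemma pfister_iso:
  assumes mult: "\<And>d d'. d \<in> Units F ==> d' \<in> Units F ==> \<kappa> (d \<otimes> d') = \<kappa> d \<otimes>\<^bsub>T\<^esub> \<kappa> d'"
    and triv: "\<And>d. d \<in> Units F ==> \<kappa> d = \<one>\<^bsub>T\<^esub> \<longleftrightarrow> is_square_in F d"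
    and img: "X0 = \<kappa> ` {d. locsq d}"
  shows "\<exists>\<phi>\<in>iso ((witt_group F)\<lparr>carrier := P\<rparr>) (T\<lparr>carrier := X0\<rparr>).
    \<forall>d\<in>Units F. witt_class F (binary_pfister F d) \<in> P \<longrightarrow> \<phi> (witt_class F (binary_pfister F d)) = \<kappa> d"
proof -
  let ?B = "\<lambda>d. witt_class F (binary_pfister F d)"
  have sq: "is_square_in F (c \<otimes> c)" if "c \<in> Units F" for c using that unfolding is_square_in_def by auto
  have B_iff: "?B d = ?B d' \<longleftrightarrow> \<kappa> d = \<kappa> d'" if u: "d \<in> Units F" "d' \<in> Units F" for d d'
  proof -
    note b = F.reg_binary_pfister[OF u(1)] F.reg_binary_pfister[OF u(2)]
    show ?thesis
    proof
      assume "?B d = ?B d'"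
      then have "F.eqv 2 (binary_pfister F d) (binary_pfister F d')" using F.cls_eq_iff[OF b] F.weq_same_dim[OF _ b] by simp
      then obtain c where c: "c \<in> Units F" "d = c \<otimes> c \<otimes> d'" using F.binary_pfister_eqvD u by metis
      have "\<kappa> (c \<otimes> c) = \<kappa> \<one>"
        using triv[of "c \<otimes> c"] triv[of "\<one>"] sq[OF c(1)] sq[of "\<one>"] c(1) by simp
      then show "\<kappa> d = \<kappa> d'" using mult[of "c \<otimes> c" d'] mult[of "\<one>" d'] c u by (simp add: F.Units_closed)
    next
      assume eq: "\<kappa> d = \<kappa> d'"
      have "\<kappa> (d \<otimes> d') = \<kappa> (d \<otimes> d)" using mult u eq by simp
      also have "\<dots> = \<one>\<^bsub>T\<^esub>" using triv[of "d \<otimes> d"] sq u by simp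
      finally obtain y where y: "y \<in> carrier F" "d \<otimes> d' = y \<otimes> y"
        using triv[of "d \<otimes> d'"] u by (auto simp: is_square_in_def)
      have yu: "y \<in> Units F" using y u F.integral[of d d'] by (auto simp: F.Units_iff)
      \<comment> \<open>From d d' = y y one gets d = c c d' with c = y/d'.\<close>
      define c where "c = y \<otimes> inv d'"
      have c: "c \<in> Units F" using yu u by (simp add: c_def)
      have "c \<otimes> c \<otimes> d' = (y \<otimes> y) \<otimes> inv d' \<otimes> (inv d' \<otimes> d')"
      proof -
        have "(y \<otimes> i) \<otimes> (y \<otimes> i) \<otimes> d' = (y \<otimes> y) \<otimes> i \<otimes> (i \<otimes> d')" if "i \<in> carrier F" for i
          using that u y(1) by (simp add: F.m_ac F.Units_closed)
        from this[of "inv d'"] show ?thesis using u by (simp add: c_def)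
      qed
      also have "\<dots> = d \<otimes> d' \<otimes> inv d'" using u y(2)[symmetric] by (simp add: F.Units_closed)
      also have "\<dots> = d" using u by (simp add: F.m_assoc F.Units_closed)
      finally have "F.eqv 2 (binary_pfister F d) (binary_pfister F d')" using F.binary_pfister_square[OF c u(2)] by simp
      then show "?B d = ?B d'" using F.cls_eq_iff[OF b] F.weq_of_eqv by simp
    qed
  qed
  define \<phi> where "\<phi> Z = \<kappa> (SOME d. d \<in> Units F \<and> ?B d = Z)" for Z
  have \<phi>: "\<phi> (?B d) = \<kappa> d" if "d \<in> Units F" for d
  proof -
    have "(SOME d'. d' \<in> Units F \<and> ?B d' = ?B d) \<in> Units F \<and> ?B (SOME d'. d' \<in> Units F \<and> ?B d' = ?B d) = ?B d"
      by (rule someI[of "\<lambda>d'. d' \<in> Units F \<and> ?B d' = ?B d" d]) (use that in simp)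
    then show ?thesis unfolding \<phi>_def using B_iff that by blast
  qed
  have lu: "locsq d ==> d \<in> Units F" for d by (simp add: locsq_def)
  have "\<phi> \<in> iso ((witt_group F)\<lparr>carrier := P\<rparr>) (T\<lparr>carrier := X0\<rparr>)"
    unfolding iso_def
  proof (intro CollectI conjI homI)
    fix x assume "x \<in> carrier ((witt_group F)\<lparr>carrier := P\<rparr>)"
    then obtain d where d: "locsq d" "x = ?B d" by (auto simp: P_eq)
    then show "\<phi> x \<in> carrier (T\<lparr>carrier := X0\<rparr>)" using \<phi> lu img by simp
    fix y assume "y \<in> carrier ((witt_group F)\<lparr>carrier := P\<rparr>)"
    then obtain d' where d': "locsq d'" "y = ?B d'" by (auto simp: P_eq)
    show "\<phi> (x \<otimes>\<^bsub>(witt_group F)\<lparr>carrier := P\<rparr>\<^esub> y) = \<phi> x \<otimes>\<^bsub>T\<lparr>carrier := X0\<rparr>\<^esub> \<phi> y"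
      using d d' pfister_add[OF d(1) d'(1)] \<phi> lu mult by simp
  next
    show "bij_betw \<phi> (carrier ((witt_group F)\<lparr>carrier := P\<rparr>)) (carrier (T\<lparr>carrier := X0\<rparr>))"
      unfolding bij_betw_def
    proof
      show "inj_on \<phi> (carrier ((witt_group F)\<lparr>carrier := P\<rparr>))"
      proof (rule inj_onI)
        fix x y assume "x \<in> carrier ((witt_group F)\<lparr>carrier := P\<rparr>)" "y \<in> carrier ((witt_group F)\<lparr>carrier := P\<rparr>)" and eq: "\<phi> x = \<phi> y"
        then obtain d d' where d: "locsq d" "x = ?B d" "locsq d'" "y = ?B d'" by (auto simp: P_eq)
        show "x = y" using eq B_iff[OF lu[OF d(1)] lu[OF d(3)]] \<phi>[OF lu[OF d(1)]] \<phi>[OF lu[OF d(3)]] unfolding d(2,4) by simp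
      qed
      have "P = ?B ` {d. locsq d}" unfolding P_eq by blast
      then have "\<phi> ` P = (\<lambda>d. \<phi> (?B d)) ` {d. locsq d}" by (simp only: image_image)
      also have "\<dots> = \<kappa> ` {d. locsq d}" by (rule image_cong[OF refl]) (simp add: \<phi> lu)
      finally have "\<phi> ` P = \<kappa> ` {d. locsq d}" .
      then show "\<phi> ` carrier ((witt_group F)\<lparr>carrier := P\<rparr>) = carrier (T\<lparr>carrier := X0\<rparr>)" using img by simp
    qed
  qed
  then show ?thesis using \<phi> by blast
qed

text \<open>A counterexample is anisotropic, hence regular; its dimension is at least two because it
  is isotropic locally, and less than three by \<open>isotropic_descent\<close>. A binary form that
  is isotropic at every index is locally a hyperbolic plane, so its class lies in \<open>P\<close>,
  which is excluded.\<close>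

theorem isotropy_local_global:
  assumes q: "quad_form F q" and P: "dim_row q \<noteq> 2 \<or> witt_class F q \<notin> P"
    and loc: "\<And>v. v \<in> V12 ==> isotropic (K v) (map_mat (e v) q)"
  shows "isotropic F q"
proof (rule ccontr)
  assume an: "\<not> isotropic F q"
  define n where "n = dim_row q"
  have reg: "q \<in> reg F n" using F.anisotropic_reg[OF _ an] q by (simp add: quad_form_iff n_def)
  have regv: "map_mat (e v) q \<in> reg (K v) n" if "v \<in> V12" for v
    using reg_map[OF cr(1) Kcr e_hom reg] that by auto
  have fv: "form_field (K v)" if "v \<in> V12" for v using form_K that by auto
  obtain u where u: "u \<in> V12" using V1_nonempty by auto
  have "n \<ge> 2" using form_field.isotropic_split[OF fv[OF u] regv[OF u] loc[OF u]] by (metis le_add1)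
  moreover have "\<not> n \<ge> 3" using isotropic_descent[OF reg _ loc] an by blast
  ultimately have n: "n = 2" by simp
  have "witt_class (K v) (map_mat (e v) q) = \<zero>\<^bsub>witt_ring (K v)\<^esub>" if v: "v \<in> V12" for v
  proof -
    interpret Kv: form_field "K v" by (rule fv[OF v])
    show ?thesis using Kv.eqv_H_cls[of 1] Kv.isotropic_binary[OF _ loc[OF v]] regv[OF v] n by (simp add: Kv.H_1)
  qed
  then have "witt_class F q \<in> P" using P_iff[OF reg] by blast
  then show False using P n by (simp add: n_def)
qed

text \<open>Let \<open>p\<close> be the anisotropic part. If \<open>p\<close> is isotropic at every
  index, then by \<open>isotropy_local_global\<close> it is binary with class in \<open>P\<close>,
  and all its local Witt indices are one: this is the correction by one. Otherwise the smallest
  local index of \<open>p\<close> is zero, and the class of \<open>p\<close> lies in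
  \<open>P\<close> only if \<open>p\<close> is zero, since a form that is anisotropic at some index
  and hyperbolic there has dimension zero.\<close>

theorem witt_index_local_global:
  assumes "q \<in> regular_forms F"
  shows "int (witt_index F q) = int (Min ((\<lambda>v. witt_index (K v) (map_mat (e v) q)) ` (V12))) -
    (if witt_class F q \<in> P - {\<zero>\<^bsub>witt_ring F\<^esub>} then 1 else 0)"
proof -
  define n where "n = dim_row q"
  have q: "q \<in> reg F n" using assms by (simp add: regular_iff n_def)
  obtain i m p where p: "n = 2 * i + m" "p \<in> reg F m" "\<not> isotropic F p" "F.eqv n q (F.H i \<bottom> p)"
    using F.witt_decomposition[OF q] .
  have i: "witt_index F q = i" using F.witt_index_eq[OF p(4,2,3)] .
  have Vf: "finite (V12)" "V12 \<noteq> {}" using fin V1_nonempty by auto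
  have fv: "form_field (K v)" "v \<in> VV" if "v \<in> V12" for v using form_K that by auto
  have pv: "map_mat (e v) p \<in> reg (K v) m" if "v \<in> V12" for v
    using reg_map[OF cr(1) Kcr e_hom p(2)] that by auto
  have wv: "witt_index (K v) (map_mat (e v) q) = i + witt_index (K v) (map_mat (e v) p)" if v: "v \<in> V12" for v
  proof -
    interpret Kv: form_field "K v" by (rule fv[OF v])
    note base = F.R Kv.R e_hom[OF fv(2)[OF v]]
    have "isometric (K v) (map_mat (e v) q) (map_mat (e v) (F.H i \<bottom> p))"
      by (rule isometric_map[OF base F.eqvD(3)[OF p(4)] reg_rmat[OF F.eqvD(2)[OF p(4)]]])
    then have "Kv.eqv n (map_mat (e v) q) (map_mat (e v) (F.H i \<bottom> p))"
      by (rule Kv.eqvI[OF _ reg_map[OF base F.eqvD(2)[OF p(4)]]])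
    then show ?thesis
      using Kv.witt_index_eqv Kv.witt_index_H_perp[OF pv[OF v]] by (simp add: map_perp[OF base] map_hyperbolic_space[OF base])
  qed
  have "F.weq q p"
    using F.weq_trans[OF F.weq_of_eqv[OF p(4)] F.weq_trans[OF F.weq_of_eqv[OF F.eqv_comm[OF F.reg_H p(2)]] F.weq_sym[OF F.weq_perp_H[OF p(2)]]]] .
  then have cqp: "witt_class F q = witt_class F p" using F.cls_eq_iff[OF q p(2)] by simp
  have aniso0: "witt_index (K v) (map_mat (e v) p) = 0" if v: "v \<in> V12" "\<not> isotropic (K v) (map_mat (e v) p)" for v
  proof -
    interpret Kv: form_field "K v" by (rule fv[OF v(1)])
    have "Kv.eqv m (map_mat (e v) p) (Kv.H 0 \<bottom>\<^bsub>K v\<^esub> map_mat (e v) p)"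
      using Kv.eqv_refl[OF pv[OF v(1)]] perp_Nil_left[OF Kv.R] by (simp add: Kv.H_0)
    then show ?thesis using Kv.witt_index_eq[OF _ pv[OF v(1)] v(2)] by simp
  qed
  show ?thesis
  proof (cases "\<forall>v\<in>V12. isotropic (K v) (map_mat (e v) p)")
    case True
    have dp: "dim_row p = m" using reg_dim[OF p(2)] .
    have qf: "quad_form F p" using reg_symm[OF p(2)] dp by (simp add: quad_form_iff)
    have m: "m = 2" "witt_class F p \<in> P" using isotropy_local_global[OF qf] True p(3) dp by auto
    have "witt_index (K v) (map_mat (e v) p) = 1" if v: "v \<in> V12" for v
    proof -
      interpret Kv: form_field "K v" by (rule fv[OF v])
      have "Kv.eqv 2 (map_mat (e v) p) (Kv.H 1)" using Kv.isotropic_binary[of "map_mat (e v) p"] True v pv[OF v] m by (simp add: Kv.H_1)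
      then have "Kv.eqv 2 (map_mat (e v) p) (Kv.H 1 \<bottom>\<^bsub>K v\<^esub> diag_form (K v) [])"
        using perp_Nil_right[OF Kv.R] by simp
      then show ?thesis using Kv.witt_index_eq[OF _ Kv.reg_nil Kv.not_isotropic_0[OF reg_symm[OF Kv.reg_nil]]] by simp
    qed
    then have "(\<lambda>v. witt_index (K v) (map_mat (e v) q)) ` (V12) = {i + 1}" using wv Vf(2) by auto
    moreover have "witt_class F p \<noteq> \<zero>\<^bsub>witt_ring F\<^esub>"
    proof
      assume "witt_class F p = \<zero>\<^bsub>witt_ring F\<^esub>"
      then have "F.eqv 2 p (F.H 1)" using F.cls_zero_iff[OF p(2)] m by (auto simp: One_nat_def)
      then show False using F.isotropic_eqv F.isotropic_hyperbolic_plane p(3) by (simp add: F.H_1)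
    qed
    ultimately show ?thesis using i m cqp by simp
  next
    case False
    then obtain u where u: "u \<in> V12" "\<not> isotropic (K u) (map_mat (e u) p)" by blast
    have "Min ((\<lambda>v. witt_index (K v) (map_mat (e v) q)) ` (V12)) = i"
    proof (rule Min_eqI)
      show "i \<in> (\<lambda>v. witt_index (K v) (map_mat (e v) q)) ` (V12)" using wv[OF u(1)] aniso0[OF u] by (intro image_eqI[OF _ u(1)]) simp
      show "finite ((\<lambda>v. witt_index (K v) (map_mat (e v) q)) ` (V12))" by (rule finite_imageI[OF Vf(1)])
      fix y assume "y \<in> (\<lambda>v. witt_index (K v) (map_mat (e v) q)) ` (V12)"
      then obtain v where "v \<in> V12" "y = witt_index (K v) (map_mat (e v) q)" by blast
      then show "i \<le> y" using wv[of v] by linarith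
    qed
    moreover have "witt_class F p \<in> P ==> witt_class F p = \<zero>\<^bsub>witt_ring F\<^esub>"
    proof -
      assume "witt_class F p \<in> P"
      then have z: "witt_class (K u) (map_mat (e u) p) = \<zero>\<^bsub>witt_ring (K u)\<^esub>" using P_iff[OF p(2)] u(1) by blast
      interpret Ku: form_field "K u" by (rule fv[OF u(1)])
      obtain k where k: "m = 2 * k" "Ku.eqv m (map_mat (e u) p) (Ku.H k)" using Ku.cls_zero_iff[OF pv[OF u(1)]] z by blast
      have "k = 0"
      proof (rule ccontr)
        assume "k \<noteq> 0"
        then obtain j where "k = Suc j" using not0_implies_Suc by blast
        then have "isotropic (K u) (Ku.H k)"
          using Ku.isotropic_H_Suc_perp[OF Ku.reg_nil, of j] perp_Nil_right[OF Ku.R] by simp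
        then show False using Ku.isotropic_eqv[OF k(2)] u(2) by simp
      qed
      then have "p = diag_form F []" using k(1) p(2) F.reg_0_eq by simp
      then show ?thesis by (simp add: F.witt_zero)
    qed
    ultimately show ?thesis using i cqp by auto
  qed
qed

end

section \<open>Homomorphisms and exactness of the Witt sequence\<close>

section \<open>The exact sequence\<close>

lemma group_hom_difference:
  assumes "group G1" "group G2" "comm_group G0" "f1 \<in> hom G1 G0" "f2 \<in> hom G2 G0"
  shows "group_hom (G1 \<times>\<times> G2) G0 (\<lambda>(x, y). f1 x \<otimes>\<^bsub>G0\<^esub> inv\<^bsub>G0\<^esub> (f2 y))"
proof -
  interpret G0: comm_group G0 by fact
  note c1 = hom_in_carrier[OF assms(4)] and c2 = hom_in_carrier[OF assms(5)]
  show ?thesis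
  proof (intro group_hom.intro group_hom_axioms.intro DirProd_group assms(1,2) G0.is_group homI)
    fix p assume p: "p \<in> carrier (G1 \<times>\<times> G2)"
    then show "(case p of (x, y) => f1 x \<otimes>\<^bsub>G0\<^esub> inv\<^bsub>G0\<^esub> f2 y) \<in> carrier G0" using c1 c2 by auto
    fix q assume q: "q \<in> carrier (G1 \<times>\<times> G2)"
    obtain x y x' y' where xy: "p = (x, y)" "q = (x', y')" by (cases p, cases q)
    then have m: "x \<in> carrier G1" "y \<in> carrier G2" "x' \<in> carrier G1" "y' \<in> carrier G2" using p q by auto
    show "(case p \<otimes>\<^bsub>G1 \<times>\<times> G2\<^esub> q of (x, y) => f1 x \<otimes>\<^bsub>G0\<^esub> inv\<^bsub>G0\<^esub> f2 y) =
        (case p of (x, y) => f1 x \<otimes>\<^bsub>G0\<^esub> inv\<^bsub>G0\<^esub> f2 y) \<otimes>\<^bsub>G0\<^esub> (case q of (x, y) => f1 x \<otimes>\<^bsub>G0\<^esub> inv\<^bsub>G0\<^esub> f2 y)"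
      using c1[OF m(1)] c1[OF m(3)] c2[OF m(2)] c2[OF m(4)]
      by (simp add: xy hom_mult[OF assms(4) m(1,3)] hom_mult[OF assms(5) m(2,4)] G0.inv_mult G0.m_ac)
  qed
qed

context patching_diamond
begin

interpretation F: form_field F by (rule form_F)

abbreviation "WP V \<equiv> witt_group_prod V K"

lemma comm_group_K: "v \<in> VV ==> comm_group (witt_group (K v))"
  using form_field.comm_group_witt[OF form_K] .

lemma comm_group_prod:
  assumes "V \<subseteq> VV" shows "comm_group (WP V)"
proof -
  have g: "group (WP V)"
    unfolding witt_group_prod_def using comm_group_K assms by (intro product_group) (auto simp: comm_group_def)
  show ?thesis
  proof (rule group.group_comm_groupI[OF g])
    fix x y assume "x \<in> carrier (WP V)" "y \<in> carrier (WP V)"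
    then have xy: "\<And>v. v \<in> V ==> x v \<in> carrier (witt_group (K v))" "\<And>v. v \<in> V ==> y v \<in> carrier (witt_group (K v))"
      by (auto simp: witt_group_prod_def)
    have "x v \<otimes>\<^bsub>witt_group (K v)\<^esub> y v = y v \<otimes>\<^bsub>witt_group (K v)\<^esub> x v" if "v \<in> V" for v
      using comm_groupE(4)[OF comm_group_K xy(1)[OF that] xy(2)[OF that]] that assms by blast
    then show "x \<otimes>\<^bsub>WP V\<^esub> y = y \<otimes>\<^bsub>WP V\<^esub> x"
      by (simp add: witt_group_prod_def restrict_eq_iff)
  qed
qed

lemma hom_prodI:
  assumes "\<And>v. v \<in> V ==> f v \<in> hom G (witt_group (K v))"
  shows "(\<lambda>x. \<lambda>v\<in>V. f v x) \<in> hom G (WP V)"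
proof (rule homI)
  fix x assume x: "x \<in> carrier G"
  show "(\<lambda>v\<in>V. f v x) \<in> carrier (WP V)"
    using hom_in_carrier[OF assms x] by (simp add: witt_group_prod_def)
  fix y assume y: "y \<in> carrier G"
  show "(\<lambda>v\<in>V. f v (x \<otimes>\<^bsub>G\<^esub> y)) = (\<lambda>v\<in>V. f v x) \<otimes>\<^bsub>WP V\<^esub> (\<lambda>v\<in>V. f v y)"
    using hom_mult[OF assms x y] by (simp add: witt_group_prod_def restrict_eq_iff)
qed

lemma witt_res_field_prod_eq:
  "witt_res_field_prod V1 K a1 = (\<lambda>Z. \<lambda>v\<in>V1. witt_res (K v) (e v) Z)"
  "witt_res_field_prod V2 K a2 = (\<lambda>Z. \<lambda>v\<in>V2. witt_res (K v) (e v) Z)"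
  unfolding witt_res_field_prod_def by (simp_all add: fun_eq_iff restrict_def e_1 e_2)

lemma witt_res_prod_eq:
  "witt_res_prod V V0 K b = (\<lambda>Z. \<lambda>w\<in>V0. witt_res (K w) (factor_hom V K b w) (Z (factor_below V K b w)))"
  unfolding witt_res_prod_def factor_hom_def Let_def ..

lemma witt_res_field_prod_hom:
  "witt_res_field_prod V1 K a1 \<in> hom (witt_group F) (WP V1)"
  "witt_res_field_prod V2 K a2 \<in> hom (witt_group F) (WP V2)"
  unfolding witt_res_field_prod_eq by (intro hom_prodI witt_res_hom[OF form_F form_K e_hom]; simp)+

lemma witt_res_prod_hom:
  assumes "V = V1 \<and> b = b1 \<or> V = V2 \<and> b = b2"
  shows "witt_res_prod V V0 K b \<in> hom (WP V) (WP V0)"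
  unfolding witt_res_prod_eq
proof (rule hom_prodI)
  fix w assume w: "w \<in> V0"
  note fp = factor_props[OF assms w]
  have "witt_res (K w) (factor_hom V K b w) \<in> hom (witt_group (K (factor_below V K b w))) (witt_group (K w))"
    by (rule witt_res_hom[OF form_K[OF fp(2)] form_K fp(3)]) (use w in simp)
  moreover have "(\<lambda>Z. Z (factor_below V K b w)) \<in> hom (WP V) (witt_group (K (factor_below V K b w)))"
    using fp(1) by (intro homI) (auto simp: witt_group_prod_def)
  ultimately show "(\<lambda>Z. witt_res (K w) (factor_hom V K b w) (Z (factor_below V K b w))) \<in> hom (WP V) (witt_group (K w))"
    using hom_compose by (force simp: comp_def)
qed

abbreviation "res \<equiv> (\<lambda>Z. (witt_res_field_prod V1 K a1 Z, witt_res_field_prod V2 K a2 Z))"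
abbreviation "diff \<equiv> (\<lambda>(Y1, Y2). witt_res_prod V1 V0 K b1 Y1 \<otimes>\<^bsub>WP V0\<^esub>
  inv\<^bsub>WP V0\<^esub> (witt_res_prod V2 V0 K b2 Y2))"

lemma groups: "comm_group (WP V0)" "group (WP V1)" "group (WP V2)" "group (witt_group F)"
  using comm_group_prod[of V0] comm_group_prod[of V1] comm_group_prod[of V2] F.comm_group_witt by (auto simp: comm_group_def)

lemma res_group_hom: "group_hom (witt_group F) (WP V1 \<times>\<times> WP V2) res"
proof (intro group_hom.intro group_hom_axioms.intro groups DirProd_group)
  show "res \<in> hom (witt_group F) (WP V1 \<times>\<times> WP V2)"
  proof (rule homI)
    fix x assume x: "x \<in> carrier (witt_group F)"
    show "res x \<in> carrier (WP V1 \<times>\<times> WP V2)"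
      using hom_in_carrier[OF witt_res_field_prod_hom(1) x] hom_in_carrier[OF witt_res_field_prod_hom(2) x] by simp
    fix y assume y: "y \<in> carrier (witt_group F)"
    show "res (x \<otimes>\<^bsub>witt_group F\<^esub> y) = res x \<otimes>\<^bsub>WP V1 \<times>\<times> WP V2\<^esub> res y"
      using hom_mult[OF witt_res_field_prod_hom(1) x y] hom_mult[OF witt_res_field_prod_hom(2) x y] by simp
  qed
qed

lemma diff_group_hom: "group_hom (WP V1 \<times>\<times> WP V2) (WP V0) diff"
  by (rule group_hom_difference[OF groups(2,3,1) witt_res_prod_hom witt_res_prod_hom]) auto

lemma res_cls:
  assumes "q \<in> reg F n" "v \<in> VV"
  shows "witt_res (K v) (e v) (witt_class F q) = witt_class (K v) (map_mat (e v) q)"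
  by (rule witt_res_cls[OF form_F form_K[OF assms(2)] e_hom[OF assms(2)] assms(1)])

lemma kernel_res: "kernel (witt_group F) (WP V1 \<times>\<times> WP V2) res = P"
proof -
  have "Z \<in> P \<longleftrightarrow> res Z = \<one>\<^bsub>WP V1 \<times>\<times> WP V2\<^esub>" if Z: "Z \<in> carrier (witt_ring F)" for Z
  proof -
    obtain q n where q: "q \<in> reg F n" "Z = witt_class F q" using F.witt_carrierE[OF Z] .
    have "Z \<in> P \<longleftrightarrow> (\<forall>v\<in>V12. witt_res (K v) (e v) Z = \<zero>\<^bsub>witt_ring (K v)\<^esub>)"
      using P_iff[OF q(1)] res_cls[OF q(1)] q(2) by simp
    then show ?thesis unfolding witt_res_field_prod_eq by (auto simp: witt_group_prod_def restrict_eq_iff)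
  qed
  moreover have "P \<subseteq> carrier (witt_ring F)"
    unfolding P_eq using F.cls_carrier[OF F.reg_binary_pfister] by (auto simp: locsq_def)
  ultimately show ?thesis unfolding kernel_def by auto
qed

lemma subgroup_P: "subgroup P (witt_group F)"
  using group_hom.subgroup_kernel[OF res_group_hom] unfolding kernel_res .

text \<open>
  If the parity were not constant, the idempotents of \<open>F\<^sub>1\<close> and \<open>F\<^sub>2\<close> that cut out the even indices would
  descend to a non-trivial idempotent of the field \<open>F\<close>.
\<close>

lemma constant_parity:
  fixes n :: "'v => nat"
  assumes "\<And>w. w \<in> V0 ==> even (n (factor_below V1 K b1 w)) \<longleftrightarrow> even (n (factor_below V2 K b2 w))"
  obtains b where "\<forall>v\<in>V12. even (n v) \<longleftrightarrow> b"
proof -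
  let ?d = "\<lambda>v. if even (n v) then \<one>\<^bsub>K v\<^esub> else \<zero>\<^bsub>K v\<^esub>"
  let ?D = "\<lambda>V. \<lambda>v\<in>V. ?d v"
  have oc: "\<one>\<^bsub>K v\<^esub> \<in> carrier (K v)" "\<zero>\<^bsub>K v\<^esub> \<in> carrier (K v)" "\<one>\<^bsub>K v\<^esub> \<noteq> \<zero>\<^bsub>K v\<^esub>" if "v \<in> VV" for v
    using cring.cring_simprules(2,6)[OF Kcr[OF that]] domain.one_not_zero[OF field.axioms(1)[OF field_K[OF that]]] by auto
  have D: "?D V1 \<in> carrier F1" "?D V2 \<in> carrier F2" using oc by (auto simp: product_ring_simps)
  have bD: "b (?D V) w = (if even (n (factor_below V K b w)) then \<one>\<^bsub>K w\<^esub> else \<zero>\<^bsub>K w\<^esub>)"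
    if A: "V = V1 \<and> b = b1 \<or> V = V2 \<and> b = b2" and w: "w \<in> V0" for V b w
  proof -
    note fp = factor_props[OF A w]
    have w': "w \<in> VV" using w by simp
    have "b (?D V) w = factor_hom V K b w (?D V (factor_below V K b w))"
      using factor_below_props(3)[of V K V0 b w "?D V"] A w rings rgf fin homs D by blast
    also have "\<dots> = (if even (n (factor_below V K b w)) then \<one>\<^bsub>K w\<^esub> else \<zero>\<^bsub>K w\<^esub>)"
      using fp(1) ring_hom_one[OF fp(3)] ring_hom_zero[OF fp(3)] field_K[OF fp(2)] field_K[OF w'] by (simp add: field.is_ring)
    finally show ?thesis .
  qed
  have "b1 (?D V1) = b2 (?D V2)"
  proof -
    have m: "b1 (?D V1) \<in> (\<Pi>\<^sub>E w\<in>V0. carrier (K w))" "b2 (?D V2) \<in> (\<Pi>\<^sub>E w\<in>V0. carrier (K w))"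
      using ring_hom_closed[OF homs(3) D(1)] ring_hom_closed[OF homs(4) D(2)] by (auto simp: product_ring_simps)
    have "b1 (?D V1) w = b2 (?D V2) w" if "w \<in> V0" for w
      using bD[of V1 b1, OF _ that] bD[of V2 b2, OF _ that] assms[OF that] by simp
    then show ?thesis using PiE_ext[OF m] by blast
  qed
  then obtain z where z: "z \<in> carrier F" "a1 z = ?D V1" "a2 z = ?D V2" using element_descent[OF D] by blast
  have ez: "e v z = ?d v" if "v \<in> V12" for v
    using that z(2,3) disj by (auto simp: e_def)
  have "a1 (z \<otimes> z) = a1 z"
    unfolding ring_hom_mult[OF homs(1) z(1) z(1)] z(2) using cring.cring_simprules(12,26)[OF Kcr] oc
    by (auto simp: product_ring_simps restrict_eq_iff)
  then have zz: "z \<otimes> z = z \<otimes> \<one>" using inj_onD[OF injs(1), of "z \<otimes> z" z] z(1) by simp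
  then have "z = \<zero> \<or> z = \<one>" using F.m_lcancel[of z z "\<one>"] z(1) by auto
  then show ?thesis
  proof
    assume z0: "z = \<zero>"
    have "odd (n v)" if v: "v \<in> V12" for v
    proof -
      have v': "v \<in> VV" using v by auto
      have "e v z = \<zero>\<^bsub>K v\<^esub>" unfolding z0 using ring_hom_zero[OF e_hom[OF v'] rings(1) field.is_ring[OF field_K[OF v']]] .
      then show ?thesis using ez[OF v] oc(3)[OF v'] by (auto split: if_splits)
    qed
    then show ?thesis using that[of False] by simp
  next
    assume z1: "z = \<one>"
    have "even (n v)" if v: "v \<in> V12" for v
    proof -
      have v': "v \<in> VV" using v by auto
      have "e v z = \<one>\<^bsub>K v\<^esub>" unfolding z1 using ring_hom_one[OF e_hom[OF v']] .
      then show ?thesis using ez[OF v] oc(3)[OF v'] by (auto split: if_splits)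
    qed
    then show ?thesis using that[of True] by simp
  qed
qed

text \<open>The sum \<open>S\<close> bounds all dimensions, so 2 S + 2 or 2 S + 1 is large enough
  and of the right parity. It is positive even if all dimensions are zero, as patching for GL
  requires.\<close>

lemma common_dimension:
  fixes n :: "'v => nat"
  assumes "\<forall>v\<in>V12. even (n v) \<longleftrightarrow> b"
  obtains N where "N > 0" "\<forall>v\<in>V12. \<exists>m. N = n v + 2 * m"
proof -
  define S where "S = (\<Sum>v\<in>V12. n v)"
  have le: "n v \<le> S" if "v \<in> V12" for v
    unfolding S_def using fin that by (intro member_le_sum) auto
  have "\<exists>m. 2 * S + (if b then 2 else 1) = n v + 2 * m" if v: "v \<in> V12" for v
  proof (cases b)
    case True
    then obtain k where k: "n v = 2 * k" using assms v by blast
    then show ?thesis using True le[OF v] by (intro exI[of _ "S + 1 - k"]) simp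
  next
    case False
    then obtain k where k: "n v = 2 * k + 1" using assms v oddE by blast
    then show ?thesis using False le[OF v] by (intro exI[of _ "S - k"]) simp
  qed
  then show ?thesis using that[of "2 * S + (if b then 2 else 1)"] by simp
qed

text \<open>Representatives of one common dimension become isometric over each field of
  \<open>F0\<close>, since Witt equivalent forms of equal dimension are isometric. The glued
  isometries form an element of GL over \<open>F0\<close>; its two factors change the forms over
  \<open>F1\<close> and \<open>F2\<close> into forms that agree over \<open>F0\<close> and descend
  to \<open>F\<close>.\<close>

lemma witt_class_descent:
  assumes Y: "\<And>v. v \<in> V12 ==> Y v \<in> carrier (witt_ring (K v))"
    and eq: "\<And>w. w \<in> V0 ==> witt_res (K w) (factor_hom V1 K b1 w) (Y (factor_below V1 K b1 w)) =
      witt_res (K w) (factor_hom V2 K b2 w) (Y (factor_below V2 K b2 w))"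
  obtains q n where "q \<in> reg F n" "\<And>v. v \<in> V12 ==> witt_class (K v) (map_mat (e v) q) = Y v"
proof -
  let ?f1 = "factor_below V1 K b1" and ?f2 = "factor_below V2 K b2"
  let ?h1 = "factor_hom V1 K b1" and ?h2 = "factor_hom V2 K b2"
  have fp1: "?f1 w \<in> V1" "?f1 w \<in> VV" "?h1 w \<in> Ring.ring_hom (K (?f1 w)) (K w)" if "w \<in> V0" for w
    using factor_props[of V1 b1 w] that by auto
  have fp2: "?f2 w \<in> V2" "?f2 w \<in> VV" "?h2 w \<in> Ring.ring_hom (K (?f2 w)) (K w)" if "w \<in> V0" for w
    using factor_props[of V2 b2 w] that by auto
  have in0: "w \<in> VV" if "w \<in> V0" for w using that by simp
  have in12: "v \<in> VV" if "v \<in> V12" for v using that by auto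
  have weq: "(map_mat (?h1 w) A, map_mat (?h2 w) B) \<in> witt_rel (K w)"
    if w: "w \<in> V0" and A: "A \<in> reg (K (?f1 w)) n1" "Y (?f1 w) = witt_class (K (?f1 w)) A"
      and B: "B \<in> reg (K (?f2 w)) n2" "Y (?f2 w) = witt_class (K (?f2 w)) B" for w A B n1 n2
  proof -
    interpret Kw: form_field "K w" by (rule form_K[OF in0[OF w]])
    have "Kw.cls (map_mat (?h1 w) A) = Kw.cls (map_mat (?h2 w) B)"
      using eq[OF w] A(2) B(2) witt_res_cls[OF form_K[OF fp1(2)[OF w]] Kw.form_field_axioms fp1(3)[OF w] A(1)]
        witt_res_cls[OF form_K[OF fp2(2)[OF w]] Kw.form_field_axioms fp2(3)[OF w] B(1)] by simp
    then show ?thesis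
      using Kw.cls_eq_iff[OF reg_map[OF Kcr[OF fp1(2)[OF w]] Kw.R fp1(3)[OF w] A(1)] reg_map[OF Kcr[OF fp2(2)[OF w]] Kw.R fp2(3)[OF w] B(1)]] by simp
  qed
  have "\<forall>v\<in>V12. \<exists>p. snd p \<in> reg (K v) (fst p) \<and> Y v = witt_class (K v) (snd p)"
  proof
    fix v assume v: "v \<in> V12"
    obtain A k where "A \<in> reg (K v) k" "Y v = witt_class (K v) A"
      using form_field.witt_carrierE[OF form_K[OF in12[OF v]] Y[OF v]] .
    then show "\<exists>p. snd p \<in> reg (K v) (fst p) \<and> Y v = witt_class (K v) (snd p)" by (intro exI[of _ "(k, A)"]) simp
  qed
  from bchoice[OF this] obtain p where p: "\<forall>v\<in>V12. snd (p v) \<in> reg (K v) (fst (p v)) \<and> Y v = witt_class (K v) (snd (p v))" by blast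
  define n Q where "n = (\<lambda>v. fst (p v))" and "Q = (\<lambda>v. snd (p v))"
  have Q: "Q v \<in> reg (K v) (n v)" "Y v = witt_class (K v) (Q v)" if "v \<in> V12" for v
    using p that by (auto simp: n_def Q_def)
  \<comment> \<open>Witt equivalence preserves the parity of the dimension, so parities agree
    wherever two indices lie below the same \<open>w\<close>.\<close>
  have "even (n (?f1 w)) \<longleftrightarrow> even (n (?f2 w))" if w: "w \<in> V0" for w
  proof -
    have f: "?f1 w \<in> V12" "?f2 w \<in> V12" using fp1(1)[OF w] fp2(1)[OF w] by auto
    interpret Kw: form_field "K w" by (rule form_K[OF in0[OF w]])
    show ?thesis
      by (rule Kw.weq_even[OF weq[OF w Q(1)[OF f(1)] Q(2)[OF f(1)] Q(1)[OF f(2)] Q(2)[OF f(2)]]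
        reg_map[OF Kcr[OF fp1(2)[OF w]] Kw.R fp1(3)[OF w] Q(1)[OF f(1)]] reg_map[OF Kcr[OF fp2(2)[OF w]] Kw.R fp2(3)[OF w] Q(1)[OF f(2)]]])
  qed
  from constant_parity[OF this] obtain b where "\<forall>v\<in>V12. even (n v) \<longleftrightarrow> b" .
  from common_dimension[OF this] obtain N where N: "N > 0" "\<forall>v\<in>V12. \<exists>m. N = n v + 2 * m" .
  have "\<exists>Q'. Q' \<in> reg (K v) N \<and> Y v = witt_class (K v) Q'" if v: "v \<in> V12" for v
  proof -
    interpret Kv: form_field "K v" by (rule form_K[OF in12[OF v]])
    obtain m where m: "N = n v + 2 * m" using N(2) v by blast
    have r: "Q v \<bottom>\<^bsub>K v\<^esub> Kv.H m \<in> reg (K v) N" using reg_perp[OF Kv.R Q(1)[OF v] Kv.reg_H] m by simp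
    then show ?thesis using Kv.cls_eq_iff[OF Q(1)[OF v] r] Kv.weq_perp_H[OF Q(1)[OF v]] Q(2)[OF v] by auto
  qed
  then have "\<forall>v\<in>V12. \<exists>Q'. Q' \<in> reg (K v) N \<and> Y v = witt_class (K v) Q'" by blast
  from bchoice[OF this] obtain Q' where "\<forall>v\<in>V12. Q' v \<in> reg (K v) N \<and> Y v = witt_class (K v) (Q' v)" by blast
  then have Q': "Q' v \<in> reg (K v) N" "Y v = witt_class (K v) (Q' v)" if "v \<in> V12" for v using that by blast+
  have glue: "\<exists>M\<in>reg (product_ring V K) N. \<forall>v\<in>V. cp v M = Q' v"
    if V: "V \<subseteq> V12" "ring (product_ring V K)" "\<And>v. v \<in> V ==> field (K v)" for V
  proof -
    have "\<exists>C\<in>carrier (GL N (K v)). C = Q' v" if "v \<in> V" for v using reg_GL[OF Q'(1)] that V(1) by auto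
    from glue_choice[OF V(2,3) this] obtain M where M: "M \<in> carrier (GL N (product_ring V K))" "\<And>v. v \<in> V ==> cp v M = Q' v" by blast
    have "transpose_mat M = M"
    proof (rule cp_ext[OF V(2,3) rmat_transpose[OF GL_rmat[OF M(1)]] GL_rmat[OF M(1)]])
      fix v assume v: "v \<in> V"
      have "transpose_mat (Q' v) = Q' v" using Q'(1)[of v] v V(1) by (auto simp: reg_def)
      then show "cp v (transpose_mat M) = cp v M" using M(2)[OF v] by (simp add: transpose_map_mat[symmetric])
    qed
    then show ?thesis using M by (auto simp: reg_def)
  qed
  obtain M1 where M1: "M1 \<in> reg F1 N" "\<And>v. v \<in> V1 ==> cp v M1 = Q' v" using glue[OF _ pr1] by blast
  obtain M2 where M2: "M2 \<in> reg F2 N" "\<And>v. v \<in> V2 ==> cp v M2 = Q' v" using glue[OF _ pr2] by blast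
  note M1r = reg_rmat[OF M1(1)] and M2r = reg_rmat[OF M2(1)]
  note b1r = rmat_map[OF hb1] and b2r = rmat_map[OF hb2]
  have "\<exists>C\<in>carrier (GL N (K w)). pullback (K w) (cp w (map_mat b1 M1)) C = cp w (map_mat b2 M2)" if w: "w \<in> V0" for w
  proof -
    have f: "?f1 w \<in> V12" "?f2 w \<in> V12" using fp1(1)[OF w] fp2(1)[OF w] by auto
    interpret Kw: form_field "K w" by (rule form_K[OF in0[OF w]])
    note r = reg_map[OF Kcr[OF fp1(2)[OF w]] Kw.R fp1(3)[OF w] Q'(1)[OF f(1)]] reg_map[OF Kcr[OF fp2(2)[OF w]] Kw.R fp2(3)[OF w] Q'(1)[OF f(2)]]
    have "Kw.eqv N (map_mat (?h1 w) (Q' (?f1 w))) (map_mat (?h2 w) (Q' (?f2 w)))"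
      by (rule Kw.weq_same_dim[OF weq[OF w Q'(1)[OF f(1)] Q'(2)[OF f(1)] Q'(1)[OF f(2)] Q'(2)[OF f(2)]] r])
    then have "isometric (K w) (map_mat (?h2 w) (Q' (?f2 w))) (map_mat (?h1 w) (Q' (?f1 w)))" by (rule Kw.eqvD(3)[OF Kw.eqv_sym])
    moreover have "cp w (map_mat b1 M1) = map_mat (?h1 w) (Q' (?f1 w))" "cp w (map_mat b2 M2) = map_mat (?h2 w) (Q' (?f2 w))"
      using cp_b[OF _ w M1r] cp_b[OF _ w M2r] M1(2)[OF fp1(1)[OF w]] M2(2)[OF fp2(1)[OF w]] by auto
    ultimately show ?thesis using isometricE[OF Kw.R _ reg_rmat[OF r(1)]] by metis
  qed
  from glue_choice[OF pr0 this] obtain g where g: "g \<in> carrier (GL N F0)"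
    "\<And>w. w \<in> V0 ==> pullback (K w) (cp w (map_mat b1 M1)) (cp w g) = cp w (map_mat b2 M2)" by blast
  have gM: "pullback F0 (map_mat b1 M1) g = map_mat b2 M2"
    by (rule product_pullback_eqI[OF pr0 b1r[OF M1r] GL_rmat[OF g(1)] b2r[OF M2r]]) (simp_all add: g(2))
  obtain g1 g2 where gg: "g1 \<in> carrier (GL N F1)" "g2 \<in> carrier (GL N F2)" "g = map_mat b1 g1 \<star>\<^bsub>F0\<^esub> map_mat b2 g2"
    using GL_factor[OF _ g(1)] N(1) by auto
  obtain k where k: "k \<in> carrier (GL N F2)" "g2 \<star>\<^bsub>F2\<^esub> k = one_m F2 N" using GL_inverse[OF cr(3) gg(2)] by blast
  note g1r = GL_rmat[OF gg(1)] and g2r = GL_rmat[OF gg(2)] and kr = GL_rmat[OF k(1)]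
  have inv0: "map_mat b2 g2 \<star>\<^bsub>F0\<^esub> map_mat b2 k = one_m F0 N"
    using map_mat_prod[OF hb2 g2r kr] k(2) map_one_m[OF hb2] by simp
  have "pullback F0 (pullback F0 (map_mat b1 M1) (map_mat b1 g1)) (map_mat b2 g2) = map_mat b2 M2"
    using pullback_pullback[OF cr(4) b1r[OF M1r] b1r[OF g1r] b2r[OF g2r]] gM gg(3) by simp
  from pullback_inverse[OF cr(4) rmat_pullback[OF cr(4) b1r[OF M1r] b1r[OF g1r]] b2r[OF g2r] b2r[OF kr] inv0 this]
  have "map_mat b1 (pullback F1 M1 g1) = map_mat b2 (pullback F2 M2 k)"
    using map_pullback[OF hb1 M1r g1r] map_pullback[OF hb2 M2r kr] by simp
  then obtain q where q: "q \<in> carrier (GL N F)" "map_mat a1 q = pullback F1 M1 g1" "map_mat a2 q = pullback F2 M2 k"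
    using GL_descent[OF _ reg_GL[OF reg_pullback[OF cr(2) M1(1) gg(1)]] reg_GL[OF reg_pullback[OF cr(3) M2(1) k(1)]]] N(1) by auto
  have "transpose_mat q = q"
    using map_mat_inj[OF injs(1) rmat_transpose[OF GL_rmat[OF q(1)]] GL_rmat[OF q(1)]] q(2) reg_pullback[OF cr(2) M1(1) gg(1)]
    by (simp add: transpose_map_mat[symmetric] reg_def)
  then have qr: "q \<in> reg F N" using q(1) by (simp add: reg_def)
  have "witt_class (K v) (map_mat (e v) q) = Y v" if v: "v \<in> V12" for v
  proof -
    interpret Kv: form_field "K v" by (rule form_K[OF in12[OF v]])
    have "\<exists>C\<in>carrier (GL N (K v)). pullback (K v) (Q' v) C = map_mat (e v) q"
    proof (cases "v \<in> V1")
      case True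
      then show ?thesis
        using cp_pullback[OF pr1 True M1r g1r] M1(2)[OF True] q(2) cp_a1[OF True, of q] GL_cp[OF pr1 True gg(1)]
        by (intro bexI[of _ "cp v g1"]) simp_all
    next
      case False
      then have v2: "v \<in> V2" using v by simp
      then show ?thesis
        using cp_pullback[OF pr2 v2 M2r kr] M2(2)[OF v2] q(3) cp_a2[OF v2, of q] GL_cp[OF pr2 v2 k(1)]
        by (intro bexI[of _ "cp v k"]) simp_all
    qed
    then have "isometric (K v) (map_mat (e v) q) (Q' v)" using isometricI[OF Kv.R _ reg_rmat[OF Q'(1)[OF v]]] by blast
    from Kv.weq_of_eqv[OF Kv.eqvI[OF this Q'(1)[OF v]]] show ?thesis
      using Kv.cls_eq_iff[OF reg_map[OF cr(1) Kv.R e_hom[OF in12[OF v]] qr] Q'(1)[OF v]] Q'(2)[OF v] by simp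
  qed
  then show ?thesis using that qr by blast
qed

lemma kernel_diff:
  "kernel (WP V1 \<times>\<times> WP V2) (WP V0) diff = res ` carrier (witt_group F)"
proof -
  interpret W0: comm_group "WP V0" by (rule groups)
  let ?r1 = "witt_res_prod V1 V0 K b1" and ?r2 = "witt_res_prod V2 V0 K b2"
  have rc: "?r1 Y1 \<in> carrier (WP V0)" "?r2 Y2 \<in> carrier (WP V0)"
    if "Y1 \<in> carrier (WP V1)" "Y2 \<in> carrier (WP V2)" for Y1 Y2
    using hom_in_carrier[OF witt_res_prod_hom] that by auto
  have ker: "(Y1, Y2) \<in> kernel (WP V1 \<times>\<times> WP V2) (WP V0) diff \<longleftrightarrow>
      Y1 \<in> carrier (WP V1) \<and> Y2 \<in> carrier (WP V2) \<and> ?r1 Y1 = ?r2 Y2" for Y1 Y2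
    using rc[of Y1 Y2] W0.inv_solve_right'[OF W0.one_closed, of "?r1 Y1" "?r2 Y2"] by (auto simp: kernel_def)
  have resc: "Z \<in> carrier (witt_group F) ==> witt_res_field_prod V1 K a1 Z \<in> carrier (WP V1) \<and> witt_res_field_prod V2 K a2 Z \<in> carrier (WP V2)" for Z
    using hom_in_carrier[OF witt_res_field_prod_hom(1)] hom_in_carrier[OF witt_res_field_prod_hom(2)] by blast
  show ?thesis
  proof (intro equalityI subsetI)
    fix y assume "y \<in> kernel (WP V1 \<times>\<times> WP V2) (WP V0) diff"
    then obtain Y1 Y2 where Y: "y = (Y1, Y2)" "Y1 \<in> carrier (WP V1)" "Y2 \<in> carrier (WP V2)" "?r1 Y1 = ?r2 Y2"
      using ker by (cases y) auto
    have PiE: "Y1 \<in> (\<Pi>\<^sub>E v\<in>V1. carrier (witt_ring (K v)))" "Y2 \<in> (\<Pi>\<^sub>E v\<in>V2. carrier (witt_ring (K v)))"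
      using Y(2,3) by (simp_all add: witt_group_prod_def)
    \<comment> \<open>The two families are merged into one, unambiguously because \<open>V1\<close>
      and \<open>V2\<close> are disjoint.\<close>
    define Y' where "Y' = (\<lambda>v. if v \<in> V1 then Y1 v else Y2 v)"
    have Y'2: "v \<in> V2 ==> Y' v = Y2 v" for v using disj by (auto simp: Y'_def)
    have Y'1: "v \<in> V1 ==> Y' v = Y1 v" for v by (simp add: Y'_def)
    have "Y' v \<in> carrier (witt_ring (K v))" if "v \<in> V12" for v using that PiE by (auto simp: Y'_def)
    moreover have "witt_res (K w) (factor_hom V1 K b1 w) (Y' (factor_below V1 K b1 w)) =
      witt_res (K w) (factor_hom V2 K b2 w) (Y' (factor_below V2 K b2 w))" if w: "w \<in> V0" for w
      using fun_cong[OF Y(4), of w] w factor_props(1)[of V1 b1 w] factor_props(1)[of V2 b2 w] by (simp add: witt_res_prod_eq Y'1 Y'2)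
    ultimately obtain q n where q: "q \<in> reg F n" "\<And>v. v \<in> V12 ==> witt_class (K v) (map_mat (e v) q) = Y' v"
      using witt_class_descent[of Y'] by blast
    have "witt_res_field_prod V1 K a1 (witt_class F q) v = Y1 v" for v
      using q(2)[of v] Y'1[of v] res_cls[OF q(1), of v] PiE_arb[OF PiE(1), of v] by (cases "v \<in> V1") (auto simp: witt_res_field_prod_eq)
    moreover have "witt_res_field_prod V2 K a2 (witt_class F q) v = Y2 v" for v
      using q(2)[of v] Y'2[of v] res_cls[OF q(1), of v] PiE_arb[OF PiE(2), of v] by (cases "v \<in> V2") (auto simp: witt_res_field_prod_eq)
    ultimately have "res (witt_class F q) = y" using Y(1) by (simp add: fun_eq_iff)
    then show "y \<in> res ` carrier (witt_group F)" using F.cls_carrier[OF q(1)] by force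
  next
    fix y assume "y \<in> res ` carrier (witt_group F)"
    then obtain Z where Z: "Z \<in> carrier (witt_ring F)" "y = res Z" by auto
    obtain q n where q: "q \<in> reg F n" "Z = witt_class F q" using F.witt_carrierE[OF Z(1)] .
    \<comment> \<open>Along either side of the diamond, the class restricts to that of the
      w-component of \<open>map_mat b (map_mat a q)\<close>; commutativity of the diamond then
      compares the two sides.\<close>
    have r: "witt_res (K w) (factor_hom V K b w) (witt_res (K (factor_below V K b w)) (e (factor_below V K b w)) Z) = witt_class (K w) (cp w (map_mat b (map_mat a q)))"
      if A: "V = V1 \<and> b = b1 \<and> a = a1 \<or> V = V2 \<and> b = b2 \<and> a = a2" and w: "w \<in> V0" for V b a w
    proof -
      have A': "V = V1 \<and> b = b1 \<or> V = V2 \<and> b = b2" using A by blast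
      let ?u = "factor_below V K b w"
      note fp = factor_props[OF A' w]
      have w': "w \<in> VV" using w by simp
      have "map_mat (e ?u) q = cp ?u (map_mat a q)" using A fp(1) cp_a1[of ?u q] cp_a2[of ?u q] by auto
      moreover have "map_mat a q \<in> rmat (product_ring V K) n n"
        using A rmat_map[OF ha1 reg_rmat[OF q(1)]] rmat_map[OF ha2 reg_rmat[OF q(1)]] by auto
      ultimately have "map_mat (factor_hom V K b w) (map_mat (e ?u) q) = cp w (map_mat b (map_mat a q))" using cp_b[OF A' w] by simp
      then show ?thesis
        using res_cls[OF q(1) fp(2)] witt_res_cls[OF form_K[OF fp(2)] form_K[OF w'] fp(3) reg_map[OF cr(1) Kcr[OF fp(2)] e_hom[OF fp(2)] q(1)]] q(2) by simp
    qed
    have "?r1 (witt_res_field_prod V1 K a1 Z) = ?r2 (witt_res_field_prod V2 K a2 Z)"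
      unfolding witt_res_prod_eq restrict_eq_iff
    proof
      fix w assume w: "w \<in> V0"
      show "witt_res (K w) (factor_hom V1 K b1 w) (witt_res_field_prod V1 K a1 Z (factor_below V1 K b1 w)) =
        witt_res (K w) (factor_hom V2 K b2 w) (witt_res_field_prod V2 K a2 Z (factor_below V2 K b2 w))"
        using r[of V1 b1 a1 w] r[of V2 b2 a2 w] w factor_props(1)[of V1 b1 w] factor_props(1)[of V2 b2 w] map_commutes[OF reg_rmat[OF q(1)]]
        by (simp add: witt_res_field_prod_eq)
    qed
    then show "y \<in> kernel (WP V1 \<times>\<times> WP V2) (WP V0) diff"
      using resc[of Z] Z ker by simp
  qed
qed

end

section \<open>Square classes and Kummer classes as descriptions of P\<close>

section \<open>Square classes\<close>

context field
begin

lemma unit_squares_normal: "unit_squares R \<lhd> units_of R"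
proof -
  interpret U: comm_group "units_of R" by (rule units_comm_group)
  have "subgroup (unit_squares R) (units_of R)"
  proof
    show "unit_squares R \<subseteq> carrier (units_of R)" by (auto simp: unit_squares_def units_of_carrier)
    show "\<one>\<^bsub>units_of R\<^esub> \<in> unit_squares R" unfolding unit_squares_def by (auto simp: units_of_one intro!: exI[of _ \<one>])
  next
    fix x y assume "x \<in> unit_squares R" "y \<in> unit_squares R"
    then obtain a b where ab: "a \<in> Units R" "b \<in> Units R" "x = a \<otimes> a" "y = b \<otimes> b" by (auto simp: unit_squares_def)
    then have "x \<otimes> y = (a \<otimes> b) \<otimes> (a \<otimes> b)" by (simp add: m_ac Units_closed)
    then show "x \<otimes>\<^bsub>units_of R\<^esub> y \<in> unit_squares R" using ab unfolding unit_squares_def units_of_mult by blast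
  next
    fix x assume "x \<in> unit_squares R"
    then obtain a where a: "a \<in> Units R" "x = a \<otimes> a" by (auto simp: unit_squares_def)
    then have "inv\<^bsub>units_of R\<^esub> x = inv\<^bsub>units_of R\<^esub> a \<otimes>\<^bsub>units_of R\<^esub> inv\<^bsub>units_of R\<^esub> a"
      using U.inv_mult[of a a] by (simp add: units_of_carrier units_of_mult)
    moreover have "inv\<^bsub>units_of R\<^esub> a \<in> Units R" using U.inv_closed[of a] a by (simp add: units_of_carrier)
    ultimately show "inv\<^bsub>units_of R\<^esub> x \<in> unit_squares R" unfolding unit_squares_def by (auto simp: units_of_mult)
  qed
  then show ?thesis by (rule U.subgroup_imp_normal)
qed

lemma square_class_mult:
  assumes "d \<in> Units R" "d' \<in> Units R"
  shows "square_class R (d \<otimes> d') = square_class R d \<otimes>\<^bsub>square_class_group R\<^esub> square_class R d'"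
  using normal.rcos_sum[OF unit_squares_normal, of d d'] assms
  by (simp add: square_class_group_def square_class_def units_of_carrier units_of_mult)

lemma square_class_trivial_iff:
  assumes "d \<in> Units R"
  shows "square_class R d = \<one>\<^bsub>square_class_group R\<^esub> \<longleftrightarrow> is_square_in R d"
proof -
  interpret N: normal "unit_squares R" "units_of R" by (rule unit_squares_normal)
  have "square_class R d = \<one>\<^bsub>square_class_group R\<^esub> \<longleftrightarrow> d \<in> unit_squares R"
    unfolding square_class_group_def square_class_def one_FactGroup
    using N.coset_join1[OF _ _ N.subgroup_axioms, of d] N.coset_join2[OF _ N.subgroup_axioms, of d] assms by (auto simp: units_of_carrier)
  also have "\<dots> \<longleftrightarrow> is_square_in R d"
    using assms by (auto simp: unit_squares_def is_square_in_def field_Units)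
  finally show ?thesis .
qed

lemma carrier_square_class_group: "carrier (square_class_group R) = square_class R ` Units R"
  by (auto simp: square_class_group_def FactGroup_def RCOSETS_def square_class_def units_of_carrier)

end

text \<open>The union in \<open>square_class_res\<close> runs over a coset; changing
  \<open>d\<close> by a square changes its image by a square, so all members of the union
  coincide.\<close>

lemma square_class_res_eq:
  assumes R: "field R" and S: "field S" and h: "h \<in> Ring.ring_hom R S" and d: "d \<in> Units R"
  shows "square_class_res S h (square_class R d) = square_class S (h d)"
proof -
  interpret R: field R by fact
  interpret S: field S by fact
  interpret N: normal "unit_squares S" "units_of S" by (rule S.unit_squares_normal)
  have hU: "h x \<in> Units S" if "x \<in> Units R" for x
  proof -
    have "h x \<noteq> \<zero>\<^bsub>S\<^esub>"
      using inj_onD[OF non_trivial_field_hom_is_inj[OF h R S], of x "\<zero>\<^bsub>R\<^esub>"] ring_hom_zero[OF h R.is_ring S.is_ring] that by (auto simp: R.field_Units)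
    then show ?thesis using ring_hom_closed[OF h] that by (auto simp: S.field_Units)
  qed
  have "square_class S (h y) = square_class S (h d)" if "y \<in> square_class R d" for y
  proof -
    from that obtain x where x: "x \<in> Units R" "y = x \<otimes>\<^bsub>R\<^esub> x \<otimes>\<^bsub>R\<^esub> d"
      by (auto simp: square_class_def r_coset_def unit_squares_def units_of_mult)
    have hy: "h y = (h x \<otimes>\<^bsub>S\<^esub> h x) \<otimes>\<^bsub>S\<^esub> h d" using x d ring_hom_mult[OF h] by (simp add: R.Units_closed)
    have s: "h x \<otimes>\<^bsub>S\<^esub> h x \<in> unit_squares S" using hU[OF x(1)] by (auto simp: unit_squares_def)
    have "unit_squares S #>\<^bsub>units_of S\<^esub> h y = (unit_squares S #>\<^bsub>units_of S\<^esub> (h x \<otimes>\<^bsub>S\<^esub> h x)) #>\<^bsub>units_of S\<^esub> h d"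
      using N.coset_mult_assoc[OF N.subset, of "h x \<otimes>\<^bsub>S\<^esub> h x" "h d"] hU[OF x(1)] hU[OF d] hy by (simp add: units_of_carrier units_of_mult)
    also have "unit_squares S #>\<^bsub>units_of S\<^esub> (h x \<otimes>\<^bsub>S\<^esub> h x) = unit_squares S"
      using N.coset_join2[OF _ N.subgroup_axioms s] N.subset s by blast
    finally show ?thesis by (simp add: square_class_def)
  qed
  moreover have "d \<in> square_class R d"
    using d by (auto simp: square_class_def r_coset_def unit_squares_def units_of_mult R.Units_closed intro!: exI[of _ "\<one>\<^bsub>R\<^esub>"])
  ultimately show ?thesis unfolding square_class_res_def by blast
qed

context patching_diamond
begin

interpretation F: form_field F by (rule form_F)

lemma square_class_local_kernel_eq:
  "square_class_local_kernel F (VV) K e = square_class F ` {d. locsq d}"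
proof -
  have "(\<lambda>v\<in>VV. square_class_res (K v) (e v) (square_class F d)) = \<one>\<^bsub>product_group (VV) (\<lambda>v. square_class_group (K v))\<^esub>
      \<longleftrightarrow> locsq d" if d: "d \<in> Units F" for d
  proof -
    have "square_class_res (K v) (e v) (square_class F d) = \<one>\<^bsub>square_class_group (K v)\<^esub> \<longleftrightarrow> is_square_in (K v) (e v d)" if v: "v \<in> VV" for v
      using square_class_res_eq[OF field_F field_K[OF v] e_hom[OF v] d] field.square_class_trivial_iff[OF field_K[OF v] e_Units[OF v d]] by simp
    then show ?thesis unfolding one_product_group restrict_eq_iff locsq_all using d by blast
  qed
  then show ?thesis
    unfolding square_class_local_kernel_def kernel_def F.carrier_square_class_group by (auto simp: locsq_def)
qed

lemma pfister_square_class_iso: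
  "\<exists>\<psi>\<in>iso ((witt_group F)\<lparr>carrier := P\<rparr>) ((square_class_group F)\<lparr>carrier := square_class_local_kernel F (VV) K e\<rparr>).
    \<forall>d\<in>Units F. witt_class F (binary_pfister F d) \<in> P \<longrightarrow> \<psi> (witt_class F (binary_pfister F d)) = square_class F d"
  by (rule pfister_iso[OF F.square_class_mult F.square_class_trivial_iff square_class_local_kernel_eq])

end

context patching_diamond
begin

interpretation F: form_field F by (rule form_F)

text \<open>Kummer theory presents every class as that of a unit \<open>d\<close>, and compatibility
  with restriction turns triviality at \<open>v\<close> into \<open>e v d\<close> being a
  square.\<close>

lemma H1_local_kernel_eq:
  "H1_local_kernel 2 F (VV) K e = kummer_class 2 F ` {d. locsq d}"
proof -
  have "(\<lambda>v\<in>VV. H1_res 2 F (K v) (e v) (kummer_class 2 F d)) = \<one>\<^bsub>product_group (VV) (\<lambda>v. H1_mu 2 (K v))\<^esub>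
      \<longleftrightarrow> locsq d" if d: "d \<in> Units F" for d
  proof -
    have "H1_res 2 F (K v) (e v) (kummer_class 2 F d) = \<one>\<^bsub>H1_mu 2 (K v)\<^esub> \<longleftrightarrow> is_square_in (K v) (e v d)" if v: "v \<in> VV" for v
    proof -
      interpret Kv: form_field "K v" by (rule form_K[OF v])
      show ?thesis
        using H1_res_kummer[OF field_F two_F field_K[OF v] Kv.two e_hom[OF v] d]
          kummer_class_trivial_iff[OF field_K[OF v] Kv.two e_Units[OF v d]] by simp
    qed
    then show ?thesis unfolding one_product_group restrict_eq_iff locsq_all using d by blast
  qed
  moreover have "carrier (H1_mu 2 F) = kummer_class 2 F ` Units F"
    using kummer_class_surj[OF field_F two_F] kummer_class_closed[OF field_F two_F] by blast
  ultimately show ?thesis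
    unfolding H1_local_kernel_def kernel_def by (auto simp: locsq_def)
qed

lemma pfister_H1_iso:
  "\<exists>\<phi>\<in>iso ((witt_group F)\<lparr>carrier := P\<rparr>) ((H1_mu 2 F)\<lparr>carrier := H1_local_kernel 2 F (VV) K e\<rparr>).
    \<forall>d\<in>Units F. witt_class F (binary_pfister F d) \<in> P \<longrightarrow> \<phi> (witt_class F (binary_pfister F d)) = kummer_class 2 F d"
  by (rule pfister_iso[OF kummer_class_mult[OF field_F two_F] kummer_class_trivial_iff[OF field_F two_F] H1_local_kernel_eq])

end

theorem theorem4p1:
  fixes F :: "'f ring" and K :: "'v \<Rightarrow> 'k ring" and V0 V1 V2 :: "'v set"
    and a1 a2 :: "'f \<Rightarrow> 'v \<Rightarrow> 'k" and b1 b2 :: "('v \<Rightarrow> 'k) \<Rightarrow> 'v \<Rightarrow> 'k"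
  defines "F0 \<equiv> product_ring V0 K" and "F1 \<equiv> product_ring V1 K" and "F2 \<equiv> product_ring V2 K"
  defines "e \<equiv> (\<lambda>v x. if v \<in> V1 then a1 x v else if v \<in> V2 then a2 x v else b1 (a1 x) v)"
  defines "P \<equiv> pfister_classes F F1 F2 F0 a1 a2 b1"
  defines "W1 \<equiv> witt_group_prod V1 K" and "W2 \<equiv> witt_group_prod V2 K"
    and "W0 \<equiv> witt_group_prod V0 K"
  defines "res \<equiv> (\<lambda>Z. (witt_res_field_prod V1 K a1 Z, witt_res_field_prod V2 K a2 Z))"
    and "diff \<equiv> (\<lambda>(Y1, Y2). witt_res_prod V1 V0 K b1 Y1 \<otimes>\<^bsub>W0\<^esub> inv\<^bsub>W0\<^esub> (witt_res_prod V2 V0 K b2 Y2))"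
  assumes "field F" and "\<one>\<^bsub>F\<^esub> \<oplus>\<^bsub>F\<^esub> \<one>\<^bsub>F\<^esub> \<noteq> \<zero>\<^bsub>F\<^esub>"
    and "finite V0" and "finite V1" and "finite V2"
    and "V0 \<inter> V1 = {}" and "V0 \<inter> V2 = {}" and "V1 \<inter> V2 = {}"
    and "\<And>v. v \<in> V0 \<union> V1 \<union> V2 \<Longrightarrow> field (K v)"
    and "injective_diamond F F1 F2 F0 a1 a2 b1 b2"
    and "patching F F1 F2 F0 a1 a2 b1 b2"
    and "\<And>n. n > 0 \<Longrightarrow> SO_factorization (hyperbolic_space F n) F1 F2 F0 a1 a2 b1 b2"
  shows
    \<comment> \<open>(a)\<close>
    "(subgroup P (witt_group F) \<and>
      group_hom (witt_group F) (W1 \<times>\<times> W2) res \<and>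
      group_hom (W1 \<times>\<times> W2) W0 diff \<and>
      kernel (witt_group F) (W1 \<times>\<times> W2) res = P \<and>
      kernel (W1 \<times>\<times> W2) W0 diff = res ` carrier (witt_group F)) \<and>
     \<comment> \<open>(b)\<close>
     (\<exists>\<phi> \<in> iso ((witt_group F)\<lparr>carrier := P\<rparr>)
               ((H1_mu 2 F)\<lparr>carrier := H1_local_kernel 2 F (V0 \<union> V1 \<union> V2) K e\<rparr>).
        \<forall>d\<in>Units F. witt_class F (binary_pfister F d) \<in> P \<longrightarrow>
          \<phi> (witt_class F (binary_pfister F d)) = kummer_class 2 F d) \<and>
     (\<exists>\<psi> \<in> iso ((witt_group F)\<lparr>carrier := P\<rparr>)
               ((square_class_group F)\<lparr>carrier :=
                  square_class_local_kernel F (V0 \<union> V1 \<union> V2) K e\<rparr>).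
        \<forall>d\<in>Units F. witt_class F (binary_pfister F d) \<in> P \<longrightarrow>
          \<psi> (witt_class F (binary_pfister F d)) = square_class F d) \<and>
     \<comment> \<open>(c)\<close>
     (\<forall>q\<in>regular_forms F. SO_factorization q F1 F2 F0 a1 a2 b1 b2) \<and>
     \<comment> \<open>(d)\<close>
     (\<forall>q. quad_form F q \<longrightarrow> dim_row q \<noteq> 2 \<or> witt_class F q \<notin> P \<longrightarrow>
        (\<forall>v\<in>V1 \<union> V2. isotropic (K v) (map_mat (e v) q)) \<longrightarrow> isotropic F q) \<and>
     \<comment> \<open>(e)\<close>
     (\<forall>q\<in>regular_forms F.
        int (witt_index F q) =
          int (Min ((\<lambda>v. witt_index (K v) (map_mat (e v) q)) ` (V1 \<union> V2))) -
          (if witt_class F q \<in> P - {\<zero>\<^bsub>witt_ring F\<^esub>} then 1 else 0))"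
proof -
  note defs = P_def F0_def F1_def F2_def W0_def W1_def W2_def res_def diff_def and e_eq = e_def
  interpret patching_diamond F K V0 V1 V2 a1 a2 b1 b2
    using assms unfolding F0_def F1_def F2_def by (intro patching_diamond.intro)
  have e: "e = patching_diamond.e V1 V2 a1 a2 b1" unfolding e_eq e_def ..
  show ?thesis
    unfolding defs e
    by (intro conjI subgroup_P res_group_hom diff_group_hom kernel_res kernel_diff pfister_H1_iso pfister_square_class_iso
        ballI allI impI SO_factorization_all isotropy_local_global witt_index_local_global) (assumption | blast)+
qed

end
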